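(* Let $\mathbf{v}_1,\ldots,\mathbf{v}_k$ be orthogonal unit vectors in $\mathbb{R}^k$ and consider the optimization problem \[ \min_{\mathbf{w}_1,\ldots,\mathbf{w}_n\in\mathbb{R}^k} F(\mathbf{w}_1,\ldots,\mathbf{w}_n),\qquad F(\mathbf{w}_1,\ldots,\mathbf{w}_n)=\mathbb{E}_{\mathbf{x}\sim\mathcal{N}(\mathbf{0},I_k)}\left[\frac{1}{2}\left(\sum_{i=1}^{n}[\mathbf{w}_i^\top\mathbf{x}]_+-\sum_{i=1}^{k}[\mathbf{v}_i^\top\mathbf{x}]_+\right)^2\right]. \] Then for $n=k\in\{6,7,\ldots,20\}$, as well as for $(k,n)\in\{(8,9),(10,11),(11,12),(12,13),\ldots,(19,20)\}$ (i.e. $(8,9)$ and all pairs $(k,k+1)$ with $10\le k\le 19$), the function $F$ has spurious local minima.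
   Context: $[z]_+=\max\{0,z\}$ denotes the ReLU function. A spurious local minimum of a function $F$ on Euclidean space is a point $\mathbf{w}$ such that $\inf_{\mathbf{w}'}F(\mathbf{w}')<F(\mathbf{w})\le F(\mathbf{w}')$ for all $\mathbf{w}'$ in some open neighborhood of $\mathbf{w}$. *)

theory Defs
  imports "HOL-Probability.Probability"
begin

definition relu :: "real \<Rightarrow> real" where
  "relu z = max 0 z"

text \<open>Standard Gaussian N(0, I_k) on R^k, with R^k represented as functions
  nat \<Rightarrow> real, coordinates 0..k-1 (extensional outside).\<close>
definition gauss :: "nat \<Rightarrow> (nat \<Rightarrow> real) measure" where
  "gauss k = PiM {..<k} (\<lambda>_. density lborel std_normal_density)"

text \<open>Weights: W i j is the j-th coordinate of w_(i+1) (i < n, j < k);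
  targets: V i j is the j-th coordinate of v_(i+1) (i < k, j < k).\<close>
definition relu_loss :: "nat \<Rightarrow> nat \<Rightarrow> (nat \<Rightarrow> nat \<Rightarrow> real) \<Rightarrow> (nat \<Rightarrow> nat \<Rightarrow> real) \<Rightarrow> real" where
  "relu_loss k n V W = integral\<^sup>L (gauss k)
     (\<lambda>x. (1/2) * ((\<Sum>i<n. relu (\<Sum>j<k. W i j * x j)) - (\<Sum>i<k. relu (\<Sum>j<k. V i j * x j)))\<^sup>2)"

definition orthonormal_rows :: "nat \<Rightarrow> (nat \<Rightarrow> nat \<Rightarrow> real) \<Rightarrow> bool" where
  "orthonormal_rows k V \<longleftrightarrow>
     (\<forall>i<k. \<forall>i'<k. (\<Sum>j<k. V i j * V i' j) = (if i = i' then 1 else 0))"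

text \<open>Spurious local minimum of a function on R^(n*k), the point being an n-tuple
  of vectors in R^k (only entries i < n, j < k are relevant); the open neighbourhood
  is a Euclidean ball.\<close>
definition spurious_local_min :: "nat \<Rightarrow> nat \<Rightarrow> ((nat \<Rightarrow> nat \<Rightarrow> real) \<Rightarrow> real) \<Rightarrow> (nat \<Rightarrow> nat \<Rightarrow> real) \<Rightarrow> bool" where
  "spurious_local_min n k F W \<longleftrightarrow>
     (\<exists>W'. F W' < F W) \<and>
     (\<exists>e>0. \<forall>W'. (\<Sum>i<n. \<Sum>j<k. (W' i j - W i j)\<^sup>2) < e\<^sup>2 \<longrightarrow> F W \<le> F W')"

definition pairs_claimed :: "(nat \<times> nat) set" where
  "pairs_claimed = {(k, k) | k. 6 \<le> k \<and> k \<le> 20} \<union> {(8, 9)} \<union> {(k, k + 1) | k. 10 \<le> k \<and> k \<le> 19}"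

end

theory Submission
  imports Defs "HOL-Real_Asymp.Real_Asymp" "Jordan_Normal_Form.Determinant"
begin

text \<open>A product of two rectified Gaussian linear forms has an explicit expectation in terms of norms and inner products, so
  \<open>2 \<pi> F\<close> becomes an elementary function of the Gram data of the rows, and orthonormality of the targets lets one work in
  the target basis. In each case there is a critical point invariant under permuting all but one of the targets. We take a dyadic
  approximation \<open>C\<close> of it, at which the gradient has entries at most \<open>2^-41\<close> and the Hessian is at least \<open>1/128\<close>. An
  explicit Lipschitz bound on the Hessian shows that the loss on the sphere of radius \<open>2^-27\<close> around \<open>C\<close> exceeds its value
  at \<open>C\<close>, so the minimum over the closed ball is attained inside and is a local minimum; the loss there is positive,
  whereas the target network itself has loss zero.

  By symmetry the Hessian splits into a form in the off-diagonal entries, bounded by two scalars, and two quadratic forms in six and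
  seven variables. Their positivity, the gradient bound and the size of the loss are finite computations with \<open>\<pi>\<close>, square
  roots and arctangents, carried out in interval arithmetic on integers by rewriting.\<close>

section \<open>Gaussian expectations of products of two rectified linear forms\<close>

text \<open>The closed form of the loss divides by the area of the parallelogram spanned by two
  vectors, so all estimates are confined to a region where norms and areas stay away from zero.
  Nothing is proved at the critical point itself; only inequalities at the dyadic point enter. On
  the sphere of radius r = 2^-27 the gradient costs at most 20 * 2^-41 * r (there are at most 400
  entries), the Hessian gains r^2 / 256 and the cubic remainder costs at most r^2 / 600. In units of
  r^2 these are about 0.0012, 0.0039 and 0.0017, so the gain wins, but not by much: this fixes the
  precision of the point and the radius. The two quadratic forms reflect how permutations of the m
  symmetric indices act: six numbers attached to each index, taken relative to their means, and
  seven quantities invariant under the permutations. The other entries of a perturbation matter only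
  through row and column sums and are eliminated by least squares. For n = k the point is near 2/k
  times the all-ones matrix minus the identity; for n = k + 1 all but one of the targets are nearly
  reproduced by a row, and two extra rows have negative inner products with the remaining
  target.\<close>

abbreviation stdn :: "real measure" where "stdn \<equiv> density lborel std_normal_density"

lemma nn_integral_shear_snd:
  fixes f :: "real \<times> real \<Rightarrow> ennreal"
  assumes [measurable]: "f \<in> borel_measurable borel"
  shows "(\<integral>\<^sup>+x. \<integral>\<^sup>+y. f (x, y + u * x) \<partial>lborel \<partial>lborel) = (\<integral>\<^sup>+x. \<integral>\<^sup>+y. f (x, y) \<partial>lborel \<partial>lborel)"
proof (rule nn_integral_cong)
  fix x :: real
  have [measurable]: "f \<in> borel_measurable (borel \<Otimes>\<^sub>M borel)"
    using assms by (simp add: borel_prod)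
  have m: "(\<lambda>y. f (x, y)) \<in> borel_measurable borel" by measurable
  show "(\<integral>\<^sup>+y. f (x, y + u * x) \<partial>lborel) = (\<integral>\<^sup>+y. f (x, y) \<partial>lborel)"
    using nn_integral_real_affine[OF m, of 1 "u * x"] by (simp add: add.commute)
qed

lemma nn_integral_shear_fst:
  fixes f :: "real \<times> real \<Rightarrow> ennreal"
  assumes [measurable]: "f \<in> borel_measurable borel"
  shows "(\<integral>\<^sup>+x. \<integral>\<^sup>+y. f (x + u * y, y) \<partial>lborel \<partial>lborel) = (\<integral>\<^sup>+x. \<integral>\<^sup>+y. f (x, y) \<partial>lborel \<partial>lborel)"
proof -
  have [measurable]: "f \<in> borel_measurable (borel \<Otimes>\<^sub>M borel)"
    using assms by (simp add: borel_prod)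
  have sw: "(\<integral>\<^sup>+x. \<integral>\<^sup>+y. g (x, y) \<partial>lborel \<partial>lborel) = (\<integral>\<^sup>+y. \<integral>\<^sup>+x. g (x, y) \<partial>lborel \<partial>lborel)"
    if [measurable]: "g \<in> borel_measurable (borel \<Otimes>\<^sub>M borel)" for g :: "real \<times> real \<Rightarrow> ennreal"
    by (rule lborel_pair.Fubini'[symmetric]) measurable
  have "(\<integral>\<^sup>+x. \<integral>\<^sup>+y. f (x + u * y, y) \<partial>lborel \<partial>lborel) = (\<integral>\<^sup>+y. \<integral>\<^sup>+x. f (x + u * y, y) \<partial>lborel \<partial>lborel)"
    using sw[of "\<lambda>(x,y). f (x + u * y, y)"] by simp
  also have "\<dots> = (\<integral>\<^sup>+y. \<integral>\<^sup>+x. f (x, y) \<partial>lborel \<partial>lborel)"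
    using nn_integral_shear_snd[of "\<lambda>(y,x). f (x, y)" u] by (simp add: borel_prod[symmetric])
  also have "\<dots> = (\<integral>\<^sup>+x. \<integral>\<^sup>+y. f (x, y) \<partial>lborel \<partial>lborel)"
    using sw[of f] by simp
  finally show ?thesis .
qed

text \<open>A rotation is a composition of three shears.\<close>

lemma nn_integral_lborel_rotate:
  fixes f :: "real \<times> real \<Rightarrow> ennreal"
  assumes f: "f \<in> borel_measurable borel" and cs: "c\<^sup>2 + s\<^sup>2 = 1" and s: "s \<noteq> 0"
  shows "(\<integral>\<^sup>+x. \<integral>\<^sup>+y. f (c * x - s * y, s * x + c * y) \<partial>lborel \<partial>lborel)
       = (\<integral>\<^sup>+x. \<integral>\<^sup>+y. f (x, y) \<partial>lborel \<partial>lborel)"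
proof -
  \<comment> \<open>For c = cos t and s = sin t this is -tan (t / 2). The two outer shears use
    \<open>u\<close>, the middle one uses \<open>s\<close>.\<close>
  define u where "u = (c - 1) / s"
  have us: "1 + s * u = c" using s by (simp add: u_def)
  have "u + u * c = (c\<^sup>2 - 1) / s" by (simp add: u_def power2_eq_square algebra_simps add_divide_distrib[symmetric] diff_divide_distrib[symmetric])
  also have "c\<^sup>2 - 1 = - s * s" using cs by (simp add: power2_eq_square)
  finally have uc: "u + u * c = - s" using s by simp
  note fm = f[unfolded borel_prod[symmetric]]
  define f1 where "f1 = (\<lambda>(x, y). f (x + u * y, y))"
  define f2 where "f2 = (\<lambda>(x, y). f1 (x, y + s * x))"
  have f1m: "f1 \<in> borel_measurable (borel \<Otimes>\<^sub>M borel)" unfolding f1_def using fm by measurable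
  have f2m: "f2 \<in> borel_measurable (borel \<Otimes>\<^sub>M borel)" unfolding f2_def using f1m by measurable
  have e: "f (c * x - s * y, s * x + c * y) = f2 (x + u * y, y)" for x y
  proof -
    have "y + s * (x + u * y) = s * x + (1 + s * u) * y" by (simp add: algebra_simps)
    hence a: "y + s * (x + u * y) = s * x + c * y" by (simp only: us)
    have "x + u * y + u * (s * x + c * y) = (1 + s * u) * x + (u + u * c) * y" by (simp add: algebra_simps)
    hence "x + u * y + u * (s * x + c * y) = c * x - s * y" by (simp add: us uc)
    with a show ?thesis by (simp add: f2_def f1_def)
  qed
  have "(\<integral>\<^sup>+x. \<integral>\<^sup>+y. f (c * x - s * y, s * x + c * y) \<partial>lborel \<partial>lborel)
     = (\<integral>\<^sup>+x. \<integral>\<^sup>+y. f2 (x + u * y, y) \<partial>lborel \<partial>lborel)" by (simp add: e)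
  also have "\<dots> = (\<integral>\<^sup>+x. \<integral>\<^sup>+y. f2 (x, y) \<partial>lborel \<partial>lborel)"
    using f2m by (intro nn_integral_shear_fst) (simp add: borel_prod)
  also have "\<dots> = (\<integral>\<^sup>+x. \<integral>\<^sup>+y. f1 (x, y) \<partial>lborel \<partial>lborel)"
    unfolding f2_def prod.case using f1m by (intro nn_integral_shear_snd) (simp add: borel_prod)
  also have "\<dots> = (\<integral>\<^sup>+x. \<integral>\<^sup>+y. f (x, y) \<partial>lborel \<partial>lborel)"
    unfolding f1_def prod.case using f by (intro nn_integral_shear_fst)
  finally show ?thesis .
qed

lemma nn_integral_stdn2:
  fixes f :: "real \<times> real \<Rightarrow> ennreal"
  assumes "f \<in> borel_measurable (borel \<Otimes>\<^sub>M borel)"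
  shows "(\<integral>\<^sup>+x. \<integral>\<^sup>+y. f (x, y) \<partial>stdn \<partial>stdn)
    = (\<integral>\<^sup>+x. \<integral>\<^sup>+y. ennreal (exp (- (x\<^sup>2 + y\<^sup>2) / 2) / (2 * pi)) * f (x, y) \<partial>lborel \<partial>lborel)"
proof -
  note [measurable] = assms
  have e: "ennreal (std_normal_density x) * (ennreal (std_normal_density y) * z)
      = ennreal (exp (- (x\<^sup>2 + y\<^sup>2) / 2) / (2 * pi)) * z" for x y z
  proof -
    have "std_normal_density x * std_normal_density y = exp (- (x\<^sup>2 + y\<^sup>2) / 2) / (2 * pi)"
      by (simp add: std_normal_density_def exp_add[symmetric] add_divide_distrib diff_divide_distrib)
    thus ?thesis by (simp add: ennreal_mult[symmetric] mult.assoc[symmetric])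
  qed
  have "(\<integral>\<^sup>+x. \<integral>\<^sup>+y. f (x, y) \<partial>stdn \<partial>stdn)
    = (\<integral>\<^sup>+x. ennreal (std_normal_density x) * (\<integral>\<^sup>+y. ennreal (std_normal_density y) * f (x, y) \<partial>lborel) \<partial>lborel)"
    by (subst nn_integral_density; simp add: nn_integral_density)
  also have "\<dots> = (\<integral>\<^sup>+x. \<integral>\<^sup>+y. ennreal (exp (- (x\<^sup>2 + y\<^sup>2) / 2) / (2 * pi)) * f (x, y) \<partial>lborel \<partial>lborel)"
    by (simp add: nn_integral_cmult[symmetric] e)
  finally show ?thesis .
qed

lemma nn_integral_stdn_rotate:
  fixes f :: "real \<times> real \<Rightarrow> ennreal"
  assumes f: "f \<in> borel_measurable (borel \<Otimes>\<^sub>M borel)" and cs: "c\<^sup>2 + s\<^sup>2 = 1" and c: "c \<ge> 0"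
  shows "(\<integral>\<^sup>+x. \<integral>\<^sup>+y. f (c * x - s * y, s * x + c * y) \<partial>stdn \<partial>stdn)
       = (\<integral>\<^sup>+x. \<integral>\<^sup>+y. f (x, y) \<partial>stdn \<partial>stdn)"
proof (cases "s = 0")
  case True
  hence "c = 1" using cs c by (simp add: power2_eq_1_iff)
  with True show ?thesis by simp
next
  case False
  note [measurable] = f
  define h where "h = (\<lambda>(x, y). ennreal (exp (- (x\<^sup>2 + y\<^sup>2) / 2) / (2 * pi)) * f (x, y))"
  have h: "h \<in> borel_measurable (borel \<Otimes>\<^sub>M borel)" unfolding h_def by measurable
  have n: "(c * x - s * y)\<^sup>2 + (s * x + c * y)\<^sup>2 = x\<^sup>2 + y\<^sup>2" for x y
  proof -
    have "(c * x - s * y)\<^sup>2 + (s * x + c * y)\<^sup>2 = (c\<^sup>2 + s\<^sup>2) * (x\<^sup>2 + y\<^sup>2)"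
      by (simp add: algebra_simps power2_eq_square)
    thus ?thesis by (simp add: cs)
  qed
  have "(\<integral>\<^sup>+x. \<integral>\<^sup>+y. f (c * x - s * y, s * x + c * y) \<partial>stdn \<partial>stdn)
      = (\<integral>\<^sup>+x. \<integral>\<^sup>+y. h (c * x - s * y, s * x + c * y) \<partial>lborel \<partial>lborel)"
    unfolding h_def prod.case n
    by (rule nn_integral_stdn2[of "\<lambda>(x, y). f (c * x - s * y, s * x + c * y)", unfolded prod.case]) measurable
  also have "\<dots> = (\<integral>\<^sup>+x. \<integral>\<^sup>+y. h (x, y) \<partial>lborel \<partial>lborel)"
    using h by (intro nn_integral_lborel_rotate cs False) (simp add: borel_prod)
  also have "\<dots> = (\<integral>\<^sup>+x. \<integral>\<^sup>+y. f (x, y) \<partial>stdn \<partial>stdn)"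
    by (simp add: nn_integral_stdn2[OF f] h_def)
  finally show ?thesis .
qed

section \<open>Joint law of two linear forms in Gaussian coordinates\<close>

lemma prob_space_stdn: "prob_space stdn"
  using prob_space_normal_density[of 1 0] by simp

lemma nn_integral_stdn_swap:
  fixes f :: "real \<Rightarrow> real \<Rightarrow> ennreal"
  assumes "case_prod f \<in> borel_measurable (borel \<Otimes>\<^sub>M borel)"
  shows "(\<integral>\<^sup>+x. \<integral>\<^sup>+y. f x y \<partial>stdn \<partial>stdn) = (\<integral>\<^sup>+y. \<integral>\<^sup>+x. f x y \<partial>stdn \<partial>stdn)"
proof -
  interpret N: prob_space stdn by (rule prob_space_stdn)
  interpret pair_sigma_finite stdn stdn ..
  show ?thesis
    by (rule Fubini'[symmetric]) (use assms in simp)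
qed

text \<open>Polar coordinates in the right half-plane. The zero vector is given the direction (1,
  0), so a rotation is available in every case.\<close>

lemma sqrt_unit_vector:
  fixes u v :: real
  assumes "u \<ge> 0"
  obtains c s r where "c \<ge> 0" "r \<ge> 0" "c\<^sup>2 + s\<^sup>2 = 1" "r\<^sup>2 = u\<^sup>2 + v\<^sup>2" "u = r * c" "v = r * s"
proof (cases "u\<^sup>2 + v\<^sup>2 = 0")
  case True
  hence "u = 0" "v = 0" by (simp_all add: sum_power2_eq_zero_iff)
  thus ?thesis using that[of 1 0 0] by simp
next
  case False
  define r where "r = sqrt (u\<^sup>2 + v\<^sup>2)"
  have "u\<^sup>2 + v\<^sup>2 > 0" using False by (metis sum_power2_ge_zero order_le_less)
  hence r: "r > 0" "r\<^sup>2 = u\<^sup>2 + v\<^sup>2" by (simp_all add: r_def)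
  have "(u / r)\<^sup>2 + (v / r)\<^sup>2 = 1"
    using r(1) unfolding power_divide add_divide_distrib[symmetric] r(2)[symmetric] by simp
  thus ?thesis using that[of "u / r" r "v / r"] r assms by simp
qed

text \<open>The vectors (\<open>\<alpha>\<close>, 0) and (\<open>\<beta>\<close>,
  \<open>\<gamma>\<close>) have the same Gram matrix as \<open>a\<close> and \<open>b\<close> (a
  Cholesky factorization), and this matrix determines the law of a Gaussian pair. Induction on the
  dimension proves it from rotation invariance of the plane alone: each new coordinate is absorbed
  by two rotations. No quotient by \<open>\<alpha>\<close> is formed, so \<open>a = 0\<close> is
  included.\<close>

lemma gauss_pair_law:
  fixes a b :: "nat \<Rightarrow> real"
  shows "\<exists>\<alpha> \<beta> \<gamma>. \<alpha> \<ge> 0 \<and> \<gamma> \<ge> 0 \<and> \<alpha>\<^sup>2 = (\<Sum>j<k. a j * a j) \<and> \<alpha> * \<beta> = (\<Sum>j<k. a j * b j)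
    \<and> \<beta>\<^sup>2 + \<gamma>\<^sup>2 = (\<Sum>j<k. b j * b j)
    \<and> (\<forall>f \<in> borel_measurable (borel \<Otimes>\<^sub>M borel).
         (\<integral>\<^sup>+x. f (\<Sum>j<k. a j * x j, \<Sum>j<k. b j * x j) \<partial>gauss k :: ennreal)
       = (\<integral>\<^sup>+x. \<integral>\<^sup>+y. f (\<alpha> * x, \<beta> * x + \<gamma> * y) \<partial>stdn \<partial>stdn))"
proof (induction k)
  interpret N: prob_space stdn by (rule prob_space_stdn)
  interpret P: product_sigma_finite "\<lambda>_::nat. stdn" ..
  case 0
  have "space stdn = UNIV" by simp
  hence [simp]: "emeasure stdn UNIV = 1" using N.emeasure_space_1 by simp
  show ?case
    by (rule exI[of _ 0] exI[of _ 0])+ (simp add: gauss_def PiM_empty nn_integral_count_space_finite)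
next
  interpret N: prob_space stdn by (rule prob_space_stdn)
  interpret P: product_sigma_finite "\<lambda>_::nat. stdn" ..
  case (Suc k)
  then obtain \<alpha> \<beta> \<gamma> where IH: "\<alpha> \<ge> 0" "\<gamma> \<ge> 0" "\<alpha>\<^sup>2 = (\<Sum>j<k. a j * a j)" "\<alpha> * \<beta> = (\<Sum>j<k. a j * b j)"
    "\<beta>\<^sup>2 + \<gamma>\<^sup>2 = (\<Sum>j<k. b j * b j)"
    and law: "\<And>f :: real \<times> real \<Rightarrow> ennreal. f \<in> borel_measurable (borel \<Otimes>\<^sub>M borel) \<Longrightarrow>
       (\<integral>\<^sup>+x. f (\<Sum>j<k. a j * x j, \<Sum>j<k. b j * x j) \<partial>gauss k)
       = (\<integral>\<^sup>+x. \<integral>\<^sup>+y. f (\<alpha> * x, \<beta> * x + \<gamma> * y) \<partial>stdn \<partial>stdn)" by blast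
  \<comment> \<open>First rotation, of the old first coordinate and the new one: it turns the
    coefficients (\<open>\<alpha>\<close>, \<open>a k\<close>) of the first form into
    (\<open>r\<close>, 0) and those of the second form into (\<open>\<beta>'\<close>,
    \<open>d\<close>).\<close>
  obtain c s r where c: "c \<ge> 0" "r \<ge> 0" "c\<^sup>2 + s\<^sup>2 = 1" "r\<^sup>2 = \<alpha>\<^sup>2 + (a k)\<^sup>2" "\<alpha> = r * c" "a k = r * s"
    using sqrt_unit_vector[OF IH(1)] .
  define d where "d = b k * c - \<beta> * s"
  define \<beta>' where "\<beta>' = \<beta> * c + b k * s"
  \<comment> \<open>Second rotation, leaving the first coordinate alone: it turns
    (\<open>\<gamma>\<close>, \<open>d\<close>) into (\<open>r'\<close>, 0), and the freed
    coordinate integrates to 1.\<close>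
  obtain c' s' r' where c': "c' \<ge> 0" "r' \<ge> 0" "c'\<^sup>2 + s'\<^sup>2 = 1" "r'\<^sup>2 = \<gamma>\<^sup>2 + d\<^sup>2" "\<gamma> = r' * c'" "d = r' * s'"
    using sqrt_unit_vector[OF IH(2)] .
  have cc: "c * c = 1 - s * s" "c' * c' = 1 - s' * s'" using c(3) c'(3) by (simp_all add: power2_eq_square)
  have "\<beta>'\<^sup>2 + d\<^sup>2 = (c\<^sup>2 + s\<^sup>2) * (\<beta>\<^sup>2 + (b k)\<^sup>2)" unfolding \<beta>'_def d_def
    by (simp add: algebra_simps power2_eq_square)
  hence q: "\<beta>'\<^sup>2 + r'\<^sup>2 = \<beta>\<^sup>2 + \<gamma>\<^sup>2 + (b k)\<^sup>2" using c(3) c'(4) by simp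
  have "r * \<beta>' = \<alpha> * \<beta> + a k * b k" unfolding \<beta>'_def c(5,6) by (simp add: algebra_simps)
  hence rb: "r * \<beta>' = (\<Sum>j<Suc k. a j * b j)" using IH by simp
  have "(\<integral>\<^sup>+x. f (\<Sum>j<Suc k. a j * x j, \<Sum>j<Suc k. b j * x j) \<partial>gauss (Suc k))
     = (\<integral>\<^sup>+x. \<integral>\<^sup>+y. f (r * x, \<beta>' * x + r' * y) \<partial>stdn \<partial>stdn)"
    if fm[measurable]: "f \<in> borel_measurable (borel \<Otimes>\<^sub>M borel)" for f :: "real \<times> real \<Rightarrow> ennreal"
  proof -
    have "(\<integral>\<^sup>+x. f (\<Sum>j<Suc k. a j * x j, \<Sum>j<Suc k. b j * x j) \<partial>gauss (Suc k))
      = (\<integral>\<^sup>+y. \<integral>\<^sup>+x. f (\<Sum>j<Suc k. a j * (x(k := y)) j, \<Sum>j<Suc k. b j * (x(k := y)) j) \<partial>gauss k \<partial>stdn)"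
      unfolding gauss_def lessThan_Suc[of k]
      by (rule P.product_nn_integral_insert_rev) (auto simp: lessThan_Suc[symmetric])
    also have "\<dots> = (\<integral>\<^sup>+y. \<integral>\<^sup>+x. f ((\<Sum>j<k. a j * x j) + a k * y, (\<Sum>j<k. b j * x j) + b k * y) \<partial>gauss k \<partial>stdn)"
      by simp
    also have "\<dots> = (\<integral>\<^sup>+y. \<integral>\<^sup>+x. \<integral>\<^sup>+z. f (\<alpha> * x + a k * y, \<beta> * x + \<gamma> * z + b k * y) \<partial>stdn \<partial>stdn \<partial>stdn)"
    proof (rule nn_integral_cong)
      fix y
      show "(\<integral>\<^sup>+x. f ((\<Sum>j<k. a j * x j) + a k * y, (\<Sum>j<k. b j * x j) + b k * y) \<partial>gauss k)
         = (\<integral>\<^sup>+x. \<integral>\<^sup>+z. f (\<alpha> * x + a k * y, \<beta> * x + \<gamma> * z + b k * y) \<partial>stdn \<partial>stdn)"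
        using law[of "\<lambda>(u, v). f (u + a k * y, v + b k * y)"] by simp
    qed
    also have "\<dots> = (\<integral>\<^sup>+x. \<integral>\<^sup>+y. \<integral>\<^sup>+z. f (\<alpha> * x + a k * y, \<beta> * x + \<gamma> * z + b k * y) \<partial>stdn \<partial>stdn \<partial>stdn)"
      by (rule nn_integral_stdn_swap) measurable
    also have "\<dots> = (\<integral>\<^sup>+x. \<integral>\<^sup>+y. \<integral>\<^sup>+z. f (r * x, \<beta>' * x + (\<gamma> * z + d * y)) \<partial>stdn \<partial>stdn \<partial>stdn)"
    proof -
      define g where "g = (\<lambda>(x, y). \<integral>\<^sup>+z. f (\<alpha> * x + a k * y, \<beta> * x + \<gamma> * z + b k * y) \<partial>stdn)"
      have g: "g \<in> borel_measurable (borel \<Otimes>\<^sub>M borel)" unfolding g_def by measurable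
      have 1: "\<alpha> * (c * x - s * y) + a k * (s * x + c * y) = r * x" for x y
      proof -
        have "\<alpha> * (c * x - s * y) + a k * (s * x + c * y) = r * ((c * c + s * s) * x)"
          unfolding c(5,6) by (simp add: algebra_simps)
        thus ?thesis using c(3) by (simp add: power2_eq_square)
      qed
      have 2: "\<beta> * (c * x - s * y) + \<gamma> * z + b k * (s * x + c * y) = \<beta>' * x + (\<gamma> * z + d * y)" for x y z
        unfolding \<beta>'_def d_def by (simp add: algebra_simps)
      show ?thesis using nn_integral_stdn_rotate[OF g c(3,1)] unfolding g_def prod.case 1 2 by simp
    qed
    also have "\<dots> = (\<integral>\<^sup>+x. \<integral>\<^sup>+z. \<integral>\<^sup>+y. f (r * x, \<beta>' * x + (\<gamma> * z + d * y)) \<partial>stdn \<partial>stdn \<partial>stdn)"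
      by (intro nn_integral_cong nn_integral_stdn_swap) measurable
    also have "\<dots> = (\<integral>\<^sup>+x. \<integral>\<^sup>+z. \<integral>\<^sup>+y. f (r * x, \<beta>' * x + r' * z) \<partial>stdn \<partial>stdn \<partial>stdn)"
    proof (rule nn_integral_cong)
      fix x
      define g where "g = (\<lambda>(z, y). f (r * x, \<beta>' * x + (\<gamma> * z + d * y)))"
      have g: "g \<in> borel_measurable (borel \<Otimes>\<^sub>M borel)" unfolding g_def by measurable
      have 1: "\<gamma> * (c' * z - s' * y) + d * (s' * z + c' * y) = r' * z" for z y
      proof -
        have "\<gamma> * (c' * z - s' * y) + d * (s' * z + c' * y) = r' * ((c' * c' + s' * s') * z)"
          unfolding c'(5,6) by (simp add: algebra_simps)
        thus ?thesis using c'(3) by (simp add: power2_eq_square)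
      qed
      show "(\<integral>\<^sup>+z. \<integral>\<^sup>+y. f (r * x, \<beta>' * x + (\<gamma> * z + d * y)) \<partial>stdn \<partial>stdn)
          = (\<integral>\<^sup>+z. \<integral>\<^sup>+y. f (r * x, \<beta>' * x + r' * z) \<partial>stdn \<partial>stdn)"
        using nn_integral_stdn_rotate[OF g c'(3,1)] unfolding g_def prod.case 1 by simp
    qed
    also have "\<dots> = (\<integral>\<^sup>+x. \<integral>\<^sup>+z. f (r * x, \<beta>' * x + r' * z) \<partial>stdn \<partial>stdn)"
      using N.emeasure_space_1 by simp
    finally show ?thesis .
  qed
  hence "\<forall>f \<in> borel_measurable (borel \<Otimes>\<^sub>M borel). (\<integral>\<^sup>+x. f (\<Sum>j<Suc k. a j * x j, \<Sum>j<Suc k. b j * x j) \<partial>gauss (Suc k) :: ennreal)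
     = (\<integral>\<^sup>+x. \<integral>\<^sup>+y. f (r * x, \<beta>' * x + r' * y) \<partial>stdn \<partial>stdn)" by blast
  moreover have "r\<^sup>2 = (\<Sum>j<Suc k. a j * a j)" "\<beta>'\<^sup>2 + r'\<^sup>2 = (\<Sum>j<Suc k. b j * b j)"
    using c(4) q IH by (simp_all add: power2_eq_square)
  ultimately show ?case using c(2) c'(2) rb by blast
qed

section \<open>Expectation of a product of two rectified linear forms\<close>

lemma nn_integral_cubic_gaussian:
  fixes c :: real
  assumes c: "c > 0"
  shows "(\<integral>\<^sup>+x. ennreal (x ^ 3 * exp (- (c * x\<^sup>2) / 2)) * indicator {0..} x \<partial>lborel) = ennreal (2 / c\<^sup>2)"
proof -
  let ?F = "\<lambda>x. - (x\<^sup>2 / c + 2 / c\<^sup>2) * exp (- (c * x\<^sup>2) / 2)"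
  have "(\<integral>\<^sup>+x. ennreal (x ^ 3 * exp (- (c * x\<^sup>2) / 2)) * indicator {0..} x \<partial>lborel) = ennreal (0 - ?F 0)"
  proof (rule nn_integral_FTC_atLeast)
    fix x :: real
    show "DERIV ?F x :> x ^ 3 * exp (- (c * x\<^sup>2) / 2)"
      using c by (auto intro!: derivative_eq_intros simp: field_simps power2_eq_square power3_eq_cube)
    show "(?F \<longlongrightarrow> 0) at_top" using c by real_asymp
  qed auto
  thus ?thesis by simp
qed

text \<open>The angular part of the expectation, with t the slope y / x. The ramp starts at t =
  -beta / gamma, where the antiderivative simplifies because beta * t - gamma equals -gamma * (1 +
  t^2).\<close>

lemma nn_integral_ramp_cauchy:
  fixes \<beta> \<gamma> :: real
  assumes g: "\<gamma> > 0"
  shows "(\<integral>\<^sup>+t. ennreal (relu (\<beta> + \<gamma> * t) / (1 + t\<^sup>2)\<^sup>2) \<partial>lborel)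
    = ennreal ((\<gamma> + \<beta> * (pi / 2 + arctan (\<beta> / \<gamma>))) / 2)"
proof -
  let ?F = "\<lambda>t. (\<beta> * (t / (1 + t\<^sup>2) + arctan t) - \<gamma> / (1 + t\<^sup>2)) / 2"
  let ?a = "- \<beta> / \<gamma>"
  have pos: "1 + t\<^sup>2 > 0" for t :: real by (smt (verit) zero_le_power2)
  have "(\<integral>\<^sup>+t. ennreal (relu (\<beta> + \<gamma> * t) / (1 + t\<^sup>2)\<^sup>2) \<partial>lborel)
    = (\<integral>\<^sup>+t. ennreal ((\<beta> + \<gamma> * t) / (1 + t\<^sup>2)\<^sup>2) * indicator {?a..} t \<partial>lborel)"
  proof (rule nn_integral_cong)
    fix t :: real
    have "?a \<le> t \<longleftrightarrow> 0 \<le> \<beta> + \<gamma> * t" using g by (auto simp: field_simps)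
    thus "ennreal (relu (\<beta> + \<gamma> * t) / (1 + t\<^sup>2)\<^sup>2) = ennreal ((\<beta> + \<gamma> * t) / (1 + t\<^sup>2)\<^sup>2) * indicator {?a..} t"
      by (auto simp: relu_def indicator_def max_def)
  qed
  also have "\<dots> = ennreal (\<beta> * (pi / 2) / 2 - ?F ?a)"
  proof (rule nn_integral_FTC_atLeast)
    fix t :: real assume t: "?a \<le> t"
    show "0 \<le> (\<beta> + \<gamma> * t) / (1 + t\<^sup>2)\<^sup>2" using t g by (auto simp: field_simps)
    have ne: "1 + t\<^sup>2 \<noteq> 0" using pos[of t] by simp
    have d1: "((\<lambda>t. t / (1 + t\<^sup>2)) has_real_derivative ((1 + t\<^sup>2) - t * (2 * t)) / (1 + t\<^sup>2)\<^sup>2) (at t)"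
      using ne by (auto intro!: derivative_eq_intros simp: power2_eq_square)
    have d2: "((\<lambda>t. \<gamma> / (1 + t\<^sup>2)) has_real_derivative (- \<gamma> * (2 * t)) / (1 + t\<^sup>2)\<^sup>2) (at t)"
      using ne by (auto intro!: derivative_eq_intros simp: power2_eq_square)
    have d3: "(arctan has_real_derivative (1 + t\<^sup>2) / (1 + t\<^sup>2)\<^sup>2) (at t)"
      using DERIV_arctan[of t] ne by (simp add: power2_eq_square[of "1 + t\<^sup>2"] inverse_eq_divide)
    have "DERIV ?F t :> (\<beta> * (((1 + t\<^sup>2) - t * (2 * t)) / (1 + t\<^sup>2)\<^sup>2 + (1 + t\<^sup>2) / (1 + t\<^sup>2)\<^sup>2) - (- \<gamma> * (2 * t)) / (1 + t\<^sup>2)\<^sup>2) / 2"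
      by (intro DERIV_cdivide DERIV_diff DERIV_cmult DERIV_add d1 d2 d3)
    moreover have "(\<beta> * (((1 + t\<^sup>2) - t * (2 * t)) / (1 + t\<^sup>2)\<^sup>2 + (1 + t\<^sup>2) / (1 + t\<^sup>2)\<^sup>2) - (- \<gamma> * (2 * t)) / (1 + t\<^sup>2)\<^sup>2) / 2
       = (\<beta> + \<gamma> * t) / (1 + t\<^sup>2)\<^sup>2"
    proof -
      have "(\<beta> * (x / D + y / D) - z / D) / 2 = ((\<beta> * (x + y) - z) / 2) / D" for x y z D :: real
        by (simp add: add_divide_distrib diff_divide_distrib algebra_simps)
      moreover have "(\<beta> * ((1 + t\<^sup>2 - t * (2 * t)) + (1 + t\<^sup>2)) - (- \<gamma> * (2 * t))) / 2 = \<beta> + \<gamma> * t"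
        by (simp add: power2_eq_square algebra_simps)
      ultimately show ?thesis by metis
    qed
    ultimately show "DERIV ?F t :> (\<beta> + \<gamma> * t) / (1 + t\<^sup>2)\<^sup>2" by (simp only:)
  next
    have "((\<lambda>t::real. t / (1 + t\<^sup>2)) \<longlongrightarrow> 0) at_top" "((\<lambda>t::real. \<gamma> / (1 + t\<^sup>2)) \<longlongrightarrow> 0) at_top" by real_asymp+
    hence "(?F \<longlongrightarrow> (\<beta> * (0 + pi / 2) - 0) / 2) at_top"
      by (intro tendsto_intros tendsto_arctan_at_top) auto
    thus "(?F \<longlongrightarrow> \<beta> * (pi / 2) / 2) at_top" by simp
  qed measurable
  also have "\<beta> * (pi / 2) / 2 - ?F ?a = (\<gamma> + \<beta> * (pi / 2 + arctan (\<beta> / \<gamma>))) / 2"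
  proof -
    have s: "1 + ?a\<^sup>2 = (\<beta>\<^sup>2 + \<gamma>\<^sup>2) / \<gamma>\<^sup>2" using g by (simp add: field_simps power_divide)
    have q: "\<beta>\<^sup>2 + \<gamma>\<^sup>2 > 0" using g by (smt (verit) zero_le_power2 zero_less_power2)
    have "\<beta> * (?a / (1 + ?a\<^sup>2)) - \<gamma> / (1 + ?a\<^sup>2) = (\<beta> * ?a - \<gamma>) / (1 + ?a\<^sup>2)"
      by (simp add: diff_divide_distrib)
    also have "\<beta> * ?a - \<gamma> = - \<gamma> * (1 + ?a\<^sup>2)"
      unfolding s using g by (simp add: field_simps power2_eq_square)
    also have "\<dots> / (1 + ?a\<^sup>2) = - \<gamma>"
      using pos[of ?a] by (intro nonzero_mult_div_cancel_right) simp
    finally have "\<beta> * (?a / (1 + ?a\<^sup>2)) - \<gamma> / (1 + ?a\<^sup>2) = - \<gamma>" .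
    hence "\<beta> * (?a / (1 + ?a\<^sup>2) + arctan ?a) - \<gamma> / (1 + ?a\<^sup>2) = \<beta> * arctan ?a - \<gamma>"
      by (simp only: distrib_left)
    moreover have "arctan ?a = - arctan (\<beta> / \<gamma>)" using arctan_minus[of "\<beta> / \<gamma>"] by simp
    ultimately show ?thesis by (simp add: field_simps)
  qed
  finally show ?thesis .
qed

text \<open>The first factor vanishes for x <= 0. For x > 0 substitute y = x * t: the two rectified
  forms and the Jacobian each give a factor x, and the exponent becomes -(1 + t^2) x^2 / 2.
  Integrating over x first yields 2 / (1 + t^2)^2 and leaves the angular integral.\<close>

lemma nn_integral_stdn_relu_relu:
  fixes \<alpha> \<beta> \<gamma> :: real
  assumes a: "\<alpha> \<ge> 0" and g: "\<gamma> > 0"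
  shows "(\<integral>\<^sup>+x. \<integral>\<^sup>+y. ennreal (relu (\<alpha> * x) * relu (\<beta> * x + \<gamma> * y)) \<partial>stdn \<partial>stdn)
    = ennreal (\<alpha> * (\<gamma> + \<beta> * (pi / 2 + arctan (\<beta> / \<gamma>))) / (2 * pi))"
proof -
  have [measurable]: "relu \<in> borel_measurable borel" unfolding relu_def by measurable
  have rn: "relu z \<ge> 0" for z by (simp add: relu_def)
  define W where "W = (\<lambda>x t. ennreal (\<alpha> / (2 * pi) * relu (\<beta> + \<gamma> * t)) * (ennreal (x ^ 3 * exp (- ((1 + t\<^sup>2) * x\<^sup>2) / 2)) * indicator {0..} x))"
  have "(\<integral>\<^sup>+x. \<integral>\<^sup>+y. ennreal (relu (\<alpha> * x) * relu (\<beta> * x + \<gamma> * y)) \<partial>stdn \<partial>stdn)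
    = (\<integral>\<^sup>+x. \<integral>\<^sup>+y. ennreal (exp (- (x\<^sup>2 + y\<^sup>2) / 2) / (2 * pi)) * ennreal (relu (\<alpha> * x) * relu (\<beta> * x + \<gamma> * y)) \<partial>lborel \<partial>lborel)"
    using nn_integral_stdn2[of "\<lambda>(x, y). ennreal (relu (\<alpha> * x) * relu (\<beta> * x + \<gamma> * y))"] by simp
  also have "\<dots> = (\<integral>\<^sup>+x. \<integral>\<^sup>+t. W x t \<partial>lborel \<partial>lborel)"
  proof (rule nn_integral_cong)
    fix x :: real
    show "(\<integral>\<^sup>+y. ennreal (exp (- (x\<^sup>2 + y\<^sup>2) / 2) / (2 * pi)) * ennreal (relu (\<alpha> * x) * relu (\<beta> * x + \<gamma> * y)) \<partial>lborel)
      = (\<integral>\<^sup>+t. W x t \<partial>lborel)"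
    proof (cases "x > 0")
      case False
      hence "\<alpha> * x \<le> 0" using a by (simp add: mult_nonneg_nonpos)
      hence "relu (\<alpha> * x) = 0" by (simp add: relu_def)
      moreover have "x = 0 \<or> indicator {0..} x = (0::ennreal)" using False by (auto simp: indicator_def)
      ultimately show ?thesis by (auto simp: W_def)
    next
      case True
      have "(\<integral>\<^sup>+y. ennreal (exp (- (x\<^sup>2 + y\<^sup>2) / 2) / (2 * pi)) * ennreal (relu (\<alpha> * x) * relu (\<beta> * x + \<gamma> * y)) \<partial>lborel)
        = ennreal \<bar>x\<bar> * (\<integral>\<^sup>+t. ennreal (exp (- (x\<^sup>2 + (0 + x * t)\<^sup>2) / 2) / (2 * pi)) * ennreal (relu (\<alpha> * x) * relu (\<beta> * x + \<gamma> * (0 + x * t))) \<partial>lborel)"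
        using True by (intro nn_integral_real_affine) auto
      also have "\<dots> = (\<integral>\<^sup>+t. ennreal \<bar>x\<bar> * (ennreal (exp (- (x\<^sup>2 + (0 + x * t)\<^sup>2) / 2) / (2 * pi)) * ennreal (relu (\<alpha> * x) * relu (\<beta> * x + \<gamma> * (0 + x * t)))) \<partial>lborel)"
        by (rule nn_integral_cmult[symmetric]) measurable
      also have "\<dots> = (\<integral>\<^sup>+t. W x t \<partial>lborel)"
      proof (rule nn_integral_cong)
        fix t :: real
        have r1: "relu (\<alpha> * x) = \<alpha> * x" using True a by (simp add: relu_def)
        have "\<beta> * x + \<gamma> * (0 + x * t) = x * (\<beta> + \<gamma> * t)" by (simp add: algebra_simps)
        hence r2: "relu (\<beta> * x + \<gamma> * (0 + x * t)) = x * relu (\<beta> + \<gamma> * t)"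
          using True by (simp add: relu_def max_def zero_le_mult_iff)
        have e: "x\<^sup>2 + (0 + x * t)\<^sup>2 = (1 + t\<^sup>2) * x\<^sup>2" by (simp add: algebra_simps power2_eq_square)
        show "ennreal \<bar>x\<bar> * (ennreal (exp (- (x\<^sup>2 + (0 + x * t)\<^sup>2) / 2) / (2 * pi)) * ennreal (relu (\<alpha> * x) * relu (\<beta> * x + \<gamma> * (0 + x * t)))) = W x t"
          unfolding r1 r2 e W_def using True a rn[of "\<beta> + \<gamma> * t"]
          by (simp add: ennreal_mult[symmetric] power3_eq_cube algebra_simps)
      qed
      finally show ?thesis .
    qed
  qed
  also have "\<dots> = (\<integral>\<^sup>+t. \<integral>\<^sup>+x. W x t \<partial>lborel \<partial>lborel)"
    unfolding W_def by (rule lborel_pair.Fubini'[symmetric]) measurable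
  also have "\<dots> = (\<integral>\<^sup>+t. ennreal (\<alpha> / (2 * pi) * relu (\<beta> + \<gamma> * t)) * ennreal (2 / (1 + t\<^sup>2)\<^sup>2) \<partial>lborel)"
  proof (rule nn_integral_cong)
    fix t :: real
    have "1 + t\<^sup>2 > 0" by (smt (verit) zero_le_power2)
    thus "(\<integral>\<^sup>+x. W x t \<partial>lborel) = ennreal (\<alpha> / (2 * pi) * relu (\<beta> + \<gamma> * t)) * ennreal (2 / (1 + t\<^sup>2)\<^sup>2)"
      unfolding W_def by (subst nn_integral_cmult) (simp_all only: nn_integral_cubic_gaussian, measurable)
  qed
  also have "\<dots> = (\<integral>\<^sup>+t. ennreal (\<alpha> / pi) * ennreal (relu (\<beta> + \<gamma> * t) / (1 + t\<^sup>2)\<^sup>2) \<partial>lborel)"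
    using a rn by (intro nn_integral_cong) (simp add: ennreal_mult[symmetric])
  also have "\<dots> = ennreal (\<alpha> / pi) * ennreal ((\<gamma> + \<beta> * (pi / 2 + arctan (\<beta> / \<gamma>))) / 2)"
    by (subst nn_integral_cmult) (simp_all add: nn_integral_ramp_cauchy g)
  also have "\<dots> = ennreal (\<alpha> / pi * ((\<gamma> + \<beta> * (pi / 2 + arctan (\<beta> / \<gamma>))) / 2))"
    using a by (intro ennreal_mult'[symmetric]) simp
  finally show ?thesis by (simp add: field_simps)
qed

text \<open>For squared norms \<open>p\<close>, \<open>q\<close> and an angle t between the vectors,
  the square root is |w| |v| sin t and the bracket is pi - t: this is the arc-cosine kernel of
  degree one without its factor 1 / (2 pi). Written with an arctangent it is smooth in the Gram data
  wherever the area is positive.\<close>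

definition Phi :: "real \<Rightarrow> real \<Rightarrow> real \<Rightarrow> real" where
  "Phi p q s = sqrt (p * q - s\<^sup>2) + s * (pi / 2 + arctan (s / sqrt (p * q - s\<^sup>2)))"

definition dp :: "nat \<Rightarrow> (nat \<Rightarrow> real) \<Rightarrow> (nat \<Rightarrow> real) \<Rightarrow> real" where
  "dp k x y = (\<Sum>j<k. x j * y j)"

lemma relu_measurable[measurable]: "relu \<in> borel_measurable borel"
  unfolding relu_def by measurable

lemma linear_form_measurable[measurable]: "(\<lambda>x. \<Sum>j<k. a j * x j) \<in> borel_measurable (gauss k)"
  unfolding gauss_def by measurable

lemma has_bochner_integral_relu_relu:
  assumes D: "dp k a b ^ 2 < dp k a a * dp k b b"
  shows "has_bochner_integral (gauss k) (\<lambda>x. relu (\<Sum>j<k. a j * x j) * relu (\<Sum>j<k. b j * x j))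
     (Phi (dp k a a) (dp k b b) (dp k a b) / (2 * pi))"
proof -
  obtain \<alpha> \<beta> \<gamma> where l: "\<alpha> \<ge> 0" "\<gamma> \<ge> 0" "\<alpha>\<^sup>2 = dp k a a" "\<alpha> * \<beta> = dp k a b" "\<beta>\<^sup>2 + \<gamma>\<^sup>2 = dp k b b"
    and law: "\<And>f :: real \<times> real \<Rightarrow> ennreal. f \<in> borel_measurable (borel \<Otimes>\<^sub>M borel) \<Longrightarrow>
       (\<integral>\<^sup>+x. f (\<Sum>j<k. a j * x j, \<Sum>j<k. b j * x j) \<partial>gauss k)
       = (\<integral>\<^sup>+x. \<integral>\<^sup>+y. f (\<alpha> * x, \<beta> * x + \<gamma> * y) \<partial>stdn \<partial>stdn)"
    using gauss_pair_law[where k=k and a=a and b=b] unfolding dp_def by blast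
  have "\<alpha>\<^sup>2 * \<gamma>\<^sup>2 = dp k a a * dp k b b - (dp k a b)\<^sup>2"
    unfolding l(3,4,5)[symmetric] by (simp add: algebra_simps power_mult_distrib)
  hence Dg: "sqrt (dp k a a * dp k b b - (dp k a b)\<^sup>2) = \<alpha> * \<gamma>" and "\<alpha> * \<gamma> \<noteq> 0"
    using l(1,2) D by (auto simp flip: power_mult_distrib simp: real_sqrt_unique)
  hence ag: "\<alpha> > 0" "\<gamma> > 0" using l(1,2) by auto
  let ?v = "\<alpha> * (\<gamma> + \<beta> * (pi / 2 + arctan (\<beta> / \<gamma>))) / (2 * pi)"
  have v: "Phi (dp k a a) (dp k b b) (dp k a b) / (2 * pi) = ?v"
    unfolding Phi_def Dg unfolding l(4)[symmetric] using ag by (simp add: field_simps)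
  have "(\<integral>\<^sup>+x. ennreal (relu (\<Sum>j<k. a j * x j) * relu (\<Sum>j<k. b j * x j)) \<partial>gauss k) = ennreal ?v"
    using law[of "\<lambda>(u, v). ennreal (relu u * relu v)"] nn_integral_stdn_relu_relu[OF l(1) ag(2), of \<beta>] by simp
  \<comment> \<open>Needed to read the \<open>ennreal\<close> value as a Bochner integral. For beta
    < 0 the angle pi / 2 + arctan (beta / gamma) is arctan (gamma / (-beta)), hence at most gamma /
    (-beta).\<close>
  moreover have "?v \<ge> 0"
  proof -
    have "pi / 2 + arctan (\<beta> / \<gamma>) \<ge> 0" using arctan_lbound[of "\<beta> / \<gamma>"] by simp
    have "\<gamma> + \<beta> * (pi / 2 + arctan (\<beta> / \<gamma>)) \<ge> 0"
    proof (cases "\<beta> \<ge> 0")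
      case True thus ?thesis using ag \<open>pi / 2 + arctan (\<beta> / \<gamma>) \<ge> 0\<close> by simp
    next
      case False
      hence "arctan (\<gamma> / (- \<beta>)) \<le> \<gamma> / (- \<beta>)" using ag by (intro arctan_le_self) (simp add: divide_nonneg_neg)
      moreover have "arctan (1 / (\<beta> / \<gamma>)) = sgn (\<beta> / \<gamma>) * pi / 2 - arctan (\<beta> / \<gamma>)"
        using Transcendental.arctan_inverse[of "\<beta> / \<gamma>"] False ag by simp
      moreover have "\<beta> / \<gamma> < 0" using False ag by (simp add: divide_neg_pos)
      hence "sgn (\<beta> / \<gamma>) = - 1" by (simp only: sgn_neg)
      ultimately have "pi / 2 + arctan (\<beta> / \<gamma>) \<le> \<gamma> / (- \<beta>)"
        by (simp add: arctan_minus)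
      thus ?thesis using False by (simp add: field_simps)
    qed
    thus ?thesis using l(1) by simp
  qed
  ultimately show ?thesis unfolding v
    by (intro has_bochner_integral_nn_integral) (auto simp: relu_def)
qed

text \<open>Equal vectors span no area, and there \<open>Phi p p p\<close> evaluates, through
  division by zero, to \<open>p * pi / 2\<close>, which would give half of the true value. Squares
  are therefore integrated separately, as half of a Gaussian second moment.\<close>

lemma has_bochner_integral_relu_square:
  "has_bochner_integral (gauss k) (\<lambda>x. relu (\<Sum>j<k. a j * x j) * relu (\<Sum>j<k. a j * x j)) (dp k a a / 2)"
proof -
  interpret N: prob_space stdn by (rule prob_space_stdn)
  obtain \<alpha> \<beta> \<gamma> where l: "\<alpha> \<ge> 0" "\<alpha>\<^sup>2 = dp k a a"
    and law: "\<And>f :: real \<times> real \<Rightarrow> ennreal. f \<in> borel_measurable (borel \<Otimes>\<^sub>M borel) \<Longrightarrow>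
       (\<integral>\<^sup>+x. f (\<Sum>j<k. a j * x j, \<Sum>j<k. a j * x j) \<partial>gauss k)
       = (\<integral>\<^sup>+x. \<integral>\<^sup>+y. f (\<alpha> * x, \<beta> * x + \<gamma> * y) \<partial>stdn \<partial>stdn)"
    using gauss_pair_law[where k=k and a=a and b=a] unfolding dp_def by blast
  have hb: "has_bochner_integral lborel (\<lambda>x. indicator {0..} x *\<^sub>R (exp (- x\<^sup>2) * x ^ (2 * 1))) (sqrt pi / 4)"
    using gaussian_moment_even_pos[of 1] by simp
  have nn: "(\<integral>\<^sup>+x. ennreal (indicator {0..} x * (exp (- x\<^sup>2) * x\<^sup>2)) \<partial>lborel) = ennreal (sqrt pi / 4)"
    using has_bochner_integral_integral_eq[OF hb]
      nn_integral_eq_integral[OF integrable.intros[OF hb]] by (simp add: indicator_def)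
  have "(\<integral>\<^sup>+x. ennreal (relu (\<Sum>j<k. a j * x j) * relu (\<Sum>j<k. a j * x j)) \<partial>gauss k)
     = (\<integral>\<^sup>+x. ennreal (relu (\<alpha> * x) * relu (\<alpha> * x)) \<partial>stdn)"
    using law[of "\<lambda>(u, v). ennreal (relu u * relu u)"] N.emeasure_space_1 by simp
  also have "\<dots> = (\<integral>\<^sup>+x. ennreal (std_normal_density x) * ennreal (relu (\<alpha> * x) * relu (\<alpha> * x)) \<partial>lborel)"
    by (subst nn_integral_density) simp_all
  also have "\<dots> = ennreal \<bar>sqrt 2\<bar> * (\<integral>\<^sup>+x. ennreal (std_normal_density (0 + sqrt 2 * x)) * ennreal (relu (\<alpha> * (0 + sqrt 2 * x)) * relu (\<alpha> * (0 + sqrt 2 * x))) \<partial>lborel)"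
    by (intro nn_integral_real_affine) auto
  also have "\<dots> = ennreal \<bar>sqrt 2\<bar> * (\<integral>\<^sup>+x. ennreal (2 * \<alpha>\<^sup>2 / sqrt (2 * pi)) * ennreal (indicator {0..} x * (exp (- x\<^sup>2) * x\<^sup>2)) \<partial>lborel)"
  proof -
    have "ennreal (std_normal_density (0 + sqrt 2 * x)) * ennreal (relu (\<alpha> * (0 + sqrt 2 * x)) * relu (\<alpha> * (0 + sqrt 2 * x)))
       = ennreal (2 * \<alpha>\<^sup>2 / sqrt (2 * pi)) * ennreal (indicator {0..} x * (exp (- x\<^sup>2) * x\<^sup>2))" for x
    proof -
      have r: "relu (\<alpha> * (0 + sqrt 2 * x)) * relu (\<alpha> * (0 + sqrt 2 * x)) = 2 * \<alpha>\<^sup>2 * (indicator {0..} x * x\<^sup>2)"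
      proof (cases "x \<ge> 0")
        case True
        hence "relu (\<alpha> * (0 + sqrt 2 * x)) = \<alpha> * sqrt 2 * x" using l by (simp add: relu_def)
        thus ?thesis using True by (simp add: power2_eq_square)
      next
        case False
        hence "\<alpha> * (0 + sqrt 2 * x) \<le> 0" using l by (simp add: mult_nonneg_nonpos)
        hence "relu (\<alpha> * (0 + sqrt 2 * x)) = 0" by (simp add: relu_def)
        thus ?thesis using False by simp
      qed
      have d: "std_normal_density (0 + sqrt 2 * x) = exp (- x\<^sup>2) / sqrt (2 * pi)"
        by (simp add: std_normal_density_def power_mult_distrib)
      show ?thesis unfolding r d by (simp add: ennreal_mult[symmetric] indicator_def)
    qed
    thus ?thesis by simp
  qed
  also have "\<dots> = ennreal (sqrt 2) * (ennreal (2 * \<alpha>\<^sup>2 / sqrt (2 * pi)) * ennreal (sqrt pi / 4))"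
    by (subst nn_integral_cmult) (auto simp: nn)
  also have "\<dots> = ennreal (\<alpha>\<^sup>2 / 2)"
    by (simp add: ennreal_mult[symmetric] real_sqrt_mult)
  finally show ?thesis
    by (intro has_bochner_integral_nn_integral) (auto simp: relu_def l(2)[symmetric])
qed

section \<open>The loss as a function of Gram data\<close>

lemma dp_commute: "dp k x y = dp k y x"
  unfolding dp_def by (simp add: mult.commute)

lemma Phi_orthonormal: "Phi 1 1 0 = 1" by (simp add: Phi_def)

lemma sum_pairs_symmetric:
  fixes f :: "nat \<Rightarrow> nat \<Rightarrow> real"
  assumes "\<And>i j. i < n \<Longrightarrow> j < n \<Longrightarrow> f i j = f j i"
  shows "(\<Sum>i<n. \<Sum>j<n. f i j) = (\<Sum>i<n. f i i) + 2 * (\<Sum>i<n. \<Sum>j<i. f i j)"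
  using assms
proof (induction n)
  case (Suc n)
  have "(\<Sum>i<Suc n. \<Sum>j<Suc n. f i j) = (\<Sum>i<n. \<Sum>j<n. f i j) + (\<Sum>i<n. f i n) + (\<Sum>j<n. f n j) + f n n"
    by (simp add: sum.distrib)
  moreover have "(\<Sum>i<n. f i n) = (\<Sum>j<n. f n j)" using Suc.prems by (intro sum.cong) auto
  moreover have "(\<Sum>i<n. \<Sum>j<n. f i j) = (\<Sum>i<n. f i i) + 2 * (\<Sum>i<n. \<Sum>j<i. f i j)"
    using Suc.prems by (intro Suc.IH) auto
  ultimately show ?case by simp
qed simp

text \<open>\<open>C i j\<close> stands for the inner product of row \<open>i\<close> with target
  \<open>j\<close>, so the targets are the unit vectors. The terms with \<open>pi / 2\<close> are
  the squares of single rectified rows, and the last summand is the second moment of the target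
  network alone.\<close>

definition scaled_loss :: "nat \<Rightarrow> nat \<Rightarrow> (nat \<Rightarrow> nat \<Rightarrow> real) \<Rightarrow> real" where
  "scaled_loss k n C = (\<Sum>i<n. \<Sum>j<i. Phi (dp k (C i) (C i)) (dp k (C j) (C j)) (dp k (C i) (C j)))
     + pi / 2 * (\<Sum>i<n. dp k (C i) (C i))
     - (\<Sum>i<n. \<Sum>j<k. Phi (dp k (C i) (C i)) 1 (C i j))
     + (real k * pi + real k * (real k - 1)) / 2"

text \<open>The square is expanded and integrated term by term. Strict Cauchy-Schwarz is asked of
  all pairs of distinct vectors because the closed form divides by their area; equal indices use the
  formula for squares.\<close>

lemma relu_loss_gram:
  assumes V: "orthonormal_rows k V"
    and W: "\<And>i j. i < n \<Longrightarrow> j < n \<Longrightarrow> i \<noteq> j \<Longrightarrow> (dp k (W i) (W j))\<^sup>2 < dp k (W i) (W i) * dp k (W j) (W j)"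
    and WV: "\<And>i j. i < n \<Longrightarrow> j < k \<Longrightarrow> (dp k (W i) (V j))\<^sup>2 < dp k (W i) (W i)"
  shows "relu_loss k n V W = ((\<Sum>i<n. \<Sum>j<i. Phi (dp k (W i) (W i)) (dp k (W j) (W j)) (dp k (W i) (W j)))
     + pi / 2 * (\<Sum>i<n. dp k (W i) (W i))
     - (\<Sum>i<n. \<Sum>j<k. Phi (dp k (W i) (W i)) 1 (dp k (W i) (V j)))
     + (real k * pi + real k * (real k - 1)) / 2) / (2 * pi)"
proof -
  have VV: "dp k (V i) (V j) = (if i = j then 1 else 0)" if "i < k" "j < k" for i j
    using V that by (auto simp: orthonormal_rows_def dp_def)
  define R where "R = (\<lambda>i x. relu (\<Sum>j<k. W i j * x j))"
  define S where "S = (\<lambda>i x. relu (\<Sum>j<k. V i j * x j))"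
  define A where "A = (\<lambda>i j. if i = j then dp k (W i) (W i) / 2 else Phi (dp k (W i) (W i)) (dp k (W j) (W j)) (dp k (W i) (W j)) / (2 * pi))"
  define B where "B = (\<lambda>i j. Phi (dp k (W i) (W i)) 1 (dp k (W i) (V j)) / (2 * pi))"
  define G where "G = (\<lambda>(i::nat) j. if i = j then 1 / 2 else 1 / (2 * pi))"
  have A: "has_bochner_integral (gauss k) (\<lambda>x. R i x * R j x) (A i j)" if "i < n" "j < n" for i j
    unfolding R_def A_def
    using has_bochner_integral_relu_square[of k "W i"] has_bochner_integral_relu_relu[of k "W i" "W j"] W that by auto
  have B: "has_bochner_integral (gauss k) (\<lambda>x. R i x * S j x) (B i j)" if "i < n" "j < k" for i j
    unfolding R_def S_def B_def
    using has_bochner_integral_relu_relu[of k "W i" "V j"] WV[OF that] VV[OF that(2,2)] by simp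
  have G: "has_bochner_integral (gauss k) (\<lambda>x. S i x * S j x) (G i j)" if "i < k" "j < k" for i j
    unfolding S_def G_def
    using has_bochner_integral_relu_square[of k "V i"] has_bochner_integral_relu_relu[of k "V i" "V j"] VV that
    by (auto simp: Phi_orthonormal)
  have e: "1 / 2 * ((\<Sum>i<n. R i x) - (\<Sum>i<k. S i x))\<^sup>2
     = 1 / 2 * ((\<Sum>i<n. \<Sum>j<n. R i x * R j x) - 2 * (\<Sum>i<n. \<Sum>j<k. R i x * S j x) + (\<Sum>i<k. \<Sum>j<k. S i x * S j x))" for x
    by (simp add: sum_product[symmetric] power2_eq_square algebra_simps)
  have "has_bochner_integral (gauss k) (\<lambda>x. 1 / 2 * ((\<Sum>i<n. \<Sum>j<n. R i x * R j x) - 2 * (\<Sum>i<n. \<Sum>j<k. R i x * S j x) + (\<Sum>i<k. \<Sum>j<k. S i x * S j x)))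
     (1 / 2 * ((\<Sum>i<n. \<Sum>j<n. A i j) - 2 * (\<Sum>i<n. \<Sum>j<k. B i j) + (\<Sum>i<k. \<Sum>j<k. G i j)))"
    by (intro has_bochner_integral_mult_right has_bochner_integral_add has_bochner_integral_diff has_bochner_integral_sum A B G) auto
  hence "relu_loss k n V W = 1 / 2 * ((\<Sum>i<n. \<Sum>j<n. A i j) - 2 * (\<Sum>i<n. \<Sum>j<k. B i j) + (\<Sum>i<k. \<Sum>j<k. G i j))"
    unfolding relu_loss_def R_def[symmetric] S_def[symmetric]
    by (simp only: e[unfolded R_def S_def] R_def S_def has_bochner_integral_integral_eq)
  moreover have "(\<Sum>i<n. \<Sum>j<n. A i j) = (\<Sum>i<n. dp k (W i) (W i)) / 2
     + 2 * (\<Sum>i<n. \<Sum>j<i. Phi (dp k (W i) (W i)) (dp k (W j) (W j)) (dp k (W i) (W j))) / (2 * pi)"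
  proof -
    have "(\<Sum>i<n. \<Sum>j<n. A i j) = (\<Sum>i<n. A i i) + 2 * (\<Sum>i<n. \<Sum>j<i. A i j)"
      by (rule sum_pairs_symmetric) (auto simp: A_def Phi_def dp_commute mult.commute)
    also have "(\<Sum>i<n. \<Sum>j<i. A i j) = (\<Sum>i<n. \<Sum>j<i. Phi (dp k (W i) (W i)) (dp k (W j) (W j)) (dp k (W i) (W j))) / (2 * pi)"
      unfolding sum_divide_distrib by (intro sum.cong refl) (auto simp: A_def)
    also have "(\<Sum>i<n. A i i) = (\<Sum>i<n. dp k (W i) (W i)) / 2" by (simp add: A_def sum_divide_distrib)
    finally show ?thesis by simp
  qed
  moreover have "(\<Sum>i<k. \<Sum>j<k. G i j) = real k / 2 + (real k * (real k - 1)) / (2 * pi)"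
  proof -
    have "(\<Sum>j<k. G i j) = 1 / 2 + (real k - 1) / (2 * pi)" if "i < k" for i
    proof -
      have "(\<Sum>j<k. G i j) = (\<Sum>j<k. 1 / (2 * pi) + (if i = j then 1 / 2 - 1 / (2 * pi) else 0))"
        by (intro sum.cong) (auto simp: G_def)
      also have "\<dots> = real k / (2 * pi) + (1 / 2 - 1 / (2 * pi))" using that by (simp add: sum.distrib)
      finally show ?thesis by (simp add: diff_divide_distrib)
    qed
    hence "(\<Sum>i<k. \<Sum>j<k. G i j) = real k * (1 / 2 + (real k - 1) / (2 * pi))" by simp
    thus ?thesis by (simp add: algebra_simps)
  qed
  moreover have "(\<Sum>i<n. \<Sum>j<k. B i j) = (\<Sum>i<n. \<Sum>j<k. Phi (dp k (W i) (W i)) 1 (dp k (W i) (V j))) / (2 * pi)"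
    by (simp add: B_def sum_divide_distrib)
  ultimately show ?thesis by (simp only:) (simp add: add_divide_distrib diff_divide_distrib right_diff_distrib distrib_left)
qed

text \<open>For square matrices a right inverse is a left inverse. The relations between columns
  express that the targets form a complete basis, which Parseval's identity requires.\<close>

lemma orthonormal_rows_transpose:
  assumes "orthonormal_rows k V" "i < k" "j < k"
  shows "(\<Sum>l<k. V l i * V l j) = (if i = j then 1 else 0)"
proof -
  define A where "A = mat k k (\<lambda>(i, j). V i j)"
  have c: "A \<in> carrier_mat k k" by (simp add: A_def)
  have "A * transpose_mat A = 1\<^sub>m k"
    using assms(1) by (intro eq_matI) (auto simp: A_def scalar_prod_def orthonormal_rows_def atLeast0LessThan)
  hence "transpose_mat A * A = 1\<^sub>m k"
    using c by (intro mat_mult_left_right_inverse[OF c]) auto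
  hence "(transpose_mat A * A) $$ (i, j) = 1\<^sub>m k $$ (i, j)" by simp
  thus ?thesis using assms(2,3) by (simp add: A_def scalar_prod_def atLeast0LessThan)
qed

lemma parseval:
  assumes "orthonormal_rows k V"
  shows "dp k (\<lambda>l. dp k x (V l)) (\<lambda>l. dp k y (V l)) = dp k x y"
proof -
  have "dp k (\<lambda>l. dp k x (V l)) (\<lambda>l. dp k y (V l)) = (\<Sum>l<k. \<Sum>i<k. \<Sum>j<k. x i * y j * (V l i * V l j))"
    unfolding dp_def sum_product by (intro sum.cong refl) (simp add: algebra_simps)
  also have "\<dots> = (\<Sum>i<k. \<Sum>j<k. \<Sum>l<k. x i * y j * (V l i * V l j))"
    by (subst sum.swap) (intro sum.cong refl sum.swap)
  also have "\<dots> = (\<Sum>i<k. \<Sum>j<k. x i * y j * (if i = j then 1 else 0))"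
    using orthonormal_rows_transpose[OF assms] by (simp add: sum_distrib_left[symmetric])
  also have "\<dots> = dp k x y" by (simp add: dp_def if_distrib cong: if_cong)
  finally show ?thesis .
qed

text \<open>By Parseval's identity the coordinates in the target basis have the same Gram matrix as
  the rows, so the loss depends on \<open>W\<close> only through \<open>C\<close>, for every
  orthonormal \<open>V\<close> alike.\<close>

lemma relu_loss_eq_scaled_loss:
  assumes V: "orthonormal_rows k V"
    and C: "\<And>i l. i < n \<Longrightarrow> l < k \<Longrightarrow> C i l = dp k (W i) (V l)"
    and CC: "\<And>i j. i < n \<Longrightarrow> j < n \<Longrightarrow> i \<noteq> j \<Longrightarrow> (dp k (C i) (C j))\<^sup>2 < dp k (C i) (C i) * dp k (C j) (C j)"
    and CE: "\<And>i j. i < n \<Longrightarrow> j < k \<Longrightarrow> (C i j)\<^sup>2 < dp k (C i) (C i)"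
  shows "relu_loss k n V W = scaled_loss k n C / (2 * pi)"
proof -
  have g: "dp k (C i) (C j) = dp k (W i) (W j)" if "i < n" "j < n" for i j
    using parseval[OF V, of "W i" "W j"] C that by (simp add: dp_def)
  have "relu_loss k n V W = ((\<Sum>i<n. \<Sum>j<i. Phi (dp k (W i) (W i)) (dp k (W j) (W j)) (dp k (W i) (W j)))
     + pi / 2 * (\<Sum>i<n. dp k (W i) (W i))
     - (\<Sum>i<n. \<Sum>j<k. Phi (dp k (W i) (W i)) 1 (dp k (W i) (V j)))
     + (real k * pi + real k * (real k - 1)) / 2) / (2 * pi)"
  proof (rule relu_loss_gram[OF V])
    show "(dp k (W i) (W j))\<^sup>2 < dp k (W i) (W i) * dp k (W j) (W j)" if "i < n" "j < n" "i \<noteq> j" for i j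
      using CC[OF that] unfolding g[OF that(1,2)] g[OF that(1,1)] g[OF that(2,2)] .
    show "(dp k (W i) (V j))\<^sup>2 < dp k (W i) (W i)" if "i < n" "j < k" for i j
      using CE[OF that] unfolding g[OF that(1,1)] C[OF that] .
  qed
  also have "\<dots> = scaled_loss k n C / (2 * pi)"
    by (simp add: scaled_loss_def g C)
  finally show ?thesis .
qed

section \<open>Second-order expansion\<close>

lemma dp_add_left: "dp k (\<lambda>j. x j + y j) z = dp k x z + dp k y z"
  by (simp add: dp_def algebra_simps sum.distrib)

lemma dp_scale_left: "dp k (\<lambda>j. c * x j) z = c * dp k x z"
  by (simp add: dp_def sum_distrib_left algebra_simps)

lemma dp_diff_left: "dp k (\<lambda>j. x j - y j) z = dp k x z - dp k y z"
  by (simp add: dp_def algebra_simps sum_subtractf)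

lemma dp_add_right: "dp k z (\<lambda>j. x j + y j) = dp k z x + dp k z y"
  and dp_scale_right: "dp k z (\<lambda>j. c * x j) = c * dp k z x"
  and dp_diff_right: "dp k z (\<lambda>j. x j - y j) = dp k z x - dp k z y"
  by (simp_all add: dp_commute[of k z] dp_add_left dp_scale_left dp_diff_left)

lemmas dp_linear = dp_add_left dp_scale_left dp_diff_left dp_add_right dp_scale_right dp_diff_right

lemma dp_nonneg: "0 \<le> dp k x x"
  by (simp add: dp_def sum_nonneg)

lemma dp_Cauchy_Schwarz: "(dp k x y)\<^sup>2 \<le> dp k x x * dp k y y"
  using Cauchy_Schwarz_ineq_sum[of x y "{..<k}"] by (simp add: dp_def power2_eq_square)

lemma abs_dp_le:
  assumes "dp k x x \<le> a\<^sup>2" "dp k y y \<le> b\<^sup>2" "a \<ge> 0" "b \<ge> 0"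
  shows "\<bar>dp k x y\<bar> \<le> a * b"
proof -
  have "(dp k x y)\<^sup>2 \<le> a\<^sup>2 * b\<^sup>2"
    using dp_Cauchy_Schwarz[of k x y] mult_mono[OF assms(1,2)] dp_nonneg[of k y] by fastforce
  thus ?thesis using assms(3,4) by (metis power_mult_distrib abs_le_square_iff abs_of_nonneg mult_nonneg_nonneg)
qed

text \<open>Along the segment t -> (w + t d, v + t e), \<open>P\<close> and \<open>Q\<close> are
  half the derivatives of the squared norms and \<open>S\<close> is the derivative of the inner
  product. The bounds with the factor \<open>sqrt (p * q - s\<^sup>2)\<close> are the point: the
  derivatives of area and angle are these numerators divided by the area, hence of order
  \<open>\<epsilon>\<close> however small the area is. The constants come from 4 = 1 / sqrt (1/16)
  and 11/10 = sqrt (121/100).\<close>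

lemma gram_bounds:
  fixes k w v d e and \<epsilon> :: real
  defines "p \<equiv> dp k w w" and "q \<equiv> dp k v v" and "s \<equiv> dp k w v"
  defines "P \<equiv> dp k w d" and "Q \<equiv> dp k v e" and "S \<equiv> dp k w e + dp k v d"
  assumes p: "1 / 16 \<le> p" "p \<le> 121 / 100" and q: "1 / 16 \<le> q" "q \<le> 121 / 100"
    and Dpos: "p * q - s\<^sup>2 > 0"
    and d: "dp k d d \<le> \<epsilon>\<^sup>2" and e: "dp k e e \<le> \<epsilon>\<^sup>2" and eps: "0 \<le> \<epsilon>"
  shows "\<bar>P / p\<bar> \<le> 4 * \<epsilon>" "\<bar>Q / q\<bar> \<le> 4 * \<epsilon>" "\<bar>S\<bar> \<le> 22 / 10 * \<epsilon>" "\<bar>dp k d e\<bar> \<le> \<epsilon>\<^sup>2"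
    "\<bar>p * q * (P / p + Q / q) - s * S\<bar> \<le> 22 / 10 * \<epsilon> * sqrt (p * q - s\<^sup>2)"
    "\<bar>S - s * (P / p + Q / q)\<bar> \<le> 8 * \<epsilon> * sqrt (p * q - s\<^sup>2)"
    "\<bar>s\<bar> \<le> 121 / 100" "sqrt (p * q - s\<^sup>2) \<le> 121 / 100"
proof -
  have p0: "p > 0" "q > 0" using p q by auto
  define D where "D = sqrt (p * q - s\<^sup>2)"
  have D: "D > 0" "D\<^sup>2 = p * q - s\<^sup>2" using Dpos by (auto simp: D_def)
  have ww: "dp k w w \<le> (11 / 10)\<^sup>2" and vv: "dp k v v \<le> (11 / 10)\<^sup>2"
    using p q by (simp_all add: p_def q_def power2_eq_square)
  have half: "\<bar>dp k x y / dp k x x\<bar> \<le> 4 * \<epsilon>" if x: "1 / 16 \<le> dp k x x" and y: "dp k y y \<le> \<epsilon>\<^sup>2" for x y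
  proof -
    have x0: "dp k x x > 0" using x by linarith
    have "(dp k x y / dp k x x)\<^sup>2 \<le> dp k x x * dp k y y / (dp k x x)\<^sup>2"
      using dp_Cauchy_Schwarz[of k x y] by (simp add: power_divide divide_right_mono)
    also have "\<dots> = dp k y y / dp k x x" using x0 by (simp add: power2_eq_square)
    also have "\<dots> \<le> \<epsilon>\<^sup>2 / (1 / 16)" using x y x0 dp_nonneg[of k y] by (intro frac_le) auto
    also have "\<dots> = (4 * \<epsilon>)\<^sup>2" by (simp add: power_mult_distrib)
    finally show ?thesis using eps by (metis abs_le_square_iff abs_of_nonneg mult_nonneg_nonneg zero_le_numeral)
  qed
  show "\<bar>P / p\<bar> \<le> 4 * \<epsilon>" "\<bar>Q / q\<bar> \<le> 4 * \<epsilon>" unfolding P_def Q_def p_def q_def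
    using half p q d e by (auto simp: p_def q_def)
  show "\<bar>dp k d e\<bar> \<le> \<epsilon>\<^sup>2" using abs_dp_le[OF d e eps eps] by (simp add: power2_eq_square)
  have "\<bar>dp k w e\<bar> \<le> 11 / 10 * \<epsilon>" "\<bar>dp k v d\<bar> \<le> 11 / 10 * \<epsilon>"
    using abs_dp_le[OF ww e _ eps] abs_dp_le[OF vv d _ eps] by simp_all
  thus "\<bar>S\<bar> \<le> 22 / 10 * \<epsilon>" unfolding S_def by linarith
  show "\<bar>s\<bar> \<le> 121 / 100" using abs_dp_le[OF ww vv] by (simp add: s_def)
  have "p * q \<le> (121 / 100) * (121 / 100)" using p q p0 by (intro mult_mono) auto
  hence "p * q - s\<^sup>2 \<le> (121 / 100)\<^sup>2" by (simp add: power2_eq_square) (smt (verit) zero_le_square)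
  thus "sqrt (p * q - s\<^sup>2) \<le> 121 / 100" by (metis real_sqrt_le_iff real_sqrt_abs abs_of_nonneg zero_le_divide_iff zero_le_numeral)
  have sv: "dp k v w = s" by (simp add: s_def dp_commute)
  text \<open>The two numerators are the inner products with the normal parts, whose lengths carry a factor \<open>D\<close>.\<close>
  have n1: "dp k (\<lambda>j. q * w j - s * v j) (\<lambda>j. q * w j - s * v j) = q * D\<^sup>2"
    and n2: "dp k (\<lambda>j. p * v j - s * w j) (\<lambda>j. p * v j - s * w j) = p * D\<^sup>2"
    unfolding D(2) by (simp_all add: dp_linear sv p_def[symmetric] q_def[symmetric] s_def[symmetric] power2_eq_square algebra_simps)
  have "q * D\<^sup>2 \<le> (11 / 10 * D)\<^sup>2" "p * D\<^sup>2 \<le> (11 / 10 * D)\<^sup>2"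
    using mult_right_mono[OF q(2), of "D\<^sup>2"] mult_right_mono[OF p(2), of "D\<^sup>2"] by (auto simp: power_mult_distrib power2_eq_square)
  hence b1: "\<bar>dp k (\<lambda>j. q * w j - s * v j) d\<bar> \<le> 11 / 10 * D * \<epsilon>" "\<bar>dp k (\<lambda>j. p * v j - s * w j) e\<bar> \<le> 11 / 10 * D * \<epsilon>"
    unfolding n1[symmetric] n2[symmetric]
    using abs_dp_le[OF _ d _ eps, of "\<lambda>j. q * w j - s * v j" "11 / 10 * D"] abs_dp_le[OF _ e _ eps, of "\<lambda>j. p * v j - s * w j" "11 / 10 * D"] D(1)
    by (simp_all only: mult_nonneg_nonneg less_imp_le zero_le_divide_iff zero_le_numeral simp_thms)
  have "p * q * (P / p + Q / q) - s * S = dp k (\<lambda>j. q * w j - s * v j) d + dp k (\<lambda>j. p * v j - s * w j) e"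
    using p0 by (simp add: dp_linear P_def[symmetric] Q_def[symmetric] S_def field_simps)
  moreover have "11 / 10 * D * \<epsilon> + 11 / 10 * D * \<epsilon> = 22 / 10 * \<epsilon> * D" by simp
  ultimately show "\<bar>p * q * (P / p + Q / q) - s * S\<bar> \<le> 22 / 10 * \<epsilon> * sqrt (p * q - s\<^sup>2)"
    unfolding D_def[symmetric] using b1 by linarith
  \<comment> \<open>These are the residuals of the orthogonal projection of one vector onto the
    other; the norms are at least 1/4, which gives lengths of at most 4 * D.\<close>
  have m1: "dp k (\<lambda>j. v j - s / p * w j) (\<lambda>j. v j - s / p * w j) = D\<^sup>2 / p"
    and m2: "dp k (\<lambda>j. w j - s / q * v j) (\<lambda>j. w j - s / q * v j) = D\<^sup>2 / q"
    unfolding D(2) dp_linear sv p_def[symmetric] q_def[symmetric] s_def[symmetric]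
    using p0 by (simp_all add: power2_eq_square field_simps)
  have "D\<^sup>2 / p \<le> D\<^sup>2 / (1 / 16)" "D\<^sup>2 / q \<le> D\<^sup>2 / (1 / 16)"
    by (intro frac_le; use p q in simp)+
  hence "D\<^sup>2 / p \<le> (4 * D)\<^sup>2" "D\<^sup>2 / q \<le> (4 * D)\<^sup>2" by (simp_all add: power_mult_distrib)
  hence b2: "\<bar>dp k (\<lambda>j. v j - s / p * w j) d\<bar> \<le> 4 * D * \<epsilon>" "\<bar>dp k (\<lambda>j. w j - s / q * v j) e\<bar> \<le> 4 * D * \<epsilon>"
    unfolding m1[symmetric] m2[symmetric]
    using abs_dp_le[OF _ d _ eps, of "\<lambda>j. v j - s / p * w j" "4 * D"] abs_dp_le[OF _ e _ eps, of "\<lambda>j. w j - s / q * v j" "4 * D"] D(1)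
    by (simp_all only: mult_nonneg_nonneg less_imp_le zero_le_divide_iff zero_le_numeral simp_thms)
  have "S - s * (P / p + Q / q) = dp k (\<lambda>j. v j - s / p * w j) d + dp k (\<lambda>j. w j - s / q * v j) e"
    unfolding dp_linear P_def[symmetric] Q_def[symmetric] S_def by (simp add: algebra_simps)
  moreover have "4 * D * \<epsilon> + 4 * D * \<epsilon> = 8 * \<epsilon> * D" by simp
  ultimately show "\<bar>S - s * (P / p + Q / q)\<bar> \<le> 8 * \<epsilon> * sqrt (p * q - s\<^sup>2)"
    unfolding D_def[symmetric] using b2 by linarith
qed

section \<open>Three derivatives of the pair function along a segment\<close>

lemma abs_mult_le: "\<bar>x\<bar> \<le> a \<Longrightarrow> \<bar>y\<bar> \<le> b \<Longrightarrow> \<bar>x * y\<bar> \<le> a * b" for x y a b :: real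
  unfolding abs_mult by (intro mult_mono) auto

text \<open>The derivatives of the logarithmic rates \<open>l\<close> and \<open>m\<close>, of the
  area \<open>D\<close> and of the angle are treated as plain numbers here; only their sizes matter.
  Since \<open>D1\<close> and \<open>T1\<close> are of order \<open>\<epsilon>\<close> without loss,
  the second derivatives lose just one factor 11 from \<open>1 / D\<close>.\<close>

lemma third_derivative_bound:
  fixes p q s A B C S l m D \<epsilon> :: real
  defines "l1 \<equiv> A / p - 2 * l\<^sup>2" and "m1 \<equiv> B / q - 2 * m\<^sup>2"
    and "l2 \<equiv> - 2 * (A / p) * l - 4 * l * (A / p - 2 * l\<^sup>2)" and "m2 \<equiv> - 2 * (B / q) * m - 4 * m * (B / q - 2 * m\<^sup>2)"
    and "D1 \<equiv> (p * q * (l + m) - s * S) / D" and "T1 \<equiv> (S - s * (l + m)) / D"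
  defines "D2 \<equiv> (2 * p * q * (l + m)\<^sup>2 + p * q * (l1 + m1) - S\<^sup>2 - 2 * s * C - D1\<^sup>2) / D"
    and "T2 \<equiv> (2 * C - S * (l + m) - s * (l1 + m1) - T1 * D1) / D"
  assumes p: "1 / 16 \<le> p" "p \<le> 121 / 100" and q: "1 / 16 \<le> q" "q \<le> 121 / 100"
    and A: "0 \<le> A" "A \<le> \<epsilon>\<^sup>2" and B: "0 \<le> B" "B \<le> \<epsilon>\<^sup>2" and C: "\<bar>C\<bar> \<le> \<epsilon>\<^sup>2" and eps: "0 \<le> \<epsilon>"
    and l: "\<bar>l\<bar> \<le> 4 * \<epsilon>" and m: "\<bar>m\<bar> \<le> 4 * \<epsilon>" and S: "\<bar>S\<bar> \<le> 22 / 10 * \<epsilon>"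
    and D: "1 / 11 \<le> D" "D \<le> 121 / 100" and s: "\<bar>s\<bar> \<le> 121 / 100"
    and D1: "\<bar>p * q * (l + m) - s * S\<bar> \<le> 22 / 10 * \<epsilon> * D"
    and T1: "\<bar>S - s * (l + m)\<bar> \<le> 8 * \<epsilon> * D"
  shows "\<bar>D2 * (l + m) + 2 * D1 * (l1 + m1) + D * (l2 + m2) + 4 * C * T1 + S * T2\<bar> \<le> 30900 * \<epsilon> ^ 3"
proof -
  have D0: "D > 0" using D by linarith
  have D1': "\<bar>D1\<bar> \<le> 22 / 10 * \<epsilon>" and T1': "\<bar>T1\<bar> \<le> 8 * \<epsilon>"
    using D1 T1 D0 by (auto simp: D1_def T1_def abs_divide pos_divide_le_eq)
  have half: "0 \<le> a / x \<and> a / x \<le> 16 * \<epsilon>\<^sup>2" if "1 / 16 \<le> x" "0 \<le> a" "a \<le> \<epsilon>\<^sup>2" for a x :: real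
  proof -
    have "a / x \<le> \<epsilon>\<^sup>2 / (1 / 16)" using that by (intro frac_le) auto
    thus ?thesis using that by simp
  qed
  note Ap = half[OF p(1) A] and Bq = half[OF q(1) B]
  have sq: "0 \<le> x\<^sup>2 \<and> x\<^sup>2 \<le> 16 * \<epsilon>\<^sup>2" if "\<bar>x\<bar> \<le> 4 * \<epsilon>" for x :: real
    using power_mono[OF that, of 2] by (simp add: power_mult_distrib)
  have l1: "\<bar>l1\<bar> \<le> 32 * \<epsilon>\<^sup>2" using Ap sq[OF l] unfolding l1_def by linarith
  have m1: "\<bar>m1\<bar> \<le> 32 * \<epsilon>\<^sup>2" using Bq sq[OF m] unfolding m1_def by linarith
  have e3: "\<epsilon> ^ 3 = \<epsilon>\<^sup>2 * \<epsilon>" by (simp add: power3_eq_cube power2_eq_square)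
  have ap: "\<bar>A / p\<bar> \<le> 16 * \<epsilon>\<^sup>2" "\<bar>B / q\<bar> \<le> 16 * \<epsilon>\<^sup>2" using Ap Bq by auto
  have "\<bar>(A / p) * l\<bar> \<le> 64 * \<epsilon> ^ 3" "\<bar>l * l1\<bar> \<le> 128 * \<epsilon> ^ 3" "\<bar>(B / q) * m\<bar> \<le> 64 * \<epsilon> ^ 3" "\<bar>m * m1\<bar> \<le> 128 * \<epsilon> ^ 3"
    using abs_mult_le[OF ap(1) l] abs_mult_le[OF l l1] abs_mult_le[OF ap(2) m] abs_mult_le[OF m m1] by (simp_all add: e3 algebra_simps)
  hence l2: "\<bar>l2\<bar> \<le> 640 * \<epsilon> ^ 3" and m2: "\<bar>m2\<bar> \<le> 640 * \<epsilon> ^ 3"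
    unfolding l2_def m2_def l1_def[symmetric] m1_def[symmetric] by (simp_all only: mult.assoc)
  have lm: "\<bar>l + m\<bar> \<le> 8 * \<epsilon>" using l m by linarith
  have lm1: "\<bar>l1 + m1\<bar> \<le> 64 * \<epsilon>\<^sup>2" using l1 m1 by linarith
  have pq: "\<bar>p * q\<bar> \<le> 147 / 100"
  proof -
    have "\<bar>p * q\<bar> \<le> 121 / 100 * (121 / 100)" by (rule abs_mult_le) (use p q in auto)
    thus ?thesis by simp
  qed
  have lmsq: "\<bar>(l + m)\<^sup>2\<bar> \<le> 64 * \<epsilon>\<^sup>2" using abs_mult_le[OF lm lm] by (simp add: power2_eq_square algebra_simps)
  have Ssq: "\<bar>S\<^sup>2\<bar> \<le> 5 * \<epsilon>\<^sup>2" "\<bar>D1\<^sup>2\<bar> \<le> 5 * \<epsilon>\<^sup>2"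
  proof -
    have "22 / 10 * \<epsilon> * (22 / 10 * \<epsilon>) = 484 / 100 * \<epsilon>\<^sup>2" by (simp add: power2_eq_square)
    thus "\<bar>S\<^sup>2\<bar> \<le> 5 * \<epsilon>\<^sup>2" "\<bar>D1\<^sup>2\<bar> \<le> 5 * \<epsilon>\<^sup>2"
      using abs_mult_le[OF S S] abs_mult_le[OF D1' D1'] zero_le_power2[of \<epsilon>]
      unfolding power2_eq_square[of S] power2_eq_square[of D1] by linarith+
  qed
  have "\<bar>p * q * (l + m)\<^sup>2\<bar> \<le> 95 * \<epsilon>\<^sup>2" "\<bar>p * q * (l1 + m1)\<bar> \<le> 95 * \<epsilon>\<^sup>2" "\<bar>s * C\<bar> \<le> 13 / 10 * \<epsilon>\<^sup>2"
    using abs_mult_le[OF pq lmsq] abs_mult_le[OF pq lm1] abs_mult_le[OF s C] zero_le_power2[of \<epsilon>] by linarith+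
  hence "\<bar>2 * p * q * (l + m)\<^sup>2 + p * q * (l1 + m1) - S\<^sup>2 - 2 * s * C - D1\<^sup>2\<bar> \<le> 298 * \<epsilon>\<^sup>2"
    using Ssq unfolding mult.assoc by linarith
  hence D2: "\<bar>D2\<bar> \<le> 3278 * \<epsilon>\<^sup>2"
  proof -
    assume a: "\<bar>2 * p * q * (l + m)\<^sup>2 + p * q * (l1 + m1) - S\<^sup>2 - 2 * s * C - D1\<^sup>2\<bar> \<le> 298 * \<epsilon>\<^sup>2"
    have "\<bar>D2\<bar> \<le> 298 * \<epsilon>\<^sup>2 / (1 / 11)" unfolding D2_def abs_divide
      using a D D0 by (intro frac_le) auto
    thus ?thesis by simp
  qed
  have "\<bar>S * (l + m)\<bar> \<le> 18 * \<epsilon>\<^sup>2" "\<bar>s * (l1 + m1)\<bar> \<le> 78 * \<epsilon>\<^sup>2" "\<bar>T1 * D1\<bar> \<le> 18 * \<epsilon>\<^sup>2"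
    using abs_mult_le[OF S lm] abs_mult_le[OF s lm1] abs_mult_le[OF T1' D1'] zero_le_power2[of \<epsilon>]
    by (simp_all add: power2_eq_square)
  hence b: "\<bar>2 * C - S * (l + m) - s * (l1 + m1) - T1 * D1\<bar> \<le> 116 * \<epsilon>\<^sup>2" using C by linarith
  have T2: "\<bar>T2\<bar> \<le> 1276 * \<epsilon>\<^sup>2"
  proof -
    have "\<bar>T2\<bar> \<le> 116 * \<epsilon>\<^sup>2 / (1 / 11)" unfolding T2_def abs_divide
      using b D D0 by (intro frac_le) auto
    thus ?thesis by simp
  qed
  have e3': "0 \<le> \<epsilon> ^ 3" using eps by simp
  have DD: "\<bar>D\<bar> \<le> 121 / 100" and lm2: "\<bar>l2 + m2\<bar> \<le> 1280 * \<epsilon> ^ 3" using D D0 l2 m2 by linarith+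
  have "\<bar>D2 * (l + m)\<bar> \<le> 26224 * \<epsilon> ^ 3" "\<bar>D1 * (l1 + m1)\<bar> \<le> 141 * \<epsilon> ^ 3" "\<bar>D * (l2 + m2)\<bar> \<le> 1549 * \<epsilon> ^ 3"
    "\<bar>C * T1\<bar> \<le> 8 * \<epsilon> ^ 3" "\<bar>S * T2\<bar> \<le> 2808 * \<epsilon> ^ 3"
    using abs_mult_le[OF D2 lm] abs_mult_le[OF D1' lm1] abs_mult_le[OF DD lm2] abs_mult_le[OF C T1'] abs_mult_le[OF S T2] e3'
    by (simp_all add: e3 algebra_simps)
  \<comment> \<open>26224 + 2 * 141 + 1549 + 4 * 8 + 2808 = 30895.\<close>
  hence "\<bar>D2 * (l + m) + 2 * (D1 * (l1 + m1)) + D * (l2 + m2) + 4 * (C * T1) + S * T2\<bar> \<le> 30900 * \<epsilon> ^ 3" using e3' by linarith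
  thus ?thesis by (simp add: mult.assoc)
qed

text \<open>Second derivative of \<open>Phi\<close> along the segment from (w, v) in direction (d,
  e): \<open>A\<close>, \<open>B\<close>, \<open>C\<close> are the Gram entries of d and e,
  \<open>P\<close> and \<open>Q\<close> the inner products of each vector with its own direction,
  and \<open>S\<close> is the sum of the two mixed inner products. \<open>pair_gradient\<close> is
  the first derivative.\<close>

definition pair_hessian :: "real \<Rightarrow> real \<Rightarrow> real \<Rightarrow> real \<Rightarrow> real \<Rightarrow> real \<Rightarrow> real \<Rightarrow> real \<Rightarrow> real \<Rightarrow> real" where
  "pair_hessian p q s A B C P Q S = (let D = sqrt (p * q - s\<^sup>2) in
     D / p * A + D / q * B + 2 * (pi / 2 + arctan (s / D)) * C
     + (S - s * (P / p + Q / q))\<^sup>2 / D - D * (P / p - Q / q)\<^sup>2)"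

definition pair_gradient :: "real \<Rightarrow> real \<Rightarrow> real \<Rightarrow> real \<Rightarrow> real \<Rightarrow> real \<Rightarrow> real" where
  "pair_gradient p q s P Q S = (let D = sqrt (p * q - s\<^sup>2) in
     D * (P / p + Q / q) + (pi / 2 + arctan (s / D)) * S)"

text \<open>The squared norms and the inner product are quadratic polynomials in t. With the
  logarithmic rates \<open>l\<close>, \<open>m\<close>, the area \<open>D\<close> and the angle
  \<open>T\<close> as variables, the derivatives of each of these are rational in the others, which
  keeps all three derivatives of \<open>Phi\<close> short.\<close>

lemma Phi_path_derivatives:
  fixes p0 P0 A q0 Q0 B s0 S0 C t :: real
  defines "P \<equiv> \<lambda>t. P0 + t * A" and "Q \<equiv> \<lambda>t. Q0 + t * B" and "S \<equiv> \<lambda>t. S0 + 2 * t * C"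
    and "p \<equiv> \<lambda>t. p0 + 2 * t * P0 + t\<^sup>2 * A" and "q \<equiv> \<lambda>t. q0 + 2 * t * Q0 + t\<^sup>2 * B"
    and "s \<equiv> \<lambda>t. s0 + t * S0 + t\<^sup>2 * C"
  defines "D \<equiv> \<lambda>t. sqrt (p t * q t - (s t)\<^sup>2)" and "l \<equiv> \<lambda>t. P t / p t" and "m \<equiv> \<lambda>t. Q t / q t"
  defines "T \<equiv> \<lambda>t. pi / 2 + arctan (s t / D t)"
  defines "l1 \<equiv> \<lambda>t. A / p t - 2 * (l t)\<^sup>2" and "m1 \<equiv> \<lambda>t. B / q t - 2 * (m t)\<^sup>2"
    and "D1 \<equiv> \<lambda>t. (p t * q t * (l t + m t) - s t * S t) / D t"
    and "T1 \<equiv> \<lambda>t. (S t - s t * (l t + m t)) / D t"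
  defines "l2 \<equiv> \<lambda>t. - 2 * (A / p t) * l t - 4 * l t * (A / p t - 2 * (l t)\<^sup>2)"
    and "m2 \<equiv> \<lambda>t. - 2 * (B / q t) * m t - 4 * m t * (B / q t - 2 * (m t)\<^sup>2)"
    and "D2 \<equiv> \<lambda>t. (2 * p t * q t * (l t + m t)\<^sup>2 + p t * q t * (l1 t + m1 t) - (S t)\<^sup>2 - 2 * s t * C - (D1 t)\<^sup>2) / D t"
    and "T2 \<equiv> \<lambda>t. (2 * C - S t * (l t + m t) - s t * (l1 t + m1 t) - T1 t * D1 t) / D t"
  assumes pos: "p t > 0" "q t > 0" "p t * q t - (s t)\<^sup>2 > 0"
  shows "((\<lambda>t. Phi (p t) (q t) (s t)) has_real_derivative D t * (l t + m t) + T t * S t) (at t)"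
    "((\<lambda>t. D t * (l t + m t) + T t * S t) has_real_derivative
       D1 t * (l t + m t) + D t * (l1 t + m1 t) + T1 t * S t + 2 * C * T t) (at t)"
    "((\<lambda>t. D1 t * (l t + m t) + D t * (l1 t + m1 t) + T1 t * S t + 2 * C * T t) has_real_derivative
       D2 t * (l t + m t) + 2 * D1 t * (l1 t + m1 t) + D t * (l2 t + m2 t) + 4 * C * T1 t + S t * T2 t) (at t)"
proof -
  have Dt: "D t > 0" "(D t)\<^sup>2 = p t * q t - (s t)\<^sup>2" using pos by (auto simp: D_def)
  have dP: "(P has_real_derivative A) (at t)" "(Q has_real_derivative B) (at t)" "(S has_real_derivative 2 * C) (at t)"
    unfolding P_def Q_def S_def by (auto intro!: derivative_eq_intros)
  have dp': "(p has_real_derivative 2 * P t) (at t)" "(q has_real_derivative 2 * Q t) (at t)" "(s has_real_derivative S t) (at t)"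
    unfolding p_def q_def s_def P_def Q_def S_def by (auto intro!: derivative_eq_intros simp: algebra_simps)
  have lp: "P t = l t * p t" "Q t = m t * q t" using pos by (auto simp: l_def m_def)
  have dl: "(l has_real_derivative l1 t) (at t)"
  proof -
    have "(l has_real_derivative (A * p t - P t * (2 * P t)) / (p t * p t)) (at t)"
      unfolding l_def using pos by (intro DERIV_divide dP dp') auto
    moreover have "(A * p t - P t * (2 * P t)) / (p t * p t) = l1 t"
      unfolding l1_def lp using pos by (simp add: field_simps power2_eq_square)
    ultimately show ?thesis by simp
  qed
  have dm: "(m has_real_derivative m1 t) (at t)"
  proof -
    have "(m has_real_derivative (B * q t - Q t * (2 * Q t)) / (q t * q t)) (at t)"
      unfolding m_def using pos by (intro DERIV_divide dP dp') auto
    moreover have "(B * q t - Q t * (2 * Q t)) / (q t * q t) = m1 t"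
      unfolding m1_def lp using pos by (simp add: field_simps power2_eq_square)
    ultimately show ?thesis by simp
  qed
  have dl1: "(l1 has_real_derivative l2 t) (at t)"
  proof -
    have "(l1 has_real_derivative (0 * p t - A * (2 * P t)) / (p t * p t) - 2 * (of_nat 2 * (l1 t * l t ^ (2 - Suc 0)))) (at t)"
      unfolding l1_def using pos dl[unfolded l1_def]
      by (intro DERIV_diff DERIV_cmult DERIV_power DERIV_divide DERIV_const dp') auto
    moreover have "(0 * p t - A * (2 * P t)) / (p t * p t) - 2 * (of_nat 2 * (l1 t * l t ^ (2 - Suc 0))) = l2 t"
      unfolding l2_def l1_def lp using pos by (simp add: field_simps)
    ultimately show ?thesis by simp
  qed
  have dm1: "(m1 has_real_derivative m2 t) (at t)"
  proof -
    have "(m1 has_real_derivative (0 * q t - B * (2 * Q t)) / (q t * q t) - 2 * (of_nat 2 * (m1 t * m t ^ (2 - Suc 0)))) (at t)"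
      unfolding m1_def using pos dm[unfolded m1_def]
      by (intro DERIV_diff DERIV_cmult DERIV_power DERIV_divide DERIV_const dp') auto
    moreover have "(0 * q t - B * (2 * Q t)) / (q t * q t) - 2 * (of_nat 2 * (m1 t * m t ^ (2 - Suc 0))) = m2 t"
      unfolding m2_def m1_def lp using pos by (simp add: field_simps)
    ultimately show ?thesis by simp
  qed
  have dpq: "((\<lambda>t. p t * q t) has_real_derivative 2 * p t * q t * (l t + m t)) (at t)"
  proof -
    have "((\<lambda>t. p t * q t) has_real_derivative 2 * P t * q t + 2 * Q t * p t) (at t)"
      by (intro DERIV_mult dp')
    thus ?thesis by (simp add: lp algebra_simps)
  qed
  have dD: "(D has_real_derivative D1 t) (at t)"
  proof -
    have d: "((\<lambda>t. p t * q t - (s t)\<^sup>2) has_real_derivative 2 * p t * q t * (l t + m t) - of_nat 2 * (S t * s t ^ (2 - Suc 0))) (at t)"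
      by (intro DERIV_diff dpq DERIV_power dp')
    have "(sqrt has_real_derivative inverse (D t) / 2) (at (p t * q t - (s t)\<^sup>2))"
      unfolding D_def by (rule DERIV_real_sqrt) (use pos in simp)
    from DERIV_chain2[OF this d] have "(D has_real_derivative inverse (D t) / 2 * (2 * p t * q t * (l t + m t) - of_nat 2 * (S t * s t ^ (2 - Suc 0)))) (at t)"
      unfolding D_def .
    moreover have "inverse (D t) / 2 * (2 * p t * q t * (l t + m t) - of_nat 2 * (S t * s t ^ (2 - Suc 0))) = D1 t"
      unfolding D1_def using Dt by (simp add: field_simps)
    ultimately show ?thesis by simp
  qed
  have dT: "(T has_real_derivative T1 t) (at t)"
  proof -
    have d: "((\<lambda>t. s t / D t) has_real_derivative (S t * D t - s t * D1 t) / (D t * D t)) (at t)"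
      using Dt by (intro DERIV_divide dp' dD) auto
    have "(T has_real_derivative 0 + inverse (1 + (s t / D t)\<^sup>2) * ((S t * D t - s t * D1 t) / (D t * D t))) (at t)"
      unfolding T_def by (intro DERIV_add DERIV_const DERIV_chain2[OF DERIV_arctan d])
    moreover have "0 + inverse (1 + (s t / D t)\<^sup>2) * ((S t * D t - s t * D1 t) / (D t * D t)) = T1 t"
    proof -
      have "1 + (s t / D t)\<^sup>2 = p t * q t / (D t)\<^sup>2" using Dt by (simp add: power_divide field_simps)
      hence i: "inverse (1 + (s t / D t)\<^sup>2) * (x / (D t * D t)) = x / (p t * q t)" for x
        using Dt(1) pos by (simp add: power2_eq_square)
      \<comment> \<open>By \<open>D\<^sup>2 = p * q - s\<^sup>2\<close> the numerator of the
        quotient rule acquires the factor \<open>p * q\<close>, which cancels against 1 + (s / D)^2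
        = p q / D^2.\<close>
      have n: "S t * D t - s t * D1 t = p t * q t * T1 t"
      proof -
        have tD: "T1 t * D t = S t - s t * (l t + m t)" unfolding T1_def using Dt(1) by simp
        have "(S t * D t - s t * D1 t) * D t = S t * (D t)\<^sup>2 - s t * (p t * q t * (l t + m t) - s t * S t)"
          unfolding D1_def using Dt(1) by (simp add: field_simps power2_eq_square)
        also have "\<dots> = p t * q t * (T1 t * D t)"
          unfolding Dt(2) tD by (simp add: algebra_simps power2_eq_square)
        finally show ?thesis using Dt(1) by simp
      qed
      show ?thesis unfolding i n using pos by simp
    qed
    ultimately show ?thesis by simp
  qed
  have quot: "(x * D t - y * D t * z) / (D t * D t) = (x - y * z) / D t" for x y z
    using Dt(1) by (simp add: field_simps)
  have dD1: "(D1 has_real_derivative D2 t) (at t)"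
  proof -
    have "(D1 has_real_derivative ((2 * p t * q t * (l t + m t) * (l t + m t) + (l1 t + m1 t) * (p t * q t) - (S t * S t + 2 * C * s t)) * D t
        - (p t * q t * (l t + m t) - s t * S t) * D1 t) / (D t * D t)) (at t)"
      unfolding D1_def[abs_def] using Dt(1)
      by (intro DERIV_divide DERIV_diff DERIV_mult dpq DERIV_add dl dm dp' dP dD[unfolded D1_def]) auto
    moreover have "p t * q t * (l t + m t) - s t * S t = D1 t * D t" using Dt(1) by (simp add: D1_def)
    ultimately have "(D1 has_real_derivative (2 * p t * q t * (l t + m t) * (l t + m t) + (l1 t + m1 t) * (p t * q t)
        - (S t * S t + 2 * C * s t) - D1 t * D1 t) / D t) (at t)"
      by (simp only: quot)
    thus ?thesis unfolding D2_def by (simp add: power2_eq_square algebra_simps)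
  qed
  have dT1: "(T1 has_real_derivative T2 t) (at t)"
  proof -
    have "(T1 has_real_derivative ((2 * C - (S t * (l t + m t) + (l1 t + m1 t) * s t)) * D t
        - (S t - s t * (l t + m t)) * D1 t) / (D t * D t)) (at t)"
      unfolding T1_def[abs_def] using Dt(1)
      by (intro DERIV_divide DERIV_diff DERIV_mult DERIV_add dl dm dp' dP dD) auto
    moreover have "S t - s t * (l t + m t) = T1 t * D t" using Dt(1) by (simp add: T1_def)
    ultimately have "(T1 has_real_derivative (2 * C - (S t * (l t + m t) + (l1 t + m1 t) * s t) - T1 t * D1 t) / D t) (at t)"
      by (simp only: quot)
    thus ?thesis unfolding T2_def by (simp add: algebra_simps)
  qed
  have "((\<lambda>t. D t + s t * T t) has_real_derivative D1 t + (S t * T t + T1 t * s t)) (at t)"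
    by (intro DERIV_add DERIV_mult dD dp' dT)
  \<comment> \<open>The derivative of the area and \<open>s\<close> times that of the angle add up
    to a multiple of the squared area, so the first derivative of \<open>Phi\<close> contains no
    quotient by the area.\<close>
  moreover have "D1 t + (S t * T t + T1 t * s t) = D t * (l t + m t) + T t * S t"
  proof -
    have "D1 t + T1 t * s t = (p t * q t - (s t)\<^sup>2) * (l t + m t) / D t"
      unfolding D1_def T1_def by (simp add: add_divide_distrib[symmetric] diff_divide_distrib[symmetric] algebra_simps power2_eq_square)
    hence "D1 t + T1 t * s t = D t * (l t + m t)" unfolding Dt(2)[symmetric] using Dt(1) by (simp add: power2_eq_square)
    thus ?thesis by (simp add: algebra_simps)
  qed
  ultimately have "((\<lambda>t. D t + s t * T t) has_real_derivative D t * (l t + m t) + T t * S t) (at t)"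
    by (simp only:)
  moreover have "(\<lambda>t. D t + s t * T t) = (\<lambda>t. Phi (p t) (q t) (s t))"
    unfolding Phi_def D_def T_def ..
  ultimately show "((\<lambda>t. Phi (p t) (q t) (s t)) has_real_derivative D t * (l t + m t) + T t * S t) (at t)"
    by simp
  have "((\<lambda>t. D t * (l t + m t) + T t * S t) has_real_derivative
      D1 t * (l t + m t) + (l1 t + m1 t) * D t + (T1 t * S t + 2 * C * T t)) (at t)"
    by (intro DERIV_add DERIV_mult dD dl dm dT dP)
  thus "((\<lambda>t. D t * (l t + m t) + T t * S t) has_real_derivative
       D1 t * (l t + m t) + D t * (l1 t + m1 t) + T1 t * S t + 2 * C * T t) (at t)"
    by (simp add: algebra_simps)
  have "((\<lambda>t. D1 t * (l t + m t) + D t * (l1 t + m1 t) + T1 t * S t + 2 * C * T t) has_real_derivative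
      (D2 t * (l t + m t) + (l1 t + m1 t) * D1 t) + (D1 t * (l1 t + m1 t) + (l2 t + m2 t) * D t)
        + (T2 t * S t + 2 * C * T1 t) + 2 * C * T1 t) (at t)"
    by (intro DERIV_add DERIV_mult DERIV_cmult dD dl dm dT dP dD1 dl1 dm1 dT1)
  thus "((\<lambda>t. D1 t * (l t + m t) + D t * (l1 t + m1 t) + T1 t * S t + 2 * C * T t) has_real_derivative
       D2 t * (l t + m t) + 2 * D1 t * (l1 t + m1 t) + D t * (l2 t + m2 t) + 4 * C * T1 t + S t * T2 t) (at t)"
    by (simp add: algebra_simps)
qed

text \<open>Taylor's formula with a Lagrange remainder of third order; 5150 = 30900 / 6. The
  hypotheses are a little stronger than the bounds 1/16, 121/100 and 1/121 used along the segment,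
  which therefore persist for \<open>\<epsilon> \<le> 1 / 1000000\<close>.\<close>

lemma Phi_second_order:
  fixes k w v d e and \<epsilon> :: real
  defines "p \<equiv> dp k w w" and "q \<equiv> dp k v v" and "s \<equiv> dp k w v"
    and "A \<equiv> dp k d d" and "B \<equiv> dp k e e" and "C \<equiv> dp k d e"
    and "P \<equiv> dp k w d" and "Q \<equiv> dp k v e" and "S \<equiv> dp k w e + dp k v d"
    and "w' \<equiv> \<lambda>j. w j + d j" and "v' \<equiv> \<lambda>j. v j + e j"
  assumes p: "7 / 100 \<le> p" "p \<le> 11 / 10" and q: "7 / 100 \<le> q" "q \<le> 11 / 10"
    and D: "101 / 10000 \<le> p * q - s\<^sup>2"
    and d: "A \<le> \<epsilon>\<^sup>2" and e: "B \<le> \<epsilon>\<^sup>2" and eps: "0 \<le> \<epsilon>" "\<epsilon> \<le> 1 / 1000000"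
  shows "(dp k w' v')\<^sup>2 < dp k w' w' * dp k v' v'"
    and "\<bar>Phi (dp k w' w') (dp k v' v') (dp k w' v') - Phi p q s - pair_gradient p q s P Q S
       - pair_hessian p q s A B C P Q S / 2\<bar> \<le> 5150 * \<epsilon> ^ 3"
proof -
  define Pt where "Pt = (\<lambda>t. P + t * A)"
  define Qt where "Qt = (\<lambda>t. Q + t * B)"
  define St where "St = (\<lambda>t. S + 2 * t * C)"
  define pt where "pt = (\<lambda>t. p + 2 * t * P + t\<^sup>2 * A)"
  define qt where "qt = (\<lambda>t. q + 2 * t * Q + t\<^sup>2 * B)"
  define st where "st = (\<lambda>t. s + t * S + t\<^sup>2 * C)"
  define wt where "wt = (\<lambda>t j. w j + t * d j)"
  define vt where "vt = (\<lambda>t j. v j + t * e j)"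
  have gram: "dp k (wt t) (wt t) = pt t" "dp k (vt t) (vt t) = qt t" "dp k (wt t) (vt t) = st t"
    "dp k (wt t) d = Pt t" "dp k (vt t) e = Qt t" "dp k (wt t) e + dp k (vt t) d = St t" for t
    by (simp_all add: wt_def vt_def dp_linear pt_def qt_def st_def Pt_def Qt_def St_def p_def q_def s_def P_def Q_def S_def A_def B_def C_def
        power2_eq_square dp_commute[of k d w] dp_commute[of k e v] dp_commute[of k d v] dp_commute[of k e d] algebra_simps)
  have A0: "0 \<le> A" "0 \<le> B" by (simp_all add: A_def B_def dp_nonneg)
  have e2: "\<epsilon>\<^sup>2 \<le> \<epsilon> / 1000000" using mult_left_mono[OF eps(2,1)] by (simp add: power2_eq_square)
  \<comment> \<open>The Gram entries move by at most 3 epsilon, and the Gram determinant by at most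
    9 epsilon + 12 epsilon.\<close>
  have pos: "1 / 16 \<le> pt t" "pt t \<le> 121 / 100" "1 / 16 \<le> qt t" "qt t \<le> 121 / 100" "1 / 121 \<le> pt t * qt t - (st t)\<^sup>2"
    if t: "0 \<le> t" "t \<le> 1" for t
  proof -
    have le: "\<bar>x\<bar> \<le> 11 / 10 * \<epsilon> \<Longrightarrow> \<bar>t * x\<bar> \<le> 11 / 10 * \<epsilon>" for x
      using t abs_mult_le[of t 1 x "11 / 10 * \<epsilon>"] by simp
    have ww: "dp k w w \<le> (105 / 100)\<^sup>2" and vv: "dp k v v \<le> (105 / 100)\<^sup>2"
      using p q by (simp_all add: p_def q_def power2_eq_square)
    have PP: "\<bar>P\<bar> \<le> 11 / 10 * \<epsilon>" "\<bar>Q\<bar> \<le> 11 / 10 * \<epsilon>" "\<bar>dp k w e\<bar> \<le> 11 / 10 * \<epsilon>" "\<bar>dp k v d\<bar> \<le> 11 / 10 * \<epsilon>"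
      using abs_dp_le[OF ww d[unfolded A_def] _ eps(1)] abs_dp_le[OF vv e[unfolded B_def] _ eps(1)]
        abs_dp_le[OF ww e[unfolded B_def] _ eps(1)] abs_dp_le[OF vv d[unfolded A_def] _ eps(1)] eps(1)
      by (auto simp: P_def Q_def)
    have t2: "0 \<le> t\<^sup>2" "t\<^sup>2 \<le> 1" using t by (auto simp: power_le_one)
    have tA: "0 \<le> t\<^sup>2 * A" "t\<^sup>2 * A \<le> \<epsilon> / 1000000" "0 \<le> t\<^sup>2 * B" "t\<^sup>2 * B \<le> \<epsilon> / 1000000"
      using mult_mono[OF t2(2) d] mult_mono[OF t2(2) e] t2 A0 e2 by auto
    have CC: "\<bar>t\<^sup>2 * C\<bar> \<le> \<epsilon> / 1000000"
    proof -
      have "\<bar>C\<bar> \<le> \<epsilon>\<^sup>2" using abs_dp_le[OF d[unfolded A_def] e[unfolded B_def] eps(1,1)] by (simp add: C_def power2_eq_square)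
      hence "\<bar>t\<^sup>2 * C\<bar> \<le> 1 * \<epsilon>\<^sup>2" using t2 by (intro abs_mult_le) auto
      thus ?thesis using e2 by simp
    qed
    have pd: "\<bar>pt t - p\<bar> \<le> 3 * \<epsilon>" "\<bar>qt t - q\<bar> \<le> 3 * \<epsilon>"
      unfolding pt_def qt_def using le[OF PP(1)] le[OF PP(2)] tA eps by (auto simp: abs_le_iff algebra_simps)
    have sd: "\<bar>st t - s\<bar> \<le> 3 * \<epsilon>"
      unfolding st_def S_def using le[OF PP(3)] le[OF PP(4)] CC eps by (auto simp: abs_le_iff algebra_simps)
    show "1 / 16 \<le> pt t" "pt t \<le> 121 / 100" "1 / 16 \<le> qt t" "qt t \<le> 121 / 100"
      using pd p q eps(2) by (auto simp: abs_le_iff)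
    have s11: "\<bar>s\<bar> \<le> 12 / 10" using abs_dp_le[OF ww vv] by (simp add: s_def)
    have "\<bar>(st t - s) * (st t + s)\<bar> \<le> 3 * \<epsilon> * 3" using sd s11 eps by (intro abs_mult_le) auto
    hence a: "\<bar>(st t)\<^sup>2 - s\<^sup>2\<bar> \<le> 9 * \<epsilon>" by (simp add: power2_eq_square algebra_simps)
    have "\<bar>(pt t - p) * qt t\<bar> \<le> 3 * \<epsilon> * 2" "\<bar>p * (qt t - q)\<bar> \<le> 2 * (3 * \<epsilon>)"
      using pd p q eps by (intro abs_mult_le; auto)+
    hence "\<bar>pt t * qt t - p * q\<bar> \<le> 12 * \<epsilon>" by (simp add: algebra_simps)
    thus "1 / 121 \<le> pt t * qt t - (st t)\<^sup>2" using a D eps(2) by linarith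
  qed
  show "(dp k w' v')\<^sup>2 < dp k w' w' * dp k v' v'"
    using pos(5)[of 1] gram[of 1] by (simp add: wt_def vt_def w'_def v'_def)
  define D where "D = (\<lambda>t. sqrt (pt t * qt t - (st t)\<^sup>2))"
  define l where "l = (\<lambda>t. Pt t / pt t)"
  define m where "m = (\<lambda>t. Qt t / qt t)"
  define T where "T = (\<lambda>t. pi / 2 + arctan (st t / D t))"
  define l1 where "l1 = (\<lambda>t. A / pt t - 2 * (l t)\<^sup>2)"
  define m1 where "m1 = (\<lambda>t. B / qt t - 2 * (m t)\<^sup>2)"
  define D1 where "D1 = (\<lambda>t. (pt t * qt t * (l t + m t) - st t * St t) / D t)"
  define T1 where "T1 = (\<lambda>t. (St t - st t * (l t + m t)) / D t)"
  define l2 where "l2 = (\<lambda>t. - 2 * (A / pt t) * l t - 4 * l t * (A / pt t - 2 * (l t)\<^sup>2))"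
  define m2 where "m2 = (\<lambda>t. - 2 * (B / qt t) * m t - 4 * m t * (B / qt t - 2 * (m t)\<^sup>2))"
  define D2 where "D2 = (\<lambda>t. (2 * pt t * qt t * (l t + m t)\<^sup>2 + pt t * qt t * (l1 t + m1 t) - (St t)\<^sup>2 - 2 * st t * C - (D1 t)\<^sup>2) / D t)"
  define T2 where "T2 = (\<lambda>t. (2 * C - St t * (l t + m t) - st t * (l1 t + m1 t) - T1 t * D1 t) / D t)"
  note defs = Pt_def Qt_def St_def pt_def qt_def st_def D_def l_def m_def T_def l1_def m1_def D1_def T1_def l2_def m2_def D2_def T2_def
  define f0 where "f0 = (\<lambda>t. Phi (pt t) (qt t) (st t))"
  define f1 where "f1 = (\<lambda>t. D t * (l t + m t) + T t * St t)"
  define f2 where "f2 = (\<lambda>t. D1 t * (l t + m t) + D t * (l1 t + m1 t) + T1 t * St t + 2 * C * T t)"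
  define f3 where "f3 = (\<lambda>t. D2 t * (l t + m t) + 2 * D1 t * (l1 t + m1 t) + D t * (l2 t + m2 t) + 4 * C * T1 t + St t * T2 t)"
  define diff where "diff = (\<lambda>i::nat. if i = 0 then f0 else if i = 1 then f1 else if i = 2 then f2 else f3)"
  have der: "(f0 has_real_derivative f1 t) (at t)" "(f1 has_real_derivative f2 t) (at t)" "(f2 has_real_derivative f3 t) (at t)"
    if t: "0 \<le> t" "t \<le> 1" for t
  proof -
    have ps: "pt t > 0" "qt t > 0" "pt t * qt t - (st t)\<^sup>2 > 0" using pos[OF t] by linarith+
    note pd = Phi_path_derivatives[where ?p0.0 = p and ?P0.0 = P and ?A = A and ?q0.0 = q and ?Q0.0 = Q and ?B = B
        and ?s0.0 = s and ?S0.0 = S and ?C = C, OF ps[unfolded pt_def qt_def st_def]]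
    show "(f0 has_real_derivative f1 t) (at t)" "(f1 has_real_derivative f2 t) (at t)" "(f2 has_real_derivative f3 t) (at t)"
      unfolding f0_def f1_def f2_def f3_def defs by (fact pd)+
  qed
  have "\<exists>t. 0 < t \<and> t < 1 \<and> f0 1 = (\<Sum>m<3. diff m 0 / fact m * 1 ^ m) + diff 3 t / fact 3 * 1 ^ 3"
  proof (rule Maclaurin)
    show "\<forall>m t. m < 3 \<and> 0 \<le> t \<and> t \<le> 1 \<longrightarrow> (diff m has_real_derivative diff (Suc m) t) (at t)"
    proof (intro allI impI)
      fix i :: nat and t :: real assume a: "i < 3 \<and> 0 \<le> t \<and> t \<le> 1"
      hence "i = 0 \<or> i = 1 \<or> i = 2" by auto
      thus "(diff i has_real_derivative diff (Suc i) t) (at t)" using der[of t] a by (auto simp: diff_def)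
    qed
  qed (auto simp: diff_def)
  then obtain t where t: "0 < t" "t < 1" and
    "f0 1 = (\<Sum>m<3. diff m 0 / fact m * 1 ^ m) + diff 3 t / fact 3 * 1 ^ 3" by blast
  hence tay: "f0 1 = f0 0 + f1 0 + f2 0 / 2 + f3 t / 6"
    by (simp add: diff_def eval_nat_numeral fact_numeral)
  have t01: "0 \<le> t" "t \<le> 1" using t by auto
  have Dpos: "pt t * qt t - (st t)\<^sup>2 > 0" using pos(5)[OF t01] by linarith
  note gb = gram_bounds[where k = k and w = "wt t" and v = "vt t" and d = d and e = e and \<epsilon> = \<epsilon>,
      unfolded gram, OF pos(1-4)[OF t01] Dpos d[unfolded A_def] e[unfolded B_def] eps(1)]
  have "sqrt (1 / 121) \<le> D t" unfolding D_def using pos(5)[OF t01] by (intro real_sqrt_le_mono)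
  hence D11: "1 / 11 \<le> D t" by (simp add: real_sqrt_divide)
  have f: "Pt t / pt t = l t" "Qt t / qt t = m t" "sqrt (pt t * qt t - (st t)\<^sup>2) = D t"
    by (simp_all add: l_def m_def D_def)
  note gb = gb[unfolded f C_def[symmetric]]
  have "\<bar>f3 t\<bar> \<le> 30900 * \<epsilon> ^ 3"
    unfolding f3_def D2_def T2_def l1_def m1_def l2_def m2_def D1_def T1_def
    by (rule third_derivative_bound[OF pos(1-4)[OF t01] A0(1) d A0(2) e gb(4) eps(1) gb(1-3) D11 gb(8,7,5,6)])
  moreover have "Phi (dp k w' w') (dp k v' v') (dp k w' v') = f0 1"
    using gram[of 1] by (simp add: wt_def vt_def w'_def v'_def f0_def)
  moreover have z: "pt 0 = p" "qt 0 = q" "st 0 = s" "Pt 0 = P" "Qt 0 = Q" "St 0 = S"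
    by (simp_all add: defs(1-6))
  moreover have "f1 0 = pair_gradient p q s P Q S"
    unfolding f1_def pair_gradient_def Let_def T_def D_def l_def m_def z ..
  \<comment> \<open>Fact 1 completes the square in \<open>S\<close> using
    \<open>p * q - s\<^sup>2 = D0\<^sup>2\<close>; fact 2 combines the square of P/p + Q/q with the
    terms from the derivatives of the rates into minus the square of P/p - Q/q.\<close>
  moreover have "f2 0 = pair_hessian p q s A B C P Q S"
  proof -
    define D0 where "D0 = sqrt (p * q - s\<^sup>2)"
    have D0: "D0 > 0" "D0\<^sup>2 = p * q - s\<^sup>2" using D by (auto simp: D0_def)
    define L where "L = P / p + Q / q"
    have "(p * q * L - s * S) / D0 * L + (S - s * L) / D0 * S
       = ((S - s * L)\<^sup>2 + (p * q - s\<^sup>2) * L\<^sup>2) / D0"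
      by (simp add: add_divide_distrib[symmetric] diff_divide_distrib[symmetric] algebra_simps power2_eq_square)
    also have "\<dots> = (S - s * L)\<^sup>2 / D0 + D0 * L\<^sup>2"
      unfolding D0(2)[symmetric] using D0(1) by (simp add: add_divide_distrib power2_eq_square)
    finally have 1: "(p * q * L - s * S) / D0 * L + (S - s * L) / D0 * S = (S - s * L)\<^sup>2 / D0 + D0 * L\<^sup>2" .
    have 2: "D0 * L\<^sup>2 + D0 * (A / p - 2 * (P / p)\<^sup>2 + (B / q - 2 * (Q / q)\<^sup>2)) = D0 / p * A + D0 / q * B - D0 * (P / p - Q / q)\<^sup>2"
      unfolding L_def by (simp add: algebra_simps power2_eq_square)
    show ?thesis
      unfolding f2_def pair_hessian_def Let_def T_def T1_def D1_def l1_def m1_def l_def m_def D_def z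
      unfolding D0_def[symmetric] L_def[symmetric] using 1 2 by (simp add: algebra_simps)
  qed
  moreover have "f0 0 = Phi p q s" by (simp add: f0_def z)
  ultimately show "\<bar>Phi (dp k w' w') (dp k v' v') (dp k w' v') - Phi p q s - pair_gradient p q s P Q S
       - pair_hessian p q s A B C P Q S / 2\<bar> \<le> 5150 * \<epsilon> ^ 3"
    using tay by linarith
qed

section \<open>From a certified point to a local minimum\<close>

text \<open>First derivative of \<open>scaled_loss\<close> at \<open>C\<close> in direction
  \<open>d\<close>; \<open>hess_form\<close> is the second. Targets do not move, so in a pair of a
  row and a target the direction of the second vector is zero.\<close>

definition grad_form :: "nat \<Rightarrow> nat \<Rightarrow> (nat \<Rightarrow> nat \<Rightarrow> real) \<Rightarrow> (nat \<Rightarrow> nat \<Rightarrow> real) \<Rightarrow> real" where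
  "grad_form k n C d =
     (\<Sum>i<n. \<Sum>j<i. pair_gradient (dp k (C i) (C i)) (dp k (C j) (C j)) (dp k (C i) (C j))
        (dp k (C i) (d i)) (dp k (C j) (d j)) (dp k (C i) (d j) + dp k (C j) (d i)))
     + pi * (\<Sum>i<n. dp k (C i) (d i))
     - (\<Sum>i<n. \<Sum>j<k. pair_gradient (dp k (C i) (C i)) 1 (C i j) (dp k (C i) (d i)) 0 (d i j))"

definition hess_form :: "nat \<Rightarrow> nat \<Rightarrow> (nat \<Rightarrow> nat \<Rightarrow> real) \<Rightarrow> (nat \<Rightarrow> nat \<Rightarrow> real) \<Rightarrow> real" where
  "hess_form k n C d =
     (\<Sum>i<n. \<Sum>j<i. pair_hessian (dp k (C i) (C i)) (dp k (C j) (C j)) (dp k (C i) (C j))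
        (dp k (d i) (d i)) (dp k (d j) (d j)) (dp k (d i) (d j))
        (dp k (C i) (d i)) (dp k (C j) (d j)) (dp k (C i) (d j) + dp k (C j) (d i)))
     + pi * (\<Sum>i<n. dp k (d i) (d i))
     - (\<Sum>i<n. \<Sum>j<k. pair_hessian (dp k (C i) (C i)) 1 (C i j)
         (dp k (d i) (d i)) 0 0 (dp k (C i) (d i)) 0 (d i j))"

text \<open>The margin of 101/10000 over 1/121 keeps every area at least 1/11 on the short segments
  of the Taylor argument.\<close>

definition nondegenerate :: "nat \<Rightarrow> nat \<Rightarrow> (nat \<Rightarrow> nat \<Rightarrow> real) \<Rightarrow> bool" where
  "nondegenerate k n C \<longleftrightarrow> (\<forall>i<n. 7 / 100 \<le> dp k (C i) (C i) \<and> dp k (C i) (C i) \<le> 11 / 10)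
     \<and> (\<forall>i<n. \<forall>j<i. 101 / 10000 \<le> dp k (C i) (C i) * dp k (C j) (C j) - (dp k (C i) (C j))\<^sup>2)
     \<and> (\<forall>i<n. \<forall>j<k. 101 / 10000 \<le> dp k (C i) (C i) - (C i j)\<^sup>2)"

lemma dp_unit_right: "j < k \<Longrightarrow> dp k x (\<lambda>l. if l = j then 1 else 0) = x j"
  by (simp add: dp_def if_distrib cong: if_cong)

lemma dp_unit_left: "j < k \<Longrightarrow> dp k (\<lambda>l. if l = j then 1 else 0) x = x j"
  by (simp add: dp_commute[of k _ x] dp_unit_right)

lemma dp_zero_right: "dp k x (\<lambda>_. 0) = 0" and dp_zero_left: "dp k (\<lambda>_. 0) x = 0"
  by (simp_all add: dp_def)

lemma sum_pairs_add:
  fixes A :: "nat \<Rightarrow> real"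
  shows "(\<Sum>i<n. \<Sum>j<i. A i + A j) = (real n - 1) * (\<Sum>i<n. A i)"
proof (induction n)
  case (Suc n)
  have "(\<Sum>j<n. A n + A j) = real n * A n + (\<Sum>j<n. A j)" by (simp add: sum.distrib)
  thus ?case using Suc by (simp add: algebra_simps)
qed simp

lemma expansion_arith:
  fixes f f' g h e1 b b' gb hb e2 P c pg pn :: real
  assumes "f' \<ge> f + g + h / 2 - e1" "b' \<le> b + gb + hb / 2 + e2"
  shows "f' + (P + pg + pn / 2) - b' + c \<ge> f + P - b + c + (g + pg - gb) + (h + pn - hb) / 2 - (e1 + e2)"
  using assms by (simp add: add_divide_distrib diff_divide_distrib)

text \<open>Each row belongs to n - 1 pairs of rows and to k pairs with targets, which gives the
  factor of the summed cubic error. The first two conclusions keep the closed form of the loss valid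
  on the whole ball.\<close>

lemma scaled_loss_expansion:
  fixes k n :: nat and r :: real and C d :: "nat \<Rightarrow> nat \<Rightarrow> real"
  defines "N \<equiv> \<Sum>i<n. dp k (d i) (d i)" and "C' \<equiv> \<lambda>i j. C i j + d i j"
  assumes nd: "nondegenerate k n C" and N: "N \<le> r\<^sup>2" and r: "0 \<le> r" "r \<le> 1 / 1000000"
  shows "\<And>i j. i < n \<Longrightarrow> j < n \<Longrightarrow> i \<noteq> j \<Longrightarrow> (dp k (C' i) (C' j))\<^sup>2 < dp k (C' i) (C' i) * dp k (C' j) (C' j)"
    and "\<And>i j. i < n \<Longrightarrow> j < k \<Longrightarrow> (C' i j)\<^sup>2 < dp k (C' i) (C' i)"
    and "scaled_loss k n C' \<ge> scaled_loss k n C + grad_form k n C d + hess_form k n C d / 2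
       - 5150 * (real n - 1 + real k) * r * N"
proof -
  define A where "A = (\<lambda>i. dp k (d i) (d i))"
  have A0: "A i \<ge> 0" for i by (simp add: A_def dp_nonneg)
  have AN: "A i \<le> N" if "i < n" for i
    unfolding N_def using member_le_sum[of i "{..<n}" "\<lambda>i. dp k (d i) (d i)"] that by (simp add: A_def dp_nonneg)
  have AAN: "A i + A j \<le> N" if "i < n" "j < n" "i \<noteq> j" for i j
  proof -
    have "(\<Sum>l\<in>{i, j}. dp k (d l) (d l)) \<le> N"
      unfolding N_def using that by (intro sum_mono2) (auto simp: dp_nonneg)
    thus ?thesis using that by (simp add: A_def)
  qed
  have cube: "(sqrt x) ^ 3 \<le> r * x \<and> sqrt x \<le> r" if "0 \<le> x" "x \<le> N" for x
  proof -
    have s: "sqrt x \<le> r" using that N r(1) by (intro real_le_lsqrt) auto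
    have "(sqrt x) ^ 3 = sqrt x * x" using that by (simp add: power3_eq_cube)
    also have "\<dots> \<le> r * x" using s that by (intro mult_right_mono)
    finally show ?thesis using s by simp
  qed
  have ww: "(dp k (C' i) (C' j))\<^sup>2 < dp k (C' i) (C' i) * dp k (C' j) (C' j)"
    "Phi (dp k (C' i) (C' i)) (dp k (C' j) (C' j)) (dp k (C' i) (C' j)) \<ge>
       Phi (dp k (C i) (C i)) (dp k (C j) (C j)) (dp k (C i) (C j))
       + pair_gradient (dp k (C i) (C i)) (dp k (C j) (C j)) (dp k (C i) (C j))
        (dp k (C i) (d i)) (dp k (C j) (d j)) (dp k (C i) (d j) + dp k (C j) (d i))
       + pair_hessian (dp k (C i) (C i)) (dp k (C j) (C j)) (dp k (C i) (C j))
        (A i) (A j) (dp k (d i) (d j))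
        (dp k (C i) (d i)) (dp k (C j) (d j)) (dp k (C i) (d j) + dp k (C j) (d i)) / 2
       - 5150 * (r * (A i + A j))"
    if ij: "i < n" "j < i" for i j
  proof -
    have jn: "j < n" "i \<noteq> j" using ij by auto
    \<comment> \<open>A radius adapted to the pair, so that
      \<open>e ^ 3 \<le> r * (A i + A j)\<close>: the cubic errors then add up to a multiple of
      \<open>r * N\<close> instead of costing \<open>r ^ 3\<close> for each pair.\<close>
    define e where "e = sqrt (A i + A j)"
    have e: "e ^ 3 \<le> r * (A i + A j)" "e \<le> r" "0 \<le> e" "A i \<le> e\<^sup>2" "A j \<le> e\<^sup>2"
      using cube[of "A i + A j"] AAN[OF ij(1) jn] A0 by (auto simp: e_def add_nonneg_nonneg)
    have e1: "e \<le> 1 / 1000000" using e(2) r(2) by linarith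
    have p: "7 / 100 \<le> dp k (C i) (C i)" "dp k (C i) (C i) \<le> 11 / 10" "7 / 100 \<le> dp k (C j) (C j)" "dp k (C j) (C j) \<le> 11 / 10"
      "101 / 10000 \<le> dp k (C i) (C i) * dp k (C j) (C j) - (dp k (C i) (C j))\<^sup>2"
      using nd ij jn by (auto simp: nondegenerate_def)
    note so = Phi_second_order[OF p e(4,5)[unfolded A_def] e(3) e1]
    show "(dp k (C' i) (C' j))\<^sup>2 < dp k (C' i) (C' i) * dp k (C' j) (C' j)"
      unfolding C'_def using so(1) .
    show "Phi (dp k (C' i) (C' i)) (dp k (C' j) (C' j)) (dp k (C' i) (C' j)) \<ge>
       Phi (dp k (C i) (C i)) (dp k (C j) (C j)) (dp k (C i) (C j))
       + pair_gradient (dp k (C i) (C i)) (dp k (C j) (C j)) (dp k (C i) (C j))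
        (dp k (C i) (d i)) (dp k (C j) (d j)) (dp k (C i) (d j) + dp k (C j) (d i))
       + pair_hessian (dp k (C i) (C i)) (dp k (C j) (C j)) (dp k (C i) (C j))
        (A i) (A j) (dp k (d i) (d j))
        (dp k (C i) (d i)) (dp k (C j) (d j)) (dp k (C i) (d j) + dp k (C j) (d i)) / 2
       - 5150 * (r * (A i + A j))"
      using so(2) e(1) unfolding C'_def A_def abs_le_iff by linarith
  qed
  have we: "(C' i j)\<^sup>2 < dp k (C' i) (C' i)"
    "Phi (dp k (C' i) (C' i)) 1 (C' i j) \<le>
       Phi (dp k (C i) (C i)) 1 (C i j)
       + pair_gradient (dp k (C i) (C i)) 1 (C i j) (dp k (C i) (d i)) 0 (d i j)
       + pair_hessian (dp k (C i) (C i)) 1 (C i j) (A i) 0 0 (dp k (C i) (d i)) 0 (d i j) / 2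
       + 5150 * (r * A i)"
    if ij: "i < n" "j < k" for i j
  proof -
    define e where "e = sqrt (A i)"
    have e: "e ^ 3 \<le> r * A i" "e \<le> r" "0 \<le> e" "A i \<le> e\<^sup>2"
      using cube[of "A i"] AN[OF ij(1)] A0 by (auto simp: e_def)
    have e1: "e \<le> 1 / 1000000" using e(2) r(2) by linarith
    have p: "7 / 100 \<le> dp k (C i) (C i)" "dp k (C i) (C i) \<le> 11 / 10"
      "101 / 10000 \<le> dp k (C i) (C i) * 1 - (C i j)\<^sup>2"
      using nd ij by (auto simp: nondegenerate_def)
    have q: "7 / 100 \<le> (1::real)" "1 \<le> 11 / (10::real)" "0 \<le> e\<^sup>2" by auto
    \<comment> \<open>The target is the unit vector with index \<open>j\<close>, moved in direction
      zero.\<close>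
    note so = Phi_second_order[where k = k and w = "C i" and d = "d i" and v = "\<lambda>l. if l = j then 1 else 0" and e = "\<lambda>_. 0" and \<epsilon> = e,
        unfolded dp_unit_right[OF ij(2)] dp_unit_left[OF ij(2)] dp_zero_right dp_zero_left add_0_left add_0_right simp_thms if_True,
        OF p(1,2) q(1,2) p(3) e(4)[unfolded A_def] q(3) e(3) e1]
    show "(C' i j)\<^sup>2 < dp k (C' i) (C' i)"
      unfolding C'_def using so(1) by simp
    show "Phi (dp k (C' i) (C' i)) 1 (C' i j) \<le>
       Phi (dp k (C i) (C i)) 1 (C i j)
       + pair_gradient (dp k (C i) (C i)) 1 (C i j) (dp k (C i) (d i)) 0 (d i j)
       + pair_hessian (dp k (C i) (C i)) 1 (C i j) (A i) 0 0 (dp k (C i) (d i)) 0 (d i j) / 2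
       + 5150 * (r * A i)"
      using so(2) e(1) unfolding C'_def A_def abs_le_iff by linarith
  qed
  show "(dp k (C' i) (C' j))\<^sup>2 < dp k (C' i) (C' i) * dp k (C' j) (C' j)" if "i < n" "j < n" "i \<noteq> j" for i j
    using ww(1)[of i j] ww(1)[of j i] that by (cases "j < i") (auto simp: dp_commute mult.commute)
  show "(C' i j)\<^sup>2 < dp k (C' i) (C' i)" if "i < n" "j < k" for i j using we(1) that .
  have 1: "(\<Sum>i<n. \<Sum>j<i. Phi (dp k (C' i) (C' i)) (dp k (C' j) (C' j)) (dp k (C' i) (C' j)))
     \<ge> (\<Sum>i<n. \<Sum>j<i. Phi (dp k (C i) (C i)) (dp k (C j) (C j)) (dp k (C i) (C j)))
     + (\<Sum>i<n. \<Sum>j<i. pair_gradient (dp k (C i) (C i)) (dp k (C j) (C j)) (dp k (C i) (C j))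
        (dp k (C i) (d i)) (dp k (C j) (d j)) (dp k (C i) (d j) + dp k (C j) (d i)))
     + (\<Sum>i<n. \<Sum>j<i. pair_hessian (dp k (C i) (C i)) (dp k (C j) (C j)) (dp k (C i) (C j))
        (A i) (A j) (dp k (d i) (d j))
        (dp k (C i) (d i)) (dp k (C j) (d j)) (dp k (C i) (d j) + dp k (C j) (d i))) / 2
     - 5150 * (r * (\<Sum>i<n. \<Sum>j<i. A i + A j))"
    unfolding sum_divide_distrib sum_distrib_left sum.distrib[symmetric] sum_subtractf[symmetric]
    by (intro sum_mono) (use ww(2) in auto)
  have 2: "(\<Sum>i<n. \<Sum>j<k. Phi (dp k (C' i) (C' i)) 1 (C' i j))
     \<le> (\<Sum>i<n. \<Sum>j<k. Phi (dp k (C i) (C i)) 1 (C i j))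
     + (\<Sum>i<n. \<Sum>j<k. pair_gradient (dp k (C i) (C i)) 1 (C i j) (dp k (C i) (d i)) 0 (d i j))
     + (\<Sum>i<n. \<Sum>j<k. pair_hessian (dp k (C i) (C i)) 1 (C i j) (A i) 0 0 (dp k (C i) (d i)) 0 (d i j)) / 2
     + 5150 * (r * (\<Sum>i<n. \<Sum>j<k. A i))"
    unfolding sum_divide_distrib sum_distrib_left sum.distrib[symmetric]
    by (intro sum_mono) (use we(2) in auto)
  have 3: "(\<Sum>i<n. dp k (C' i) (C' i)) = (\<Sum>i<n. dp k (C i) (C i)) + 2 * (\<Sum>i<n. dp k (C i) (d i)) + N"
    unfolding C'_def N_def sum_distrib_left sum.distrib[symmetric]
    by (intro sum.cong refl) (simp add: dp_linear dp_commute)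
  have s1: "(\<Sum>i<n. \<Sum>j<i. A i + A j) = (real n - 1) * N"
    using sum_pairs_add[of A n] by (simp add: N_def A_def)
  have s2: "(\<Sum>i<n. \<Sum>j<k. A i) = real k * N" by (simp add: N_def A_def sum_distrib_left)
  have 4: "pi / 2 * (\<Sum>i<n. dp k (C' i) (C' i)) = pi / 2 * (\<Sum>i<n. dp k (C i) (C i)) + pi * (\<Sum>i<n. dp k (C i) (d i)) + pi * N / 2"
    unfolding 3 by (simp add: algebra_simps)
  have Ai: "dp k (d i) (d i) = A i" for i by (simp add: A_def)
  have NA: "(\<Sum>i<n. A i) = N" by (simp add: N_def A_def)
  have 5: "5150 * (real n - 1 + real k) * r * N = 5150 * (r * ((real n - 1) * N)) + 5150 * (r * (real k * N))"
    by (simp add: algebra_simps)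
  show "scaled_loss k n C' \<ge> scaled_loss k n C + grad_form k n C d + hess_form k n C d / 2
       - 5150 * (real n - 1 + real k) * r * N"
    unfolding scaled_loss_def grad_form_def hess_form_def 5 4 Ai NA using 1 2 unfolding s1 s2 by (rule expansion_arith)
qed

section \<open>The minimum over a closed ball is attained inside\<close>

lemma continuous_Phi:
  assumes "continuous_on S p" "continuous_on S q" "continuous_on S s"
    "\<And>x. x \<in> S \<Longrightarrow> (s x)\<^sup>2 < p x * q x"
  shows "continuous_on S (\<lambda>x. Phi (p x) (q x) (s x :: real))"
  unfolding Phi_def using assms by (intro continuous_intros) (auto, metis less_irrefl)

lemma continuous_on_entry: "continuous_on S (\<lambda>C :: nat \<Rightarrow> nat \<Rightarrow> real. C i j)"
proof -
  have 1: "continuous_on UNIV (\<lambda>f :: nat \<Rightarrow> real. f j)" by (rule continuous_on_product_coordinates)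
  have 2: "continuous_on S (\<lambda>C :: nat \<Rightarrow> nat \<Rightarrow> real. C i)"
    by (rule continuous_on_subset[OF continuous_on_product_coordinates]) simp
  show ?thesis by (rule continuous_on_compose2[OF 1 2]) simp
qed

text \<open>Points are functions on all pairs of naturals, where a bound on finitely many entries
  does not give compactness. A product of intervals is compact by Tychonoff's theorem, and
  degenerate intervals pin the entries outside the matrix.\<close>

lemma compact_box:
  fixes l u :: "nat \<Rightarrow> nat \<Rightarrow> real"
  shows "compact {C. \<forall>i j. l i j \<le> C i j \<and> C i j \<le> u i j}"
proof -
  have c1: "compact (PiE UNIV (\<lambda>j. {l i j..u i j}))" for i
    using compactin_PiE[of "\<lambda>_. euclidean" UNIV "\<lambda>j. {l i j..u i j}"]
    by (simp add: euclidean_product_topology)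
  have "compact (PiE UNIV (\<lambda>i. PiE UNIV (\<lambda>j. {l i j..u i j})))"
    using compactin_PiE[of "\<lambda>_. euclidean" UNIV "\<lambda>i. PiE UNIV (\<lambda>j. {l i j..u i j})"] c1
    by (simp add: euclidean_product_topology)
  moreover have "PiE UNIV (\<lambda>i. PiE UNIV (\<lambda>j. {l i j..u i j})) = {C. \<forall>i j. l i j \<le> C i j \<and> C i j \<le> u i j}"
    by (auto simp: PiE_def Pi_iff)
  ultimately show ?thesis by simp
qed

text \<open>All that computation has to establish about a point. \<open>G\<close> is the gradient,
  and the bound on the loss is there to keep it positive at the nearby minimum.\<close>

definition certified_point :: "nat \<Rightarrow> nat \<Rightarrow> (nat \<Rightarrow> nat \<Rightarrow> real) \<Rightarrow> bool" where
  "certified_point k n C \<longleftrightarrow> nondegenerate k n C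
     \<and> (\<exists>G. (\<forall>i<n. \<forall>j<k. \<bar>G i j\<bar> \<le> 1 / 2 ^ 41) \<and> (\<forall>d. grad_form k n C d = (\<Sum>i<n. \<Sum>j<k. G i j * d i j)))
     \<and> (\<forall>d. hess_form k n C d \<ge> 1 / 128 * (\<Sum>i<n. dp k (d i) (d i)))
     \<and> scaled_loss k n C \<ge> 1 / 1000"

text \<open>As n - 1 + k <= 39, the remainder on the ball is at most 5150 * 39 * r = 200850 * r
  times the squared distance, and 200850 / 2^27 < 1/600. This leaves 1/256 - 1/600 times the squared
  distance against the linear term.\<close>

lemma certified_point_local_min:
  assumes cert: "certified_point k n C" and kn: "n \<le> 20" "k \<le> 20"
  shows "\<exists>C1. scaled_loss k n C1 > 0 \<and> (\<Sum>i<n. \<Sum>j<k. (C1 i j - C i j)\<^sup>2) < (1 / 2 ^ 27)\<^sup>2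
    \<and> (\<forall>C'. (\<Sum>i<n. \<Sum>j<k. (C' i j - C i j)\<^sup>2) \<le> (1 / 2 ^ 27)\<^sup>2 \<longrightarrow> scaled_loss k n C1 \<le> scaled_loss k n C')"
proof -
  define r where "r = (1 / 2 ^ 27 :: real)"
  define NN where "NN = (\<lambda>C'. \<Sum>i<n. \<Sum>j<k. (C' i j - C i j)\<^sup>2)"
  have r: "0 \<le> r" "r \<le> 1 / 1000000" "r > 0" by (auto simp: r_def)
  have nd: "nondegenerate k n C" using cert by (simp add: certified_point_def)
  obtain G where G: "\<And>i j. i < n \<Longrightarrow> j < k \<Longrightarrow> \<bar>G i j\<bar> \<le> 1 / 2 ^ 41"
    and gf: "\<And>d. grad_form k n C d = (\<Sum>i<n. \<Sum>j<k. G i j * d i j)"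
    using cert unfolding certified_point_def by blast
  have NNd: "(\<Sum>i<n. dp k (\<lambda>j. C' i j - C i j) (\<lambda>j. C' i j - C i j)) = NN C'" for C'
    by (simp add: NN_def dp_def power2_eq_square)
  have lower: "scaled_loss k n C' \<ge> scaled_loss k n C - 20 / 2 ^ 41 * sqrt (NN C') + NN C' / 256 - 200850 * r * NN C'"
    and nd1: "\<And>i j. i < n \<Longrightarrow> j < n \<Longrightarrow> i \<noteq> j \<Longrightarrow> (dp k (C' i) (C' j))\<^sup>2 < dp k (C' i) (C' i) * dp k (C' j) (C' j)"
    and nd2: "\<And>i j. i < n \<Longrightarrow> j < k \<Longrightarrow> (C' i j)\<^sup>2 < dp k (C' i) (C' i)"
    if C': "NN C' \<le> r\<^sup>2" for C'
  proof -
    define d where "d = (\<lambda>i j. C' i j - C i j)"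
    have dN: "(\<Sum>i<n. dp k (d i) (d i)) = NN C'" using NNd[of C'] by (simp add: d_def)
    have Cd: "(\<lambda>i j. C i j + d i j) = C'" and Cd': "\<And>i. (\<lambda>j. C i j + d i j) = C' i" by (simp_all add: d_def)
    note ex = scaled_loss_expansion[OF nd, of d r, unfolded dN Cd, OF C' r(1,2)]
    show "(dp k (C' i) (C' j))\<^sup>2 < dp k (C' i) (C' i) * dp k (C' j) (C' j)" if "i < n" "j < n" "i \<noteq> j" for i j
      using ex(1)[OF that] unfolding Cd' .
    show "(C' i j)\<^sup>2 < dp k (C' i) (C' i)" if "i < n" "j < k" for i j using ex(2)[OF that] unfolding Cd' by (simp add: d_def)
    have N0: "NN C' \<ge> 0" by (simp add: NN_def sum_nonneg)
    have h: "hess_form k n C d \<ge> 1 / 128 * NN C'"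
      using cert unfolding certified_point_def dN[symmetric] by blast
    have g: "\<bar>grad_form k n C d\<bar> \<le> 20 / 2 ^ 41 * sqrt (NN C')"
    proof -
      have "\<bar>grad_form k n C d\<bar> \<le> (\<Sum>i<n. \<Sum>j<k. \<bar>G i j * d i j\<bar>)"
        unfolding gf by (intro order_trans[OF sum_abs] sum_mono order_trans[OF sum_abs]) simp
      also have "\<dots> \<le> (\<Sum>i<n. \<Sum>j<k. 1 / 2 ^ 41 * \<bar>d i j\<bar>)"
        unfolding abs_mult by (intro sum_mono mult_right_mono G) auto
      also have "\<dots> = 1 / 2 ^ 41 * (\<Sum>(i, j)\<in>{..<n} \<times> {..<k}. \<bar>d i j\<bar>)"
        by (simp add: sum.cartesian_product sum_distrib_left case_prod_beta)
      also have "(\<Sum>(i, j)\<in>{..<n} \<times> {..<k}. \<bar>d i j\<bar>) \<le> 20 * sqrt (NN C')"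
      proof -
        let ?S = "{..<n} \<times> {..<k}"
        have c: "(\<Sum>x\<in>?S. \<bar>d (fst x) (snd x)\<bar> * 1)\<^sup>2
           \<le> (\<Sum>x\<in>?S. \<bar>d (fst x) (snd x)\<bar>\<^sup>2) * (\<Sum>x\<in>?S. 1\<^sup>2)"
          by (rule Cauchy_Schwarz_ineq_sum)
        have NS: "(\<Sum>x\<in>?S. \<bar>d (fst x) (snd x)\<bar>\<^sup>2) = NN C'"
          by (simp add: NN_def d_def sum.cartesian_product case_prod_beta)
        \<comment> \<open>Cauchy-Schwarz over at most 400 entries produces the factor 20 = sqrt 400
          in the gradient term.\<close>
        have "real n * real k \<le> 20 * 20" using kn by (intro mult_mono) auto
        hence "NN C' * (\<Sum>x\<in>?S. 1\<^sup>2) \<le> NN C' * 400"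
          using N0 by (intro mult_left_mono) (auto simp: card_cartesian_product)
        moreover have "NN C' * 400 = (20 * sqrt (NN C'))\<^sup>2" using N0 by (simp add: power_mult_distrib)
        ultimately have "(\<Sum>x\<in>?S. \<bar>d (fst x) (snd x)\<bar>)\<^sup>2 \<le> (20 * sqrt (NN C'))\<^sup>2"
          using c unfolding NS by simp
        hence "(\<Sum>x\<in>?S. \<bar>d (fst x) (snd x)\<bar>) \<le> 20 * sqrt (NN C')"
          by (rule power2_le_imp_le) (simp add: N0)
        thus ?thesis by (simp add: case_prod_beta)
      qed
      finally show ?thesis by simp
    qed
    have "5150 * (real n - 1 + real k) * r * NN C' \<le> 5150 * 39 * r * NN C'"
      using kn r N0 by (intro mult_right_mono) auto
    thus "scaled_loss k n C' \<ge> scaled_loss k n C - 20 / 2 ^ 41 * sqrt (NN C') + NN C' / 256 - 200850 * r * NN C'"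
      using ex(3) g h unfolding abs_le_iff by linarith
  qed
  \<comment> \<open>The closed ball, restricted to matrices that vanish outside the relevant entries
    and enclosed in a box to make it compact.\<close>
  define B where "B = {C'. (\<forall>i j. (if i < n \<and> j < k then C i j - r else 0) \<le> C' i j \<and> C' i j \<le> (if i < n \<and> j < k then C i j + r else 0)) \<and> NN C' \<le> r\<^sup>2}"
  have cont: "continuous_on S NN" for S
    unfolding NN_def by (intro continuous_intros continuous_on_entry)
  have "closed {C'. NN C' \<le> r\<^sup>2}"
    using continuous_closed_preimage[OF cont[of UNIV] closed_UNIV closed_atMost[of "r\<^sup>2"]] by (simp add: vimage_def)
  hence "compact ({C'. \<forall>i j. (if i < n \<and> j < k then C i j - r else 0) \<le> C' i j \<and> C' i j \<le> (if i < n \<and> j < k then C i j + r else 0)} \<inter> {C'. NN C' \<le> r\<^sup>2})"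
    by (intro compact_Int_closed compact_box)
  moreover have "B = {C'. \<forall>i j. (if i < n \<and> j < k then C i j - r else 0) \<le> C' i j \<and> C' i j \<le> (if i < n \<and> j < k then C i j + r else 0)} \<inter> {C'. NN C' \<le> r\<^sup>2}"
    unfolding B_def by (rule Collect_conj_eq)
  ultimately have compB: "compact B" by simp
  define C0 where "C0 = (\<lambda>i j. if i < n \<and> j < k then C i j else 0)"
  have C0: "C0 \<in> B" using r by (auto simp: B_def C0_def NN_def)
  have dpc: "continuous_on S (\<lambda>C' :: nat \<Rightarrow> nat \<Rightarrow> real. dp k (C' i) (C' j))" for S i j
    unfolding dp_def by (intro continuous_intros continuous_on_entry)
  have "continuous_on B (scaled_loss k n)"
    unfolding scaled_loss_def[abs_def]
    by (intro continuous_intros continuous_Phi dpc continuous_on_entry) (auto simp: B_def intro!: nd1 nd2)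
  then obtain C1 where C1: "C1 \<in> B" "\<And>C'. C' \<in> B \<Longrightarrow> scaled_loss k n C1 \<le> scaled_loss k n C'"
    using continuous_attains_inf[OF compB] C0 by blast
  have cong: "scaled_loss k n C' = scaled_loss k n C''" "NN C' = NN C''"
    if "\<And>i j. i < n \<Longrightarrow> j < k \<Longrightarrow> C' i j = C'' i j" for C' C''
    using that by (simp_all add: scaled_loss_def NN_def dp_def)
  \<comment> \<open>Clearing the irrelevant entries changes neither the loss nor the distance, so
    minimality on \<open>B\<close> extends to the whole ball.\<close>
  have min: "scaled_loss k n C1 \<le> scaled_loss k n C'" if C': "NN C' \<le> r\<^sup>2" for C'
  proof -
    define C'' where "C'' = (\<lambda>i j. if i < n \<and> j < k then C' i j else 0)"
    have e: "scaled_loss k n C'' = scaled_loss k n C'" "NN C'' = NN C'"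
      using cong[of C'' C'] by (auto simp: C''_def)
    have "\<bar>C' i j - C i j\<bar> \<le> r" if "i < n" "j < k" for i j
    proof -
      have "(C' i j - C i j)\<^sup>2 \<le> (\<Sum>j<k. (C' i j - C i j)\<^sup>2)"
        using that by (intro member_le_sum) auto
      also have "\<dots> \<le> NN C'" unfolding NN_def
        using that by (intro member_le_sum[of i _ "\<lambda>i. \<Sum>j<k. (C' i j - C i j)\<^sup>2"]) (auto intro: sum_nonneg)
      also have "\<dots> \<le> r\<^sup>2" by (rule C')
      finally show ?thesis using r(1) by (metis abs_le_square_iff abs_of_nonneg)
    qed
    hence "C'' \<in> B" using C' e(2) by (auto simp: B_def C''_def abs_le_iff) (smt (verit))+
    thus ?thesis using C1(2) e(1) by metis
  qed
  have C1r: "NN C1 \<le> r\<^sup>2" using C1(1) by (simp add: B_def)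
  have N0: "NN C1 \<ge> 0" by (simp add: NN_def sum_nonneg)
  have rv: "200850 * r \<le> 1 / 600" by (simp add: r_def)
  have lo: "scaled_loss k n C1 \<ge> scaled_loss k n C - 20 / 2 ^ 41 * sqrt (NN C1) + NN C1 / 256 - NN C1 / 600"
    using lower[OF C1r] mult_right_mono[OF rv N0] by simp
  have sq: "sqrt (NN C1) \<le> r" using C1r r(1) N0 by (intro real_le_lsqrt) auto
  have pos: "scaled_loss k n C1 > 0"
  proof -
    have "scaled_loss k n C \<ge> 1 / 1000" using cert by (simp add: certified_point_def)
    moreover have "20 / 2 ^ 41 * sqrt (NN C1) \<le> 20 / 2 ^ 41 * r" using sq by (intro mult_left_mono) auto
    moreover have "20 / 2 ^ 41 * r < 1 / 1000" by (simp add: r_def)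
    ultimately show ?thesis using lo N0 by linarith
  qed
  \<comment> \<open>On the sphere the loss would exceed its value at \<open>C\<close>, because 20 /
    2^14 < 1/256 - 1/600, while the minimizer cannot be worse than \<open>C\<close>.\<close>
  have "NN C1 < r\<^sup>2"
  proof (rule ccontr)
    assume "\<not> NN C1 < r\<^sup>2"
    hence e: "NN C1 = r\<^sup>2" using C1r by simp
    hence "sqrt (NN C1) = r" using r by simp
    hence "scaled_loss k n C1 \<ge> scaled_loss k n C + r\<^sup>2 / 256 - r\<^sup>2 / 600 - 20 / 2 ^ 41 * r" using lo e by simp
    moreover have "r\<^sup>2 / 256 - r\<^sup>2 / 600 - 20 / 2 ^ 41 * r > 0" by (simp add: r_def power_divide)
    moreover have "scaled_loss k n C1 \<le> scaled_loss k n C" by (rule min) (simp add: NN_def)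
    ultimately show False by linarith
  qed
  with pos min show ?thesis unfolding NN_def r_def by blast
qed

text \<open>Coordinates in the target basis form an isometry, so balls around \<open>W1\<close>
  correspond to balls around \<open>C1\<close>. The loss formula is available only on the ball
  around \<open>C\<close>, and the neighborhood of \<open>W1\<close> is chosen to stay within
  it.\<close>

theorem certified_point_spurious:
  assumes cert: "certified_point k n C" and kn: "n \<le> 20" "k \<le> 20" "k \<le> n" and V: "orthonormal_rows k V"
  shows "\<exists>W. spurious_local_min n k (relu_loss k n V) W"
proof -
  obtain C1 where C1: "scaled_loss k n C1 > 0"
    "(\<Sum>i<n. \<Sum>j<k. (C1 i j - C i j)\<^sup>2) < (1 / 2 ^ 27)\<^sup>2"
    "\<And>C'. (\<Sum>i<n. \<Sum>j<k. (C' i j - C i j)\<^sup>2) \<le> (1 / 2 ^ 27)\<^sup>2 \<Longrightarrow> scaled_loss k n C1 \<le> scaled_loss k n C'"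
    using certified_point_local_min[OF cert kn(1,2)] by blast
  define coord where "coord = (\<lambda>(W :: nat \<Rightarrow> nat \<Rightarrow> real) i l. dp k (W i) (V l))"
  \<comment> \<open>The matrix whose coordinates in the target basis are \<open>C1\<close>.\<close>
  define W1 where "W1 = (\<lambda>i j. \<Sum>l<k. C1 i l * V l j)"
  have VV: "dp k (V i) (V j) = (if i = j then 1 else 0)" if "i < k" "j < k" for i j
    using V that by (auto simp: orthonormal_rows_def dp_def)
  have W1: "coord W1 i l = C1 i l" if "l < k" for i l
  proof -
    have "coord W1 i l = (\<Sum>m<k. C1 i m * dp k (V m) (V l))"
      unfolding coord_def W1_def dp_def sum_distrib_right sum_distrib_left
      by (subst sum.swap) (simp add: mult.assoc)
    also have "\<dots> = C1 i l" using that by (simp add: VV if_distrib cong: if_cong)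
    finally show ?thesis .
  qed
  have nd: "nondegenerate k n C" using cert by (simp add: certified_point_def)
  have loss: "relu_loss k n V W = scaled_loss k n (coord W) / (2 * pi)"
    if W: "(\<Sum>i<n. \<Sum>j<k. (coord W i j - C i j)\<^sup>2) \<le> (1 / 2 ^ 27)\<^sup>2" for W
  proof (rule relu_loss_eq_scaled_loss[OF V])
    define d where "d = (\<lambda>i j. coord W i j - C i j)"
    have dN: "(\<Sum>i<n. dp k (d i) (d i)) \<le> (1 / 2 ^ 27)\<^sup>2" using W by (simp add: d_def dp_def power2_eq_square)
    have Cd: "(\<lambda>i j. C i j + d i j) = coord W" and Cd': "\<And>i. (\<lambda>j. C i j + d i j) = coord W i" by (simp_all add: d_def)
    note ex = scaled_loss_expansion[OF nd dN, unfolded Cd]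
    show "(dp k (coord W i) (coord W j))\<^sup>2 < dp k (coord W i) (coord W i) * dp k (coord W j) (coord W j)" if "i < n" "j < n" "i \<noteq> j" for i j
      using ex(1)[OF _ _ that] unfolding Cd' by simp
    show "(coord W i j)\<^sup>2 < dp k (coord W i) (coord W i)" if "i < n" "j < k" for i j
      using ex(2)[OF _ _ that] unfolding Cd' by (simp add: d_def)
  qed (simp add: coord_def)
  have l1: "relu_loss k n V W1 = scaled_loss k n C1 / (2 * pi)"
  proof -
    have "relu_loss k n V W1 = scaled_loss k n (coord W1) / (2 * pi)"
      by (rule loss) (use C1(2) W1 in simp)
    also have "scaled_loss k n (coord W1) = scaled_loss k n C1"
      by (simp add: scaled_loss_def dp_def W1)
    finally show ?thesis .
  qed
  \<comment> \<open>The distance from \<open>C1\<close> to the boundary of the ball around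
    \<open>C\<close>; by the triangle inequality all points closer than this to \<open>C1\<close>
    remain in the ball.\<close>
  define e where "e = 1 / 2 ^ 27 - sqrt (\<Sum>i<n. \<Sum>j<k. (C1 i j - C i j)\<^sup>2)"
  have "sqrt (\<Sum>i<n. \<Sum>j<k. (C1 i j - C i j)\<^sup>2) < 1 / 2 ^ 27"
    using C1(2) by (intro real_less_lsqrt) (auto intro!: sum_nonneg)
  hence e: "e > 0" by (simp add: e_def)
  have local_min: "relu_loss k n V W1 \<le> relu_loss k n V W'"
    if W': "(\<Sum>i<n. \<Sum>j<k. (W' i j - W1 i j)\<^sup>2) < e\<^sup>2" for W'
  proof -
    have iso: "(\<Sum>j<k. (coord W' i j - C1 i j)\<^sup>2) = (\<Sum>j<k. (W' i j - W1 i j)\<^sup>2)" for i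
    proof -
      have "(\<Sum>j<k. (W' i j - W1 i j)\<^sup>2) = dp k (\<lambda>j. W' i j - W1 i j) (\<lambda>j. W' i j - W1 i j)"
        by (simp add: dp_def power2_eq_square)
      also have "\<dots> = dp k (\<lambda>l. dp k (\<lambda>j. W' i j - W1 i j) (V l)) (\<lambda>l. dp k (\<lambda>j. W' i j - W1 i j) (V l))"
        by (rule parseval[OF V, symmetric])
      also have "\<dots> = (\<Sum>l<k. (coord W' i l - coord W1 i l)\<^sup>2)"
      proof -
        have "dp k (\<lambda>j. W' i j - W1 i j) (V l) = coord W' i l - coord W1 i l" for l
          by (simp add: dp_diff_left coord_def)
        thus ?thesis by (simp only:) (simp add: dp_def[of k "\<lambda>l. coord W' i l - coord W1 i l"] power2_eq_square)
      qed
      finally show ?thesis using W1 by simp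
    qed
    let ?S = "{..<n} \<times> {..<k}"
    have L2: "L2_set (\<lambda>x. coord W' (fst x) (snd x) - C1 (fst x) (snd x)) ?S < e"
    proof -
      have "(\<Sum>x\<in>?S. (coord W' (fst x) (snd x) - C1 (fst x) (snd x))\<^sup>2) = (\<Sum>i<n. \<Sum>j<k. (coord W' i j - C1 i j)\<^sup>2)"
        by (simp add: sum.cartesian_product case_prod_beta)
      also have "\<dots> = (\<Sum>i<n. \<Sum>j<k. (W' i j - W1 i j)\<^sup>2)" by (simp only: iso)
      finally have "(\<Sum>x\<in>?S. (coord W' (fst x) (snd x) - C1 (fst x) (snd x))\<^sup>2) < e\<^sup>2" using W' by (simp only:)
      thus ?thesis unfolding L2_set_def using e by (intro real_less_lsqrt) (auto intro!: sum_nonneg)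
    qed
    have "L2_set (\<lambda>x. coord W' (fst x) (snd x) - C (fst x) (snd x)) ?S
      \<le> L2_set (\<lambda>x. coord W' (fst x) (snd x) - C1 (fst x) (snd x)) ?S + L2_set (\<lambda>x. C1 (fst x) (snd x) - C (fst x) (snd x)) ?S"
      using L2_set_triangle_ineq[of "\<lambda>x. coord W' (fst x) (snd x) - C1 (fst x) (snd x)" "\<lambda>x. C1 (fst x) (snd x) - C (fst x) (snd x)" ?S] by simp
    also have "L2_set (\<lambda>x. C1 (fst x) (snd x) - C (fst x) (snd x)) ?S = 1 / 2 ^ 27 - e"
      by (simp add: L2_set_def e_def sum.cartesian_product case_prod_beta)
    finally have "L2_set (\<lambda>x. coord W' (fst x) (snd x) - C (fst x) (snd x)) ?S \<le> 1 / 2 ^ 27" using L2 by simp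
    hence "(L2_set (\<lambda>x. coord W' (fst x) (snd x) - C (fst x) (snd x)) ?S)\<^sup>2 \<le> (1 / 2 ^ 27)\<^sup>2"
      by (intro power_mono) (auto simp: L2_set_nonneg)
    hence N: "(\<Sum>i<n. \<Sum>j<k. (coord W' i j - C i j)\<^sup>2) \<le> (1 / 2 ^ 27)\<^sup>2"
      by (simp add: L2_set_def sum_nonneg sum.cartesian_product case_prod_beta)
    show ?thesis unfolding l1 loss[OF N] using C1(3)[OF N] by (simp add: divide_right_mono)
  qed
  \<comment> \<open>Padding the targets with n - k zero rows reproduces the target network exactly;
    this is where \<open>k \<le> n\<close> enters.\<close>
  have "relu_loss k n V (\<lambda>i j. if i < k then V i j else 0) = 0"
  proof -
    have "(\<Sum>i<n. relu (\<Sum>j<k. (if i < k then V i j else 0) * x j)) = (\<Sum>i<k. relu (\<Sum>j<k. V i j * x j))" for x :: "nat \<Rightarrow> real"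
      using kn(3) by (intro sum.mono_neutral_cong_right) (auto simp: relu_def)
    thus ?thesis by (simp add: relu_loss_def)
  qed
  moreover have "relu_loss k n V W1 > 0" unfolding l1 using C1(1) by simp
  ultimately have "\<exists>W'. relu_loss k n V W' < relu_loss k n V W1" by metis
  thus ?thesis unfolding spurious_local_min_def using e local_min by blast
qed

section \<open>Interval arithmetic\<close>

text \<open>Rounding toward zero makes halving the deletion of the last binary digit for either
  sign, so one rewrite rule for each numeral constructor evaluates it.\<close>

definition halve :: "int \<Rightarrow> int" where
  "halve x = (if 0 \<le> x then x div 2 else - ((- x) div 2))"

lemma halve_simps [simp]:
  "halve 0 = 0" "halve 1 = 0" "halve (- 1) = 0"
  "halve (numeral (num.Bit0 n)) = numeral n" "halve (numeral (num.Bit1 n)) = numeral n"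
  "halve (- numeral (num.Bit0 n)) = - numeral n" "halve (- numeral (num.Bit1 n)) = - numeral n"
  by (simp_all add: halve_def numeral_Bit0_div_2 numeral_Bit1_div_2)

lemma halve_bounds:
  "0 \<le> x \<Longrightarrow> 0 \<le> halve x \<and> 2 * halve x \<le> x \<and> x \<le> 2 * halve x + 1"
  "x \<le> 0 \<Longrightarrow> halve x \<le> 0 \<and> x \<le> 2 * halve x \<and> 2 * halve x - 1 \<le> x"
  unfolding halve_def by auto

text \<open>Truncated division by 2 to the power of the first argument, by recursion on the binary
  digits of the exponent: even exponents shift twice by half of it.\<close>

fun shift :: "num \<Rightarrow> int \<Rightarrow> int" where
  "shift num.One x = halve x"
| "shift (num.Bit0 n) x = shift n (shift n x)"
| "shift (num.Bit1 n) x = halve (shift n (shift n x))"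

text \<open>Iterated floors compose to a single floor: for integers, \<open>y < (z + 1) * P\<close>
  improves to \<open>y + 1 \<le> (z + 1) * P\<close>, so no rounding error accumulates in the
  recursion.\<close>

lemma shift_bounds_nonneg:
  "0 \<le> x \<Longrightarrow> 0 \<le> shift n x \<and> shift n x * 2 ^ numeral n \<le> x \<and> x < (shift n x + 1) * 2 ^ numeral n"
proof (induction n arbitrary: x)
  case One
  thus ?case using halve_bounds(1)[of x] by auto
next
  case (Bit0 n)
  define y where "y = shift n x"
  define z where "z = shift n y"
  define P where "P = (2 ^ numeral n :: int)"
  have P: "P > 0" "2 ^ numeral (num.Bit0 n) = P * P" unfolding P_def numeral_Bit0 power_add by (simp, rule refl)
  have y: "0 \<le> y" "y * P \<le> x" "x < (y + 1) * P" using Bit0.IH[OF Bit0.prems] unfolding y_def P_def by blast+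
  have z: "0 \<le> z" "z * P \<le> y" "y + 1 \<le> (z + 1) * P" using Bit0.IH[OF y(1)] unfolding z_def P_def by auto
  have "z * P * P \<le> y * P" "(y + 1) * P \<le> (z + 1) * P * P" using mult_right_mono[OF z(2), of P] mult_right_mono[OF z(3), of P] P(1) by (simp_all only: less_imp_le)
  hence "z * (P * P) \<le> x" "x < (z + 1) * (P * P)" using y unfolding mult.assoc by linarith+
  thus ?case using z(1) unfolding P(2) by (simp add: z_def y_def)
next
  case (Bit1 n)
  define y where "y = shift n x"
  define z where "z = shift n y"
  define h where "h = halve z"
  define P where "P = (2 ^ numeral n :: int)"
  have P: "P > 0" "2 ^ numeral (num.Bit1 n) = 2 * (P * P)" unfolding P_def numeral_Bit1 power_add power_one_right by (simp, simp only: mult.commute)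
  have y: "0 \<le> y" "y * P \<le> x" "x < (y + 1) * P" using Bit1.IH[OF Bit1.prems] unfolding y_def P_def by blast+
  have z: "0 \<le> z" "z * P \<le> y" "y + 1 \<le> (z + 1) * P" using Bit1.IH[OF y(1)] unfolding z_def P_def by auto
  have "z * P * P \<le> y * P" "(y + 1) * P \<le> (z + 1) * P * P" using mult_right_mono[OF z(2), of P] mult_right_mono[OF z(3), of P] P(1) by (simp_all only: less_imp_le)
  hence *: "z * (P * P) \<le> x" "x < (z + 1) * (P * P)" using y unfolding mult.assoc by linarith+
  have h: "0 \<le> h" "2 * h \<le> z" "z + 1 \<le> 2 * h + 2" using halve_bounds(1)[OF z(1)] by (auto simp: h_def)
  have "2 * h * (P * P) \<le> z * (P * P)" "(z + 1) * (P * P) \<le> (2 * h + 2) * (P * P)"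
    using mult_right_mono[OF h(2), of "P * P"] mult_right_mono[OF h(3), of "P * P"] P(1) by (simp_all only: less_imp_le mult_nonneg_nonneg)
  hence "h * (2 * (P * P)) \<le> x" "x < (h + 1) * (2 * (P * P))" using * by (simp_all add: algebra_simps)
  thus ?case using h(1) unfolding P(2) by (simp add: h_def z_def y_def)
qed

lemma halve_minus: "halve (- x) = - halve x"
  unfolding halve_def by (cases x "0 :: int" rule: linorder_cases) auto

lemma shift_minus: "shift n (- x) = - shift n x"
  by (induction n arbitrary: x) (simp_all add: halve_minus)

lemma shift_error: "\<bar>real_of_int x / 2 ^ numeral n - real_of_int (shift n x)\<bar> \<le> 1"
proof -
  have *: "\<bar>real_of_int x / 2 ^ numeral n - real_of_int (shift n x)\<bar> \<le> 1" if "0 \<le> x" for x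
  proof -
    have a: "shift n x * 2 ^ numeral n \<le> x" "x \<le> (shift n x + 1) * 2 ^ numeral n"
      using shift_bounds_nonneg[OF that, of n] by auto
    have "real_of_int (shift n x) * 2 ^ numeral n \<le> real_of_int x"
      using iffD2[OF of_int_le_iff[where 'a = real] a(1)] by simp
    moreover have "real_of_int x \<le> (real_of_int (shift n x) + 1) * 2 ^ numeral n"
      using iffD2[OF of_int_le_iff[where 'a = real] a(2)] by simp
    ultimately show ?thesis by (auto simp: abs_le_iff field_simps)
  qed
  show ?thesis
  proof (cases "0 \<le> x")
    case False
    hence "\<bar>real_of_int (- x) / 2 ^ numeral n - real_of_int (shift n (- x))\<bar> \<le> 1" by (intro *) simp
    thus ?thesis by (simp add: shift_minus abs_minus_commute)
  qed (rule *)
qed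

text \<open>Midpoint and radius, both in units of 2^-B. The scale is an argument of
  \<open>approximates\<close> and not stored in the interval, so all computation is on plain
  integers.\<close>

datatype iv = Iv int int

definition approximates :: "num \<Rightarrow> real \<Rightarrow> iv \<Rightarrow> bool" where
  "approximates B x X \<longleftrightarrow> (case X of Iv a r \<Rightarrow> \<bar>x * 2 ^ numeral B - real_of_int a\<bar> \<le> real_of_int r)"

lemma approximates_Iv: "approximates B x (Iv a r) \<longleftrightarrow> \<bar>x * 2 ^ numeral B - real_of_int a\<bar> \<le> real_of_int r"
  by (simp add: approximates_def)

fun iabs :: "int \<Rightarrow> int" where "iabs x = (if x < 0 then - x else x)"

lemma iabs_eq: "iabs x = \<bar>x\<bar>" by simp

fun iv_add :: "iv \<Rightarrow> iv \<Rightarrow> iv" where "iv_add (Iv a r) (Iv b q) = Iv (a + b) (r + q)"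
fun iv_sub :: "iv \<Rightarrow> iv \<Rightarrow> iv" where "iv_sub (Iv a r) (Iv b q) = Iv (a - b) (r + q)"
fun iv_neg :: "iv \<Rightarrow> iv" where "iv_neg (Iv a r) = Iv (- a) r"
text \<open>One of the two extra units pays for truncating the midpoint, the other for truncating
  the radius.\<close>

fun iv_mul :: "num \<Rightarrow> iv \<Rightarrow> iv \<Rightarrow> iv" where
  "iv_mul B (Iv a r) (Iv b q) = Iv (shift B (a * b)) (shift B (iabs a * q + iabs b * r + r * q) + 2)"
fun iv_scale :: "int \<Rightarrow> iv \<Rightarrow> iv" where "iv_scale n (Iv a r) = Iv (n * a) (iabs n * r)"
fun iv_chop :: "num \<Rightarrow> iv \<Rightarrow> iv" where "iv_chop n (Iv a r) = Iv (shift n a) (shift n r + 2)"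

lemma approximates_add: "approximates B x X \<Longrightarrow> approximates B y Y \<Longrightarrow> approximates B (x + y) (iv_add X Y)"
  by (cases X; cases Y) (auto simp: approximates_Iv distrib_right)

lemma approximates_sub: "approximates B x X \<Longrightarrow> approximates B y Y \<Longrightarrow> approximates B (x - y) (iv_sub X Y)"
  by (cases X; cases Y) (auto simp: approximates_Iv left_diff_distrib)

lemma approximates_neg: "approximates B x X \<Longrightarrow> approximates B (- x) (iv_neg X)"
  by (cases X) (auto simp: approximates_Iv)

lemma abs_diff_scale: "P > 0 \<Longrightarrow> \<bar>x * P - a\<bar> / P = \<bar>x - a / P\<bar>" for x a P :: real
proof -
  assume P: "P > 0"
  have "\<bar>x * P - a\<bar> / P = \<bar>(x * P - a) / P\<bar>" using P by (simp add: abs_divide)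
  also have "(x * P - a) / P = x - a / P" using P by (simp add: diff_divide_distrib)
  finally show ?thesis .
qed

lemma abs_triangle_rounding: "\<bar>u - v\<bar> \<le> e \<Longrightarrow> \<bar>v - w\<bar> \<le> 1 \<Longrightarrow> \<bar>e - f\<bar> \<le> 1 \<Longrightarrow> \<bar>u - w\<bar> \<le> f + 2"
  for u v w e f :: real by linarith

lemma approximates_mul:
  assumes "approximates B x X" "approximates B y Y"
  shows "approximates B (x * y) (iv_mul B X Y)"
proof -
  obtain a r b q where XY: "X = Iv a r" "Y = Iv b q" by (cases X; cases Y)
  define P where "P = (2 ^ numeral B :: real)"
  have P: "P > 0" by (simp add: P_def)
  define u where "u = x * P - a"
  define v where "v = y * P - b"
  have u: "\<bar>u\<bar> \<le> r" "\<bar>v\<bar> \<le> q" using assms by (auto simp: XY approximates_Iv u_def v_def P_def)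
  have e: "x * y * P * P = (a + u) * (b + v)" by (simp add: u_def v_def algebra_simps)
  have t: "\<bar>s * w\<bar> \<le> real_of_int k" if "\<bar>s\<bar> \<le> real_of_int i" "\<bar>w\<bar> \<le> real_of_int j" "k = i * j" for s w :: real and i j k
  proof -
    have "\<bar>s\<bar> * \<bar>w\<bar> \<le> real_of_int i * real_of_int j" using that by (intro mult_mono) auto
    thus ?thesis using that by (simp add: abs_mult)
  qed
  define E where "E = \<bar>a\<bar> * q + \<bar>b\<bar> * r + r * q"
  have "\<bar>a * v\<bar> \<le> real_of_int (\<bar>a\<bar> * q)" "\<bar>u * b\<bar> \<le> real_of_int (\<bar>b\<bar> * r)" "\<bar>u * v\<bar> \<le> real_of_int (r * q)"
    using t[of a "\<bar>a\<bar>" v q] t[of b "\<bar>b\<bar>" u r] t[of u r v q] u by (simp_all add: mult.commute)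
  moreover have "x * y * P * P - real_of_int (a * b) = a * v + u * b + u * v" unfolding e by (simp add: algebra_simps)
  ultimately have "\<bar>x * y * P * P - real_of_int (a * b)\<bar> \<le> real_of_int E" unfolding E_def by linarith
  hence "\<bar>x * y * P * P - real_of_int (a * b)\<bar> / P \<le> real_of_int E / P" using P by (simp add: divide_right_mono)
  hence 1: "\<bar>x * y * P - real_of_int (a * b) / P\<bar> \<le> real_of_int E / P"
    unfolding abs_diff_scale[OF P] .
  have 2: "\<bar>real_of_int (a * b) / P - real_of_int (shift B (a * b))\<bar> \<le> 1"
    "\<bar>real_of_int E / P - real_of_int (shift B E)\<bar> \<le> 1" unfolding P_def by (rule shift_error)+
  have "\<bar>x * y * P - real_of_int (shift B (a * b))\<bar> \<le> real_of_int (shift B E) + 2"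
    by (rule abs_triangle_rounding[OF 1 2])
  thus ?thesis by (simp add: XY approximates_Iv iabs_eq E_def P_def del: iabs.simps)
qed

lemma approximates_scale:
  assumes "approximates B x X"
  shows "approximates B (real_of_int n * x) (iv_scale n X)"
proof -
  obtain a r where X: "X = Iv a r" by (cases X)
  have "\<bar>real_of_int n\<bar> * \<bar>x * 2 ^ numeral B - real_of_int a\<bar> \<le> \<bar>real_of_int n\<bar> * real_of_int r"
    using assms by (intro mult_left_mono) (auto simp: X approximates_Iv)
  hence "\<bar>real_of_int n * (x * 2 ^ numeral B - real_of_int a)\<bar> \<le> \<bar>real_of_int n\<bar> * real_of_int r" by (simp add: abs_mult)
  thus ?thesis by (simp add: X approximates_Iv iabs_eq algebra_simps del: iabs.simps)
qed

lemma approximates_chop: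
  assumes "approximates B x X" "numeral B = numeral n + (numeral B' :: nat)"
  shows "approximates B' x (iv_chop n X)"
proof -
  obtain a r where X: "X = Iv a r" by (cases X)
  define P where "P = (2 ^ numeral n :: real)"
  have P: "P > 0" by (simp add: P_def)
  have "\<bar>x * 2 ^ numeral B' * P - real_of_int a\<bar> \<le> real_of_int r"
    using assms(1) unfolding X approximates_Iv P_def assms(2) power_add by (simp only: ac_simps)
  hence "\<bar>x * 2 ^ numeral B' * P - real_of_int a\<bar> / P \<le> real_of_int r / P" using P by (simp only: divide_right_mono less_imp_le)
  hence 1: "\<bar>x * 2 ^ numeral B' - real_of_int a / P\<bar> \<le> real_of_int r / P"
    unfolding abs_diff_scale[OF P] .
  have 2: "\<bar>real_of_int a / P - real_of_int (shift n a)\<bar> \<le> 1" "\<bar>real_of_int r / P - real_of_int (shift n r)\<bar> \<le> 1"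
    unfolding P_def by (rule shift_error)+
  have "\<bar>x * 2 ^ numeral B' - real_of_int (shift n a)\<bar> \<le> real_of_int (shift n r) + 2"
    by (rule abs_triangle_rounding[OF 1 2])
  thus ?thesis by (simp add: X approximates_Iv)
qed

lemma approximates_dyadic: "approximates B (real_of_int a / 2 ^ numeral B) (Iv a 0)"
  by (simp add: approximates_Iv)

text \<open>Inverses, square roots and arctangents are guessed outside the logic and checked here,
  so that evaluation needs only sums, products and comparisons of integers.\<close>

fun inverse_ok :: "num \<Rightarrow> iv \<Rightarrow> iv \<Rightarrow> bool" where
  "inverse_ok B (Iv a r) (Iv y t) \<longleftrightarrow> r < a \<and> 0 \<le> t \<and>
     iabs (a * y - 2 ^ numeral B * 2 ^ numeral B) + iabs y * r \<le> t * (a - r)"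

text \<open>From \<open>(a + u) (1/x) = 1\<close> in units of \<open>2^-B\<close>, \<open>(a + u) (z - y) = 4^B - a y - u y\<close>.\<close>

lemma approximates_inverse:
  assumes "approximates B x (Iv a r)" "inverse_ok B (Iv a r) (Iv y t)"
  shows "approximates B (inverse x) (Iv y t)" "x > 0"
proof -
  define P where "P = (2 ^ numeral B :: real)"
  have P: "P > 0" by (simp add: P_def)
  define u where "u = x * P - a"
  have u: "\<bar>u\<bar> \<le> r" using assms by (simp add: approximates_Iv u_def P_def)
  have ok: "r < a" "0 \<le> t" "\<bar>a * y - 2 ^ numeral B * 2 ^ numeral B\<bar> + \<bar>y\<bar> * r \<le> t * (a - r)"
    using assms(2) by (simp_all add: iabs_eq del: iabs.simps)
  have xP: "x * P = a + u" "a + u \<ge> a - r" "a - r > (0::real)" using u ok(1) by (auto simp: u_def abs_le_iff)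
  hence x: "x * P > 0" by linarith
  thus x0: "x > 0" using P by (simp add: zero_less_mult_iff)
  define z where "z = inverse x * P"
  have "(a + u) * z = P * P" unfolding xP(1)[symmetric] z_def using x0 by simp
  hence "(a + u) * (z - y) = P * P - a * y - u * y" by (simp add: algebra_simps)
  hence 1: "\<bar>(a + u) * (z - y)\<bar> \<le> \<bar>a * y - P * P\<bar> + \<bar>u * y\<bar>" by linarith
  have 2: "\<bar>u * y\<bar> \<le> \<bar>y\<bar> * r" using mult_right_mono[OF u, of "\<bar>real_of_int y\<bar>"] by (simp add: abs_mult mult.commute)
  have 3: "\<bar>a * y - P * P\<bar> + \<bar>real_of_int y\<bar> * r \<le> real_of_int t * (real_of_int a - r)"
  proof -
    have "real_of_int (\<bar>a * y - 2 ^ numeral B * 2 ^ numeral B\<bar> + \<bar>y\<bar> * r) \<le> real_of_int (t * (a - r))"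
      using ok(3) by (simp only: of_int_le_iff)
    thus ?thesis by (simp add: P_def)
  qed
  have 4: "real_of_int t * (real_of_int a - r) \<le> t * (a + u)" using xP(2) ok(2) by (intro mult_left_mono) auto
  have "\<bar>(a + u) * (z - y)\<bar> = \<bar>z - y\<bar> * (a + u)" using x xP(1) by (simp add: abs_mult mult.commute)
  hence "\<bar>z - y\<bar> * (a + u) \<le> t * (a + u)" using 1 2 3 4 by simp
  hence "\<bar>z - y\<bar> \<le> t" using x xP(1) by simp
  thus "approximates B (inverse x) (Iv y t)" by (simp add: approximates_Iv z_def P_def)
qed

text \<open>The end points of the guessed interval are squared; a square carries the scale 2^B twice
  and the radicand once, hence the additional factor.\<close>

fun sqrt_ok :: "num \<Rightarrow> iv \<Rightarrow> iv \<Rightarrow> bool" where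
  "sqrt_ok B (Iv a r) (Iv y t) \<longleftrightarrow> 0 \<le> y - t \<and> 0 \<le> t \<and> (y - t) * (y - t) \<le> (a - r) * 2 ^ numeral B
     \<and> (a + r) * 2 ^ numeral B \<le> (y + t) * (y + t)"

lemma approximates_sqrt:
  assumes "approximates B x (Iv a r)" "sqrt_ok B (Iv a r) (Iv y t)"
  shows "approximates B (sqrt x) (Iv y t)"
proof -
  define P where "P = (2 ^ numeral B :: real)"
  have P: "P > 0" by (simp add: P_def)
  have xb: "a - r \<le> x * P" "x * P \<le> a + r" using assms(1) by (auto simp: approximates_Iv P_def abs_le_iff)
  have ok: "0 \<le> y - t" "0 \<le> t" "(y - t) * (y - t) \<le> (a - r) * 2 ^ numeral B" "(a + r) * 2 ^ numeral B \<le> (y + t) * (y + t)"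
    using assms(2) by simp_all
  have 1: "(real_of_int y - t) * (real_of_int y - t) \<le> (a - r) * P" "(a + r) * P \<le> (real_of_int y + t) * (real_of_int y + t)"
    using iffD2[OF of_int_le_iff[where 'a = real] ok(3)] iffD2[OF of_int_le_iff[where 'a = real] ok(4)]
    by (simp_all add: P_def)
  have y: "0 \<le> real_of_int y - t" using ok(1) by (metis of_int_0_le_iff of_int_diff)
  have "(a - r) * P \<le> x * P * P" "x * P * P \<le> (a + r) * P" using xb P by (auto intro: mult_right_mono)
  hence 2: "(real_of_int y - t)\<^sup>2 \<le> x * P\<^sup>2" "x * P\<^sup>2 \<le> (real_of_int y + t)\<^sup>2"
    using 1 by (auto simp: power2_eq_square mult.assoc)
  have s: "sqrt x * P = sqrt (x * P\<^sup>2)" using P by (simp add: real_sqrt_mult)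
  have "real_of_int y - t \<le> sqrt (x * P\<^sup>2)" using 2(1) by (rule real_le_rsqrt)
  moreover have "sqrt (x * P\<^sup>2) \<le> real_of_int y + t" using 2(2) y ok(2) by (intro real_le_lsqrt) auto
  ultimately show ?thesis unfolding approximates_Iv P_def[symmetric] s by (simp add: abs_le_iff)
qed

section \<open>Sine, cosine and arctangent in interval arithmetic\<close>

fun horner :: "real list \<Rightarrow> real \<Rightarrow> real" where
  "horner [] y = 0"
| "horner (c # cs) y = c + y * horner cs y"

fun iv_horner :: "num \<Rightarrow> iv list \<Rightarrow> iv \<Rightarrow> iv" where
  "iv_horner B [] Y = Iv 0 0"
| "iv_horner B (c # cs) Y = iv_add c (iv_mul B Y (iv_horner B cs Y))"

lemma approximates_horner:
  assumes "list_all2 (approximates B) cs Cs" "approximates B y Y"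
  shows "approximates B (horner cs y) (iv_horner B Cs Y)"
  using assms(1)
proof (induction rule: list_all2_induct)
  case Nil
  show ?case by (simp add: approximates_Iv)
next
  case (Cons c cs C Cs)
  thus ?case using assms(2) by (auto intro!: approximates_add approximates_mul)
qed

text \<open>Taylor coefficients in the variable h^2, of cos h here and of sin h / h in
  \<open>sin_coeffs\<close>. Ten terms cover all degrees below 20, so for |h| <= 1 the remainder is
  at most 1 / 20!, and 20! = 2432902008176640000.\<close>

definition cos_coeffs :: "real list" where
  "cos_coeffs = [1, -1/2, 1/24, -1/720, 1/40320, -1/3628800, 1/479001600, -1/87178291200, 1/20922789888000, -1/6402373705728000]"

definition sin_coeffs :: "real list" where
  "sin_coeffs = [1, -1/6, 1/120, -1/5040, 1/362880, -1/39916800, 1/6227020800, -1/1307674368000, 1/355687428096000, -1/121645100408832000]"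

lemma horner_map_upt: "horner (map f [a..<a + n]) y = (\<Sum>j<n. f (a + j) * y ^ j)"
proof (induction n arbitrary: a)
  case (Suc n)
  have "horner (map f [a..<a + Suc n]) y = f a + y * horner (map f [Suc a..<Suc a + n]) y"
    by (simp add: upt_conv_Cons del: upt_Suc)
  also have "\<dots> = f a + (\<Sum>j<n. f (a + Suc j) * y ^ Suc j)"
    unfolding Suc.IH by (simp add: sum_distrib_left mult.left_commute)
  also have "\<dots> = (\<Sum>j<Suc n. f (a + j) * y ^ j)" by (subst sum.lessThan_Suc_shift) simp
  finally show ?case .
qed simp

lemma cos_taylor_even: "(\<Sum>m<2 * n. cos_coeff m * h ^ m) = (\<Sum>j<n. (- 1) ^ j / fact (2 * j) * (h\<^sup>2) ^ j)"
  by (induction n) (simp_all add: cos_coeff_def power_mult)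

lemma sin_taylor_odd: "(\<Sum>m<2 * n. sin_coeff m * h ^ m) = h * (\<Sum>j<n. (- 1) ^ j / fact (2 * j + 1) * (h\<^sup>2) ^ j)"
  by (induction n) (simp_all add: sin_coeff_def power_mult distrib_left)

lemma power_abs_le_one: "\<bar>h\<bar> \<le> 1 \<Longrightarrow> \<bar>h ^ n\<bar> \<le> 1" for h :: real
  by (simp add: power_abs power_le_one)

lemma cos_approx:
  assumes "\<bar>h\<bar> \<le> 1"
  shows "\<bar>cos h - horner cos_coeffs (h\<^sup>2)\<bar> \<le> 1 / 2432902008176640000"
proof -
  obtain t where t: "cos h = (\<Sum>m<20. cos_coeff m * h ^ m) + (cos (t + 1 / 2 * real 20 * pi) / fact 20) * h ^ 20"
    using Maclaurin_cos_expansion[of h 20] by blast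
  have c: "cos_coeffs = map (\<lambda>j. (- 1) ^ j / fact (2 * j)) [0..<0 + 10]"
    by (simp add: cos_coeffs_def upt_rec fact_numeral)
  have "(\<Sum>m<20. cos_coeff m * h ^ m) = horner cos_coeffs (h\<^sup>2)"
    unfolding c horner_map_upt using cos_taylor_even[of h 10] by simp
  hence "\<bar>cos h - horner cos_coeffs (h\<^sup>2)\<bar> = \<bar>cos (t + 1 / 2 * real 20 * pi)\<bar> * \<bar>h ^ 20\<bar> / 2432902008176640000"
    using t by (simp add: abs_mult fact_numeral)
  also have "\<dots> \<le> 1 * 1 / 2432902008176640000"
    by (intro divide_right_mono mult_mono power_abs_le_one assms) auto
  finally show ?thesis by simp
qed

lemma sin_approx:
  assumes "\<bar>h\<bar> \<le> 1"
  shows "\<bar>sin h - h * horner sin_coeffs (h\<^sup>2)\<bar> \<le> 1 / 2432902008176640000"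
proof -
  obtain t where t: "sin h = (\<Sum>m<20. sin_coeff m * h ^ m) + (sin (t + 1 / 2 * real 20 * pi) / fact 20) * h ^ 20"
    using Maclaurin_sin_expansion[of h 20] by blast
  have c: "sin_coeffs = map (\<lambda>j. (- 1) ^ j / fact (2 * j + 1)) [0..<0 + 10]"
    by (simp add: sin_coeffs_def upt_rec fact_numeral)
  have "(\<Sum>m<20. sin_coeff m * h ^ m) = h * horner sin_coeffs (h\<^sup>2)"
    unfolding c horner_map_upt using sin_taylor_odd[of h 10] by simp
  hence "\<bar>sin h - h * horner sin_coeffs (h\<^sup>2)\<bar> = \<bar>sin (t + 1 / 2 * real 20 * pi)\<bar> * \<bar>h ^ 20\<bar> / 2432902008176640000"
    using t by (simp add: abs_mult fact_numeral)
  also have "\<dots> \<le> 1 * 1 / 2432902008176640000"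
    by (intro divide_right_mono mult_mono power_abs_le_one assms) auto
  finally show ?thesis by simp
qed

text \<open>The numeral 56, written with constructors as \<open>shift\<close> recurses on them. At
  this precision 72057594037927936 = 2^56 represents the number 1.\<close>

abbreviation prec :: num where "prec \<equiv> num.Bit0 (num.Bit0 (num.Bit0 (num.Bit1 (num.Bit1 num.One))))"

definition iv_cos_coeffs :: "iv list" where
  "iv_cos_coeffs = map (\<lambda>a. Iv a 1) [72057594037927936, -36028797018963968, 3002399751580331, -100079991719344, 1787142709274, -19857141214, 150432888, -826554, 3444, -11]"
definition iv_sin_coeffs :: "iv list" where
  "iv_sin_coeffs = map (\<lambda>a. Iv a 1) [72057594037927936, -12009599006321323, 600479950316066, -14297141674192, 198571412142, -1805194656, 11571761, -55104, 203, -1]"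

lemma approximates_coeffs:
  "list_all2 (approximates prec) cos_coeffs iv_cos_coeffs"
  "list_all2 (approximates prec) sin_coeffs iv_sin_coeffs"
  by (simp_all add: cos_coeffs_def iv_cos_coeffs_def sin_coeffs_def iv_sin_coeffs_def approximates_Iv abs_le_iff)

text \<open>One unit 2^-56 exceeds the series remainder 1 / 20!.\<close>

fun iv_widen :: "iv \<Rightarrow> iv" where "iv_widen (Iv a r) = Iv a (r + 1)"

lemma approximates_widen:
  assumes "approximates prec x X" "\<bar>y - x\<bar> \<le> 1 / 2432902008176640000"
  shows "approximates prec y (iv_widen X)"
proof -
  obtain a r where X: "X = Iv a r" by (cases X)
  have "\<bar>y * 2 ^ numeral prec - x * 2 ^ numeral prec\<bar> \<le> 1"
    using assms(2) unfolding abs_le_iff by simp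
  thus ?thesis using assms(1) unfolding X iv_widen.simps approximates_Iv by simp
qed

definition iv_cos :: "iv \<Rightarrow> iv" where "iv_cos H = iv_widen (iv_horner prec iv_cos_coeffs (iv_mul prec H H))"
definition iv_sin :: "iv \<Rightarrow> iv" where "iv_sin H = iv_widen (iv_mul prec H (iv_horner prec iv_sin_coeffs (iv_mul prec H H)))"

lemma approximates_cos_sin:
  assumes "approximates prec h H" "\<bar>h\<bar> \<le> 1"
  shows "approximates prec (cos h) (iv_cos H)" "approximates prec (sin h) (iv_sin H)"
  unfolding iv_cos_def iv_sin_def
  using assms cos_approx[OF assms(2)] sin_approx[OF assms(2)]
  by (auto simp: power2_eq_square intro!: approximates_widen approximates_horner approximates_coeffs approximates_mul)

text \<open>Write (D, s) = K (cos a, sin a) with a = arctan (s / D). Rotation by -phi gives K (cos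
  (a - phi), sin (a - phi)), so the quotient on the right is |tan (a - phi)|, and |arctan x| <= |x|.
  A positive cosine alone would allow further turns; \<open>\<bar>\<phi>\<bar> \<le> 2\<close>
  excludes them.\<close>

lemma arctan_eq_add:
  fixes s D \<phi> :: real
  assumes D: "D > 0" and f: "D * cos \<phi> + s * sin \<phi> > 0" and phi: "\<bar>\<phi>\<bar> \<le> 2"
  shows "\<bar>arctan (s / D) - \<phi>\<bar> \<le> \<bar>s * cos \<phi> - D * sin \<phi>\<bar> / (D * cos \<phi> + s * sin \<phi>)"
proof -
  define a where "a = arctan (s / D)"
  define R where "R = sqrt (s\<^sup>2 + D\<^sup>2)"
  have c: "cos a > 0" unfolding a_def by (rule cos_gt_zero_pi) (use arctan_lbound arctan_ubound in auto)
  have "sin a / cos a = s / D" using tan_arctan[of "s / D"] by (simp add: a_def tan_def)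
  hence sD: "sin a * D = s * cos a" using c D by (simp add: field_simps)
  define K where "K = D / cos a"
  have K: "K > 0" "D = K * cos a" "s = K * sin a" using c D sD by (auto simp: K_def field_simps)
  have e: "s * cos \<phi> - D * sin \<phi> = K * sin (a - \<phi>)" "D * cos \<phi> + s * sin \<phi> = K * cos (a - \<phi>)"
    unfolding K(2,3) sin_diff cos_diff by (simp_all add: algebra_simps)
  have cp: "cos (a - \<phi>) > 0" using f K(1) unfolding e by (simp add: zero_less_mult_iff)
  have ab: "\<bar>a\<bar> < pi / 2" unfolding a_def using arctan_bounded[of "s / D"] by auto
  have lt: "\<bar>a - \<phi>\<bar> < pi / 2"
  proof (rule ccontr)
    assume "\<not> \<bar>a - \<phi>\<bar> < pi / 2"
    hence 1: "pi / 2 \<le> \<bar>a - \<phi>\<bar>" by simp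
    \<comment> \<open>From |a| < pi / 2 and 2 <= pi; the cosine is nonpositive between pi / 2 and 3
      pi / 2.\<close>
    have 2: "\<bar>a - \<phi>\<bar> \<le> 3 * pi / 2" using ab phi pi_ge_two by linarith
    have "cos \<bar>a - \<phi>\<bar> = - cos (\<bar>a - \<phi>\<bar> - pi)" by (simp add: cos_diff)
    moreover have "cos (\<bar>a - \<phi>\<bar> - pi) \<ge> 0" using 1 2 by (intro cos_ge_zero) auto
    ultimately have "cos \<bar>a - \<phi>\<bar> \<le> 0" by simp
    thus False using cp unfolding cos_abs_real by linarith
  qed
  have "arctan (tan (a - \<phi>)) = a - \<phi>" using lt by (intro arctan_tan) linarith+
  moreover have "tan (a - \<phi>) = (s * cos \<phi> - D * sin \<phi>) / (D * cos \<phi> + s * sin \<phi>)"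
    unfolding e tan_def using K(1) by (simp only: mult_divide_mult_cancel_left less_imp_neq[symmetric] not_False_eq_True simp_thms)
  ultimately have "\<bar>a - \<phi>\<bar> = \<bar>arctan ((s * cos \<phi> - D * sin \<phi>) / (D * cos \<phi> + s * sin \<phi>))\<bar>" by (simp only:)
  also have "\<dots> \<le> \<bar>(s * cos \<phi> - D * sin \<phi>) / (D * cos \<phi> + s * sin \<phi>)\<bar>" by (rule abs_arctan_le)
  finally show ?thesis using f by (simp add: a_def abs_divide)
qed

fun iv_abs_upper :: "iv \<Rightarrow> int" where "iv_abs_upper (Iv a r) = iabs a + r"
fun iv_lower :: "iv \<Rightarrow> int" where "iv_lower (Iv a r) = a - r"

lemma iv_bounds:
  assumes "approximates B x X"
  shows "x * 2 ^ numeral B \<ge> real_of_int (iv_lower X)" "\<bar>x * 2 ^ numeral B\<bar> \<le> real_of_int (iv_abs_upper X)"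
  using assms by (cases X; auto simp: approximates_Iv)+

text \<open>\<open>h\<close> is a guess of half the angle \<open>arctan (s / D)\<close>, in units of \<open>2^-56\<close>.\<close>

definition arctan_ok :: "iv \<Rightarrow> iv \<Rightarrow> iv \<Rightarrow> iv \<Rightarrow> int \<Rightarrow> int \<Rightarrow> bool" where
  "arctan_ok S D C Sn h t \<longleftrightarrow> iabs h \<le> 72057594037927936 \<and> 0 < iv_lower D
     \<and> 9007199254740992 \<le> iv_lower (iv_add (iv_mul prec D C) (iv_mul prec S Sn))
     \<and> 8 * iv_abs_upper (iv_sub (iv_mul prec S C) (iv_mul prec D Sn)) \<le> t"

text \<open>An arctangent may be as large as pi / 2, whereas the series bounds hold on [-1, 1]. The
  series are therefore evaluated at half the angle and doubled by the double-angle formulas. Their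
  values are passed as arguments so that rewriting computes each of them once.\<close>

definition arctan_check :: "iv \<Rightarrow> iv \<Rightarrow> int \<Rightarrow> int \<Rightarrow> iv \<Rightarrow> iv \<Rightarrow> bool" where
  "arctan_check S D h t C0 S0 = arctan_ok S D (iv_sub (iv_scale 2 (iv_mul prec C0 C0)) (Iv 72057594037927936 0))
     (iv_scale 2 (iv_mul prec S0 C0)) h t"

lemma approximates_arctan:
  assumes S: "approximates prec s S" and D: "approximates prec D' D"
    and ok: "arctan_check S D h t (iv_cos (Iv h 0)) (iv_sin (Iv h 0))"
  shows "approximates prec (arctan (s / D')) (Iv (2 * h) t)"
proof -
  define x where "x = real_of_int h / 2 ^ numeral prec"
  have ok': "iabs h \<le> 72057594037927936" "0 < iv_lower D" using ok by (auto simp: arctan_check_def arctan_ok_def simp del: iabs.simps)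
  have x: "\<bar>x\<bar> \<le> 1"
  proof -
    have "real_of_int \<bar>h\<bar> \<le> real_of_int 72057594037927936" using ok'(1) unfolding iabs_eq by (simp only: of_int_le_iff)
    thus ?thesis by (simp add: x_def)
  qed
  have H: "approximates prec x (Iv h 0)" unfolding x_def by (rule approximates_dyadic)
  note cs = approximates_cos_sin[OF H x]
  define C where "C = iv_sub (iv_scale 2 (iv_mul prec (iv_cos (Iv h 0)) (iv_cos (Iv h 0)))) (Iv 72057594037927936 0)"
  define Sn where "Sn = iv_scale 2 (iv_mul prec (iv_sin (Iv h 0)) (iv_cos (Iv h 0)))"
  have one: "approximates prec 1 (Iv 72057594037927936 0)" by (simp add: approximates_Iv)
  have "approximates prec (real_of_int 2 * (cos x * cos x) - 1) C" unfolding C_def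
    by (intro approximates_sub approximates_scale approximates_mul cs one)
  hence C: "approximates prec (cos (2 * x)) C" by (simp add: cos_double_cos power2_eq_square)
  have "approximates prec (real_of_int 2 * (sin x * cos x)) Sn" unfolding Sn_def
    by (intro approximates_scale approximates_mul cs)
  hence Sn: "approximates prec (sin (2 * x)) Sn" by (simp add: sin_double mult.assoc)
  have ok2: "9007199254740992 \<le> iv_lower (iv_add (iv_mul prec D C) (iv_mul prec S Sn))"
    "8 * iv_abs_upper (iv_sub (iv_mul prec S C) (iv_mul prec D Sn)) \<le> t"
    using ok unfolding arctan_check_def arctan_ok_def C_def Sn_def by blast+
  define P where "P = (2 ^ numeral prec :: real)"
  have P: "P = 72057594037927936" by (simp add: P_def)
  have D0: "D' > 0"
  proof -
    have "real_of_int 0 < real_of_int (iv_lower D)" using ok'(2) by (simp only: of_int_less_iff)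
    hence "D' * P > 0" using iv_bounds(1)[OF D] unfolding P_def by simp
    thus ?thesis by (simp add: P)
  qed
  define f where "f = D' * cos (2 * x) + s * sin (2 * x)"
  define e where "e = s * cos (2 * x) - D' * sin (2 * x)"
  have "approximates prec f (iv_add (iv_mul prec D C) (iv_mul prec S Sn))" unfolding f_def
    by (intro approximates_add approximates_mul C Sn D S)
  from iv_bounds(1)[OF this] have "f * P \<ge> real_of_int (iv_lower (iv_add (iv_mul prec D C) (iv_mul prec S Sn)))" by (simp only: P_def)
  moreover have "real_of_int (iv_lower (iv_add (iv_mul prec D C) (iv_mul prec S Sn))) \<ge> real_of_int 9007199254740992"
    using ok2(1) by (simp only: of_int_le_iff)
  ultimately have f: "f \<ge> 1 / 8" by (simp add: P)
  have "approximates prec e (iv_sub (iv_mul prec S C) (iv_mul prec D Sn))" unfolding e_def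
    by (intro approximates_sub approximates_mul C Sn D S)
  from iv_bounds(2)[OF this] have "\<bar>e * P\<bar> \<le> real_of_int (iv_abs_upper (iv_sub (iv_mul prec S C) (iv_mul prec D Sn)))" by (simp only: P_def)
  moreover have "real_of_int (8 * iv_abs_upper (iv_sub (iv_mul prec S C) (iv_mul prec D Sn))) \<le> real_of_int t"
    using ok2(2) by (simp only: of_int_le_iff)
  ultimately have e: "8 * \<bar>e\<bar> * P \<le> real_of_int t" by (simp add: P abs_mult)
  have "\<bar>arctan (s / D') - 2 * x\<bar> \<le> \<bar>e\<bar> / f" unfolding e_def f_def
    by (rule arctan_eq_add) (use D0 f x in \<open>auto simp: f_def\<close>)
  also have "\<dots> \<le> \<bar>e\<bar> / (1 / 8)" using f by (intro divide_left_mono) auto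
  finally have "\<bar>arctan (s / D') - 2 * x\<bar> * P \<le> 8 * \<bar>e\<bar> * P" by (simp add: P)
  hence "\<bar>(arctan (s / D') - 2 * x) * P\<bar> \<le> real_of_int t" using e by (simp add: abs_mult P)
  moreover have "2 * x * P = real_of_int (2 * h)" by (simp add: x_def P)
  ultimately show ?thesis unfolding approximates_Iv P_def[symmetric] by (simp add: left_diff_distrib)
qed

section \<open>Points with one block of symmetric rows\<close>

lemma sum_pairs_half:
  fixes f :: "nat \<Rightarrow> nat \<Rightarrow> real"
  assumes "\<And>i j. f i j = f j i"
  shows "(\<Sum>i<m. \<Sum>j<i. f i j) = ((\<Sum>i<m. \<Sum>j<m. f i j) - (\<Sum>i<m. f i i)) / 2"
  using sum_pairs_symmetric[of m f] assms by simp

text \<open>In the Hessian the squared term of two symmetric rows has this shape, with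
  \<open>Z\<close> the perturbation of the block and \<open>L\<close> depending on one row. On the
  right only the first sum sees individual off-diagonal entries; the rest uses row sums, column sums
  and the diagonal.\<close>

lemma sum_pairs_square_sum:
  fixes Z :: "nat \<Rightarrow> nat \<Rightarrow> real" and L :: "nat \<Rightarrow> real" and a :: real
  shows "(\<Sum>i<m. \<Sum>j<i. (a * (Z i j + Z j i) + L i + L j)\<^sup>2)
    = a\<^sup>2 * (\<Sum>i<m. \<Sum>j<i. (Z i j + Z j i)\<^sup>2)
      + 2 * a * (\<Sum>i<m. L i * ((\<Sum>j<m. Z i j) + (\<Sum>j<m. Z j i) - 2 * Z i i))
      + (real m - 2) * (\<Sum>i<m. (L i)\<^sup>2) + (\<Sum>i<m. L i)\<^sup>2"
proof -
  have 1: "(\<Sum>i<m. \<Sum>j<i. (Z i j + Z j i) * (L i + L j)) = (\<Sum>i<m. L i * ((\<Sum>j<m. Z i j) + (\<Sum>j<m. Z j i) - 2 * Z i i))"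
  proof -
    have "(\<Sum>i<m. \<Sum>j<m. (Z i j + Z j i) * (L i + L j))
       = (\<Sum>i<m. \<Sum>j<m. L i * (Z i j + Z j i)) + (\<Sum>i<m. \<Sum>j<m. L j * (Z i j + Z j i))"
      by (simp add: sum.distrib[symmetric] algebra_simps)
    also have "(\<Sum>i<m. \<Sum>j<m. L j * (Z i j + Z j i)) = (\<Sum>i<m. \<Sum>j<m. L i * (Z i j + Z j i))"
      by (subst sum.swap) (simp add: add.commute)
    finally have "(\<Sum>i<m. \<Sum>j<m. (Z i j + Z j i) * (L i + L j)) = 2 * (\<Sum>i<m. L i * ((\<Sum>j<m. Z i j) + (\<Sum>j<m. Z j i)))"
      by (simp add: sum_distrib_left[symmetric] sum.distrib)
    moreover have "(\<Sum>i<m. (Z i i + Z i i) * (L i + L i)) = 2 * (\<Sum>i<m. L i * (2 * Z i i))"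
      by (simp add: sum_distrib_left algebra_simps)
    moreover have "(\<Sum>i<m. \<Sum>j<i. (Z i j + Z j i) * (L i + L j))
       = ((\<Sum>i<m. \<Sum>j<m. (Z i j + Z j i) * (L i + L j)) - (\<Sum>i<m. (Z i i + Z i i) * (L i + L i))) / 2"
      by (rule sum_pairs_half) (simp add: algebra_simps)
    moreover have "(\<Sum>i<m. L i * ((\<Sum>j<m. Z i j) + (\<Sum>j<m. Z j i) - 2 * Z i i))
       = (\<Sum>i<m. L i * ((\<Sum>j<m. Z i j) + (\<Sum>j<m. Z j i))) - (\<Sum>i<m. L i * (2 * Z i i))"
      by (simp only: right_diff_distrib sum_subtractf)
    ultimately show ?thesis by argo
  qed
  have 2: "(\<Sum>i<m. \<Sum>j<i. (L i + L j)\<^sup>2) = (real m - 2) * (\<Sum>i<m. (L i)\<^sup>2) + (\<Sum>i<m. L i)\<^sup>2"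
  proof -
    have "(\<Sum>i<m. \<Sum>j<m. (L i + L j)\<^sup>2) = (\<Sum>i<m. \<Sum>j<m. (L i)\<^sup>2) + (\<Sum>i<m. \<Sum>j<m. (L j)\<^sup>2) + 2 * (\<Sum>i<m. \<Sum>j<m. L i * L j)"
      by (simp add: sum.distrib sum_distrib_left power2_sum algebra_simps)
    moreover have "(\<Sum>i<m. \<Sum>j<m. L i * L j) = (\<Sum>i<m. L i)\<^sup>2" by (simp add: sum_product power2_eq_square)
    ultimately have "(\<Sum>i<m. \<Sum>j<m. (L i + L j)\<^sup>2) = 2 * real m * (\<Sum>i<m. (L i)\<^sup>2) + 2 * (\<Sum>i<m. L i)\<^sup>2"
      by (simp add: sum_distrib_left[symmetric])
    moreover have "(\<Sum>i<m. (L i + L i)\<^sup>2) = 4 * (\<Sum>i<m. (L i)\<^sup>2)"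
      by (simp add: sum_distrib_left power2_eq_square algebra_simps)
    moreover have "(\<Sum>i<m. \<Sum>j<i. (L i + L j)\<^sup>2) = ((\<Sum>i<m. \<Sum>j<m. (L i + L j)\<^sup>2) - (\<Sum>i<m. (L i + L i)\<^sup>2)) / 2"
      by (rule sum_pairs_half) (simp add: add.commute)
    ultimately have "(\<Sum>i<m. \<Sum>j<i. (L i + L j)\<^sup>2) = (2 * real m * (\<Sum>i<m. (L i)\<^sup>2) + 2 * (\<Sum>i<m. L i)\<^sup>2 - 4 * (\<Sum>i<m. (L i)\<^sup>2)) / 2"
      by (simp only:)
    thus ?thesis by (simp only: left_diff_distrib) simp
  qed
  have "(\<Sum>i<m. \<Sum>j<i. (a * (Z i j + Z j i) + L i + L j)\<^sup>2)
     = (\<Sum>i<m. \<Sum>j<i. a\<^sup>2 * (Z i j + Z j i)\<^sup>2 + 2 * a * ((Z i j + Z j i) * (L i + L j)) + (L i + L j)\<^sup>2)"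
    by (intro sum.cong refl) (simp add: power2_eq_square algebra_simps)
  also have "\<dots> = a\<^sup>2 * (\<Sum>i<m. \<Sum>j<i. (Z i j + Z j i)\<^sup>2) + 2 * a * (\<Sum>i<m. \<Sum>j<i. (Z i j + Z j i) * (L i + L j))
     + (\<Sum>i<m. \<Sum>j<i. (L i + L j)\<^sup>2)"
    by (simp only: sum.distrib sum_distrib_left[symmetric])
  finally show ?thesis unfolding 1 2 by simp
qed

lemma sum_pairs_square_diff:
  fixes P :: "nat \<Rightarrow> real"
  shows "(\<Sum>i<m. \<Sum>j<i. (P i - P j)\<^sup>2) = real m * (\<Sum>i<m. (P i)\<^sup>2) - (\<Sum>i<m. P i)\<^sup>2"
proof -
  have "(\<Sum>i<m. \<Sum>j<m. (P i - P j)\<^sup>2) = (\<Sum>i<m. \<Sum>j<m. (P i)\<^sup>2) + (\<Sum>i<m. \<Sum>j<m. (P j)\<^sup>2) - 2 * (\<Sum>i<m. \<Sum>j<m. P i * P j)"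
    by (simp add: sum.distrib sum_subtractf sum_distrib_left power2_diff algebra_simps)
  moreover have "(\<Sum>i<m. \<Sum>j<m. P i * P j) = (\<Sum>i<m. P i)\<^sup>2" by (simp add: sum_product power2_eq_square)
  ultimately have "(\<Sum>i<m. \<Sum>j<m. (P i - P j)\<^sup>2) = 2 * real m * (\<Sum>i<m. (P i)\<^sup>2) - 2 * (\<Sum>i<m. P i)\<^sup>2"
    by (simp add: sum_distrib_left[symmetric])
  thus ?thesis by (subst sum_pairs_half) (simp_all add: power2_commute)
qed

lemma sum_pairs_dp:
  fixes d :: "nat \<Rightarrow> nat \<Rightarrow> real"
  shows "(\<Sum>i<m. \<Sum>j<i. dp k (d i) (d j)) = ((\<Sum>l<k. (\<Sum>i<m. d i l)\<^sup>2) - (\<Sum>i<m. dp k (d i) (d i))) / 2"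
proof -
  have "(\<Sum>i<m. \<Sum>j<m. dp k (d i) (d j)) = (\<Sum>l<k. (\<Sum>i<m. d i l)\<^sup>2)"
  proof -
    have "(\<Sum>i<m. \<Sum>j<m. dp k (d i) (d j)) = (\<Sum>i<m. \<Sum>l<k. \<Sum>j<m. d i l * d j l)"
      unfolding dp_def by (rule sum.cong[OF refl]) (rule sum.swap)
    also have "\<dots> = (\<Sum>l<k. \<Sum>i<m. \<Sum>j<m. d i l * d j l)" by (rule sum.swap)
    finally show ?thesis by (simp add: power2_eq_square sum_product)
  qed
  thus ?thesis by (subst sum_pairs_half) (simp_all add: dp_commute)
qed

text \<open>A least-squares minimum: among off-diagonal symmetric parts with prescribed row sums
  \<open>g i\<close>, the sum of squares is least when the entries have the form mu i + mu
  j.\<close>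

lemma sum_symmetric_square_lower:
  fixes Z :: "nat \<Rightarrow> nat \<Rightarrow> real" and m :: nat
  defines "g \<equiv> \<lambda>i. (\<Sum>j<m. Z i j) + (\<Sum>j<m. Z j i) - 2 * Z i i"
  assumes m: "m > 2"
  shows "(\<Sum>i<m. \<Sum>j<i. (Z i j + Z j i)\<^sup>2)
     \<ge> (\<Sum>i<m. (g i)\<^sup>2) / (real m - 2) - (\<Sum>i<m. g i)\<^sup>2 / (2 * (real m - 1) * (real m - 2))"
proof -
  define G where "G = (\<Sum>i<m. g i)"
  \<comment> \<open>The solution of (m - 2) mu i + (sum of all mu) = g i, the condition that the
    off-diagonal entries mu i + mu j have row sums \<open>g i\<close>; summing over i gives the sum
    of all mu.\<close>
  define \<mu> where "\<mu> = (\<lambda>i. (g i - G / (2 * (real m - 1))) / (real m - 2))"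
  have mm: "real m - 2 > 0" "real m - 1 > 0" using m by auto
  have S: "(\<Sum>i<m. \<mu> i) = G / (2 * (real m - 1))"
  proof -
    have "(\<Sum>i<m. \<mu> i) = (G - real m * (G / (2 * (real m - 1)))) / (real m - 2)"
      by (simp add: \<mu>_def sum_divide_distrib[symmetric] sum_subtractf G_def)
    also have "G - real m * (G / (2 * (real m - 1))) = G / (2 * (real m - 1)) * (real m - 2)"
      using mm by (simp add: field_simps)
    finally show ?thesis using mm by simp
  qed
  have "0 \<le> (\<Sum>i<m. \<Sum>j<i. (1 * (Z i j + Z j i) + (- \<mu> i) + (- \<mu> j))\<^sup>2)"
    by (intro sum_nonneg) simp
  also have "\<dots> = (\<Sum>i<m. \<Sum>j<i. (Z i j + Z j i)\<^sup>2) - 2 * (\<Sum>i<m. \<mu> i * g i)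
      + (real m - 2) * (\<Sum>i<m. (\<mu> i)\<^sup>2) + (\<Sum>i<m. \<mu> i)\<^sup>2"
    unfolding sum_pairs_square_sum by (simp add: g_def sum_negf sum_distrib_left)
  also have "(real m - 2) * (\<Sum>i<m. (\<mu> i)\<^sup>2) = (\<Sum>i<m. \<mu> i * g i) - (\<Sum>i<m. \<mu> i)\<^sup>2"
  proof -
    have "(real m - 2) * (\<mu> i)\<^sup>2 = \<mu> i * g i - \<mu> i * (G / (2 * (real m - 1)))" for i
    proof -
      have "(real m - 2) * \<mu> i = g i - G / (2 * (real m - 1))" using mm by (simp add: \<mu>_def)
      thus ?thesis by (metis mult.assoc mult.commute power2_eq_square right_diff_distrib)
    qed
    hence "(real m - 2) * (\<Sum>i<m. (\<mu> i)\<^sup>2) = (\<Sum>i<m. \<mu> i * g i) - (\<Sum>i<m. \<mu> i) * (G / (2 * (real m - 1)))"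
      by (simp only: sum_distrib_left sum_subtractf sum_distrib_right)
    thus ?thesis by (simp only: S power2_eq_square)
  qed
  finally have "(\<Sum>i<m. \<Sum>j<i. (Z i j + Z j i)\<^sup>2) \<ge> (\<Sum>i<m. \<mu> i * g i)" by simp
  also have "(\<Sum>i<m. \<mu> i * g i) = ((\<Sum>i<m. (g i)\<^sup>2) - (\<Sum>i<m. G / (2 * (real m - 1)) * g i)) / (real m - 2)"
    unfolding sum_subtractf[symmetric] sum_divide_distrib
    by (intro sum.cong refl) (simp add: \<mu>_def power2_eq_square left_diff_distrib diff_divide_distrib)
  also have "(\<Sum>i<m. G / (2 * (real m - 1)) * g i) = G\<^sup>2 / (2 * (real m - 1))"
    unfolding sum_distrib_left[symmetric] by (simp add: G_def power2_eq_square)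
  finally show ?thesis by (simp add: G_def diff_divide_distrib)
qed

lemma square_diff_scaled: "(k - h / M)\<^sup>2 = k\<^sup>2 - 2 / M * (k * h) + (1 / M)\<^sup>2 * h\<^sup>2" for k h M :: real
  by (simp add: power2_diff power_divide)

text \<open>The analogous minimum for antisymmetric parts, attained at the entries (h i - h j) / m,
  which have row sums \<open>h i\<close> because the \<open>h i\<close> add up to zero.\<close>

lemma sum_antisymmetric_square_lower:
  fixes Z :: "nat \<Rightarrow> nat \<Rightarrow> real"
  assumes m: "m > 0"
  shows "(\<Sum>i<m. \<Sum>j<i. (Z i j - Z j i)\<^sup>2) \<ge> (\<Sum>i<m. ((\<Sum>j<m. Z i j) - (\<Sum>j<m. Z j i))\<^sup>2) / real m"
proof -
  define h where "h = (\<lambda>i. (\<Sum>j<m. Z i j) - (\<Sum>j<m. Z j i))"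
  have h0: "(\<Sum>i<m. h i) = 0"
    unfolding h_def sum_subtractf by (subst (2) sum.swap) simp
  have c: "(\<Sum>i<m. \<Sum>j<i. (Z i j - Z j i) * (h i - h j)) = (\<Sum>i<m. (h i)\<^sup>2)"
  proof -
    have "(\<Sum>i<m. \<Sum>j<m. (Z i j - Z j i) * (h i - h j))
       = (\<Sum>i<m. \<Sum>j<m. h i * (Z i j - Z j i)) + (\<Sum>i<m. \<Sum>j<m. h j * (Z j i - Z i j))"
      by (simp add: sum.distrib[symmetric] algebra_simps)
    also have "(\<Sum>i<m. \<Sum>j<m. h j * (Z j i - Z i j)) = (\<Sum>i<m. \<Sum>j<m. h i * (Z i j - Z j i))"
      by (rule sum.swap)
    also have "(\<Sum>i<m. \<Sum>j<m. h i * (Z i j - Z j i)) = (\<Sum>i<m. (h i)\<^sup>2)"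
      by (simp add: sum_distrib_left[symmetric] sum_subtractf power2_eq_square h_def)
    finally show ?thesis by (subst sum_pairs_half) (simp_all add: algebra_simps)
  qed
  have "0 \<le> (\<Sum>i<m. \<Sum>j<i. ((Z i j - Z j i) - (h i - h j) / real m)\<^sup>2)" by (intro sum_nonneg) simp
  also have "\<dots> = (\<Sum>i<m. \<Sum>j<i. (Z i j - Z j i)\<^sup>2 - 2 / real m * ((Z i j - Z j i) * (h i - h j)) + (1 / real m)\<^sup>2 * (h i - h j)\<^sup>2)"
    by (intro sum.cong refl square_diff_scaled)
  also have "\<dots> = (\<Sum>i<m. \<Sum>j<i. (Z i j - Z j i)\<^sup>2) - 2 / real m * (\<Sum>i<m. (h i)\<^sup>2)
     + (1 / real m)\<^sup>2 * (real m * (\<Sum>i<m. (h i)\<^sup>2) - 0\<^sup>2)"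
    by (simp only: sum.distrib sum_subtractf sum_distrib_left[symmetric] c sum_pairs_square_diff h0)
  also have "(1 / real m)\<^sup>2 * (real m * (\<Sum>i<m. (h i)\<^sup>2) - 0\<^sup>2) = (\<Sum>i<m. (h i)\<^sup>2) / real m"
    using m by (simp add: power2_eq_square)
  finally show ?thesis unfolding h_def by simp
qed

lemma sum_off_diagonal_squares:
  fixes Z :: "nat \<Rightarrow> nat \<Rightarrow> real"
  shows "(\<Sum>i<m. \<Sum>j<m. (Z i j)\<^sup>2) - (\<Sum>i<m. (Z i i)\<^sup>2)
    = ((\<Sum>i<m. \<Sum>j<i. (Z i j + Z j i)\<^sup>2) + (\<Sum>i<m. \<Sum>j<i. (Z i j - Z j i)\<^sup>2)) / 2"
proof -
  have "(\<Sum>i<m. \<Sum>j<i. (Z i j + Z j i)\<^sup>2) + (\<Sum>i<m. \<Sum>j<i. (Z i j - Z j i)\<^sup>2)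
     = 2 * (\<Sum>i<m. \<Sum>j<i. (Z i j)\<^sup>2 + (Z j i)\<^sup>2)"
    by (simp add: sum.distrib[symmetric] sum_distrib_left power2_eq_square algebra_simps)
  also have "(\<Sum>i<m. \<Sum>j<i. (Z i j)\<^sup>2 + (Z j i)\<^sup>2)
     = ((\<Sum>i<m. \<Sum>j<m. (Z i j)\<^sup>2 + (Z j i)\<^sup>2) - (\<Sum>i<m. (Z i i)\<^sup>2 + (Z i i)\<^sup>2)) / 2"
    by (rule sum_pairs_half) simp
  also have "(\<Sum>i<m. \<Sum>j<m. (Z i j)\<^sup>2 + (Z j i)\<^sup>2) = 2 * (\<Sum>i<m. \<Sum>j<m. (Z i j)\<^sup>2)"
  proof -
    have "(\<Sum>i<m. \<Sum>j<m. (Z j i)\<^sup>2) = (\<Sum>i<m. \<Sum>j<m. (Z i j)\<^sup>2)" by (rule sum.swap)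
    thus ?thesis by (simp add: sum.distrib)
  qed
  finally show ?thesis by (simp add: sum_distrib_left[symmetric])
qed

text \<open>The first m rows are preserved by permuting them together with the first m targets.
  Target \<open>m\<close> is the exceptional one, so there are m + 1 targets; row \<open>m\<close>
  and, if present, row \<open>m + 1\<close> are the extra rows, constant on the first m
  targets.\<close>

definition sym_point :: "nat \<Rightarrow> real \<Rightarrow> real \<Rightarrow> real \<Rightarrow> real \<Rightarrow> real \<Rightarrow> real \<Rightarrow> real \<Rightarrow> nat \<Rightarrow> nat \<Rightarrow> real" where
  "sym_point m a b c d0 g0 d1 g1 i j = (if i < m then (if j = m then c else if j = i then a else b)
     else if i = m then (if j = m then g0 else d0) else (if j = m then g1 else d1))"

text \<open>The area of the parallelogram spanned by two vectors; \<open>obtuse\<close> is pi minus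
  the angle between them.\<close>

definition area :: "real \<Rightarrow> real \<Rightarrow> real \<Rightarrow> real" where "area p q s = sqrt (p * q - s\<^sup>2)"
definition obtuse :: "real \<Rightarrow> real \<Rightarrow> real \<Rightarrow> real" where "obtuse p q s = pi / 2 + arctan (s / area p q s)"

lemma pair_hessian_eq: "pair_hessian p q s A B C P Q S =
   area p q s * inverse p * A + area p q s * inverse q * B + 2 * obtuse p q s * C
   + inverse (area p q s) * (S - s * (inverse p * P + inverse q * Q))\<^sup>2 - area p q s * (inverse p * P - inverse q * Q)\<^sup>2"
  unfolding pair_hessian_def Let_def obtuse_def area_def divide_inverse_commute by (simp only: ac_simps)

lemma pair_gradient_eq: "pair_gradient p q s P Q S = area p q s * (inverse p * P + inverse q * Q) + obtuse p q s * S"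
  unfolding pair_gradient_def Let_def obtuse_def area_def divide_inverse_commute by (simp only: ac_simps)

lemma Phi_eq: "Phi p q s = area p q s + s * obtuse p q s"
  unfolding Phi_def obtuse_def area_def ..

lemma sum_pick: "i < m \<Longrightarrow> (\<Sum>j<m. (if j = i then a else b) * f j) = (a - b) * f i + b * (\<Sum>j<m. f j)" for a b :: real and f :: "nat \<Rightarrow> real"
proof -
  assume i: "i < m"
  have "(\<Sum>j<m. (if j = i then a else b) * f j) = (\<Sum>j<m. b * f j + (if j = i then (a - b) * f j else 0))"
    by (intro sum.cong) (auto simp: algebra_simps)
  also have "\<dots> = b * (\<Sum>j<m. f j) + (a - b) * f i" using i by (simp add: sum.distrib sum_distrib_left)
  finally show ?thesis by simp
qed

lemma sum_pick_fun: "i < m \<Longrightarrow> (\<Sum>j<m. if j = i then f j else g j) = f i - g i + (\<Sum>j<m. g j)" for f g :: "nat \<Rightarrow> real"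
proof -
  assume i: "i < m"
  have "(\<Sum>j<m. if j = i then f j else g j) = (\<Sum>j<m. g j + (if j = i then f j - g j else 0))"
    by (intro sum.cong) auto
  also have "\<dots> = (\<Sum>j<m. g j) + (f i - g i)" using i by (simp add: sum.distrib)
  finally show ?thesis by simp
qed

lemma square_shift_sum:
  fixes l :: "nat \<Rightarrow> real" and K :: real
  shows "(\<Sum>j<m. (l j + K)\<^sup>2) = (\<Sum>j<m. (l j)\<^sup>2) + 2 * K * (\<Sum>j<m. l j) + real m * K\<^sup>2"
  by (simp add: power2_sum sum.distrib sum_distrib_left algebra_simps)

lemma square_shift_sum':
  fixes l :: "nat \<Rightarrow> real" and K q :: real
  shows "(\<Sum>j<m. (K - q * l j)\<^sup>2) = real m * K\<^sup>2 - 2 * K * q * (\<Sum>j<m. l j) + q\<^sup>2 * (\<Sum>j<m. (l j)\<^sup>2)"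
  by (simp add: power2_diff power_mult_distrib sum.distrib sum_subtractf sum_distrib_left algebra_simps)

lemma hess_we_arith:
  fixes D1 D0 D2 ip I1 I0 I2 A x y P r a b c m Z :: real
  shows "(D1 * ip * A + I1 * (x - a * ip * P)\<^sup>2 - D1 * ip\<^sup>2 * P\<^sup>2) - (D0 * ip * A + I0 * (x - b * ip * P)\<^sup>2 - D0 * ip\<^sup>2 * P\<^sup>2)
     + (m * (D0 * ip * A) + I0 * (Z - 2 * b * ip * P * r + m * (b * ip)\<^sup>2 * P\<^sup>2) - m * (D0 * ip\<^sup>2 * P\<^sup>2))
     + (D2 * ip * A + I2 * (y - c * ip * P)\<^sup>2 - D2 * ip\<^sup>2 * P\<^sup>2)
   = (D1 + (m - 1) * D0 + D2) * ip * A + I1 * (x - a * ip * P)\<^sup>2 + I2 * (y - c * ip * P)\<^sup>2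
     + I0 * (Z - x\<^sup>2 - 2 * b * ip * (P * (r - x)) + (m - 1) * (b * ip)\<^sup>2 * P\<^sup>2)
     - (D1 + (m - 1) * D0 + D2) * ip\<^sup>2 * P\<^sup>2"
  by (simp add: power2_eq_square algebra_simps)

text \<open>A symmetric point together with an arbitrary direction \<open>d\<close>. The
  abbreviations \<open>p\<close>, \<open>p0\<close>, \<open>p1\<close> are squared norms and
  \<open>s\<close>, \<open>s0\<close>, \<open>s1\<close>, \<open>s01\<close> inner products of rows,
  arranged as the interval computation evaluates them. The least-squares bounds divide by m - 2,
  hence \<open>m > 2\<close>.\<close>

locale symmetric_perturbation =
  fixes m :: nat and a b c d0 g0 d1 g1 :: real and d :: "nat \<Rightarrow> nat \<Rightarrow> real"
  assumes m: "m > 2"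
begin

abbreviation "C \<equiv> sym_point m a b c d0 g0 d1 g1"
abbreviation "k \<equiv> Suc m"
abbreviation "p \<equiv> (a - b) * a + b * (a - b + real m * b) + c * c"
abbreviation "p0 \<equiv> d0 * (real m * d0) + g0 * g0"
abbreviation "p1 \<equiv> d1 * (real m * d1) + g1 * g1"
abbreviation "s \<equiv> (a - b) * b + b * (a - b + real m * b) + c * c"
abbreviation "s0 \<equiv> d0 * (a - b + real m * b) + g0 * c"
abbreviation "s1 \<equiv> d1 * (a - b + real m * b) + g1 * c"
abbreviation "s01 \<equiv> d1 * (real m * d0) + g1 * g0"

lemma dp_row: "i < m \<Longrightarrow> dp k (C i) y = (a - b) * y i + b * (\<Sum>j<m. y j) + c * y m"
  using sum_pick[of i m a b y] by (simp add: dp_def sym_point_def)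

lemma dp_row0: "dp k (C m) y = d0 * (\<Sum>j<m. y j) + g0 * y m"
  by (simp add: dp_def sym_point_def sum_distrib_left)

lemma dp_row1: "dp k (C (Suc m)) y = d1 * (\<Sum>j<m. y j) + g1 * y m"
  by (simp add: dp_def sym_point_def sum_distrib_left)

lemma sum_row: "i < m \<Longrightarrow> (\<Sum>j<m. C i j) = a - b + real m * b"
  using sum_pick[of i m a b "\<lambda>_. 1"] by (simp add: sym_point_def)

lemma sum_row0: "(\<Sum>j<m. C m j) = real m * d0" by (simp add: sym_point_def)

lemma gram_rows:
  "i < m \<Longrightarrow> dp k (C i) (C i) = p"
  "dp k (C m) (C m) = p0"
  "dp k (C (Suc m)) (C (Suc m)) = p1"
  "i < m \<Longrightarrow> j < m \<Longrightarrow> i \<noteq> j \<Longrightarrow> dp k (C i) (C j) = s"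
  "j < m \<Longrightarrow> dp k (C m) (C j) = s0"
  "j < m \<Longrightarrow> dp k (C (Suc m)) (C j) = s1"
  "dp k (C (Suc m)) (C m) = s01"
proof -
  show "i < m \<Longrightarrow> dp k (C i) (C i) = p" by (subst dp_row) (simp_all add: sum_row, simp add: sym_point_def)
  show "dp k (C m) (C m) = p0" by (subst dp_row0) (simp add: sum_row0, simp add: sym_point_def)
  show "dp k (C (Suc m)) (C (Suc m)) = p1" by (subst dp_row1) (simp add: sym_point_def)
  show "i < m \<Longrightarrow> j < m \<Longrightarrow> i \<noteq> j \<Longrightarrow> dp k (C i) (C j) = s" by (subst dp_row) (simp_all add: sum_row, simp add: sym_point_def)
  show "j < m \<Longrightarrow> dp k (C m) (C j) = s0" by (subst dp_row0) (simp add: sum_row, simp add: sym_point_def)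
  show "j < m \<Longrightarrow> dp k (C (Suc m)) (C j) = s1" by (subst dp_row1) (simp add: sum_row, simp add: sym_point_def)
  show "dp k (C (Suc m)) (C m) = s01" by (subst dp_row1) (simp add: sum_row0, simp add: sym_point_def)
qed

definition "rw i = (\<Sum>j<m. d i j)"
definition "cl j = (\<Sum>i<m. d i j)"
definition "P i = (a - b) * d i i + b * rw i + c * d i m"
definition "PR R dd gg = dd * rw R + gg * d R m"
definition "SA = (\<Sum>i<m. dp k (d i) (d i))"
text \<open>For symmetric rows i and j the square in the pair Hessian has base
  \<open>(a - b) * (d i j + d j i) + L i + L j\<close>. For an extra row \<open>R\<close> and
  symmetric row \<open>i\<close> it has base \<open>lR R dd gg i + KR R dd gg\<close>, where only
  the first summand depends on \<open>i\<close>.\<close>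

definition "L i = b * rw i + c * d i m - s * inverse p * P i"
abbreviation "pr dd gg \<equiv> dd * (real m * dd) + gg * gg"
abbreviation "sr dd gg \<equiv> dd * (a - b + real m * b) + gg * c"
definition "lR R dd gg i = dd * rw i + gg * d i m + (a - b) * d R i - sr dd gg * inverse p * P i"
definition "KR R dd gg = b * rw R + c * d R m - sr dd gg * inverse (pr dd gg) * PR R dd gg"

lemma dpP: "i < m \<Longrightarrow> dp k (C i) (d i) = P i" "dp k (C m) (d m) = PR m d0 g0" "dp k (C (Suc m)) (d (Suc m)) = PR (Suc m) d1 g1"
  by (simp_all add: dp_row dp_row0 dp_row1 P_def PR_def rw_def)

text \<open>In these names w is a symmetric row, r an extra row and e a target. After summation over
  a type of pair, single off-diagonal entries survive only in sums of squares; all else is linear in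
  row data, row sums and column sums.\<close>

lemma hess_ww:
  "(\<Sum>i<m. \<Sum>j<i. pair_hessian (dp k (C i) (C i)) (dp k (C j) (C j)) (dp k (C i) (C j))
        (dp k (d i) (d i)) (dp k (d j) (d j)) (dp k (d i) (d j))
        (dp k (C i) (d i)) (dp k (C j) (d j)) (dp k (C i) (d j) + dp k (C j) (d i)))
   = (real m - 1) * (area p p s * inverse p) * SA + obtuse p p s * ((\<Sum>l<m. (cl l)\<^sup>2) + (\<Sum>i<m. d i m)\<^sup>2 - SA)
     + inverse (area p p s) * ((a - b)\<^sup>2 * (\<Sum>i<m. \<Sum>j<i. (d i j + d j i)\<^sup>2)
        + 2 * (a - b) * (\<Sum>i<m. L i * (rw i + cl i - 2 * d i i)) + (real m - 2) * (\<Sum>i<m. (L i)\<^sup>2) + (\<Sum>i<m. L i)\<^sup>2)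
     - area p p s * (inverse p)\<^sup>2 * (real m * (\<Sum>i<m. (P i)\<^sup>2) - (\<Sum>i<m. P i)\<^sup>2)"
proof -
  have t: "pair_hessian (dp k (C i) (C i)) (dp k (C j) (C j)) (dp k (C i) (C j))
        (dp k (d i) (d i)) (dp k (d j) (d j)) (dp k (d i) (d j))
        (dp k (C i) (d i)) (dp k (C j) (d j)) (dp k (C i) (d j) + dp k (C j) (d i))
     = area p p s * inverse p * (dp k (d i) (d i) + dp k (d j) (d j)) + 2 * obtuse p p s * dp k (d i) (d j)
       + inverse (area p p s) * ((a - b) * (d i j + d j i) + L i + L j)\<^sup>2
       - area p p s * (inverse p)\<^sup>2 * (P i - P j)\<^sup>2" if ij: "i < m" "j < i" for i j
  proof -
    have jm: "j < m" "i \<noteq> j" using ij by auto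
    have S: "dp k (C i) (d j) + dp k (C j) (d i) - s * (inverse p * P i + inverse p * P j)
       = (a - b) * (d i j + d j i) + L i + L j"
      unfolding L_def by (simp only: dp_row[OF ij(1)] dp_row[OF jm(1)] rw_def[symmetric]) (simp only: algebra_simps)
    have Q: "area p p s * (inverse p * P i - inverse p * P j)\<^sup>2 = area p p s * (inverse p)\<^sup>2 * (P i - P j)\<^sup>2"
      by (simp only: right_diff_distrib[symmetric] power_mult_distrib mult.assoc)
    show ?thesis
      unfolding gram_rows(1)[OF ij(1)] gram_rows(1)[OF jm(1)] gram_rows(4)[OF ij(1) jm] dpP(1)[OF ij(1)] dpP(1)[OF jm(1)]
        pair_hessian_eq S Q by (simp only: distrib_left)
  qed
  have "(\<Sum>i<m. \<Sum>j<i. pair_hessian (dp k (C i) (C i)) (dp k (C j) (C j)) (dp k (C i) (C j))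
        (dp k (d i) (d i)) (dp k (d j) (d j)) (dp k (d i) (d j))
        (dp k (C i) (d i)) (dp k (C j) (d j)) (dp k (C i) (d j) + dp k (C j) (d i)))
    = (\<Sum>i<m. \<Sum>j<i. area p p s * inverse p * (dp k (d i) (d i) + dp k (d j) (d j)) + 2 * obtuse p p s * dp k (d i) (d j)
       + inverse (area p p s) * ((a - b) * (d i j + d j i) + L i + L j)\<^sup>2
       - area p p s * (inverse p)\<^sup>2 * (P i - P j)\<^sup>2)"
    by (intro sum.cong refl) (use t in auto)
  also have "\<dots> = area p p s * inverse p * (\<Sum>i<m. \<Sum>j<i. dp k (d i) (d i) + dp k (d j) (d j))
     + 2 * obtuse p p s * (\<Sum>i<m. \<Sum>j<i. dp k (d i) (d j))
     + inverse (area p p s) * (\<Sum>i<m. \<Sum>j<i. ((a - b) * (d i j + d j i) + L i + L j)\<^sup>2)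
     - area p p s * (inverse p)\<^sup>2 * (\<Sum>i<m. \<Sum>j<i. (P i - P j)\<^sup>2)"
    by (simp only: sum.distrib sum_subtractf sum_distrib_left[symmetric])
  also have "(\<Sum>i<m. \<Sum>j<i. dp k (d i) (d i) + dp k (d j) (d j)) = (real m - 1) * SA"
    unfolding SA_def by (rule sum_pairs_add)
  also have "(\<Sum>i<m. \<Sum>j<i. dp k (d i) (d j)) = ((\<Sum>l<m. (cl l)\<^sup>2) + (\<Sum>i<m. d i m)\<^sup>2 - SA) / 2"
    unfolding sum_pairs_dp SA_def cl_def by simp
  finally show ?thesis
    unfolding sum_pairs_square_sum sum_pairs_square_diff rw_def[symmetric] cl_def[symmetric] by (simp add: ac_simps)
qed

text \<open>The target with the index of the row has inner product \<open>a\<close>, the other ones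
  below m have \<open>b\<close>: sum as if all had \<open>b\<close> and correct one term.\<close>

lemma hess_we:
  "(\<Sum>i<m. \<Sum>j<k. pair_hessian (dp k (C i) (C i)) 1 (C i j) (dp k (d i) (d i)) 0 0 (dp k (C i) (d i)) 0 (d i j))
   = (area p 1 a + (real m - 1) * area p 1 b + area p 1 c) * inverse p * SA
     + inverse (area p 1 a) * (\<Sum>i<m. (d i i - a * inverse p * P i)\<^sup>2)
     + inverse (area p 1 c) * (\<Sum>i<m. (d i m - c * inverse p * P i)\<^sup>2)
     + inverse (area p 1 b) * ((\<Sum>i<m. \<Sum>j<m. (d i j)\<^sup>2) - (\<Sum>i<m. (d i i)\<^sup>2)
        - 2 * b * inverse p * (\<Sum>i<m. P i * (rw i - d i i)) + (real m - 1) * (b * inverse p)\<^sup>2 * (\<Sum>i<m. (P i)\<^sup>2))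
     - (area p 1 a + (real m - 1) * area p 1 b + area p 1 c) * (inverse p)\<^sup>2 * (\<Sum>i<m. (P i)\<^sup>2)"
proof -
  define f where "f = (\<lambda>D w A P x. D * inverse p * A + inverse D * (x - w * inverse p * P)\<^sup>2 - D * (inverse p)\<^sup>2 * P\<^sup>2)"
  have f: "pair_hessian p 1 w A 0 0 P 0 x = f (area p 1 w) w A P x" for w A P x
    unfolding pair_hessian_eq f_def by (simp add: power_mult_distrib mult.assoc)
  have r: "(\<Sum>j<k. pair_hessian (dp k (C i) (C i)) 1 (C i j) (dp k (d i) (d i)) 0 0 (dp k (C i) (d i)) 0 (d i j))
     = f (area p 1 a) a (dp k (d i) (d i)) (P i) (d i i) - f (area p 1 b) b (dp k (d i) (d i)) (P i) (d i i)
       + (\<Sum>j<m. f (area p 1 b) b (dp k (d i) (d i)) (P i) (d i j)) + f (area p 1 c) c (dp k (d i) (d i)) (P i) (d i m)"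
    if i: "i < m" for i
  proof -
    have "(\<Sum>j<m. f (area p 1 (C i j)) (C i j) (dp k (d i) (d i)) (P i) (d i j))
       = (\<Sum>j<m. if j = i then f (area p 1 a) a (dp k (d i) (d i)) (P i) (d i j) else f (area p 1 b) b (dp k (d i) (d i)) (P i) (d i j))"
      using i by (intro sum.cong) (auto simp: sym_point_def)
    also have "\<dots> = f (area p 1 a) a (dp k (d i) (d i)) (P i) (d i i) - f (area p 1 b) b (dp k (d i) (d i)) (P i) (d i i)
       + (\<Sum>j<m. f (area p 1 b) b (dp k (d i) (d i)) (P i) (d i j))" by (rule sum_pick_fun[OF i])
    moreover have "C i m = c" using i by (simp add: sym_point_def)
    ultimately show ?thesis unfolding gram_rows(1)[OF i] dpP(1)[OF i] f by simp
  qed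
  have r': "(\<Sum>j<m. f D w A P x) = real m * (f D w A P x)" for D w A P x by simp
  have s: "(\<Sum>j<m. f D w A Pi (d i j)) = real m * (D * inverse p * A) + inverse D * ((\<Sum>j<m. (d i j)\<^sup>2) - 2 * w * inverse p * Pi * rw i + real m * (w * inverse p)\<^sup>2 * Pi\<^sup>2)
     - real m * (D * (inverse p)\<^sup>2 * Pi\<^sup>2)" for D w A Pi i
  proof -
    have "(\<Sum>j<m. (d i j - w * inverse p * Pi)\<^sup>2) = (\<Sum>j<m. (d i j)\<^sup>2) - 2 * w * inverse p * Pi * rw i + real m * (w * inverse p)\<^sup>2 * Pi\<^sup>2"
      unfolding rw_def using square_shift_sum[of "d i" "- (w * inverse p * Pi)" m] by (simp add: power_mult_distrib algebra_simps)
    thus ?thesis unfolding f_def sum.distrib sum_subtractf sum_distrib_left[symmetric] by simp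
  qed
  have t: "(\<Sum>j<k. pair_hessian (dp k (C i) (C i)) 1 (C i j) (dp k (d i) (d i)) 0 0 (dp k (C i) (d i)) 0 (d i j))
     = (area p 1 a + (real m - 1) * area p 1 b + area p 1 c) * inverse p * dp k (d i) (d i)
     + inverse (area p 1 a) * (d i i - a * inverse p * P i)\<^sup>2
     + inverse (area p 1 c) * (d i m - c * inverse p * P i)\<^sup>2
     + inverse (area p 1 b) * ((\<Sum>j<m. (d i j)\<^sup>2) - (d i i)\<^sup>2
        - 2 * b * inverse p * (P i * (rw i - d i i)) + (real m - 1) * (b * inverse p)\<^sup>2 * (P i)\<^sup>2)
     - (area p 1 a + (real m - 1) * area p 1 b + area p 1 c) * (inverse p)\<^sup>2 * (P i)\<^sup>2" if i: "i < m" for i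
    unfolding r[OF i] s unfolding f_def
    by (rule hess_we_arith)
  have "(\<Sum>i<m. \<Sum>j<k. pair_hessian (dp k (C i) (C i)) 1 (C i j) (dp k (d i) (d i)) 0 0 (dp k (C i) (d i)) 0 (d i j))
     = (\<Sum>i<m. (area p 1 a + (real m - 1) * area p 1 b + area p 1 c) * inverse p * dp k (d i) (d i)
     + inverse (area p 1 a) * (d i i - a * inverse p * P i)\<^sup>2
     + inverse (area p 1 c) * (d i m - c * inverse p * P i)\<^sup>2
     + inverse (area p 1 b) * ((\<Sum>j<m. (d i j)\<^sup>2) - (d i i)\<^sup>2
        - 2 * b * inverse p * (P i * (rw i - d i i)) + (real m - 1) * (b * inverse p)\<^sup>2 * (P i)\<^sup>2)
     - (area p 1 a + (real m - 1) * area p 1 b + area p 1 c) * (inverse p)\<^sup>2 * (P i)\<^sup>2)"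
    by (intro sum.cong refl t) simp
  thus ?thesis
    by (simp only: sum.distrib sum_subtractf sum_distrib_left[symmetric] SA_def)
qed

text \<open>\<open>R\<close> is either extra row, with entries \<open>dd\<close> and
  \<open>gg\<close>, so that one computation serves both.\<close>

lemma hess_wr:
  assumes R: "\<And>j. j < m \<Longrightarrow> C R j = dd" "C R m = gg"
  shows "(\<Sum>j<m. pair_hessian (dp k (C R) (C R)) (dp k (C j) (C j)) (dp k (C R) (C j))
        (dp k (d R) (d R)) (dp k (d j) (d j)) (dp k (d R) (d j))
        (dp k (C R) (d R)) (dp k (C j) (d j)) (dp k (C R) (d j) + dp k (C j) (d R)))
   = real m * (area (pr dd gg) p (sr dd gg) * inverse (pr dd gg)) * dp k (d R) (d R)
     + area (pr dd gg) p (sr dd gg) * inverse p * SA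
     + 2 * obtuse (pr dd gg) p (sr dd gg) * ((\<Sum>l<m. cl l * d R l) + (\<Sum>i<m. d i m) * d R m)
     + inverse (area (pr dd gg) p (sr dd gg)) * ((\<Sum>i<m. (lR R dd gg i)\<^sup>2) + 2 * KR R dd gg * (\<Sum>i<m. lR R dd gg i) + real m * (KR R dd gg)\<^sup>2)
     - area (pr dd gg) p (sr dd gg) * (real m * (inverse (pr dd gg) * PR R dd gg)\<^sup>2
        - 2 * (inverse (pr dd gg) * PR R dd gg) * inverse p * (\<Sum>i<m. P i) + (inverse p)\<^sup>2 * (\<Sum>i<m. (P i)\<^sup>2))"
proof -
  have dpR: "dp k (C R) y = dd * (\<Sum>j<m. y j) + gg * y m" for y
    by (simp add: dp_def R sum_distrib_left)
  have pR: "dp k (C R) (C R) = pr dd gg" by (simp add: dpR R)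
  have sR: "dp k (C R) (C j) = sr dd gg" if "j < m" for j
  proof -
    have "C j m = c" using that by (simp add: sym_point_def)
    thus ?thesis unfolding dpR sum_row[OF that] by simp
  qed
  have PRR: "dp k (C R) (d R) = PR R dd gg" by (simp add: dpR PR_def rw_def)
  have t: "pair_hessian (dp k (C R) (C R)) (dp k (C j) (C j)) (dp k (C R) (C j))
        (dp k (d R) (d R)) (dp k (d j) (d j)) (dp k (d R) (d j))
        (dp k (C R) (d R)) (dp k (C j) (d j)) (dp k (C R) (d j) + dp k (C j) (d R))
     = area (pr dd gg) p (sr dd gg) * inverse (pr dd gg) * dp k (d R) (d R)
       + area (pr dd gg) p (sr dd gg) * inverse p * dp k (d j) (d j)
       + 2 * obtuse (pr dd gg) p (sr dd gg) * dp k (d R) (d j)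
       + inverse (area (pr dd gg) p (sr dd gg)) * (lR R dd gg j + KR R dd gg)\<^sup>2
       - area (pr dd gg) p (sr dd gg) * (inverse (pr dd gg) * PR R dd gg - inverse p * P j)\<^sup>2" if j: "j < m" for j
  proof -
    have S: "dp k (C R) (d j) + dp k (C j) (d R) - sr dd gg * (inverse (pr dd gg) * PR R dd gg + inverse p * P j)
       = lR R dd gg j + KR R dd gg"
      unfolding lR_def KR_def by (simp only: dpR dp_row[OF j] rw_def[symmetric]) (simp only: algebra_simps)
    show ?thesis unfolding pR sR[OF j] gram_rows(1)[OF j] PRR dpP(1)[OF j] pair_hessian_eq S ..
  qed
  have c: "(\<Sum>j<m. dp k (d R) (d j)) = (\<Sum>l<m. cl l * d R l) + (\<Sum>i<m. d i m) * d R m"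
  proof -
    have "(\<Sum>j<m. dp k (d R) (d j)) = (\<Sum>j<m. \<Sum>l<m. d R l * d j l) + (\<Sum>j<m. d R m * d j m)"
      by (simp add: dp_def sum.distrib)
    also have "(\<Sum>j<m. \<Sum>l<m. d R l * d j l) = (\<Sum>l<m. cl l * d R l)"
      unfolding cl_def sum_distrib_right by (subst sum.swap) (simp only: mult.commute)
    finally show ?thesis unfolding sum_distrib_right[of "\<lambda>i. d i m"] by (simp only: mult.commute)
  qed
  have "(\<Sum>j<m. pair_hessian (dp k (C R) (C R)) (dp k (C j) (C j)) (dp k (C R) (C j))
        (dp k (d R) (d R)) (dp k (d j) (d j)) (dp k (d R) (d j))
        (dp k (C R) (d R)) (dp k (C j) (d j)) (dp k (C R) (d j) + dp k (C j) (d R)))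
    = (\<Sum>j<m. area (pr dd gg) p (sr dd gg) * inverse (pr dd gg) * dp k (d R) (d R)
       + area (pr dd gg) p (sr dd gg) * inverse p * dp k (d j) (d j)
       + 2 * obtuse (pr dd gg) p (sr dd gg) * dp k (d R) (d j)
       + inverse (area (pr dd gg) p (sr dd gg)) * (lR R dd gg j + KR R dd gg)\<^sup>2
       - area (pr dd gg) p (sr dd gg) * (inverse (pr dd gg) * PR R dd gg - inverse p * P j)\<^sup>2)"
    by (intro sum.cong refl t) simp
  also have "\<dots> = real m * (area (pr dd gg) p (sr dd gg) * inverse (pr dd gg) * dp k (d R) (d R))
       + area (pr dd gg) p (sr dd gg) * inverse p * SA
       + 2 * obtuse (pr dd gg) p (sr dd gg) * (\<Sum>j<m. dp k (d R) (d j))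
       + inverse (area (pr dd gg) p (sr dd gg)) * (\<Sum>j<m. (lR R dd gg j + KR R dd gg)\<^sup>2)
       - area (pr dd gg) p (sr dd gg) * (\<Sum>j<m. (inverse (pr dd gg) * PR R dd gg - inverse p * P j)\<^sup>2)"
  proof -
    have e: "(\<Sum>j<m. q * u) = real m * (q * u)" for q u :: real by simp
    show ?thesis unfolding sum.distrib sum_subtractf SA_def e by (simp only: sum_distrib_left)
  qed
  finally show ?thesis unfolding c square_shift_sum square_shift_sum' by (simp only: mult.assoc)
qed

lemma hess_re:
  assumes R: "\<And>j. j < m \<Longrightarrow> C R j = dd" "C R m = gg"
  shows "(\<Sum>j<k. pair_hessian (dp k (C R) (C R)) 1 (C R j) (dp k (d R) (d R)) 0 0 (dp k (C R) (d R)) 0 (d R j))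
   = (real m * area (pr dd gg) 1 dd + area (pr dd gg) 1 gg) * inverse (pr dd gg) * dp k (d R) (d R)
     + inverse (area (pr dd gg) 1 dd) * ((\<Sum>j<m. (d R j)\<^sup>2) - 2 * dd * inverse (pr dd gg) * PR R dd gg * rw R
         + real m * (dd * inverse (pr dd gg) * PR R dd gg)\<^sup>2)
     + inverse (area (pr dd gg) 1 gg) * (d R m - gg * inverse (pr dd gg) * PR R dd gg)\<^sup>2
     - (real m * area (pr dd gg) 1 dd + area (pr dd gg) 1 gg) * (inverse (pr dd gg) * PR R dd gg)\<^sup>2"
proof -
  have dpR: "dp k (C R) y = dd * (\<Sum>j<m. y j) + gg * y m" for y
    by (simp add: dp_def R sum_distrib_left)
  have pR: "dp k (C R) (C R) = pr dd gg" by (simp add: dpR R)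
  have PRR: "dp k (C R) (d R) = PR R dd gg" by (simp add: dpR PR_def rw_def)
  have f: "pair_hessian q 1 w A 0 0 P 0 x = area q 1 w * inverse q * A + inverse (area q 1 w) * (x - w * inverse q * P)\<^sup>2 - area q 1 w * (inverse q * P)\<^sup>2" for q w A P x
    unfolding pair_hessian_eq by (simp add: mult.assoc)
  have q: "(\<Sum>j<m. (d R j - dd * inverse (pr dd gg) * PR R dd gg)\<^sup>2)
     = (\<Sum>j<m. (d R j)\<^sup>2) - 2 * dd * inverse (pr dd gg) * PR R dd gg * rw R + real m * (dd * inverse (pr dd gg) * PR R dd gg)\<^sup>2"
    unfolding rw_def using square_shift_sum[of "d R" "- (dd * inverse (pr dd gg) * PR R dd gg)" m] by (simp add: mult.assoc)
  have "(\<Sum>j<k. pair_hessian (dp k (C R) (C R)) 1 (C R j) (dp k (d R) (d R)) 0 0 (dp k (C R) (d R)) 0 (d R j))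
     = (\<Sum>j<m. area (pr dd gg) 1 dd * inverse (pr dd gg) * dp k (d R) (d R)
         + inverse (area (pr dd gg) 1 dd) * (d R j - dd * inverse (pr dd gg) * PR R dd gg)\<^sup>2 - area (pr dd gg) 1 dd * (inverse (pr dd gg) * PR R dd gg)\<^sup>2)
       + (area (pr dd gg) 1 gg * inverse (pr dd gg) * dp k (d R) (d R)
         + inverse (area (pr dd gg) 1 gg) * (d R m - gg * inverse (pr dd gg) * PR R dd gg)\<^sup>2 - area (pr dd gg) 1 gg * (inverse (pr dd gg) * PR R dd gg)\<^sup>2)"
    unfolding pR PRR f by (simp add: R)
  also have "\<dots> = real m * (area (pr dd gg) 1 dd * inverse (pr dd gg) * dp k (d R) (d R))
         + inverse (area (pr dd gg) 1 dd) * (\<Sum>j<m. (d R j - dd * inverse (pr dd gg) * PR R dd gg)\<^sup>2) - real m * (area (pr dd gg) 1 dd * (inverse (pr dd gg) * PR R dd gg)\<^sup>2)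
       + (area (pr dd gg) 1 gg * inverse (pr dd gg) * dp k (d R) (d R)
         + inverse (area (pr dd gg) 1 gg) * (d R m - gg * inverse (pr dd gg) * PR R dd gg)\<^sup>2 - area (pr dd gg) 1 gg * (inverse (pr dd gg) * PR R dd gg)\<^sup>2)"
  proof -
    have e: "(\<Sum>j<m. q * u) = real m * (q * u)" for q u :: real by simp
    show ?thesis unfolding sum.distrib sum_subtractf e by (simp only: sum_distrib_left)
  qed
  finally show ?thesis unfolding q by (simp add: distrib_right)
qed

lemma hess_rr:
  "pair_hessian (dp k (C (Suc m)) (C (Suc m))) (dp k (C m) (C m)) (dp k (C (Suc m)) (C m))
        (dp k (d (Suc m)) (d (Suc m))) (dp k (d m) (d m)) (dp k (d (Suc m)) (d m))
        (dp k (C (Suc m)) (d (Suc m))) (dp k (C m) (d m)) (dp k (C (Suc m)) (d m) + dp k (C m) (d (Suc m)))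
   = area p1 p0 s01 * inverse p1 * dp k (d (Suc m)) (d (Suc m)) + area p1 p0 s01 * inverse p0 * dp k (d m) (d m)
     + 2 * obtuse p1 p0 s01 * ((\<Sum>j<m. d m j * d (Suc m) j) + d m m * d (Suc m) m)
     + inverse (area p1 p0 s01) * (d1 * rw m + g1 * d m m + d0 * rw (Suc m) + g0 * d (Suc m) m
         - s01 * (inverse p1 * PR (Suc m) d1 g1 + inverse p0 * PR m d0 g0))\<^sup>2
     - area p1 p0 s01 * (inverse p1 * PR (Suc m) d1 g1 - inverse p0 * PR m d0 g0)\<^sup>2"
proof -
  have "dp k (d (Suc m)) (d m) = (\<Sum>j<m. d m j * d (Suc m) j) + d m m * d (Suc m) m"
    by (simp add: dp_def mult.commute)
  thus ?thesis
    unfolding gram_rows(2,3,7) dpP(2,3) pair_hessian_eq dp_row1[of "d m"] dp_row0[of "d (Suc m)"] rw_def[symmetric]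
    by (simp only: add.assoc)
qed
end

text \<open>\<open>hD\<dots>\<close>, \<open>hI\<dots>\<close>, \<open>hT\<dots>\<close> are \<open>area\<close>, its inverse and \<open>obtuse\<close> of a pair; the suffix names the pair:
  none for two symmetric rows, \<open>0\<close>/\<open>1\<close> for an extra row and a symmetric row, \<open>01\<close> for the two extra rows,
  \<open>a\<close>, \<open>b\<close>, \<open>c\<close> for a symmetric row and the target with that inner product, \<open>00\<close>, \<open>0m\<close>, \<open>10\<close>, \<open>1m\<close> for
  an extra row and a target. \<open>hchi\<close> is \<open>1\<close> if the second extra row is present and \<open>0\<close> otherwise.\<close>

record 'a hess_data =
  ha :: 'a  hb :: 'a  hc :: 'a  hd0 :: 'a  hg0 :: 'a  hd1 :: 'a  hg1 :: 'a
  hchi :: 'a  hpi :: 'a  hlam :: 'a  hm :: 'a  hm1 :: 'a  hm2 :: 'a  him :: 'a  him1 :: 'a  him2 :: 'a  hhalf :: 'a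
  hip :: 'a  hip0 :: 'a  hip1 :: 'a  hs :: 'a  hs0 :: 'a  hs1 :: 'a  hs01 :: 'a
  hD :: 'a  hD0 :: 'a  hD1 :: 'a  hD01 :: 'a  hDa :: 'a  hDb :: 'a  hDc :: 'a  hD00 :: 'a  hD0m :: 'a  hD10 :: 'a  hD1m :: 'a
  hI :: 'a  hI0 :: 'a  hI1 :: 'a  hI01 :: 'a  hIa :: 'a  hIb :: 'a  hIc :: 'a  hI00 :: 'a  hI0m :: 'a  hI10 :: 'a  hI1m :: 'a
  hT :: 'a  hT0 :: 'a  hT1 :: 'a  hT01 :: 'a

section \<open>The Hessian as two quadratic forms\<close>

definition dbl :: "'a::plus \<Rightarrow> 'a" where "dbl x = x + x"

text \<open>The coefficients and forms are stated for any type with the arithmetic operations and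
  are used twice: over the reals they are the Hessian, over intervals its check, and the two
  computations correspond operation by operation. No numerals are assumed, hence \<open>dbl\<close>
  and \<open>1 + 1\<close>. Subtracting \<open>hlam\<close> builds the desired lower bound of the
  Hessian into the form.\<close>

definition coefA :: "'a::{plus,minus,times} hess_data \<Rightarrow> 'a" where
  "coefA X = hpi X + (hm1 X * hD X + hD0 X + hchi X * hD1 X - hDa X - hm1 X * hDb X - hDc X) * hip X - hT X - hlam X"
definition coef0 :: "'a::{plus,minus,times} hess_data \<Rightarrow> 'a" where
  "coef0 X = hpi X + (hm X * hD0 X + hchi X * hD01 X - hm X * hD00 X - hD0m X) * hip0 X - hlam X"
definition coef1 :: "'a::{plus,minus,times} hess_data \<Rightarrow> 'a" where
  "coef1 X = hpi X + (hm X * hD1 X + hD01 X - hm X * hD10 X - hD1m X) * hip1 X - hlam X"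
text \<open>\<open>coefK\<close> and \<open>coefG\<close> are the weights of the antisymmetric and
  the symmetric part of the off-diagonal block entries; they must be nonnegative for the
  least-squares bounds to apply.\<close>

definition coefK :: "'a::{plus,minus,times} hess_data \<Rightarrow> 'a" where
  "coefK X = hhalf X * (coefA X - hIb X)"
definition coefG :: "'a::{plus,minus,times} hess_data \<Rightarrow> 'a" where
  "coefG X = coefK X + hI X * ((ha X - hb X) * (ha X - hb X))"
definition coefP :: "'a::{plus,minus,times} hess_data \<Rightarrow> 'a" where
  "coefP X = hip X * hip X * (hDa X + hDc X + hm1 X * hDb X - hD0 X - hchi X * hD1 X - hm X * hD X - hm1 X * (hb X * hb X) * hIb X)"
definition coefP0 :: "'a::{plus,minus,times} hess_data \<Rightarrow> 'a" where
  "coefP0 X = hip0 X * hip0 X * (hm X * hD00 X + hD0m X - hm X * hD0 X - hm X * (hd0 X * hd0 X) * hI00 X)"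
definition coefP1 :: "'a::{plus,minus,times} hess_data \<Rightarrow> 'a" where
  "coefP1 X = hip1 X * hip1 X * (hm X * hD10 X + hD1m X - hm X * hD1 X - hm X * (hd1 X * hd1 X) * hI10 X)"

text \<open>Coefficient lists of linear functionals of the six numbers attached to an index i:
  diagonal entry, last entry, row sum, column sum, and the i-th entries of the two extra
  rows.\<close>

definition vP :: "'a::{plus,minus,times,uminus,zero,one} hess_data \<Rightarrow> 'a list" where
  "vP X = [ha X - hb X, hc X, hb X, 0, 0, 0]"
definition vL :: "'a::{plus,minus,times,uminus,zero,one} hess_data \<Rightarrow> 'a list" where
  "vL X = [- (hs X * hip X * (ha X - hb X)), hc X - hs X * hip X * hc X, hb X - hs X * hip X * hb X, 0, 0, 0]"
definition vl0 :: "'a::{plus,minus,times,uminus,zero,one} hess_data \<Rightarrow> 'a list" where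
  "vl0 X = [- (hs0 X * hip X * (ha X - hb X)), hg0 X - hs0 X * hip X * hc X, hd0 X - hs0 X * hip X * hb X, 0, ha X - hb X, 0]"
definition vl1 :: "'a::{plus,minus,times,uminus,zero,one} hess_data \<Rightarrow> 'a list" where
  "vl1 X = [- (hs1 X * hip X * (ha X - hb X)), hg1 X - hs1 X * hip X * hc X, hd1 X - hs1 X * hip X * hb X, 0, 0, ha X - hb X]"
definition vEa :: "'a::{plus,minus,times,uminus,zero,one} hess_data \<Rightarrow> 'a list" where
  "vEa X = [1 - ha X * hip X * (ha X - hb X), - (ha X * hip X * hc X), - (ha X * hip X * hb X), 0, 0, 0]"
definition vEc :: "'a::{plus,minus,times,uminus,zero,one} hess_data \<Rightarrow> 'a list" where
  "vEc X = [- (hc X * hip X * (ha X - hb X)), 1 - hc X * hip X * hc X, - (hc X * hip X * hb X), 0, 0, 0]"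

text \<open>A form is a list of weighted products of two functionals; the last two items are the
  least-squares bounds of the off-diagonal part. The summand \<open>1 - hchi\<close> gives the slot
  of an absent second extra row the weight 1: the variable in it is then zero, and the elimination
  still finds a positive pivot.\<close>

definition formM :: "'a::{plus,minus,times,uminus,zero,one} hess_data \<Rightarrow> ('a \<times> 'a list \<times> 'a list) list" where
  "formM X = [
    (coefA X, [1,0,0,0,0,0], [1,0,0,0,0,0]), (coefA X, [0,1,0,0,0,0], [0,1,0,0,0,0]),
    (coef0 X - hI00 X, [0,0,0,0,1,0], [0,0,0,0,1,0]),
    (hchi X * (coef1 X - hI10 X) + (1 - hchi X), [0,0,0,0,0,1], [0,0,0,0,0,1]),
    (hT X, [0,0,0,1,0,0], [0,0,0,1,0,0]),
    (dbl (hT0 X), [0,0,0,1,0,0], [0,0,0,0,1,0]), (dbl (hchi X * hT1 X), [0,0,0,1,0,0], [0,0,0,0,0,1]),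
    (dbl (hchi X * hT01 X), [0,0,0,0,1,0], [0,0,0,0,0,1]),
    (dbl (hI X * (ha X - hb X)), vL X, [- (1 + 1),0,1,1,0,0]), (hI X * hm2 X, vL X, vL X),
    (hI0 X, vl0 X, vl0 X), (hchi X * hI1 X, vl1 X, vl1 X), (coefP X, vP X, vP X),
    (- hIa X, vEa X, vEa X), (- hIc X, vEc X, vEc X),
    (dbl (hb X * hip X * hIb X), [- 1,0,1,0,0,0], vP X),
    (coefG X * him2 X, [- (1 + 1),0,1,1,0,0], [- (1 + 1),0,1,1,0,0]),
    (coefK X * him X, [0,0,1,- 1,0,0], [0,0,1,- 1,0,0])]"

text \<open>Carries a functional of the six numbers of an index over to their sums. Row sums and
  column sums have the same total, so their coefficients merge; the last two slots belong to the
  last entries of the extra rows.\<close>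

fun up :: "'a::{plus,zero} list \<Rightarrow> 'a list" where
  "up [x, y, r, c, u, v] = [x, y, r + c, u, v, 0, 0]"
| "up l = l"

text \<open>Functionals of the seven invariant quantities: the sums of the diagonal, of the last
  column and of all block entries, the sums of the two extra rows over the first m columns, and the
  last entries of these rows.\<close>

definition nP0 :: "'a::{plus,minus,times,uminus,zero,one} hess_data \<Rightarrow> 'a list" where
  "nP0 X = [0, 0, 0, hd0 X, 0, hg0 X, 0]"
definition nP1 :: "'a::{plus,minus,times,uminus,zero,one} hess_data \<Rightarrow> 'a list" where
  "nP1 X = [0, 0, 0, 0, hd1 X, 0, hg1 X]"
definition nK0 :: "'a::{plus,minus,times,uminus,zero,one} hess_data \<Rightarrow> 'a list" where
  "nK0 X = [0, 0, 0, hb X - hs0 X * hip0 X * hd0 X, 0, hc X - hs0 X * hip0 X * hg0 X, 0]"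
definition nK1 :: "'a::{plus,minus,times,uminus,zero,one} hess_data \<Rightarrow> 'a list" where
  "nK1 X = [0, 0, 0, 0, hb X - hs1 X * hip1 X * hd1 X, 0, hc X - hs1 X * hip1 X * hg1 X]"
definition nE0 :: "'a::{plus,minus,times,uminus,zero,one} hess_data \<Rightarrow> 'a list" where
  "nE0 X = [0, 0, 0, - (hg0 X * hip0 X * hd0 X), 0, 1 - hg0 X * hip0 X * hg0 X, 0]"
definition nE1 :: "'a::{plus,minus,times,uminus,zero,one} hess_data \<Rightarrow> 'a list" where
  "nE1 X = [0, 0, 0, 0, - (hg1 X * hip1 X * hd1 X), 0, 1 - hg1 X * hip1 X * hg1 X]"
definition nX :: "'a::{plus,minus,times,uminus,zero,one} hess_data \<Rightarrow> 'a list" where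
  "nX X = [0, 0, 0, hd1 X - hs01 X * hip0 X * hd0 X, hd0 X - hs01 X * hip1 X * hd1 X,
     hg1 X - hs01 X * hip0 X * hg0 X, hg0 X - hs01 X * hip1 X * hg1 X]"
definition nQ :: "'a::{plus,minus,times,uminus,zero,one} hess_data \<Rightarrow> 'a list" where
  "nQ X = [0, 0, 0, - (hip0 X * hd0 X), hip1 X * hd1 X, - (hip0 X * hg0 X), hip1 X * hg1 X]"

text \<open>Collects the products of sums over the block. The negative last item is the part of the
  symmetric least-squares bound with the square of the total of the \<open>g i\<close>.\<close>

definition formN :: "'a::{plus,minus,times,uminus,zero,one} hess_data \<Rightarrow> ('a \<times> 'a list \<times> 'a list) list" where
  "formN X = [
    (coef0 X, [0,0,0,0,0,1,0], [0,0,0,0,0,1,0]), (hchi X * coef1 X + (1 - hchi X), [0,0,0,0,0,0,1], [0,0,0,0,0,0,1]),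
    (hT X, [0,1,0,0,0,0,0], [0,1,0,0,0,0,0]), (dbl (hT0 X), [0,1,0,0,0,0,0], [0,0,0,0,0,1,0]),
    (dbl (hchi X * hT1 X), [0,1,0,0,0,0,0], [0,0,0,0,0,0,1]), (dbl (hchi X * hT01 X), [0,0,0,0,0,1,0], [0,0,0,0,0,0,1]),
    (hI X, up (vL X), up (vL X)),
    (dbl (hI0 X), up (vl0 X), nK0 X), (hm X * hI0 X, nK0 X, nK0 X),
    (dbl (hchi X * hI1 X), up (vl1 X), nK1 X), (hchi X * (hm X * hI1 X), nK1 X, nK1 X),
    (dbl (hD0 X * hip X * hip0 X), up (vP X), nP0 X), (dbl (hchi X * (hD1 X * hip X * hip1 X)), up (vP X), nP1 X),
    (coefP0 X, nP0 X, nP0 X), (hchi X * coefP1 X, nP1 X, nP1 X),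
    (dbl (hd0 X * hip0 X * hI00 X), [0,0,0,1,0,0,0], nP0 X), (dbl (hchi X * (hd1 X * hip1 X * hI10 X)), [0,0,0,0,1,0,0], nP1 X),
    (- hI0m X, nE0 X, nE0 X), (- (hchi X * hI1m X), nE1 X, nE1 X),
    (hchi X * hI01 X, nX X, nX X), (- (hchi X * hD01 X), nQ X, nQ X),
    (hD X * (hip X * hip X), up (vP X), up (vP X)),
    (- (coefG X * (hhalf X * (him1 X * him2 X))), [- (1 + 1),0,1 + 1,0,0,0,0], [- (1 + 1),0,1 + 1,0,0,0,0])]"

fun vdot :: "real list \<Rightarrow> real list \<Rightarrow> real" where
  "vdot (x # xs) (y # ys) = x * y + vdot xs ys"
| "vdot _ _ = 0"

fun qf :: "(real \<times> real list \<times> real list) list \<Rightarrow> real list \<Rightarrow> real" where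
  "qf [] z = 0"
| "qf ((\<kappa>, l, l') # fs) z = \<kappa> * (vdot l z * vdot l' z) + qf fs z"

definition real_data :: "nat \<Rightarrow> real \<Rightarrow> real \<Rightarrow> real \<Rightarrow> real \<Rightarrow> real \<Rightarrow> real \<Rightarrow> real \<Rightarrow> real \<Rightarrow> real \<Rightarrow> real hess_data" where
  "real_data m chi lam a b c d0 g0 d1 g1 = (
     let p = (a - b) * a + b * (a - b + real m * b) + c * c; p0 = d0 * (real m * d0) + g0 * g0;
       p1 = d1 * (real m * d1) + g1 * g1; s = (a - b) * b + b * (a - b + real m * b) + c * c;
       s0 = d0 * (a - b + real m * b) + g0 * c; s1 = d1 * (a - b + real m * b) + g1 * c;
       s01 = d1 * (real m * d0) + g1 * g0 in
     \<lparr> ha = a, hb = b, hc = c, hd0 = d0, hg0 = g0, hd1 = d1, hg1 = g1,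
       hchi = chi, hpi = pi, hlam = lam, hm = real m, hm1 = real m - 1, hm2 = real m - 2,
       him = inverse (real m), him1 = inverse (real m - 1), him2 = inverse (real m - 2), hhalf = 1 / 2,
       hip = inverse p, hip0 = inverse p0, hip1 = inverse p1, hs = s, hs0 = s0, hs1 = s1, hs01 = s01,
       hD = area p p s, hD0 = area p0 p s0, hD1 = area p1 p s1, hD01 = area p1 p0 s01,
       hDa = area p 1 a, hDb = area p 1 b, hDc = area p 1 c,
       hD00 = area p0 1 d0, hD0m = area p0 1 g0, hD10 = area p1 1 d1, hD1m = area p1 1 g1,
       hI = inverse (area p p s), hI0 = inverse (area p0 p s0), hI1 = inverse (area p1 p s1), hI01 = inverse (area p1 p0 s01),
       hIa = inverse (area p 1 a), hIb = inverse (area p 1 b), hIc = inverse (area p 1 c),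
       hI00 = inverse (area p0 1 d0), hI0m = inverse (area p0 1 g0), hI10 = inverse (area p1 1 d1), hI1m = inverse (area p1 1 g1),
       hT = obtuse p p s, hT0 = obtuse p0 p s0, hT1 = obtuse p1 p s1, hT01 = obtuse p1 p0 s01 \<rparr>)"

text \<open>Pure regrouping: the contributions of all types of pairs on the left become, on the
  right, off-diagonal squares, sums over single indices, and products of invariant
  quantities.\<close>

lemma hess_total_arith:
  fixes D D0 D1 D01 Da Db Dc D00 D0m D10 D1m I I0 I1 I01 Ia Ib Ic I00 I0m I10 I1m T T0 T1 T01 ip ip0 ip1 lam pi' mm ab b d0 d1
    Sx2 Sy2 Su2 Sv2 Q2 Scl2 Sclu Sclv Suv SLg SL2 SL Sl02 Sl0 Sl12 Sl1 SP2 SP Sea Sec SroP Sgg Y U V e0 e1 K0 K1 P0 P1 E0 E1 X01 chi :: real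
  defines "SA \<equiv> Q2 + Sx2 + Sy2" and "U2 \<equiv> Su2 + e0\<^sup>2" and "V2 \<equiv> Sv2 + e1\<^sup>2"
    and "A \<equiv> pi' + ((mm - 1) * D + D0 + chi * D1 - Da - (mm - 1) * Db - Dc) * ip - T - lam"
    and "c0 \<equiv> pi' + (mm * D0 + chi * D01 - mm * D00 - D0m) * ip0 - lam"
    and "c1 \<equiv> pi' + (mm * D1 + D01 - mm * D10 - D1m) * ip1 - lam"
  shows "((mm - 1) * (D * ip) * SA + T * (Scl2 + Y\<^sup>2 - SA) + I * (ab\<^sup>2 * Sgg + 2 * ab * SLg + (mm - 2) * SL2 + SL\<^sup>2)
       - D * ip\<^sup>2 * (mm * SP2 - SP\<^sup>2))
     + (mm * (D0 * ip0) * U2 + D0 * ip * SA + 2 * T0 * (Sclu + Y * e0) + I0 * (Sl02 + 2 * K0 * Sl0 + mm * K0\<^sup>2)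
       - D0 * (mm * (ip0 * P0)\<^sup>2 - 2 * (ip0 * P0) * ip * SP + ip\<^sup>2 * SP2))
     + chi * (mm * (D1 * ip1) * V2 + D1 * ip * SA + 2 * T1 * (Sclv + Y * e1) + I1 * (Sl12 + 2 * K1 * Sl1 + mm * K1\<^sup>2)
       - D1 * (mm * (ip1 * P1)\<^sup>2 - 2 * (ip1 * P1) * ip * SP + ip\<^sup>2 * SP2))
     + chi * (D01 * ip1 * V2 + D01 * ip0 * U2 + 2 * T01 * (Suv + e0 * e1) + I01 * X01\<^sup>2 - D01 * (ip1 * P1 - ip0 * P0)\<^sup>2)
     + pi' * (SA + U2 + chi * V2)
     - ((Da + (mm - 1) * Db + Dc) * ip * SA + Ia * Sea + Ic * Sec + Ib * (Q2 - 2 * b * ip * SroP + (mm - 1) * (b * ip)\<^sup>2 * SP2)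
       - (Da + (mm - 1) * Db + Dc) * ip\<^sup>2 * SP2)
     - ((mm * D00 + D0m) * ip0 * U2 + I00 * (Su2 - 2 * d0 * ip0 * P0 * U + mm * (d0 * ip0 * P0)\<^sup>2) + I0m * E0\<^sup>2
       - (mm * D00 + D0m) * (ip0 * P0)\<^sup>2)
     - chi * ((mm * D10 + D1m) * ip1 * V2 + I10 * (Sv2 - 2 * d1 * ip1 * P1 * V + mm * (d1 * ip1 * P1)\<^sup>2) + I1m * E1\<^sup>2
       - (mm * D10 + D1m) * (ip1 * P1)\<^sup>2)
     - lam * (SA + U2 + chi * V2)
   = (A - Ib) * Q2 + I * ab\<^sup>2 * Sgg
     + (A * Sx2 + A * Sy2 + (c0 - I00) * Su2 + chi * (c1 - I10) * Sv2 + T * Scl2 + 2 * T0 * Sclu + 2 * (chi * T1) * Sclv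
       + 2 * (chi * T01) * Suv + 2 * (I * ab) * SLg + I * (mm - 2) * SL2 + I0 * Sl02 + chi * I1 * Sl12
       + ip * ip * (Da + Dc + (mm - 1) * Db - D0 - chi * D1 - mm * D - (mm - 1) * (b * b) * Ib) * SP2
       - Ia * Sea - Ic * Sec + 2 * (b * ip * Ib) * SroP)
     + (c0 * e0\<^sup>2 + chi * c1 * e1\<^sup>2 + T * Y\<^sup>2 + 2 * T0 * (Y * e0) + 2 * (chi * T1) * (Y * e1) + 2 * (chi * T01) * (e0 * e1)
       + I * SL\<^sup>2 + 2 * I0 * (Sl0 * K0) + mm * I0 * K0\<^sup>2 + 2 * (chi * I1) * (Sl1 * K1) + chi * (mm * I1) * K1\<^sup>2
       + 2 * (D0 * ip * ip0) * (SP * P0) + 2 * (chi * (D1 * ip * ip1)) * (SP * P1)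
       + ip0 * ip0 * (mm * D00 + D0m - mm * D0 - mm * (d0 * d0) * I00) * P0\<^sup>2
       + chi * (ip1 * ip1 * (mm * D10 + D1m - mm * D1 - mm * (d1 * d1) * I10)) * P1\<^sup>2
       + 2 * (d0 * ip0 * I00) * (U * P0) + 2 * (chi * (d1 * ip1 * I10)) * (V * P1)
       - I0m * E0\<^sup>2 - chi * I1m * E1\<^sup>2 + chi * I01 * X01\<^sup>2 - chi * D01 * (ip1 * P1 - ip0 * P0)\<^sup>2 + D * (ip * ip) * SP\<^sup>2)"
  unfolding assms by (simp add: power2_eq_square algebra_simps)

lemma coefG_arith: "c * (S / u - G / (2 * w * u)) = c * inverse u * S - c * (1 / 2 * (inverse w * inverse u)) * G" for c S G u w :: real
  by (cases "u = 0"; cases "w = 0") (simp_all add: field_simps)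

lemma vdot_up:
  assumes "length l = 6" "(\<Sum>i<m. z3 i) = (\<Sum>i<m. z4 i)"
  shows "vdot (up l) [\<Sum>i<m. z1 i, \<Sum>i<m. z2 i, \<Sum>i<m. z3 i, \<Sum>i<m. z5 i, \<Sum>i<m. z6 i, e0, e1]
    = (\<Sum>i<m. vdot l [z1 i, z2 i, z3 i, z4 i, z5 i, z6 i])"
proof -
  obtain x1 x2 x3 x4 x5 x6 where "l = [x1, x2, x3, x4, x5, x6]"
    using assms(1) by (auto simp: numeral_eq_Suc length_Suc_conv)
  thus ?thesis using assms(2) by (simp add: sum.distrib sum_distrib_left[symmetric] distrib_right)
qed

context symmetric_perturbation
begin

text \<open>The factor \<open>e\<close> erases the second extra row when there is none, so that both
  cases share the same forms.\<close>

definition "zv e i = [d i i, d i m, rw i, cl i, d m i, e * d (Suc m) i]"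
definition "zs e = [\<Sum>i<m. d i i, \<Sum>i<m. d i m, \<Sum>i<m. rw i, \<Sum>i<m. d m i, \<Sum>i<m. e * d (Suc m) i, d m m, e * d (Suc m) m]"

lemma sum_rw_cl: "(\<Sum>i<m. rw i) = (\<Sum>i<m. cl i)"
  unfolding rw_def cl_def by (rule sum.swap)

lemma vdot_up_zs: "length l = 6 \<Longrightarrow> vdot (up l) (zs e) = (\<Sum>i<m. vdot l (zv e i))"
  unfolding zs_def zv_def by (rule vdot_up[OF _ sum_rw_cl])

abbreviation "X e lam \<equiv> real_data m e lam a b c d0 g0 d1 g1"

lemmas data_simps = real_data_def Let_def hess_data.simps

lemma vdot_M:
  "vdot (vP (X e lam)) (zv e i) = P i"
  "vdot (vL (X e lam)) (zv e i) = L i"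
  "vdot (vl0 (X e lam)) (zv e i) = lR m d0 g0 i"
  "vdot (vl1 (X 1 lam)) (zv 1 i) = lR (Suc m) d1 g1 i"
  "vdot (vEa (X e lam)) (zv e i) = d i i - a * inverse p * P i"
  "vdot (vEc (X e lam)) (zv e i) = d i m - c * inverse p * P i"
  unfolding vP_def vL_def vl0_def vl1_def vEa_def vEc_def data_simps zv_def P_def L_def lR_def vdot.simps
  by (simp_all add: algebra_simps)

lemma vdot_N:
  "vdot (nP0 (X e lam)) (zs e) = PR m d0 g0"
  "vdot (nP1 (X 1 lam)) (zs 1) = PR (Suc m) d1 g1"
  "vdot (nK0 (X e lam)) (zs e) = KR m d0 g0"
  "vdot (nK1 (X 1 lam)) (zs 1) = KR (Suc m) d1 g1"
  "vdot (nE0 (X e lam)) (zs e) = d m m - g0 * inverse p0 * PR m d0 g0"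
  "vdot (nE1 (X 1 lam)) (zs 1) = d (Suc m) m - g1 * inverse p1 * PR (Suc m) d1 g1"
  "vdot (nX (X 1 lam)) (zs 1) = d1 * rw m + g1 * d m m + d0 * rw (Suc m) + g0 * d (Suc m) m
         - s01 * (inverse p1 * PR (Suc m) d1 g1 + inverse p0 * PR m d0 g0)"
  "vdot (nQ (X 1 lam)) (zs 1) = inverse p1 * PR (Suc m) d1 g1 - inverse p0 * PR m d0 g0"
  unfolding nP0_def nP1_def nK0_def nK1_def nE0_def nE1_def nX_def nQ_def data_simps zs_def PR_def KR_def rw_def vdot.simps
  by (simp_all add: algebra_simps)

lemma length_vecs: "length (vP Y) = 6" "length (vL Y) = 6" "length (vl0 Y) = 6" "length (vl1 Y) = 6"
  by (simp_all add: vP_def vL_def vl0_def vl1_def)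

lemma vdot_N_up:
  "vdot (up (vP (X e lam))) (zs e) = (\<Sum>i<m. P i)"
  "vdot (up (vL (X e lam))) (zs e) = (\<Sum>i<m. L i)"
  "vdot (up (vl0 (X e lam))) (zs e) = (\<Sum>i<m. lR m d0 g0 i)"
  "vdot (up (vl1 (X 1 lam))) (zs 1) = (\<Sum>i<m. lR (Suc m) d1 g1 i)"
  by (simp_all only: vdot_up_zs length_vecs vdot_M)

lemma dp_self: "dp k (d i) (d i) = (\<Sum>j<m. (d i j)\<^sup>2) + (d i m)\<^sup>2"
  by (simp add: dp_def power2_eq_square)

definition "Q2 = (\<Sum>i<m. \<Sum>j<m. (d i j)\<^sup>2) - (\<Sum>i<m. (d i i)\<^sup>2)"
definition "gv i = rw i + cl i - 2 * d i i"

lemma SA_eq: "SA = Q2 + (\<Sum>i<m. (d i i)\<^sup>2) + (\<Sum>i<m. (d i m)\<^sup>2)"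
  by (simp add: SA_def Q2_def dp_self sum.distrib)

text \<open>The off-diagonal squares split into symmetric and antisymmetric parts with weights
  \<open>coefG\<close> and \<open>coefK\<close>, and each part is at least its minimum for the given
  row and column sums.\<close>

lemma off_diagonal_lower:
  assumes "0 \<le> coefG Y" "0 \<le> coefK Y" and Y: "Y = X e lam"
  shows "(coefA Y - hIb Y) * Q2 + hI Y * (a - b)\<^sup>2 * (\<Sum>i<m. \<Sum>j<i. (d i j + d j i)\<^sup>2)
    \<ge> coefG Y * him2 Y * (\<Sum>i<m. (gv i)\<^sup>2) - coefG Y * (hhalf Y * (him1 Y * him2 Y)) * (\<Sum>i<m. gv i)\<^sup>2
      + coefK Y * him Y * (\<Sum>i<m. (rw i - cl i)\<^sup>2)"
proof -
  define Gg where "Gg = (\<Sum>i<m. \<Sum>j<i. (d i j + d j i)\<^sup>2)"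
  define Kk where "Kk = (\<Sum>i<m. \<Sum>j<i. (d i j - d j i)\<^sup>2)"
  have g: "Gg \<ge> (\<Sum>i<m. (gv i)\<^sup>2) / (real m - 2) - (\<Sum>i<m. gv i)\<^sup>2 / (2 * (real m - 1) * (real m - 2))"
    unfolding Gg_def gv_def rw_def cl_def by (rule sum_symmetric_square_lower[OF m])
  have k: "Kk \<ge> (\<Sum>i<m. (rw i - cl i)\<^sup>2) / real m"
    unfolding Kk_def rw_def cl_def by (rule sum_antisymmetric_square_lower) (use m in simp)
  have q: "Q2 = (Gg + Kk) / 2" unfolding Q2_def Gg_def Kk_def by (rule sum_off_diagonal_squares)
  have h: "him2 Y = inverse (real m - 2)" "him1 Y = inverse (real m - 1)" "him Y = inverse (real m)" "hhalf Y = 1 / 2"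
    "ha Y = a" "hb Y = b" unfolding Y data_simps by simp_all
  have cK: "coefK Y = (coefA Y - hIb Y) / 2" by (simp add: coefK_def h)
  have cG: "coefG Y = coefK Y + hI Y * (a - b)\<^sup>2" by (simp add: coefG_def h power2_eq_square)
  have "(coefA Y - hIb Y) * Q2 + hI Y * (a - b)\<^sup>2 * Gg = coefG Y * Gg + coefK Y * Kk"
    unfolding q cG cK by (simp add: algebra_simps add_divide_distrib diff_divide_distrib)
  moreover have "coefG Y * Gg \<ge> coefG Y * ((\<Sum>i<m. (gv i)\<^sup>2) / (real m - 2) - (\<Sum>i<m. gv i)\<^sup>2 / (2 * (real m - 1) * (real m - 2)))"
    by (rule mult_left_mono[OF g assms(1)])
  moreover have "coefK Y * Kk \<ge> coefK Y * ((\<Sum>i<m. (rw i - cl i)\<^sup>2) / real m)"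
    by (rule mult_left_mono[OF k assms(2)])
  moreover have "coefG Y * ((\<Sum>i<m. (gv i)\<^sup>2) / (real m - 2) - (\<Sum>i<m. gv i)\<^sup>2 / (2 * (real m - 1) * (real m - 2)))
     = coefG Y * him2 Y * (\<Sum>i<m. (gv i)\<^sup>2) - coefG Y * (hhalf Y * (him1 Y * him2 Y)) * (\<Sum>i<m. gv i)\<^sup>2"
    unfolding h by (rule coefG_arith)
  moreover have "coefK Y * ((\<Sum>i<m. (rw i - cl i)\<^sup>2) / real m) = coefK Y * him Y * (\<Sum>i<m. (rw i - cl i)\<^sup>2)"
    unfolding h by (simp only: divide_inverse_commute mult.assoc)
  ultimately show ?thesis unfolding Gg_def by argo
qed

lemma row_sums_two: "n = Suc m \<Longrightarrow> (\<Sum>i<n. f i) = (\<Sum>i<m. f i) + f m" "n = Suc (Suc m) \<Longrightarrow> (\<Sum>i<n. f i) = (\<Sum>i<m. f i) + f m + f (Suc m)" for f :: "nat \<Rightarrow> real"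
  by simp_all
end

context symmetric_perturbation
begin

lemma vdot_units_M:
  "vdot [1,0,0,0,0,0] (zv e i) = d i i" "vdot [0,1,0,0,0,0] (zv e i) = d i m"
  "vdot [0,0,0,1,0,0] (zv e i) = cl i" "vdot [0,0,0,0,1,0] (zv e i) = d m i"
  "vdot [0,0,0,0,0,1] (zv e i) = e * d (Suc m) i"
  "vdot [- (1 + 1),0,1,1,0,0] (zv e i) = gv i" "vdot [- 1,0,1,0,0,0] (zv e i) = rw i - d i i"
  "vdot [0,0,1,- 1,0,0] (zv e i) = rw i - cl i"
  by (simp_all add: zv_def gv_def)

lemma vdot_units_N:
  "vdot [0,1,0,0,0,0,0] (zs e) = (\<Sum>i<m. d i m)" "vdot [0,0,0,0,0,1,0] (zs e) = d m m"
  "vdot [0,0,0,0,0,0,1] (zs e) = e * d (Suc m) m" "vdot [0,0,0,1,0,0,0] (zs e) = rw m"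
  "vdot [0,0,0,0,1,0,0] (zs 1) = rw (Suc m)"
  "vdot [- (1 + 1),0,1 + 1,0,0,0,0] (zs e) = (\<Sum>i<m. gv i)"
  using sum_rw_cl by (simp_all add: zs_def gv_def rw_def[of m] rw_def[of "Suc m"] sum.distrib sum_subtractf sum_distrib_left[symmetric])

text \<open>The only loss in this inequality is the minimization over off-diagonal entries with
  fixed row and column sums; apart from it the Hessian is regrouped exactly.\<close>

lemma hess_lower:
  assumes e: "e = 0 \<and> n = Suc m \<or> e = 1 \<and> n = Suc (Suc m)"
    and Y: "Y = X e lam" and G: "0 \<le> coefG Y" and K: "0 \<le> coefK Y"
  shows "hess_form k n C d - lam * (\<Sum>i<n. dp k (d i) (d i))
    \<ge> (\<Sum>i<m. qf (formM Y) (zv e i)) + qf (formN Y) (zs e)"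
proof -
  have R0: "\<And>j. j < m \<Longrightarrow> C m j = d0" "C m m = g0" and R1: "\<And>j. j < m \<Longrightarrow> C (Suc m) j = d1" "C (Suc m) m = g1"
    by (simp_all add: sym_point_def)
  define SL where "SL = (\<Sum>i<m. L i)"
  define SP where "SP = (\<Sum>i<m. P i)"
  define Yy where "Yy = (\<Sum>i<m. d i m)"
  define Mrest where "Mrest = coefA Y * (\<Sum>i<m. (d i i)\<^sup>2) + coefA Y * (\<Sum>i<m. (d i m)\<^sup>2) + (coef0 Y - hI00 Y) * (\<Sum>i<m. (d m i)\<^sup>2)
       + e * (coef1 Y - hI10 Y) * (\<Sum>i<m. (d (Suc m) i)\<^sup>2) + hT Y * (\<Sum>i<m. (cl i)\<^sup>2) + 2 * hT0 Y * (\<Sum>i<m. cl i * d m i)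
       + 2 * (e * hT1 Y) * (\<Sum>i<m. cl i * d (Suc m) i) + 2 * (e * hT01 Y) * (\<Sum>i<m. d m i * d (Suc m) i)
       + 2 * (hI Y * (a - b)) * (\<Sum>i<m. L i * gv i) + hI Y * hm2 Y * (\<Sum>i<m. (L i)\<^sup>2)
       + hI0 Y * (\<Sum>i<m. (lR m d0 g0 i)\<^sup>2) + e * hI1 Y * (\<Sum>i<m. (lR (Suc m) d1 g1 i)\<^sup>2) + coefP Y * (\<Sum>i<m. (P i)\<^sup>2)
       - hIa Y * (\<Sum>i<m. (d i i - a * inverse p * P i)\<^sup>2) - hIc Y * (\<Sum>i<m. (d i m - c * inverse p * P i)\<^sup>2)
       + 2 * (b * hip Y * hIb Y) * (\<Sum>i<m. P i * (rw i - d i i))"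
  define Nrest where "Nrest = coef0 Y * (d m m)\<^sup>2 + e * coef1 Y * (d (Suc m) m)\<^sup>2 + hT Y * Yy\<^sup>2 + 2 * hT0 Y * (Yy * d m m)
       + 2 * (e * hT1 Y) * (Yy * d (Suc m) m) + 2 * (e * hT01 Y) * (d m m * d (Suc m) m)
       + hI Y * SL\<^sup>2 + 2 * hI0 Y * ((\<Sum>i<m. lR m d0 g0 i) * KR m d0 g0) + hm Y * hI0 Y * (KR m d0 g0)\<^sup>2
       + 2 * (e * hI1 Y) * ((\<Sum>i<m. lR (Suc m) d1 g1 i) * KR (Suc m) d1 g1) + e * (hm Y * hI1 Y) * (KR (Suc m) d1 g1)\<^sup>2
       + 2 * (hD0 Y * hip Y * hip0 Y) * (SP * PR m d0 g0) + 2 * (e * (hD1 Y * hip Y * hip1 Y)) * (SP * PR (Suc m) d1 g1)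
       + coefP0 Y * (PR m d0 g0)\<^sup>2 + e * coefP1 Y * (PR (Suc m) d1 g1)\<^sup>2
       + 2 * (d0 * hip0 Y * hI00 Y) * (rw m * PR m d0 g0) + 2 * (e * (d1 * hip1 Y * hI10 Y)) * (rw (Suc m) * PR (Suc m) d1 g1)
       - hI0m Y * (d m m - g0 * inverse p0 * PR m d0 g0)\<^sup>2 - e * hI1m Y * (d (Suc m) m - g1 * inverse p1 * PR (Suc m) d1 g1)\<^sup>2
       + e * hI01 Y * (d1 * rw m + g1 * d m m + d0 * rw (Suc m) + g0 * d (Suc m) m
         - s01 * (inverse p1 * PR (Suc m) d1 g1 + inverse p0 * PR m d0 g0))\<^sup>2
       - e * hD01 Y * (inverse p1 * PR (Suc m) d1 g1 - inverse p0 * PR m d0 g0)\<^sup>2 + hD Y * (hip Y * hip Y) * SP\<^sup>2"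
  have sel: "ha Y = a" "hb Y = b" "hc Y = c" "hd0 Y = d0" "hd1 Y = d1" "hchi Y = e" unfolding Y data_simps by simp_all
  have eM: "qf (formM Y) (zv e i) = coefA Y * (d i i)\<^sup>2 + coefA Y * (d i m)\<^sup>2 + (coef0 Y - hI00 Y) * (d m i)\<^sup>2
       + e * (coef1 Y - hI10 Y) * (d (Suc m) i)\<^sup>2 + hT Y * (cl i)\<^sup>2 + 2 * hT0 Y * (cl i * d m i)
       + 2 * (e * hT1 Y) * (cl i * d (Suc m) i) + 2 * (e * hT01 Y) * (d m i * d (Suc m) i)
       + 2 * (hI Y * (a - b)) * (L i * gv i) + hI Y * hm2 Y * (L i)\<^sup>2
       + hI0 Y * (lR m d0 g0 i)\<^sup>2 + e * hI1 Y * (lR (Suc m) d1 g1 i)\<^sup>2 + coefP Y * (P i)\<^sup>2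
       - hIa Y * (d i i - a * inverse p * P i)\<^sup>2 - hIc Y * (d i m - c * inverse p * P i)\<^sup>2
       + 2 * (b * hip Y * hIb Y) * (P i * (rw i - d i i))
       + coefG Y * him2 Y * (gv i)\<^sup>2 + coefK Y * him Y * (rw i - cl i)\<^sup>2" for i
    using e unfolding formM_def qf.simps vdot_units_M sel unfolding Y
    by (elim disjE conjE; hypsubst) (simp_all only: vdot_M dbl_def power2_eq_square mult_zero_left mult_zero_right mult_1_left add_0_left add_0_right diff_self diff_0_right, simp_all add: algebra_simps)
  have M: "(\<Sum>i<m. qf (formM Y) (zv e i)) = Mrest + coefG Y * him2 Y * (\<Sum>i<m. (gv i)\<^sup>2) + coefK Y * him Y * (\<Sum>i<m. (rw i - cl i)\<^sup>2)"
    unfolding eM Mrest_def by (simp only: sum.distrib sum_subtractf sum_distrib_left)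
  have N: "qf (formN Y) (zs e) = Nrest - coefG Y * (hhalf Y * (him1 Y * him2 Y)) * (\<Sum>i<m. gv i)\<^sup>2"
    using e unfolding formN_def qf.simps vdot_units_N(1-4,6) sel Nrest_def SL_def SP_def Yy_def unfolding Y
    by (elim disjE conjE; hypsubst) (simp_all only: vdot_N vdot_N_up vdot_units_N dbl_def power2_eq_square mult_zero_left mult_zero_right mult_1_left add_0_left add_0_right diff_self diff_0_right minus_zero, simp_all add: algebra_simps)
  define H where "H = (\<lambda>i j. pair_hessian (dp k (C i) (C i)) (dp k (C j) (C j)) (dp k (C i) (C j))
        (dp k (d i) (d i)) (dp k (d j) (d j)) (dp k (d i) (d j))
        (dp k (C i) (d i)) (dp k (C j) (d j)) (dp k (C i) (d j) + dp k (C j) (d i)))"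
  define E where "E = (\<lambda>i j. pair_hessian (dp k (C i) (C i)) 1 (C i j) (dp k (d i) (d i)) 0 0 (dp k (C i) (d i)) 0 (d i j))"
  define F where "F = (\<lambda>l i. \<Sum>j<l. H i j)"
  define Ee where "Ee = (\<lambda>i. \<Sum>j<k. E i j)"
  define N2 where "N2 = (\<lambda>i. dp k (d i) (d i))"
  have hf: "hess_form k n C d = (\<Sum>i<n. F i i) + pi * (\<Sum>i<n. N2 i) - (\<Sum>i<n. Ee i)"
    unfolding hess_form_def F_def H_def Ee_def E_def N2_def ..
  have Fs: "F (Suc m) (Suc m) = F m (Suc m) + H (Suc m) m" by (simp add: F_def)
  have split: "hess_form k n C d - lam * (\<Sum>i<n. dp k (d i) (d i)) = (\<Sum>i<m. F i i) + F m m + e * F m (Suc m) + e * H (Suc m) m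
     + pi * (SA + dp k (d m) (d m) + e * dp k (d (Suc m)) (d (Suc m))) - (\<Sum>i<m. Ee i) - Ee m - e * Ee (Suc m)
     - lam * (SA + dp k (d m) (d m) + e * dp k (d (Suc m)) (d (Suc m)))"
    using e
  proof (elim disjE conjE)
    assume "e = 0" "n = Suc m"
    thus "?thesis" unfolding SA_def hf N2_def[symmetric] row_sums_two(1)[OF \<open>n = Suc m\<close>] by (simp add: N2_def)
  next
    assume "e = 1" "n = Suc (Suc m)"
    thus "?thesis" unfolding SA_def hf N2_def[symmetric] row_sums_two(2)[OF \<open>n = Suc (Suc m)\<close>] Fs by (simp add: N2_def)
  qed
  have HH: "hess_form k n C d - lam * (\<Sum>i<n. dp k (d i) (d i))
     = (coefA Y - hIb Y) * Q2 + hI Y * (a - b)\<^sup>2 * (\<Sum>i<m. \<Sum>j<i. (d i j + d j i)\<^sup>2) + Mrest + Nrest"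
  proof -
    \<comment> \<open>The regrouping identity at the present point and direction; its left side
      lists the pair contributions in the order of \<open>split\<close>.\<close>
    note T = hess_total_arith[where chi = e and mm = "real m" and lam = lam and pi' = pi and ab = "a - b" and b = b and ?d0.0 = d0 and ?d1.0 = d1
      and ip = "inverse p" and ?ip0.0 = "inverse p0" and ?ip1.0 = "inverse p1"
      and D = "area p p s" and ?D0.0 = "area p0 p s0" and ?D1.0 = "area p1 p s1" and ?D01.0 = "area p1 p0 s01"
      and Da = "area p 1 a" and Db = "area p 1 b" and Dc = "area p 1 c" and ?D00.0 = "area p0 1 d0" and D0m = "area p0 1 g0"
      and ?D10.0 = "area p1 1 d1" and D1m = "area p1 1 g1"
      and I = "inverse (area p p s)" and ?I0.0 = "inverse (area p0 p s0)" and ?I1.0 = "inverse (area p1 p s1)" and ?I01.0 = "inverse (area p1 p0 s01)"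
      and Ia = "inverse (area p 1 a)" and Ib = "inverse (area p 1 b)" and Ic = "inverse (area p 1 c)"
      and ?I00.0 = "inverse (area p0 1 d0)" and I0m = "inverse (area p0 1 g0)" and ?I10.0 = "inverse (area p1 1 d1)" and I1m = "inverse (area p1 1 g1)"
      and T = "obtuse p p s" and ?T0.0 = "obtuse p0 p s0" and ?T1.0 = "obtuse p1 p s1" and ?T01.0 = "obtuse p1 p0 s01"
      and ?Sx2.0 = "\<Sum>i<m. (d i i)\<^sup>2" and ?Sy2.0 = "\<Sum>i<m. (d i m)\<^sup>2" and ?Su2.0 = "\<Sum>i<m. (d m i)\<^sup>2" and ?Sv2.0 = "\<Sum>i<m. (d (Suc m) i)\<^sup>2"
      and ?Q2.0 = Q2 and ?Scl2.0 = "\<Sum>i<m. (cl i)\<^sup>2" and Sclu = "\<Sum>i<m. cl i * d m i" and Sclv = "\<Sum>i<m. cl i * d (Suc m) i"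
      and Suv = "\<Sum>i<m. d m i * d (Suc m) i" and SLg = "\<Sum>i<m. L i * gv i" and ?SL2.0 = "\<Sum>i<m. (L i)\<^sup>2" and SL = SL
      and ?Sl02.0 = "\<Sum>i<m. (lR m d0 g0 i)\<^sup>2" and ?Sl0.0 = "\<Sum>i<m. lR m d0 g0 i"
      and ?Sl12.0 = "\<Sum>i<m. (lR (Suc m) d1 g1 i)\<^sup>2" and ?Sl1.0 = "\<Sum>i<m. lR (Suc m) d1 g1 i"
      and ?SP2.0 = "\<Sum>i<m. (P i)\<^sup>2" and SP = SP and Sea = "\<Sum>i<m. (d i i - a * inverse p * P i)\<^sup>2"
      and Sec = "\<Sum>i<m. (d i m - c * inverse p * P i)\<^sup>2" and SroP = "\<Sum>i<m. P i * (rw i - d i i)"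
      and Sgg = "\<Sum>i<m. \<Sum>j<i. (d i j + d j i)\<^sup>2" and Y = Yy and U = "rw m" and V = "rw (Suc m)" and ?e0.0 = "d m m" and ?e1.0 = "d (Suc m) m"
      and ?K0.0 = "KR m d0 g0" and ?K1.0 = "KR (Suc m) d1 g1" and ?P0.0 = "PR m d0 g0" and ?P1.0 = "PR (Suc m) d1 g1"
      and ?E0.0 = "d m m - g0 * inverse p0 * PR m d0 g0" and ?E1.0 = "d (Suc m) m - g1 * inverse p1 * PR (Suc m) d1 g1"
      and ?X01.0 = "d1 * rw m + g1 * d m m + d0 * rw (Suc m) + g0 * d (Suc m) m - s01 * (inverse p1 * PR (Suc m) d1 g1 + inverse p0 * PR m d0 g0)",
      folded SA_eq dp_self]
    show ?thesis
      unfolding Mrest_def Nrest_def coefA_def coef0_def coef1_def coefP_def coefP0_def coefP1_def unfolding Y unfolding data_simps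
    proof (rule trans[OF _ T])
      show "hess_form k n C d - lam * (\<Sum>i<n. dp k (d i) (d i)) = (real m - 1) * (area p p s * inverse p) * SA +
        obtuse p p s * ((\<Sum>i<m. (cl i)\<^sup>2) + Yy\<^sup>2 - SA) +
        inverse (area p p s) * ((a - b)\<^sup>2 * (\<Sum>i<m. \<Sum>j<i. (d i j + d j i)\<^sup>2) + 2 * (a - b) * (\<Sum>i<m. L i * gv i) + (real m - 2) * (\<Sum>i<m. (L i)\<^sup>2) + SL\<^sup>2)
        - area p p s * (inverse p)\<^sup>2 * (real m * (\<Sum>i<m. (P i)\<^sup>2) - SP\<^sup>2)
        + (real m * (area p0 p s0 * inverse p0) * dp k (d m) (d m) + area p0 p s0 * inverse p * SA + 2 * obtuse p0 p s0 * ((\<Sum>i<m. cl i * d m i) + Yy * d m m)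
           + inverse (area p0 p s0) * ((\<Sum>i<m. (lR m d0 g0 i)\<^sup>2) + 2 * KR m d0 g0 * (\<Sum>i<m. lR m d0 g0 i) + real m * (KR m d0 g0)\<^sup>2)
           - area p0 p s0 * (real m * (inverse p0 * PR m d0 g0)\<^sup>2 - 2 * (inverse p0 * PR m d0 g0) * inverse p * SP + (inverse p)\<^sup>2 * (\<Sum>i<m. (P i)\<^sup>2)))
        + e * (real m * (area p1 p s1 * inverse p1) * dp k (d (Suc m)) (d (Suc m)) + area p1 p s1 * inverse p * SA + 2 * obtuse p1 p s1 * ((\<Sum>i<m. cl i * d (Suc m) i) + Yy * d (Suc m) m)
           + inverse (area p1 p s1) * ((\<Sum>i<m. (lR (Suc m) d1 g1 i)\<^sup>2) + 2 * KR (Suc m) d1 g1 * (\<Sum>i<m. lR (Suc m) d1 g1 i) + real m * (KR (Suc m) d1 g1)\<^sup>2)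
           - area p1 p s1 * (real m * (inverse p1 * PR (Suc m) d1 g1)\<^sup>2 - 2 * (inverse p1 * PR (Suc m) d1 g1) * inverse p * SP + (inverse p)\<^sup>2 * (\<Sum>i<m. (P i)\<^sup>2)))
        + e * (area p1 p0 s01 * inverse p1 * dp k (d (Suc m)) (d (Suc m)) + area p1 p0 s01 * inverse p0 * dp k (d m) (d m)
           + 2 * obtuse p1 p0 s01 * ((\<Sum>i<m. d m i * d (Suc m) i) + d m m * d (Suc m) m)
           + inverse (area p1 p0 s01) * (d1 * rw m + g1 * d m m + d0 * rw (Suc m) + g0 * d (Suc m) m - s01 * (inverse p1 * PR (Suc m) d1 g1 + inverse p0 * PR m d0 g0))\<^sup>2
           - area p1 p0 s01 * (inverse p1 * PR (Suc m) d1 g1 - inverse p0 * PR m d0 g0)\<^sup>2)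
        + pi * (SA + dp k (d m) (d m) + e * dp k (d (Suc m)) (d (Suc m)))
        - ((area p 1 a + (real m - 1) * area p 1 b + area p 1 c) * inverse p * SA
           + inverse (area p 1 a) * (\<Sum>i<m. (d i i - a * inverse p * P i)\<^sup>2) + inverse (area p 1 c) * (\<Sum>i<m. (d i m - c * inverse p * P i)\<^sup>2)
           + inverse (area p 1 b) * (Q2 - 2 * b * inverse p * (\<Sum>i<m. P i * (rw i - d i i)) + (real m - 1) * (b * inverse p)\<^sup>2 * (\<Sum>i<m. (P i)\<^sup>2))
           - (area p 1 a + (real m - 1) * area p 1 b + area p 1 c) * (inverse p)\<^sup>2 * (\<Sum>i<m. (P i)\<^sup>2))
        - ((real m * area p0 1 d0 + area p0 1 g0) * inverse p0 * dp k (d m) (d m)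
           + inverse (area p0 1 d0) * ((\<Sum>i<m. (d m i)\<^sup>2) - 2 * d0 * inverse p0 * PR m d0 g0 * rw m + real m * (d0 * inverse p0 * PR m d0 g0)\<^sup>2)
           + inverse (area p0 1 g0) * (d m m - g0 * inverse p0 * PR m d0 g0)\<^sup>2
           - (real m * area p0 1 d0 + area p0 1 g0) * (inverse p0 * PR m d0 g0)\<^sup>2)
        - e * ((real m * area p1 1 d1 + area p1 1 g1) * inverse p1 * dp k (d (Suc m)) (d (Suc m))
           + inverse (area p1 1 d1) * ((\<Sum>i<m. (d (Suc m) i)\<^sup>2) - 2 * d1 * inverse p1 * PR (Suc m) d1 g1 * rw (Suc m) + real m * (d1 * inverse p1 * PR (Suc m) d1 g1)\<^sup>2)
           + inverse (area p1 1 g1) * (d (Suc m) m - g1 * inverse p1 * PR (Suc m) d1 g1)\<^sup>2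
           - (real m * area p1 1 d1 + area p1 1 g1) * (inverse p1 * PR (Suc m) d1 g1)\<^sup>2)
        - lam * (SA + dp k (d m) (d m) + e * dp k (d (Suc m)) (d (Suc m)))"
        unfolding split SL_def SP_def Yy_def gv_def Q2_def F_def H_def Ee_def E_def hess_ww hess_we hess_rr
        by (simp only: hess_wr[OF R0] hess_wr[OF R1] hess_re[OF R0] hess_re[OF R1])
    qed
  qed
  have "(coefA Y - hIb Y) * Q2 + hI Y * (a - b)\<^sup>2 * (\<Sum>i<m. \<Sum>j<i. (d i j + d j i)\<^sup>2)
    \<ge> coefG Y * him2 Y * (\<Sum>i<m. (gv i)\<^sup>2) - coefG Y * (hhalf Y * (him1 Y * him2 Y)) * (\<Sum>i<m. gv i)\<^sup>2
      + coefK Y * him Y * (\<Sum>i<m. (rw i - cl i)\<^sup>2)" by (rule off_diagonal_lower[OF G K Y])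
  thus ?thesis unfolding HH M N by argo
qed
end

section \<open>Separation into means over the block and centered variables\<close>

definition lift_form :: "'a::{plus,times,zero} \<Rightarrow> ('a \<times> 'a list \<times> 'a list) list \<Rightarrow> ('a \<times> 'a list \<times> 'a list) list" where
  "lift_form \<mu> fs = map (\<lambda>(\<kappa>, l, l'). (\<mu> * \<kappa>, up l, up l')) fs"

lemma qf_append: "qf (fs @ gs) z = qf fs z + qf gs z"
  by (induction fs z rule: qf.induct) simp_all

lemma length_formM: "(\<kappa>, l, l') \<in> set (formM X) \<Longrightarrow> length l = 6 \<and> length l' = 6"
  unfolding formM_def vP_def vL_def vl0_def vl1_def vEa_def vEc_def by auto

context symmetric_perturbation
begin

text \<open>Each of the six variables minus its mean over the block. Centered vectors and constant
  ones are orthogonal under permutations, so the form falls apart into the two.\<close>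

definition "zc e i = (let \<mu> = inverse (real m) in
  [d i i - \<mu> * (\<Sum>j<m. d j j), d i m - \<mu> * (\<Sum>j<m. d j m), rw i - \<mu> * (\<Sum>j<m. rw j), cl i - \<mu> * (\<Sum>j<m. cl j),
   d m i - \<mu> * (\<Sum>j<m. d m j), e * d (Suc m) i - \<mu> * (\<Sum>j<m. e * d (Suc m) j)])"

lemma vdot_zc:
  assumes "length l = 6"
  shows "vdot l (zc e i) = vdot l (zv e i) - inverse (real m) * vdot (up l) (zs e)"
proof -
  obtain x1 x2 x3 x4 x5 x6 where "l = [x1, x2, x3, x4, x5, x6]"
    using assms(1) by (auto simp: numeral_eq_Suc length_Suc_conv)
  thus ?thesis by (simp add: zc_def zv_def zs_def Let_def sum_rw_cl[symmetric] algebra_simps)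
qed

lemma centered_product_sum:
  fixes u v :: "nat \<Rightarrow> real"
  shows "(\<Sum>i<m. (u i - inverse (real m) * (\<Sum>j<m. u j)) * (v i - inverse (real m) * (\<Sum>j<m. v j)))
    = (\<Sum>i<m. u i * v i) - inverse (real m) * ((\<Sum>j<m. u j) * (\<Sum>j<m. v j))"
proof -
  define U where "U = (\<Sum>j<m. u j)"
  define W where "W = (\<Sum>j<m. v j)"
  have "(\<Sum>i<m. (u i - inverse (real m) * U) * (v i - inverse (real m) * W))
     = (\<Sum>i<m. u i * v i - inverse (real m) * W * u i - inverse (real m) * U * v i + inverse (real m) * U * (inverse (real m) * W))"
    by (intro sum.cong refl) (simp add: algebra_simps)
  also have "\<dots> = (\<Sum>i<m. u i * v i) - inverse (real m) * W * U - inverse (real m) * U * W + real m * (inverse (real m) * U * (inverse (real m) * W))"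
    unfolding sum.distrib sum_subtractf sum_distrib_left[symmetric] U_def[symmetric] W_def[symmetric] by simp
  also have "real m * (inverse (real m) * U * (inverse (real m) * W)) = inverse (real m) * U * W"
    using m by (simp add: field_simps)
  finally show ?thesis unfolding U_def W_def by simp
qed

text \<open>A sum of products equals the sum of the centered products plus 1/m times the product of
  the sums; \<open>lift_form\<close> writes the latter in the invariant quantities.\<close>

lemma sum_qf_centered:
  assumes "\<And>\<kappa> l l'. (\<kappa>, l, l') \<in> set fs \<Longrightarrow> length l = 6 \<and> length l' = 6"
  shows "(\<Sum>i<m. qf fs (zc e i)) = (\<Sum>i<m. qf fs (zv e i)) - qf (lift_form (inverse (real m)) fs) (zs e)"
  using assms
proof (induction fs)
  case (Cons f fs)
  obtain \<kappa> l l' where f: "f = (\<kappa>, l, l')" by (cases f)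
  have l: "length l = 6" "length l' = 6" using Cons.prems[of \<kappa> l l'] by (auto simp: f)
  have IH: "(\<Sum>i<m. qf fs (zc e i)) = (\<Sum>i<m. qf fs (zv e i)) - qf (lift_form (inverse (real m)) fs) (zs e)"
    by (rule Cons.IH) (use Cons.prems in auto)
  have "(\<Sum>i<m. vdot l (zc e i) * vdot l' (zc e i)) = (\<Sum>i<m. vdot l (zv e i) * vdot l' (zv e i))
     - inverse (real m) * (vdot (up l) (zs e) * vdot (up l') (zs e))"
    unfolding vdot_zc[OF l(1)] vdot_zc[OF l(2)] vdot_up_zs[OF l(1)] vdot_up_zs[OF l(2)] by (rule centered_product_sum)
  hence "\<kappa> * (\<Sum>i<m. vdot l (zc e i) * vdot l' (zc e i)) = \<kappa> * (\<Sum>i<m. vdot l (zv e i) * vdot l' (zv e i))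
     - inverse (real m) * \<kappa> * (vdot (up l) (zs e) * vdot (up l') (zs e))" by (simp add: right_diff_distrib)
  thus ?case using IH by (simp add: f lift_form_def sum.distrib sum_distrib_left[symmetric])
qed (simp add: lift_form_def)

text \<open>\<open>formM\<close> controls the centered part. Its contribution at the means is added
  to \<open>formN\<close>, and this sum is the second form to be checked.\<close>

lemma hess_form_lower:
  assumes e: "e = 0 \<and> n = Suc m \<or> e = 1 \<and> n = Suc (Suc m)"
    and Y: "Y = X e lam" and G: "0 \<le> coefG Y" and K: "0 \<le> coefK Y"
    and M: "\<And>z. length z = 6 \<Longrightarrow> 0 \<le> qf (formM Y) z"
    and N: "\<And>z. length z = 7 \<Longrightarrow> 0 \<le> qf (formN Y @ lift_form (him Y) (formM Y)) z"
  shows "hess_form k n C d \<ge> lam * (\<Sum>i<n. dp k (d i) (d i))"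
proof -
  have h: "him Y = inverse (real m)" unfolding Y data_simps by simp
  have "0 \<le> (\<Sum>i<m. qf (formM Y) (zc e i))" by (intro sum_nonneg M) (simp add: zc_def Let_def)
  also have "\<dots> = (\<Sum>i<m. qf (formM Y) (zv e i)) - qf (lift_form (inverse (real m)) (formM Y)) (zs e)"
    by (rule sum_qf_centered) (rule length_formM)
  finally have "(\<Sum>i<m. qf (formM Y) (zv e i)) \<ge> qf (lift_form (inverse (real m)) (formM Y)) (zs e)" by simp
  moreover have "0 \<le> qf (formN Y) (zs e) + qf (lift_form (inverse (real m)) (formM Y)) (zs e)"
    using N[of "zs e"] unfolding qf_append h by (simp add: zs_def)
  ultimately show ?thesis using hess_lower[OF e Y G K] by linarith
qed
end

section \<open>Symmetric matrices as upper triangular lists of rows\<close>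

fun tri_row :: "'a::{plus,times} \<Rightarrow> 'a \<Rightarrow> 'a list \<Rightarrow> 'a list \<Rightarrow> 'a list" where
  "tri_row u v (a # as) (b # bs) = (u * b + v * a) # tri_row u v as bs"
| "tri_row u v _ _ = []"

text \<open>The symmetric matrix kappa (l l'^T + l' l^T), each row starting at the diagonal. It
  represents twice the product of the functionals, which avoids halving the off-diagonal
  entries.\<close>

fun tri_of :: "'a::{plus,times} \<Rightarrow> 'a list \<Rightarrow> 'a list \<Rightarrow> 'a list list" where
  "tri_of \<kappa> (a # as) (b # bs) = tri_row (\<kappa> * a) (\<kappa> * b) (a # as) (b # bs) # tri_of \<kappa> as bs"
| "tri_of \<kappa> _ _ = []"

fun row_add :: "'a::plus list \<Rightarrow> 'a list \<Rightarrow> 'a list" where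
  "row_add (a # as) (b # bs) = (a + b) # row_add as bs"
| "row_add _ _ = []"

fun tri_add :: "'a::plus list list \<Rightarrow> 'a list list \<Rightarrow> 'a list list" where
  "tri_add (r # rs) (q # qs) = row_add r q # tri_add rs qs"
| "tri_add _ _ = []"

fun tri_sum :: "'a::{plus,times} list list \<Rightarrow> ('a \<times> 'a list \<times> 'a list) list \<Rightarrow> 'a list list" where
  "tri_sum A [] = A"
| "tri_sum A ((\<kappa>, l, l') # fs) = tri_sum (tri_add A (tri_of \<kappa> l l')) fs"

fun row_schur :: "'a::{minus,times} \<Rightarrow> 'a list \<Rightarrow> 'a list \<Rightarrow> 'a list" where
  "row_schur u (a # as) (b # bs) = (a - u * b) # row_schur u as bs"
| "row_schur u _ _ = []"

text \<open>Subtraction of y b b^T: a Schur complement when \<open>y\<close> is the inverse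
  pivot.\<close>

fun tri_schur :: "'a::{minus,times} \<Rightarrow> 'a list list \<Rightarrow> 'a list \<Rightarrow> 'a list list" where
  "tri_schur y (r # rs) (b # bs) = row_schur (y * b) r (b # bs) # tri_schur y rs bs"
| "tri_schur y _ _ = []"

fun tri_form :: "real list list \<Rightarrow> real list \<Rightarrow> real" where
  "tri_form ((a # bs) # rs) (x # xs) = a * x * x + 2 * x * vdot bs xs + tri_form rs xs"
| "tri_form _ _ = 0"

fun tri_shape :: "nat \<Rightarrow> 'a list list \<Rightarrow> bool" where
  "tri_shape 0 A \<longleftrightarrow> A = []"
| "tri_shape (Suc n) A \<longleftrightarrow> (\<exists>r rs. A = r # rs \<and> length r = Suc n \<and> tri_shape n rs)"

lemma vdot_row_add: "length r = length q \<Longrightarrow> vdot (row_add r q) z = vdot r z + vdot q z"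
proof (induction r q arbitrary: z rule: row_add.induct)
  case (1 a as b bs)
  thus ?case by (cases z) (auto simp: distrib_right)
qed auto

lemma length_row_add: "length r = length q \<Longrightarrow> length (row_add r q) = length q"
  by (induction r q rule: row_add.induct) auto

lemma tri_add_correct:
  "tri_shape n A \<Longrightarrow> tri_shape n B \<Longrightarrow> length z = n \<Longrightarrow>
     tri_shape n (tri_add A B) \<and> tri_form (tri_add A B) z = tri_form A z + tri_form B z"
proof (induction n arbitrary: A B z)
  case (Suc n)
  obtain a as A' where A: "A = (a # as) # A'" "length as = n" "tri_shape n A'" using Suc.prems(1) by (auto simp: length_Suc_conv)
  obtain b bs B' where B: "B = (b # bs) # B'" "length bs = n" "tri_shape n B'" using Suc.prems(2) by (auto simp: length_Suc_conv)
  obtain x xs where z: "z = x # xs" "length xs = n" using Suc.prems(3) by (auto simp: length_Suc_conv)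
  show ?case using Suc.IH[OF A(3) B(3) z(2)] A(2) B(2)
    by (simp add: A(1) B(1) z(1) vdot_row_add length_row_add algebra_simps)
qed simp

lemma vdot_tri_row: "length as = length bs \<Longrightarrow> vdot (tri_row u v as bs) z = u * vdot bs z + v * vdot as z"
proof (induction u v as bs arbitrary: z rule: tri_row.induct)
  case (1 u v a as b bs)
  thus ?case by (cases z) (auto simp: algebra_simps)
qed auto

lemma length_tri_row: "length as = length bs \<Longrightarrow> length (tri_row u v as bs) = length bs"
  by (induction u v as bs rule: tri_row.induct) auto

lemma tri_of_correct:
  "length l = n \<Longrightarrow> length l' = n \<Longrightarrow> length z = n \<Longrightarrow>
     tri_shape n (tri_of \<kappa> l l') \<and> tri_form (tri_of \<kappa> l l') z = 2 * (\<kappa> * (vdot l z * vdot l' z))"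
proof (induction n arbitrary: l l' z)
  case (Suc n)
  obtain a as where l: "l = a # as" "length as = n" using Suc.prems(1) by (auto simp: length_Suc_conv)
  obtain b bs where l': "l' = b # bs" "length bs = n" using Suc.prems(2) by (auto simp: length_Suc_conv)
  obtain x xs where z: "z = x # xs" "length xs = n" using Suc.prems(3) by (auto simp: length_Suc_conv)
  show ?case using Suc.IH[OF l(2) l'(2) z(2)] l(2) l'(2)
    by (simp add: l(1) l'(1) z(1) vdot_tri_row length_tri_row algebra_simps)
qed simp

lemma tri_sum_correct:
  assumes "\<And>\<kappa> l l'. (\<kappa>, l, l') \<in> set fs \<Longrightarrow> length l = n \<and> length l' = n" "tri_shape n A" "length z = n"
  shows "tri_shape n (tri_sum A fs) \<and> tri_form (tri_sum A fs) z = tri_form A z + 2 * qf fs z"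
  using assms
proof (induction A fs rule: tri_sum.induct)
  case (2 A \<kappa> l l' fs)
  have l: "length l = n" "length l' = n" using "2.prems"(1)[of \<kappa> l l'] by auto
  note o = tri_of_correct[OF l "2.prems"(3), of \<kappa>]
  note a = tri_add_correct[OF "2.prems"(2) conjunct1[OF o] "2.prems"(3)]
  have "tri_shape n (tri_sum (tri_add A (tri_of \<kappa> l l')) fs)
     \<and> tri_form (tri_sum (tri_add A (tri_of \<kappa> l l')) fs) z = tri_form (tri_add A (tri_of \<kappa> l l')) z + 2 * qf fs z"
    by (rule "2.IH") (use "2.prems" a in auto)
  thus ?case using o a by simp
qed simp

lemma vdot_row_schur: "length r = length b \<Longrightarrow> vdot (row_schur u r b) z = vdot r z - u * vdot b z"
proof (induction u r b arbitrary: z rule: row_schur.induct)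
  case (1 u a as b bs)
  thus ?case by (cases z) (auto simp: algebra_simps)
qed auto

lemma length_row_schur: "length r = length b \<Longrightarrow> length (row_schur u r b) = length b"
  by (induction u r b rule: row_schur.induct) auto

lemma tri_schur_correct:
  "tri_shape n A \<Longrightarrow> length b = n \<Longrightarrow> length z = n \<Longrightarrow>
     tri_shape n (tri_schur y A b) \<and> tri_form (tri_schur y A b) z = tri_form A z - y * (vdot b z)\<^sup>2"
proof (induction n arbitrary: A b z)
  case (Suc n)
  obtain a as A' where A: "A = (a # as) # A'" "length as = n" "tri_shape n A'" using Suc.prems(1) by (auto simp: length_Suc_conv)
  obtain b' bs where b: "b = b' # bs" "length bs = n" using Suc.prems(2) by (auto simp: length_Suc_conv)
  obtain x xs where z: "z = x # xs" "length xs = n" using Suc.prems(3) by (auto simp: length_Suc_conv)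
  show ?case using Suc.IH[OF A(3) b(2) z(2)] A(2) b(2)
    by (simp add: A(1) b(1) z(1) vdot_row_schur length_row_schur power2_eq_square algebra_simps)
qed simp

text \<open>An upper bound \<open>y\<close> of the inverse pivot suffices: \<open>a x\<^sup>2 + 2 x t \<ge> - t\<^sup>2 / a \<ge> - y t\<^sup>2\<close>.\<close>

lemma pivot_lower: "a * x * x + 2 * x * t \<ge> - (y * t\<^sup>2)" if "0 < a" "1 \<le> a * y" for a x t y :: real
proof -
  have "0 \<le> (a * x + t)\<^sup>2" by simp
  moreover have "t\<^sup>2 \<le> a * y * t\<^sup>2" using that(2) mult_right_mono[of 1 "a * y" "t\<^sup>2"] by simp
  ultimately have "0 \<le> a * (a * x * x + 2 * x * t + y * t\<^sup>2)" by (simp add: power2_eq_square algebra_simps)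
  thus ?thesis using that(1) by (simp add: zero_le_mult_iff)
qed

text \<open>One step of Gaussian elimination: bounding the first variable away costs at most the
  rank-one term that \<open>tri_schur\<close> subtracts.\<close>

lemma tri_form_pivot:
  assumes "tri_shape n A" "length b = n" "\<And>z. length z = n \<Longrightarrow> 0 \<le> tri_form (tri_schur y A b) z" "0 < a" "1 \<le> a * y" "length z = Suc n"
  shows "0 \<le> tri_form ((a # b) # A) z"
proof -
  obtain x xs where z: "z = x # xs" "length xs = n" using assms(6) by (auto simp: length_Suc_conv)
  show ?thesis using tri_schur_correct[OF assms(1,2) z(2), of y] assms(3)[OF z(2)] pivot_lower[OF assms(4,5), where x = x and t = "vdot b xs"]
    by (simp add: z(1))
qed

section \<open>Gradient, loss and nondegeneracy at a symmetric point\<close>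

lemma sum_pairs_const: "(\<Sum>i<m. \<Sum>j<i. c) = real m * (real m - 1) / 2 * c" for c :: real
  by (induction m) (simp_all add: field_simps)

context symmetric_perturbation
begin

abbreviation "Sx \<equiv> \<Sum>i<m. d i i"
abbreviation "Sy \<equiv> \<Sum>i<m. d i m"
abbreviation "Sr \<equiv> \<Sum>i<m. rw i"

lemma sum_P: "(\<Sum>i<m. P i) = (a - b) * Sx + b * Sr + c * Sy"
  unfolding P_def by (simp add: sum.distrib sum_distrib_left)

lemma grad_ww:
  "(\<Sum>i<m. \<Sum>j<i. pair_gradient (dp k (C i) (C i)) (dp k (C j) (C j)) (dp k (C i) (C j))
        (dp k (C i) (d i)) (dp k (C j) (d j)) (dp k (C i) (d j) + dp k (C j) (d i)))
   = area p p s * inverse p * ((real m - 1) * ((a - b) * Sx + b * Sr + c * Sy))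
     + obtuse p p s * ((a - b) * (Sr - Sx) + (real m - 1) * (b * Sr + c * Sy))"
proof -
  have t: "pair_gradient (dp k (C i) (C i)) (dp k (C j) (C j)) (dp k (C i) (C j))
        (dp k (C i) (d i)) (dp k (C j) (d j)) (dp k (C i) (d j) + dp k (C j) (d i))
     = area p p s * inverse p * (P i + P j) + obtuse p p s * ((a - b) * (d i j + d j i))
       + obtuse p p s * ((b * rw i + c * d i m) + (b * rw j + c * d j m))" if ij: "i < m" "j < i" for i j
  proof -
    have jm: "j < m" "i \<noteq> j" using ij by auto
    have S: "dp k (C i) (d j) + dp k (C j) (d i) = (a - b) * (d i j + d j i) + ((b * rw i + c * d i m) + (b * rw j + c * d j m))"
      by (simp only: dp_row[OF ij(1)] dp_row[OF jm(1)] rw_def[symmetric]) (simp only: algebra_simps)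
    show ?thesis
      unfolding gram_rows(1)[OF ij(1)] gram_rows(1)[OF jm(1)] gram_rows(4)[OF ij(1) jm] dpP(1)[OF ij(1)] dpP(1)[OF jm(1)]
        pair_gradient_eq S by (simp only: distrib_left mult.assoc add.assoc)
  qed
  have "(\<Sum>i<m. \<Sum>j<i. pair_gradient (dp k (C i) (C i)) (dp k (C j) (C j)) (dp k (C i) (C j))
        (dp k (C i) (d i)) (dp k (C j) (d j)) (dp k (C i) (d j) + dp k (C j) (d i)))
    = (\<Sum>i<m. \<Sum>j<i. area p p s * inverse p * (P i + P j) + obtuse p p s * ((a - b) * (d i j + d j i))
       + obtuse p p s * ((b * rw i + c * d i m) + (b * rw j + c * d j m)))"
    by (intro sum.cong refl) (use t in auto)
  also have "\<dots> = area p p s * inverse p * (\<Sum>i<m. \<Sum>j<i. P i + P j) + obtuse p p s * ((a - b) * (\<Sum>i<m. \<Sum>j<i. d i j + d j i))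
     + obtuse p p s * (\<Sum>i<m. \<Sum>j<i. (b * rw i + c * d i m) + (b * rw j + c * d j m))"
    by (simp only: sum.distrib sum_distrib_left[symmetric])
  also have "(\<Sum>i<m. \<Sum>j<i. P i + P j) = (real m - 1) * (\<Sum>i<m. P i)" by (rule sum_pairs_add)
  also have "(\<Sum>i<m. \<Sum>j<i. (b * rw i + c * d i m) + (b * rw j + c * d j m)) = (real m - 1) * (\<Sum>i<m. b * rw i + c * d i m)"
    by (rule sum_pairs_add)
  also have "(\<Sum>i<m. b * rw i + c * d i m) = b * Sr + c * Sy" by (simp add: sum.distrib sum_distrib_left)
  also have "(\<Sum>i<m. \<Sum>j<i. d i j + d j i) = Sr - Sx"
  proof -
    have "(\<Sum>i<m. \<Sum>j<i. d i j + d j i) = ((\<Sum>i<m. \<Sum>j<m. d i j + d j i) - (\<Sum>i<m. d i i + d i i)) / 2"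
      by (rule sum_pairs_half) (rule add.commute)
    moreover have "(\<Sum>i<m. \<Sum>j<m. d j i) = (\<Sum>i<m. \<Sum>j<m. d i j)" by (rule sum.swap)
    ultimately show ?thesis by (simp add: sum.distrib rw_def sum_distrib_left[symmetric])
  qed
  finally show ?thesis unfolding sum_P by (simp only: distrib_left add.assoc)
qed

lemma grad_wr:
  assumes R: "\<And>j. j < m \<Longrightarrow> C R j = dd" "C R m = gg"
  shows "(\<Sum>j<m. pair_gradient (dp k (C R) (C R)) (dp k (C j) (C j)) (dp k (C R) (C j))
        (dp k (C R) (d R)) (dp k (C j) (d j)) (dp k (C R) (d j) + dp k (C j) (d R)))
   = area (pr dd gg) p (sr dd gg) * (real m * inverse (pr dd gg) * PR R dd gg + inverse p * ((a - b) * Sx + b * Sr + c * Sy))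
     + obtuse (pr dd gg) p (sr dd gg) * (dd * Sr + gg * Sy + (a - b) * rw R + real m * (b * rw R + c * d R m))"
proof -
  have dpR: "dp k (C R) y = dd * (\<Sum>j<m. y j) + gg * y m" for y
    using R by (simp add: dp_def sum_distrib_left)
  have RR: "dp k (C R) (C R) = pr dd gg" unfolding dpR using R by simp
  have RP: "dp k (C R) (d R) = PR R dd gg" unfolding dpR PR_def rw_def ..
  have Rj: "dp k (C R) (C j) = sr dd gg" if "j < m" for j
    unfolding dpR sum_row[OF that] using that by (simp add: sym_point_def)
  have "(\<Sum>j<m. pair_gradient (dp k (C R) (C R)) (dp k (C j) (C j)) (dp k (C R) (C j))
        (dp k (C R) (d R)) (dp k (C j) (d j)) (dp k (C R) (d j) + dp k (C j) (d R)))
    = (\<Sum>j<m. area (pr dd gg) p (sr dd gg) * (inverse (pr dd gg) * PR R dd gg) + area (pr dd gg) p (sr dd gg) * inverse p * P j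
       + obtuse (pr dd gg) p (sr dd gg) * (dd * rw j + gg * d j m + (a - b) * d R j + (b * rw R + c * d R m)))"
  proof (intro sum.cong refl)
    fix j assume "j \<in> {..<m}"
    hence j: "j < m" by simp
    show "pair_gradient (dp k (C R) (C R)) (dp k (C j) (C j)) (dp k (C R) (C j))
        (dp k (C R) (d R)) (dp k (C j) (d j)) (dp k (C R) (d j) + dp k (C j) (d R))
      = area (pr dd gg) p (sr dd gg) * (inverse (pr dd gg) * PR R dd gg) + area (pr dd gg) p (sr dd gg) * inverse p * P j
       + obtuse (pr dd gg) p (sr dd gg) * (dd * rw j + gg * d j m + (a - b) * d R j + (b * rw R + c * d R m))"
      unfolding RR Rj[OF j] gram_rows(1)[OF j] dpP(1)[OF j] RP pair_gradient_eq unfolding dpR dp_row[OF j] rw_def[symmetric]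
      by (simp only: distrib_left mult.assoc add.assoc)
  qed
  also have "\<dots> = area (pr dd gg) p (sr dd gg) * (real m * inverse (pr dd gg) * PR R dd gg) + area (pr dd gg) p (sr dd gg) * inverse p * (\<Sum>j<m. P j)
     + obtuse (pr dd gg) p (sr dd gg) * (dd * Sr + gg * Sy + (a - b) * rw R + real m * (b * rw R + c * d R m))"
    by (simp add: sum.distrib sum_distrib_left[symmetric] rw_def[of R])
  finally show ?thesis unfolding sum_P by (simp only: distrib_left mult.assoc)
qed

lemma pair_gradient_target: "pair_gradient q 1 w Q 0 x = area q 1 w * inverse q * Q + obtuse q 1 w * x"
  unfolding pair_gradient_eq by (simp add: mult.assoc)

lemma grad_we:
  "(\<Sum>i<m. \<Sum>j<k. pair_gradient (dp k (C i) (C i)) 1 (C i j) (dp k (C i) (d i)) 0 (d i j))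
   = (area p 1 a + (real m - 1) * area p 1 b + area p 1 c) * inverse p * ((a - b) * Sx + b * Sr + c * Sy)
     + (obtuse p 1 a - obtuse p 1 b) * Sx + obtuse p 1 b * Sr + obtuse p 1 c * Sy"
proof -
  have r: "(\<Sum>j<k. pair_gradient (dp k (C i) (C i)) 1 (C i j) (dp k (C i) (d i)) 0 (d i j))
     = (area p 1 a + (real m - 1) * area p 1 b + area p 1 c) * inverse p * P i
       + (obtuse p 1 a - obtuse p 1 b) * d i i + obtuse p 1 b * rw i + obtuse p 1 c * d i m" if i: "i < m" for i
  proof -
    have "(\<Sum>j<m. pair_gradient p 1 (C i j) (P i) 0 (d i j))
       = (\<Sum>j<m. if j = i then pair_gradient p 1 a (P i) 0 (d i j) else pair_gradient p 1 b (P i) 0 (d i j))"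
      using i by (intro sum.cong) (auto simp: sym_point_def)
    also have "\<dots> = pair_gradient p 1 a (P i) 0 (d i i) - pair_gradient p 1 b (P i) 0 (d i i) + (\<Sum>j<m. pair_gradient p 1 b (P i) 0 (d i j))"
      by (rule sum_pick_fun[OF i])
    also have "(\<Sum>j<m. pair_gradient p 1 b (P i) 0 (d i j)) = real m * (area p 1 b * inverse p * P i) + obtuse p 1 b * rw i"
      unfolding pair_gradient_target rw_def by (simp add: sum.distrib sum_distrib_left)
    finally have *: "(\<Sum>j<m. pair_gradient p 1 (C i j) (P i) 0 (d i j)) = area p 1 a * inverse p * P i + obtuse p 1 a * d i i
      - (area p 1 b * inverse p * P i + obtuse p 1 b * d i i) + (real m * (area p 1 b * inverse p * P i) + obtuse p 1 b * rw i)"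
      unfolding pair_gradient_target .
    have "C i m = c" using i by (simp add: sym_point_def)
    hence "(\<Sum>j<k. pair_gradient (dp k (C i) (C i)) 1 (C i j) (dp k (C i) (d i)) 0 (d i j))
      = (\<Sum>j<m. pair_gradient p 1 (C i j) (P i) 0 (d i j)) + (area p 1 c * inverse p * P i + obtuse p 1 c * d i m)"
      unfolding gram_rows(1)[OF i] dpP(1)[OF i] by (simp add: pair_gradient_target)
    thus ?thesis unfolding * by (simp only: algebra_simps)
  qed
  have "(\<Sum>i<m. \<Sum>j<k. pair_gradient (dp k (C i) (C i)) 1 (C i j) (dp k (C i) (d i)) 0 (d i j))
    = (\<Sum>i<m. (area p 1 a + (real m - 1) * area p 1 b + area p 1 c) * inverse p * P i
       + (obtuse p 1 a - obtuse p 1 b) * d i i + obtuse p 1 b * rw i + obtuse p 1 c * d i m)"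
    by (intro sum.cong refl r) simp
  thus ?thesis by (simp only: sum.distrib sum_distrib_left[symmetric] sum_P)
qed

lemma grad_re:
  assumes R: "\<And>j. j < m \<Longrightarrow> C R j = dd" "C R m = gg"
  shows "(\<Sum>j<k. pair_gradient (dp k (C R) (C R)) 1 (C R j) (dp k (C R) (d R)) 0 (d R j))
   = (real m * area (pr dd gg) 1 dd + area (pr dd gg) 1 gg) * inverse (pr dd gg) * PR R dd gg
     + obtuse (pr dd gg) 1 dd * rw R + obtuse (pr dd gg) 1 gg * d R m"
proof -
  have dpR: "dp k (C R) y = dd * (\<Sum>j<m. y j) + gg * y m" for y
    using R by (simp add: dp_def sum_distrib_left)
  have RR: "dp k (C R) (C R) = pr dd gg" unfolding dpR using R by simp
  have RP: "dp k (C R) (d R) = PR R dd gg" unfolding dpR PR_def rw_def ..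
  have "(\<Sum>j<m. pair_gradient (pr dd gg) 1 (C R j) (PR R dd gg) 0 (d R j))
     = (\<Sum>j<m. area (pr dd gg) 1 dd * inverse (pr dd gg) * PR R dd gg + obtuse (pr dd gg) 1 dd * d R j)"
    by (intro sum.cong refl) (simp add: pair_gradient_target R)
  also have "\<dots> = real m * (area (pr dd gg) 1 dd * inverse (pr dd gg) * PR R dd gg) + obtuse (pr dd gg) 1 dd * rw R"
    by (simp add: sum.distrib sum_distrib_left[symmetric] rw_def)
  finally show ?thesis unfolding RR RP by (simp add: R pair_gradient_target algebra_simps)
qed

lemma grad_rr:
  "pair_gradient (dp k (C (Suc m)) (C (Suc m))) (dp k (C m) (C m)) (dp k (C (Suc m)) (C m))
        (dp k (C (Suc m)) (d (Suc m))) (dp k (C m) (d m)) (dp k (C (Suc m)) (d m) + dp k (C m) (d (Suc m)))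
   = area p1 p0 s01 * (inverse p1 * PR (Suc m) d1 g1 + inverse p0 * PR m d0 g0)
     + obtuse p1 p0 s01 * (d1 * rw m + g1 * d m m + d0 * rw (Suc m) + g0 * d (Suc m) m)"
  unfolding gram_rows dpP pair_gradient_eq unfolding dp_row0 dp_row1 rw_def[symmetric] by (simp only: add.assoc)

text \<open>\<open>cW\<close>, \<open>c0\<close> and \<open>c1\<close> are the total factors of the
  inner product of a row with its own direction, for a symmetric row and the two extra rows. The
  definitions from \<open>G\<alpha>\<close> on are the resulting coefficients of diagonal, row sum,
  last entry, and of the extra rows.\<close>

definition "cW e = pi + inverse p * ((real m - 1) * (area p p s - area p 1 b) + area p0 p s0 + e * area p1 p s1 - area p 1 a - area p 1 c)"
definition "c0 e = pi + inverse p0 * (real m * (area p0 p s0 - area p0 1 d0) + e * area p1 p0 s01 - area p0 1 g0)"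
definition "c1 = pi + inverse p1 * (real m * (area p1 p s1 - area p1 1 d1) + area p1 p0 s01 - area p1 1 g1)"
definition "G\<alpha> e = (a - b) * cW e - (a - b) * obtuse p p s - obtuse p 1 a + obtuse p 1 b"
definition "G\<beta> e = b * cW e + (a - b + (real m - 1) * b) * obtuse p p s + d0 * obtuse p0 p s0 + e * (d1 * obtuse p1 p s1) - obtuse p 1 b"
definition "G\<gamma> e = c * cW e + (real m - 1) * (c * obtuse p p s) + g0 * obtuse p0 p s0 + e * (g1 * obtuse p1 p s1) - obtuse p 1 c"
definition "G\<delta>0 e = d0 * c0 e + (a - b + real m * b) * obtuse p0 p s0 + e * (d1 * obtuse p1 p0 s01) - obtuse p0 1 d0"
definition "G\<epsilon>0 e = g0 * c0 e + real m * (c * obtuse p0 p s0) + e * (g1 * obtuse p1 p0 s01) - obtuse p0 1 g0"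
definition "G\<delta>1 = d1 * c1 + (a - b + real m * b) * obtuse p1 p s1 + d0 * obtuse p1 p0 s01 - obtuse p1 1 d1"
definition "G\<epsilon>1 = g1 * c1 + real m * (c * obtuse p1 p s1) + g0 * obtuse p1 p0 s01 - obtuse p1 1 g1"

lemma grad_total:
  assumes e: "e = 0 \<and> n = Suc m \<or> e = 1 \<and> n = Suc (Suc m)"
  shows "grad_form k n C d = G\<alpha> e * Sx + G\<beta> e * Sr + G\<gamma> e * Sy + (G\<delta>0 e * rw m + G\<epsilon>0 e * d m m)
    + e * (G\<delta>1 * rw (Suc m) + G\<epsilon>1 * d (Suc m) m)"
proof -
  have R0: "\<And>j. j < m \<Longrightarrow> C m j = d0" "C m m = g0" and R1: "\<And>j. j < m \<Longrightarrow> C (Suc m) j = d1" "C (Suc m) m = g1"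
    by (simp_all add: sym_point_def)
  define H where "H = (\<lambda>i j. pair_gradient (dp k (C i) (C i)) (dp k (C j) (C j)) (dp k (C i) (C j))
        (dp k (C i) (d i)) (dp k (C j) (d j)) (dp k (C i) (d j) + dp k (C j) (d i)))"
  define E where "E = (\<lambda>i j. pair_gradient (dp k (C i) (C i)) 1 (C i j) (dp k (C i) (d i)) 0 (d i j))"
  define F where "F = (\<lambda>l i. \<Sum>j<l. H i j)"
  define Ee where "Ee = (\<lambda>i. \<Sum>j<k. E i j)"
  define N2 where "N2 = (\<lambda>i. dp k (C i) (d i))"
  have gf: "grad_form k n C d = (\<Sum>i<n. F i i) + pi * (\<Sum>i<n. N2 i) - (\<Sum>i<n. Ee i)"
    unfolding grad_form_def F_def H_def Ee_def E_def N2_def ..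
  have Fs: "F (Suc m) (Suc m) = F m (Suc m) + H (Suc m) m" by (simp add: F_def)
  have N2: "(\<Sum>i<m. N2 i) = (a - b) * Sx + b * Sr + c * Sy" "N2 m = PR m d0 g0" "N2 (Suc m) = PR (Suc m) d1 g1"
    unfolding sum_P[symmetric] N2_def by (simp_all add: dpP)
  have split: "grad_form k n C d = (\<Sum>i<m. F i i) + F m m + e * F m (Suc m) + e * H (Suc m) m
     + pi * ((a - b) * Sx + b * Sr + c * Sy + PR m d0 g0 + e * PR (Suc m) d1 g1) - (\<Sum>i<m. Ee i) - Ee m - e * Ee (Suc m)"
    using e
  proof (elim disjE conjE)
    assume "e = 0" "n = Suc m"
    thus ?thesis unfolding gf row_sums_two(1)[OF \<open>n = Suc m\<close>] N2 by simp
  next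
    assume "e = 1" "n = Suc (Suc m)"
    thus ?thesis unfolding gf row_sums_two(2)[OF \<open>n = Suc (Suc m)\<close>] N2 Fs by simp
  qed
  show ?thesis using e
    unfolding split F_def H_def Ee_def E_def grad_ww grad_we grad_rr G\<alpha>_def G\<beta>_def G\<gamma>_def G\<delta>0_def G\<epsilon>0_def G\<delta>1_def G\<epsilon>1_def cW_def c0_def c1_def
    by (elim disjE conjE; hypsubst) (simp_all only: grad_wr[OF R0] grad_wr[OF R1] grad_re[OF R0] grad_re[OF R1] PR_def mult_zero_left mult_1_left add_0_right diff_0_right,
      simp_all only: algebra_simps)
qed

text \<open>The gradient inherits the symmetry of the point, so its matrix is a
  \<open>sym_point\<close> as well and at most seven numbers have to be small.\<close>

lemma grad_form_entries:
  assumes e: "e = 0 \<and> n = Suc m \<or> e = 1 \<and> n = Suc (Suc m)"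
  shows "grad_form k n C d = (\<Sum>i<n. \<Sum>j<k. sym_point m (G\<alpha> e + G\<beta> e) (G\<beta> e) (G\<gamma> e) (G\<delta>0 e) (G\<epsilon>0 e) G\<delta>1 G\<epsilon>1 i j * d i j)"
proof -
  \<comment> \<open>The same locale at the gradient matrix, so that its row formulas evaluate the
    pairing with \<open>d\<close>.\<close>
  interpret G: symmetric_perturbation m "G\<alpha> e + G\<beta> e" "G\<beta> e" "G\<gamma> e" "G\<delta>0 e" "G\<epsilon>0 e" G\<delta>1 G\<epsilon>1 d
    by (unfold_locales) (rule m)
  have "(\<Sum>i<n. \<Sum>j<k. G.C i j * d i j) = (\<Sum>i<n. dp k (G.C i) (d i))" unfolding dp_def ..
  also have "\<dots> = (\<Sum>i<m. dp k (G.C i) (d i)) + dp k (G.C m) (d m) + e * dp k (G.C (Suc m)) (d (Suc m))"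
    using e by auto
  also have "(\<Sum>i<m. dp k (G.C i) (d i)) = (\<Sum>i<m. G\<alpha> e * d i i + G\<beta> e * rw i + G\<gamma> e * d i m)"
    by (intro sum.cong refl) (simp add: G.dp_row rw_def)
  also have "\<dots> = G\<alpha> e * Sx + G\<beta> e * Sr + G\<gamma> e * Sy" by (simp only: sum.distrib sum_distrib_left)
  finally show ?thesis unfolding grad_total[OF e] G.dp_row0 G.dp_row1 rw_def by (rule sym)
qed

lemma scaled_loss_sym_point:
  assumes e: "e = 0 \<and> n = Suc m \<or> e = 1 \<and> n = Suc (Suc m)"
  shows "scaled_loss k n C = real m * (real m - 1) / 2 * Phi p p s + real m * Phi p0 p s0 + e * (real m * Phi p1 p s1 + Phi p1 p0 s01)
     + pi / 2 * (real m * p + p0 + e * p1)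
     - (real m * (Phi p 1 a + (real m - 1) * Phi p 1 b + Phi p 1 c) + (real m * Phi p0 1 d0 + Phi p0 1 g0) + e * (real m * Phi p1 1 d1 + Phi p1 1 g1))
     + (real k * pi + real k * (real k - 1)) / 2"
proof -
  define H where "H = (\<lambda>i j. Phi (dp k (C i) (C i)) (dp k (C j) (C j)) (dp k (C i) (C j)))"
  define E where "E = (\<lambda>i j. Phi (dp k (C i) (C i)) 1 (C i j))"
  define F where "F = (\<lambda>l i. \<Sum>j<l. H i j)"
  define Ee where "Ee = (\<lambda>i. \<Sum>j<k. E i j)"
  define N2 where "N2 = (\<lambda>i. dp k (C i) (C i))"
  have gf: "scaled_loss k n C = (\<Sum>i<n. F i i) + pi / 2 * (\<Sum>i<n. N2 i) - (\<Sum>i<n. Ee i) + (real k * pi + real k * (real k - 1)) / 2"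
    unfolding scaled_loss_def F_def H_def Ee_def E_def N2_def ..
  have Fs: "F (Suc m) (Suc m) = F m (Suc m) + H (Suc m) m" by (simp add: F_def)
  have N2: "(\<Sum>i<m. N2 i) = real m * p" "N2 m = p0" "N2 (Suc m) = p1"
    unfolding N2_def by (simp_all add: gram_rows)
  have split: "scaled_loss k n C = (\<Sum>i<m. F i i) + F m m + e * (F m (Suc m) + H (Suc m) m)
     + pi / 2 * (real m * p + p0 + e * p1) - ((\<Sum>i<m. Ee i) + Ee m + e * Ee (Suc m)) + (real k * pi + real k * (real k - 1)) / 2"
    using e
  proof (elim disjE conjE)
    assume "e = 0" "n = Suc m"
    thus ?thesis unfolding gf row_sums_two(1)[OF \<open>n = Suc m\<close>] N2 by simp
  next
    assume "e = 1" "n = Suc (Suc m)"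
    thus ?thesis unfolding gf row_sums_two(2)[OF \<open>n = Suc (Suc m)\<close>] N2 Fs by simp
  qed
  have 1: "(\<Sum>i<m. F i i) = real m * (real m - 1) / 2 * Phi p p s"
  proof -
    have "(\<Sum>i<m. F i i) = (\<Sum>i<m. \<Sum>j<i. Phi p p s)" unfolding F_def
      by (intro sum.cong refl) (auto simp: H_def gram_rows)
    thus ?thesis unfolding sum_pairs_const .
  qed
  have 2: "F m m = real m * Phi p0 p s0"
  proof -
    have "F m m = (\<Sum>j<m. Phi p0 p s0)" unfolding F_def by (intro sum.cong refl) (auto simp: H_def gram_rows)
    thus ?thesis by simp
  qed
  have 3: "F m (Suc m) = real m * Phi p1 p s1"
  proof -
    have "F m (Suc m) = (\<Sum>j<m. Phi p1 p s1)" unfolding F_def by (intro sum.cong refl) (auto simp: H_def gram_rows)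
    thus ?thesis by simp
  qed
  have 4: "H (Suc m) m = Phi p1 p0 s01" by (simp only: H_def gram_rows)
  have 5: "(\<Sum>i<m. Ee i) = real m * (Phi p 1 a + (real m - 1) * Phi p 1 b + Phi p 1 c)"
  proof -
    have "Ee i = Phi p 1 a + (real m - 1) * Phi p 1 b + Phi p 1 c" if i: "i < m" for i
    proof -
      have "(\<Sum>j<m. E i j) = (\<Sum>j<m. if j = i then Phi p 1 a else Phi p 1 b)"
        using i by (intro sum.cong) (auto simp: E_def gram_rows(1) sym_point_def[of m a b c d0 g0 d1 g1 i])
      also have "\<dots> = Phi p 1 a - Phi p 1 b + real m * Phi p 1 b" using sum_pick_fun[OF i, of "\<lambda>_. Phi p 1 a" "\<lambda>_. Phi p 1 b"] by simp
      finally have "(\<Sum>j<m. E i j) = Phi p 1 a + (real m - 1) * Phi p 1 b" by (simp add: algebra_simps)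
      moreover have "E i m = Phi p 1 c" using i unfolding E_def gram_rows(1)[OF i] by (simp add: sym_point_def)
      ultimately show ?thesis by (simp add: Ee_def)
    qed
    thus ?thesis by simp
  qed
  have 6: "Ee m = real m * Phi p0 1 d0 + Phi p0 1 g0" "Ee (Suc m) = real m * Phi p1 1 d1 + Phi p1 1 g1"
    unfolding Ee_def E_def gram_rows by (simp_all add: sym_point_def)
  show ?thesis unfolding split 1 2 3 4 5 6 ..
qed

text \<open>By symmetry three norms and eleven areas represent all rows and pairs. The second extra
  row is included in both cases; if it is absent, its dummy entries are chosen to pass.\<close>

lemma nondegenerate_sym_point:
  assumes n: "n \<le> Suc (Suc m)"
    and b: "\<And>q. q \<in> {p, p0, p1} \<Longrightarrow> 7 / 100 \<le> q \<and> q \<le> 11 / 10"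
    and A: "\<And>q r t. (q, r, t) \<in> {(p, p, s), (p0, p, s0), (p1, p, s1), (p1, p0, s01), (p, 1, a), (p, 1, b), (p, 1, c),
        (p0, 1, d0), (p0, 1, g0), (p1, 1, d1), (p1, 1, g1)} \<Longrightarrow> 101 / 10000 \<le> q * r - t\<^sup>2"
  shows "nondegenerate k n C"
proof -
  have ic: "i < m \<or> i = m \<or> i = Suc m" if "i < n" for i using that n by linarith
  have 1: "7 / 100 \<le> dp k (C i) (C i) \<and> dp k (C i) (C i) \<le> 11 / 10" if "i < n" for i
  proof -
    have "dp k (C i) (C i) \<in> {p, p0, p1}" using ic[OF that] by (elim disjE) (simp_all only: gram_rows insert_iff simp_thms)
    thus ?thesis by (rule b)
  qed
  have 2: "101 / 10000 \<le> dp k (C i) (C i) * dp k (C j) (C j) - (dp k (C i) (C j))\<^sup>2" if ij: "i < n" "j < i" for i j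
  proof (rule A)
    consider "i < m" "j < m" "i \<noteq> j" | "i = m" "j < m" | "i = Suc m" "j < m" | "i = Suc m" "j = m" using ic[OF ij(1)] ij(2) by linarith
    thus "(dp k (C i) (C i), dp k (C j) (C j), dp k (C i) (C j)) \<in> {(p, p, s), (p0, p, s0), (p1, p, s1), (p1, p0, s01), (p, 1, a), (p, 1, b), (p, 1, c),
        (p0, 1, d0), (p0, 1, g0), (p1, 1, d1), (p1, 1, g1)}"
      by cases (simp_all only: gram_rows insert_iff prod.inject simp_thms)
  qed
  have 3: "101 / 10000 \<le> dp k (C i) (C i) * 1 - (C i j)\<^sup>2" if ij: "i < n" "j < k" for i j
  proof (rule A)
    consider "i < m" "j < m" "j = i" | "i < m" "j < m" "j \<noteq> i" | "i < m" "j = m" | "i = m" "j < m" | "i = m" "j = m" | "i = Suc m" "j < m" | "i = Suc m" "j = m"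
      using ic[OF ij(1)] ij(2) by linarith
    thus "(dp k (C i) (C i), 1, C i j) \<in> {(p, p, s), (p0, p, s0), (p1, p, s1), (p1, p0, s01), (p, 1, a), (p, 1, b), (p, 1, c),
        (p0, 1, d0), (p0, 1, g0), (p1, 1, d1), (p1, 1, g1)}"
    proof cases
      case 1 thus ?thesis using gram_rows(1)[of i] by (simp add: sym_point_def)
    next
      case 2 thus ?thesis using gram_rows(1)[of i] by (simp add: sym_point_def)
    next
      case 3 thus ?thesis using gram_rows(1)[of i] by (simp add: sym_point_def)
    next
      case 4 thus ?thesis using gram_rows(2) by (simp add: sym_point_def)
    next
      case 5 thus ?thesis using gram_rows(2) by (simp add: sym_point_def)
    next
      case 6 thus ?thesis using gram_rows(3) by (simp add: sym_point_def)
    next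
      case 7 thus ?thesis using gram_rows(3) by (simp add: sym_point_def)
    qed
  qed
  show ?thesis unfolding nondegenerate_def using 1 2 3 by simp
qed
end

section \<open>Positive semidefiniteness in interval arithmetic\<close>

text \<open>The class operations on \<^typ>\<open>iv\<close> work with 28 fractional bits; they serve the Hessian bound, which has much more slack than
  the gradient bound.\<close>

abbreviation lowp :: num where "lowp \<equiv> num.Bit0 (num.Bit0 (num.Bit1 (num.Bit1 num.One)))"

text \<open>Exact zeros stay exact: the general product would give them a positive radius, and the
  coefficient lists consist largely of zeros.\<close>

fun iv_low_mul :: "iv \<Rightarrow> iv \<Rightarrow> iv" where
  "iv_low_mul (Iv a r) (Iv b q) = (if a = 0 \<and> r = 0 then Iv 0 0 else if b = 0 \<and> q = 0 then Iv 0 0 else iv_mul lowp (Iv a r) (Iv b q))"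

instantiation iv :: "{plus,minus,times,uminus,zero,one}"
begin
definition plus_iv :: "iv \<Rightarrow> iv \<Rightarrow> iv" where "plus_iv = iv_add"
definition minus_iv :: "iv \<Rightarrow> iv \<Rightarrow> iv" where "minus_iv = iv_sub"
definition times_iv :: "iv \<Rightarrow> iv \<Rightarrow> iv" where "times_iv = iv_low_mul"
definition uminus_iv :: "iv \<Rightarrow> iv" where "uminus_iv = iv_neg"
definition zero_iv :: iv where "zero_iv = Iv 0 0"
definition one_iv :: iv where "one_iv = Iv 268435456 0"
instance ..
end

abbreviation R :: "real \<Rightarrow> iv \<Rightarrow> bool" where "R \<equiv> approximates lowp"

lemma approximates_zero: "approximates B x (Iv 0 0) \<longleftrightarrow> x = 0"
  by (simp add: approximates_Iv)

lemma R_ops: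
  "R x X \<Longrightarrow> R y Y \<Longrightarrow> R (x + y) (X + Y)"
  "R x X \<Longrightarrow> R y Y \<Longrightarrow> R (x - y) (X - Y)"
  "R x X \<Longrightarrow> R y Y \<Longrightarrow> R (x * y) (X * Y)"
  "R x X \<Longrightarrow> R (- x) (- X)"
  "R 0 0" "R 1 1"
proof -
  show "R x X \<Longrightarrow> R y Y \<Longrightarrow> R (x * y) (X * Y)"
    using approximates_mul[of lowp x X y Y]
    by (cases X; cases Y) (auto simp: times_iv_def approximates_zero simp del: iv_mul.simps)
qed (simp_all add: plus_iv_def minus_iv_def uminus_iv_def zero_iv_def one_iv_def approximates_add approximates_sub approximates_neg,
     simp_all add: approximates_Iv)

section \<open>Transfer of the forms from real numbers to intervals\<close>

definition data_rel :: "real hess_data \<Rightarrow> iv hess_data \<Rightarrow> bool" where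
  "data_rel X Y \<longleftrightarrow>
     R (ha X) (ha Y) \<and> R (hb X) (hb Y) \<and> R (hc X) (hc Y) \<and> R (hd0 X) (hd0 Y) \<and> R (hg0 X) (hg0 Y) \<and> R (hd1 X) (hd1 Y) \<and> R (hg1 X) (hg1 Y)
   \<and> R (hchi X) (hchi Y) \<and> R (hpi X) (hpi Y) \<and> R (hlam X) (hlam Y) \<and> R (hm X) (hm Y) \<and> R (hm1 X) (hm1 Y) \<and> R (hm2 X) (hm2 Y)
   \<and> R (him X) (him Y) \<and> R (him1 X) (him1 Y) \<and> R (him2 X) (him2 Y) \<and> R (hhalf X) (hhalf Y)
   \<and> R (hip X) (hip Y) \<and> R (hip0 X) (hip0 Y) \<and> R (hip1 X) (hip1 Y) \<and> R (hs X) (hs Y) \<and> R (hs0 X) (hs0 Y) \<and> R (hs1 X) (hs1 Y) \<and> R (hs01 X) (hs01 Y)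
   \<and> R (hD X) (hD Y) \<and> R (hD0 X) (hD0 Y) \<and> R (hD1 X) (hD1 Y) \<and> R (hD01 X) (hD01 Y) \<and> R (hDa X) (hDa Y) \<and> R (hDb X) (hDb Y) \<and> R (hDc X) (hDc Y)
   \<and> R (hD00 X) (hD00 Y) \<and> R (hD0m X) (hD0m Y) \<and> R (hD10 X) (hD10 Y) \<and> R (hD1m X) (hD1m Y)
   \<and> R (hI X) (hI Y) \<and> R (hI0 X) (hI0 Y) \<and> R (hI1 X) (hI1 Y) \<and> R (hI01 X) (hI01 Y) \<and> R (hIa X) (hIa Y) \<and> R (hIb X) (hIb Y) \<and> R (hIc X) (hIc Y)
   \<and> R (hI00 X) (hI00 Y) \<and> R (hI0m X) (hI0m Y) \<and> R (hI10 X) (hI10 Y) \<and> R (hI1m X) (hI1m Y)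
   \<and> R (hT X) (hT Y) \<and> R (hT0 X) (hT0 Y) \<and> R (hT1 X) (hT1 Y) \<and> R (hT01 X) (hT01 Y)"

abbreviation RL :: "real list \<Rightarrow> iv list \<Rightarrow> bool" where "RL \<equiv> list_all2 R"
abbreviation RM :: "real list list \<Rightarrow> iv list list \<Rightarrow> bool" where "RM \<equiv> list_all2 RL"
abbreviation RF :: "(real \<times> real list \<times> real list) list \<Rightarrow> (iv \<times> iv list \<times> iv list) list \<Rightarrow> bool" where
  "RF \<equiv> list_all2 (rel_prod R (rel_prod RL RL))"

lemma up_other: "length l \<noteq> 6 \<Longrightarrow> up l = l"
  by (cases l rule: up.cases) auto

text \<open>\<open>up\<close> distinguishes lists by length only, and related lists have equal
  length.\<close>

lemma RL_up: "RL l l' \<Longrightarrow> RL (up l) (up l')"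
proof (cases "length l = 6")
  case True
  moreover assume "RL l l'"
  ultimately show ?thesis by (auto simp: numeral_eq_Suc length_Suc_conv list_all2_Cons1 R_ops)
next
  case False
  moreover assume l: "RL l l'"
  ultimately show ?thesis using list_all2_lengthD[OF l] by (simp add: up_other)
qed

context
  fixes X Y
  assumes data: "data_rel X Y"
begin

lemmas data' = data[unfolded data_rel_def]

text \<open>The definitions consist of operations that preserve \<open>R\<close>, so the relation
  follows their syntax; the same holds for the functionals and forms below.\<close>

lemma R_coef:
  "R (coefA X) (coefA Y)" "R (coef0 X) (coef0 Y)" "R (coef1 X) (coef1 Y)" "R (coefK X) (coefK Y)" "R (coefG X) (coefG Y)"
  "R (coefP X) (coefP Y)" "R (coefP0 X) (coefP0 Y)" "R (coefP1 X) (coefP1 Y)"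
  unfolding coefG_def coefK_def coefA_def coef0_def coef1_def coefP_def coefP0_def coefP1_def
  by (intro R_ops; use data' in blast)+

lemma RL_vec:
  "RL (vP X) (vP Y)" "RL (vL X) (vL Y)" "RL (vl0 X) (vl0 Y)" "RL (vl1 X) (vl1 Y)" "RL (vEa X) (vEa Y)" "RL (vEc X) (vEc Y)"
  "RL (nP0 X) (nP0 Y)" "RL (nP1 X) (nP1 Y)" "RL (nK0 X) (nK0 Y)" "RL (nK1 X) (nK1 Y)" "RL (nE0 X) (nE0 Y)" "RL (nE1 X) (nE1 Y)"
  "RL (nX X) (nX Y)" "RL (nQ X) (nQ Y)"
  unfolding vP_def vL_def vl0_def vl1_def vEa_def vEc_def nP0_def nP1_def nK0_def nK1_def nE0_def nE1_def nX_def nQ_def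
  by (intro list.rel_intros R_ops; use data' in blast)+

lemma RF_form: "RF (formM X) (formM Y)" "RF (formN X) (formN Y)"
  unfolding formM_def formN_def dbl_def
  by (intro list.rel_intros rel_prod.intros RL_up RL_vec R_coef R_ops; use data' in blast)+

end

lemma RF_lift: "R \<mu> \<nu> \<Longrightarrow> RF fs gs \<Longrightarrow> RF (lift_form \<mu> fs) (lift_form \<nu> gs)"
proof -
  assume "R \<mu> \<nu>" "RF fs gs"
  from this(2,1) show ?thesis unfolding lift_form_def
    by (induction rule: list_all2_induct) (auto simp: R_ops RL_up)
qed

lemma RL_tri_row: "RL as as' \<Longrightarrow> RL bs bs' \<Longrightarrow> R u u' \<Longrightarrow> R v v' \<Longrightarrow> RL (tri_row u v as bs) (tri_row u' v' as' bs')"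
proof (induction arbitrary: bs bs' rule: list_all2_induct)
  case (Cons a as a' as')
  show ?case using Cons.prems(1)
  proof (cases rule: list.rel_cases)
    case (Cons b bs b' bs')
    thus ?thesis using Cons.IH[of bs bs'] \<open>R a a'\<close> \<open>R u u'\<close> \<open>R v v'\<close> by (simp add: R_ops)
  qed simp
qed simp

lemma RM_tri_of: "RL as as' \<Longrightarrow> RL bs bs' \<Longrightarrow> R u u' \<Longrightarrow> RM (tri_of u as bs) (tri_of u' as' bs')"
proof (induction arbitrary: bs bs' rule: list_all2_induct)
  case (Cons a as a' as')
  show ?case using Cons.prems(1)
  proof (cases rule: list.rel_cases)
    case (Cons b bs b' bs')
    thus ?thesis using Cons.IH[of bs bs'] \<open>R u u'\<close> \<open>R a a'\<close> \<open>RL as as'\<close>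
      by (simp add: RL_tri_row R_ops del: tri_row.simps)
  qed simp
qed simp

lemma RL_row_add: "RL as as' \<Longrightarrow> RL bs bs' \<Longrightarrow> RL (row_add as bs) (row_add as' bs')"
proof (induction arbitrary: bs bs' rule: list_all2_induct)
  case (Cons a as a' as')
  show ?case using Cons.prems(1)
  proof (cases rule: list.rel_cases)
    case (Cons b bs b' bs')
    thus ?thesis using Cons.IH[of bs bs'] \<open>R a a'\<close> by (simp add: R_ops)
  qed simp
qed simp

lemma RM_tri_add: "RM as as' \<Longrightarrow> RM bs bs' \<Longrightarrow> RM (tri_add as bs) (tri_add as' bs')"
proof (induction arbitrary: bs bs' rule: list_all2_induct)
  case (Cons a as a' as')
  show ?case using Cons.prems(1)
  proof (cases rule: list.rel_cases)
    case (Cons b bs b' bs')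
    thus ?thesis using Cons.IH[of bs bs'] \<open>RL a a'\<close> by (simp add: RL_row_add)
  qed simp
qed simp

lemma RL_row_schur: "RL as as' \<Longrightarrow> RL bs bs' \<Longrightarrow> R u u' \<Longrightarrow> RL (row_schur u as bs) (row_schur u' as' bs')"
proof (induction arbitrary: bs bs' rule: list_all2_induct)
  case (Cons a as a' as')
  show ?case using Cons.prems(1)
  proof (cases rule: list.rel_cases)
    case (Cons b bs b' bs')
    thus ?thesis using Cons.IH[of bs bs'] \<open>R a a'\<close> \<open>R u u'\<close> by (simp add: R_ops)
  qed simp
qed simp

lemma RM_tri_schur: "RM as as' \<Longrightarrow> RL bs bs' \<Longrightarrow> R u u' \<Longrightarrow> RM (tri_schur u as bs) (tri_schur u' as' bs')"
proof (induction arbitrary: bs bs' rule: list_all2_induct)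
  case (Cons a as a' as')
  show ?case using Cons.prems(1)
  proof (cases rule: list.rel_cases)
    case (Cons b bs b' bs')
    thus ?thesis using Cons.IH[of bs bs'] \<open>R u u'\<close> \<open>RL a a'\<close>
      by (simp add: RL_row_schur R_ops del: row_schur.simps)
  qed simp
qed simp

lemma RM_tri_sum: "RF fs gs \<Longrightarrow> RM A B \<Longrightarrow> RM (tri_sum A fs) (tri_sum B gs)"
  by (induction arbitrary: A B rule: list_all2_induct) (auto simp: RM_tri_add RM_tri_of)

text \<open>Gaussian elimination on intervals with guessed upper bounds \<open>ys\<close> of the
  inverse pivots in place of division. Pivot and guess are both in units of 2^-28, so the comparison
  with 2^28 * 2^28 = 72057594037927936 says that their product is at least 1.\<close>

fun psd_ok :: "iv list list \<Rightarrow> int list \<Rightarrow> bool" where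
  "psd_ok [] ys \<longleftrightarrow> True"
| "psd_ok ((A # bs) # rs) (y # ys) \<longleftrightarrow> 0 < iv_lower A \<and> 72057594037927936 \<le> iv_lower A * y \<and> psd_ok (tri_schur (Iv y 0) rs bs) ys"
| "psd_ok _ _ \<longleftrightarrow> False"

lemma pivot_bounds:
  assumes "R a A" "0 < iv_lower A" "72057594037927936 \<le> iv_lower A * y"
  shows "0 < a" "1 \<le> a * (real_of_int y / 2 ^ numeral lowp)"
proof -
  have l: "a * 268435456 \<ge> real_of_int (iv_lower A)" using iv_bounds(1)[OF assms(1)] by simp
  have "real_of_int (iv_lower A) > 0" using assms(2) by simp
  thus "0 < a" using l by linarith
  have y: "0 < y" using assms(2,3) by (metis less_le_trans zero_less_mult_pos zero_less_numeral)
  have "real_of_int 72057594037927936 \<le> real_of_int (iv_lower A * y)" using assms(3) by (simp only: of_int_le_iff)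
  also have "\<dots> \<le> a * 268435456 * real_of_int y" using l y by (simp add: mult_right_mono)
  finally show "1 \<le> a * (real_of_int y / 2 ^ numeral lowp)" by simp
qed

lemma psd_ok_sound:
  "tri_shape n A \<Longrightarrow> RM A B \<Longrightarrow> psd_ok B ys \<Longrightarrow> length z = n \<Longrightarrow> 0 \<le> tri_form A z"
proof (induction n arbitrary: A B ys z)
  case (Suc n)
  obtain a as A' where A: "A = (a # as) # A'" "length as = n" "tri_shape n A'" using Suc.prems(1) by (auto simp: length_Suc_conv)
  obtain b bs B' where B: "B = (b # bs) # B'" "R a b" "RL as bs" "RM A' B'"
    using Suc.prems(2) unfolding A(1) by (auto simp: list_all2_Cons1)
  obtain y ys' where ys: "ys = y # ys'" using Suc.prems(3) unfolding B(1) by (cases ys) auto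
  have ok: "0 < iv_lower b" "72057594037927936 \<le> iv_lower b * y" "psd_ok (tri_schur (Iv y 0) B' bs) ys'"
    using Suc.prems(3) unfolding B(1) ys by simp_all
  \<comment> \<open>The real matrix is eliminated with the same dyadic number, so its Schur
    complement is approximated by the computed one.\<close>
  define y' where "y' = real_of_int y / 2 ^ numeral lowp"
  have RS: "RM (tri_schur y' A' as) (tri_schur (Iv y 0) B' bs)"
    unfolding y'_def by (intro RM_tri_schur B approximates_dyadic)
  have psd: "0 \<le> tri_form (tri_schur y' A' as) z" if "length z = n" for z
    by (rule Suc.IH[OF _ RS ok(3) that]) (use tri_schur_correct[OF A(3,2) that] in blast)
  show ?case unfolding A(1)
    by (rule tri_form_pivot[OF A(3,2) psd _ _ Suc.prems(4)]) (use pivot_bounds[OF B(2) ok(1,2)] in \<open>simp_all only: y'_def\<close>)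
qed simp

fun tri_zero :: "nat \<Rightarrow> 'a::zero list list" where
  "tri_zero 0 = []"
| "tri_zero (Suc n) = replicate (Suc n) 0 # tri_zero n"

lemma vdot_zero: "vdot (replicate n 0) z = 0"
proof (induction n arbitrary: z)
  case (Suc n)
  thus ?case by (cases z) auto
qed simp

lemma tri_zero_correct: "tri_shape n (tri_zero n :: real list list)" "tri_form (tri_zero n) z = 0" "RM (tri_zero n) (tri_zero n)"
proof -
  show "tri_shape n (tri_zero n :: real list list)" by (induction n) auto
  show "tri_form (tri_zero n) z = 0"
  proof (induction n arbitrary: z)
    case (Suc n)
    thus ?case by (cases z) (auto simp: vdot_zero)
  qed simp
  have "RL (replicate n 0) (replicate n 0)" for n by (induction n) (simp_all add: R_ops)
  thus "RM (tri_zero n) (tri_zero n)" by (induction n) (auto simp del: replicate.simps)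
qed

lemma qf_nonneg:
  assumes "\<And>\<kappa> l l'. (\<kappa>, l, l') \<in> set fs \<Longrightarrow> length l = n \<and> length l' = n" "RF fs gs" "psd_ok (tri_sum (tri_zero n) gs) ys" "length z = n"
  shows "0 \<le> qf fs z"
proof -
  note s = tri_sum_correct[OF assms(1) tri_zero_correct(1) assms(4)]
  have "0 \<le> tri_form (tri_sum (tri_zero n) fs) z"
    by (rule psd_ok_sound[OF conjunct1[OF s] RM_tri_sum[OF assms(2) tri_zero_correct(3)] assms(3,4)])
  thus ?thesis using s by (simp add: tri_zero_correct)
qed

text \<open>The complete test for the Hessian: the two scalars for the off-diagonal entries, the
  form in six variables and the form in seven.\<close>

definition hess_ok :: "iv hess_data \<Rightarrow> int list \<Rightarrow> int list \<Rightarrow> bool" where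
  "hess_ok Y ms ns \<longleftrightarrow> 0 \<le> iv_lower (coefG Y) \<and> 0 \<le> iv_lower (coefK Y) \<and> psd_ok (tri_sum (tri_zero 6) (formM Y)) ms
     \<and> psd_ok (tri_sum (tri_zero 7) (formN Y @ lift_form (him Y) (formM Y))) ns"

lemma length_up: "length l = 6 \<Longrightarrow> length (up l) = 7"
  by (auto simp: numeral_eq_Suc length_Suc_conv)

lemma length_formN: "(\<kappa>, l, l') \<in> set (formN X) \<Longrightarrow> length l = 7 \<and> length l' = 7"
  unfolding formN_def vP_def vL_def vl0_def vl1_def nP0_def nP1_def nK0_def nK1_def nE0_def nE1_def nX_def nQ_def by auto

lemma length_lift: "(\<kappa>, l, l') \<in> set (lift_form \<mu> (formM X)) \<Longrightarrow> length l = 7 \<and> length l' = 7"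
  unfolding lift_form_def using length_formM[of _ _ _ X] length_up by fastforce

lemma R_nonneg: "R x X \<Longrightarrow> 0 \<le> iv_lower X \<Longrightarrow> 0 \<le> x"
proof -
  assume "R x X" "0 \<le> iv_lower X"
  hence "x * 268435456 \<ge> real_of_int (iv_lower X)" "real_of_int (iv_lower X) \<ge> 0" using iv_bounds(1)[of lowp x X] by simp_all
  thus ?thesis by linarith
qed

lemma hess_ok_sound:
  assumes "data_rel X Y" "hess_ok Y ms ns"
  shows "0 \<le> coefG X" "0 \<le> coefK X" "length z = 6 \<Longrightarrow> 0 \<le> qf (formM X) z" "length w = 7 \<Longrightarrow> 0 \<le> qf (formN X @ lift_form (him X) (formM X)) w"
proof -
  show "0 \<le> coefG X" "0 \<le> coefK X" using R_coef(4,5)[OF assms(1)] assms(2) by (auto simp: hess_ok_def intro: R_nonneg)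
  have RF: "RF (formM X) (formM Y)" "RF (formN X @ lift_form (him X) (formM X)) (formN Y @ lift_form (him Y) (formM Y))"
    using RF_form[OF assms(1)] assms(1) by (auto intro!: list_all2_appendI RF_lift simp: data_rel_def)
  show "length z = 6 \<Longrightarrow> 0 \<le> qf (formM X) z"
    by (rule qf_nonneg[OF length_formM RF(1)]) (use assms(2) in \<open>auto simp: hess_ok_def\<close>)
  have l: "length l = 7 \<and> length l' = 7" if "(\<kappa>, l, l') \<in> set (formN X @ lift_form (him X) (formM X))" for \<kappa> l l'
    using that length_formN[of \<kappa> l l' X] length_lift[of \<kappa> l l' "him X" X] by auto
  show "length w = 7 \<Longrightarrow> 0 \<le> qf (formN X @ lift_form (him X) (formM X)) w"
    by (rule qf_nonneg[OF l RF(2)]) (use assms(2) in \<open>auto simp: hess_ok_def\<close>)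
qed

section \<open>Certificates\<close>

text \<open>Confirmed by the arctangent check itself: 28296951008113761 is a guess of pi / 8, half
  of arctan 1, in units of 2^-56, and this midpoint is four times as large.\<close>

definition iv_half_pi :: iv where "iv_half_pi = Iv 113187804032455044 1024"
definition iv_pi :: iv where "iv_pi = iv_scale 2 iv_half_pi"
text \<open>The radii here and in the next definitions are common to all certificates, which
  therefore list only midpoints.\<close>

definition iv_obtuse :: "int \<Rightarrow> iv" where "iv_obtuse h = iv_add iv_half_pi (Iv (2 * h) 2048)"
definition iv_area :: "int \<Rightarrow> iv" where "iv_area y = Iv y 128"
definition iv_inv :: "int \<Rightarrow> iv" where "iv_inv y = Iv y 1024"
definition iv_low_inv :: "int \<Rightarrow> iv" where "iv_low_inv y = Iv y 512"
fun iv_upper :: "iv \<Rightarrow> int" where "iv_upper (Iv a r) = a + r"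

text \<open>7/100 and 11/10 in units of 2^-56, rounded inward; the constant of
  \<open>area_ok\<close> is 101/10000, rounded up.\<close>

definition norm_ok :: "iv \<Rightarrow> bool" where
  "norm_ok P \<longleftrightarrow> 5044031582654956 \<le> iv_lower P \<and> iv_upper P \<le> 79263353441720729"

definition area_ok :: "iv \<Rightarrow> int \<Rightarrow> bool" where
  "area_ok X y \<longleftrightarrow> 727781699783073 \<le> iv_lower X \<and> sqrt_ok prec X (iv_area y)"

definition pair_ok :: "iv \<Rightarrow> iv \<Rightarrow> iv \<Rightarrow> int \<Rightarrow> int \<Rightarrow> bool" where
  "pair_ok P Q S y h \<longleftrightarrow> area_ok (iv_sub (iv_mul prec P Q) (iv_mul prec S S)) y
     \<and> arctan_check S (iv_area y) h 2048 (iv_cos (Iv h 0)) (iv_sin (Iv h 0))"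

text \<open>32768 = 2^15, which is 2^-41 in units of 2^-56.\<close>

definition small_ok :: "iv \<Rightarrow> bool" where "small_ok X \<longleftrightarrow> iv_abs_upper X \<le> 32768"
text \<open>The diagonal entry of the gradient is the sum of two coefficients and the off-diagonal
  entry is the second of them; passing both as arguments computes the shared one once.\<close>

definition small2_ok :: "iv \<Rightarrow> iv \<Rightarrow> bool" where "small2_ok X Y \<longleftrightarrow> small_ok (iv_add X Y) \<and> small_ok Y"

definition iv_Phi :: "iv \<Rightarrow> iv \<Rightarrow> int \<Rightarrow> iv" where "iv_Phi S T y = iv_add (iv_area y) (iv_mul prec S T)"

definition grad_ok where
  "grad_ok m e A B C D0 G0 D1 G1 AB U T T0 T1 T01 Ta Tb Tc T00 T0m T10 T1m cW c0 c1 \<longleftrightarrow>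
     small2_ok (iv_add (iv_sub (iv_sub (iv_mul prec AB cW) (iv_mul prec AB T)) Ta) Tb)
       (iv_sub (iv_add (iv_add (iv_add (iv_mul prec B cW) (iv_mul prec (iv_add AB (iv_scale (m - 1) B)) T)) (iv_mul prec D0 T0)) (iv_scale e (iv_mul prec D1 T1))) Tb)
     \<and> small_ok (iv_sub (iv_add (iv_add (iv_add (iv_mul prec C cW) (iv_scale (m - 1) (iv_mul prec C T))) (iv_mul prec G0 T0)) (iv_scale e (iv_mul prec G1 T1))) Tc)
     \<and> small_ok (iv_sub (iv_add (iv_add (iv_mul prec D0 c0) (iv_mul prec U T0)) (iv_scale e (iv_mul prec D1 T01))) T00)
     \<and> small_ok (iv_sub (iv_add (iv_add (iv_mul prec G0 c0) (iv_scale m (iv_mul prec C T0))) (iv_scale e (iv_mul prec G1 T01))) T0m)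
     \<and> small_ok (iv_scale e (iv_sub (iv_add (iv_add (iv_mul prec D1 c1) (iv_mul prec U T1)) (iv_mul prec D0 T01)) T10))
     \<and> small_ok (iv_scale e (iv_sub (iv_add (iv_add (iv_mul prec G1 c1) (iv_scale m (iv_mul prec C T1))) (iv_mul prec G0 T01)) T1m))"

text \<open>Twice the scaled loss is compared with 2/1000 in units of 2^-56, rounded up; doubling
  clears the halves in the loss formula.\<close>

definition loss_ok where
  "loss_ok m e P P0 P1 F F0 F1 F01 Fa Fb Fc F00 F0m F10 F1m \<longleftrightarrow> 144115188075856 \<le> iv_lower (iv_add (iv_add (iv_sub
     (iv_add (iv_add (iv_add (iv_scale (m * (m - 1)) F) (iv_scale (2 * m) F0)) (iv_scale e (iv_add (iv_scale (2 * m) F1) (iv_scale 2 F01))))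
       (iv_mul prec iv_pi (iv_add (iv_add (iv_scale m P) P0) (iv_scale e P1))))
     (iv_add (iv_add (iv_scale (2 * m) (iv_add (iv_add Fa (iv_scale (m - 1) Fb)) Fc)) (iv_add (iv_scale (2 * m) F00) (iv_scale 2 F0m)))
       (iv_scale e (iv_add (iv_scale (2 * m) F10) (iv_scale 2 F1m)))))
     (iv_scale (m + 1) iv_pi)) (iv_scale ((m + 1) * m) (Iv 72057594037927936 0)))"

text \<open>Quantities known to 56 bits lose 28 of them; inverse areas are certified directly at 28
  bits. 2097152 = 2^21 is the Hessian bound 1/128 in units of 2^-28.\<close>

definition low_data where
  "low_data m e A B C D0 G0 D1 G1 S S0 S1 S01 y y0 y1 y01 ya yb yc y00 y0m y10 y1m w w0 w1 w01 ip ip0 ip1 i i0 i1 i01 ia ib ic i00 i0m i10 i1m im im1 im2 = \<lparr> ha = iv_chop lowp A, hb = iv_chop lowp B, hc = iv_chop lowp C, hd0 = iv_chop lowp D0, hg0 = iv_chop lowp G0,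
     hd1 = iv_chop lowp D1, hg1 = iv_chop lowp G1, hchi = Iv (e * 268435456) 0, hpi = iv_chop lowp iv_pi, hlam = Iv 2097152 0,
     hm = Iv (m * 268435456) 0, hm1 = Iv ((m - 1) * 268435456) 0, hm2 = Iv ((m - 2) * 268435456) 0, him = Iv im 1, him1 = Iv im1 1,
     him2 = Iv im2 1, hhalf = Iv 134217728 0, hip = iv_chop lowp (iv_inv ip), hip0 = iv_chop lowp (iv_inv ip0), hip1 = iv_chop lowp (iv_inv ip1),
     hs = iv_chop lowp S, hs0 = iv_chop lowp S0, hs1 = iv_chop lowp S1, hs01 = iv_chop lowp S01, hD = iv_chop lowp (iv_area y),
     hD0 = iv_chop lowp (iv_area y0), hD1 = iv_chop lowp (iv_area y1), hD01 = iv_chop lowp (iv_area y01), hDa = iv_chop lowp (iv_area ya), hDb = iv_chop lowp (iv_area yb),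
     hDc = iv_chop lowp (iv_area yc), hD00 = iv_chop lowp (iv_area y00), hD0m = iv_chop lowp (iv_area y0m), hD10 = iv_chop lowp (iv_area y10), hD1m = iv_chop lowp (iv_area y1m),
     hI = iv_low_inv i, hI0 = iv_low_inv i0, hI1 = iv_low_inv i1, hI01 = iv_low_inv i01, hIa = iv_low_inv ia,
     hIb = iv_low_inv ib, hIc = iv_low_inv ic, hI00 = iv_low_inv i00, hI0m = iv_low_inv i0m, hI10 = iv_low_inv i10,
     hI1m = iv_low_inv i1m, hT = iv_chop lowp (iv_obtuse w), hT0 = iv_chop lowp (iv_obtuse w0), hT1 = iv_chop lowp (iv_obtuse w1), hT01 = iv_chop lowp (iv_obtuse w01) \<rparr>"

text \<open>In units of \<open>2^-56\<close>, the integers \<open>y\<dots>\<close> and \<open>w\<dots>\<close> are guesses of the area and of half the angle \<open>arctan (s / D)\<close> of each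
  pair, and \<open>ip\<dots>\<close> of the inverse squared norms; in units of \<open>2^-28\<close>, \<open>i\<dots>\<close> are guesses of the inverse areas,
  \<open>im\<close>, \<open>im1\<close>, \<open>im2\<close> of the inverses of \<open>m\<close>, \<open>m - 1\<close>, \<open>m - 2\<close>, and \<open>ms\<close>, \<open>ns\<close> are upper bounds of the inverse pivots.
  If there is only one extra row (\<open>e = 0\<close>), the entries \<open>d1\<close>, \<open>g1\<close> of the second one are dummies.\<close>

definition cert2 where
  "cert2 m e A B C D0 G0 D1 G1 AB U P P0 P1 S S0 S1 S01 y y0 y1 y01 ya yb yc y00 y0m y10 y1m w w0 w1 w01 wa wb wc w00 w0m w10 w1m ip ip0 ip1 i i0 i1 i01 ia ib ic i00 i0m i10 i1m im im1 im2 ms ns \<longleftrightarrow>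
     norm_ok P
   \<and> norm_ok P0
   \<and> norm_ok P1
   \<and> pair_ok P P S y w
   \<and> pair_ok P0 P S0 y0 w0
   \<and> pair_ok P1 P S1 y1 w1
   \<and> pair_ok P1 P0 S01 y01 w01
   \<and> pair_ok P (Iv 72057594037927936 0) A ya wa
   \<and> pair_ok P (Iv 72057594037927936 0) B yb wb
   \<and> pair_ok P (Iv 72057594037927936 0) C yc wc
   \<and> pair_ok P0 (Iv 72057594037927936 0) D0 y00 w00
   \<and> pair_ok P0 (Iv 72057594037927936 0) G0 y0m w0m
   \<and> pair_ok P1 (Iv 72057594037927936 0) D1 y10 w10
   \<and> pair_ok P1 (Iv 72057594037927936 0) G1 y1m w1m
   \<and> inverse_ok prec P (iv_inv ip)
   \<and> inverse_ok prec P0 (iv_inv ip0)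
   \<and> inverse_ok prec P1 (iv_inv ip1)
   \<and> inverse_ok lowp (iv_chop lowp (iv_area y)) (iv_low_inv i)
   \<and> inverse_ok lowp (iv_chop lowp (iv_area y0)) (iv_low_inv i0)
   \<and> inverse_ok lowp (iv_chop lowp (iv_area y1)) (iv_low_inv i1)
   \<and> inverse_ok lowp (iv_chop lowp (iv_area y01)) (iv_low_inv i01)
   \<and> inverse_ok lowp (iv_chop lowp (iv_area ya)) (iv_low_inv ia)
   \<and> inverse_ok lowp (iv_chop lowp (iv_area yb)) (iv_low_inv ib)
   \<and> inverse_ok lowp (iv_chop lowp (iv_area yc)) (iv_low_inv ic)
   \<and> inverse_ok lowp (iv_chop lowp (iv_area y00)) (iv_low_inv i00)
   \<and> inverse_ok lowp (iv_chop lowp (iv_area y0m)) (iv_low_inv i0m)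
   \<and> inverse_ok lowp (iv_chop lowp (iv_area y10)) (iv_low_inv i10)
   \<and> inverse_ok lowp (iv_chop lowp (iv_area y1m)) (iv_low_inv i1m)
   \<and> inverse_ok lowp (Iv (m * 268435456) 0) (Iv im 1)
   \<and> inverse_ok lowp (Iv ((m - 1) * 268435456) 0) (Iv im1 1)
   \<and> inverse_ok lowp (Iv ((m - 2) * 268435456) 0) (Iv im2 1)
   \<and> grad_ok m e A B C D0 G0 D1 G1 AB U (iv_obtuse w) (iv_obtuse w0) (iv_obtuse w1) (iv_obtuse w01) (iv_obtuse wa) (iv_obtuse wb) (iv_obtuse wc) (iv_obtuse w00) (iv_obtuse w0m) (iv_obtuse w10) (iv_obtuse w1m)
       (iv_add iv_pi (iv_mul prec (iv_inv ip) (iv_sub (iv_sub (iv_add (iv_add (iv_scale (m - 1) (iv_sub (iv_area y) (iv_area yb))) (iv_area y0)) (iv_scale e (iv_area y1))) (iv_area ya)) (iv_area yc))))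
       (iv_add iv_pi (iv_mul prec (iv_inv ip0) (iv_sub (iv_add (iv_scale m (iv_sub (iv_area y0) (iv_area y00))) (iv_scale e (iv_area y01))) (iv_area y0m))))
       (iv_add iv_pi (iv_mul prec (iv_inv ip1) (iv_sub (iv_add (iv_scale m (iv_sub (iv_area y1) (iv_area y10))) (iv_area y01)) (iv_area y1m))))
   \<and> loss_ok m e P P0 P1 (iv_Phi S (iv_obtuse w) y) (iv_Phi S0 (iv_obtuse w0) y0) (iv_Phi S1 (iv_obtuse w1) y1) (iv_Phi S01 (iv_obtuse w01) y01) (iv_Phi A (iv_obtuse wa) ya) (iv_Phi B (iv_obtuse wb) yb) (iv_Phi C (iv_obtuse wc) yc) (iv_Phi D0 (iv_obtuse w00) y00) (iv_Phi G0 (iv_obtuse w0m) y0m) (iv_Phi D1 (iv_obtuse w10) y10) (iv_Phi G1 (iv_obtuse w1m) y1m)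
   \<and> hess_ok (low_data m e A B C D0 G0 D1 G1 S S0 S1 S01 y y0 y1 y01 ya yb yc y00 y0m y10 y1m w w0 w1 w01 ip ip0 ip1 i i0 i1 i01 ia ib ic i00 i0m i10 i1m im im1 im2) ms ns"

text \<open>The certificate is unfolded in stages. Rewriting normalizes arguments before a
  definition is unfolded, so Gram data passed as arguments are computed once although
  \<open>cert2\<close> uses them many times.\<close>

definition cert1 where
  "cert1 m e A B C D0 G0 D1 G1 AB U = cert2 m e A B C D0 G0 D1 G1 AB U
     (iv_add (iv_add (iv_mul prec AB A) (iv_mul prec B U)) (iv_mul prec C C))
     (iv_add (iv_mul prec D0 (iv_scale m D0)) (iv_mul prec G0 G0)) (iv_add (iv_mul prec D1 (iv_scale m D1)) (iv_mul prec G1 G1))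
     (iv_add (iv_add (iv_mul prec AB B) (iv_mul prec B U)) (iv_mul prec C C))
     (iv_add (iv_mul prec D0 U) (iv_mul prec G0 C)) (iv_add (iv_mul prec D1 U) (iv_mul prec G1 C))
     (iv_add (iv_mul prec D1 (iv_scale m D0)) (iv_mul prec G1 G0))"

definition cert_ok where
  "cert_ok m e a b c d0 g0 d1 g1 = cert1 m e (Iv a 0) (Iv b 0) (Iv c 0) (Iv d0 0) (Iv g0 0) (Iv d1 0) (Iv g1 0)
     (iv_sub (Iv a 0) (Iv b 0)) (iv_add (iv_sub (Iv a 0) (Iv b 0)) (iv_scale m (Iv b 0)))"

lemma int_power_simps: "(2 :: int) ^ numeral prec = 72057594037927936" "(2 :: int) ^ numeral lowp = 268435456"
  by simp_all

text \<open>Enough equations to evaluate the interval functions on numerals, so that the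
  certificates are checked by rewriting within the logic.\<close>

lemmas iv_eval = arith_simps rel_simps arith_special arith_extra_simps more_arith_simps numeral_One halve_simps shift.simps
  iv_add.simps iv_sub.simps iv_neg.simps iv_mul.simps iv_scale.simps iv_chop.simps iabs.simps if_True if_False simp_thms not_True_eq_False not_False_eq_True
  list.map iv_cos_def iv_sin_def iv_cos_coeffs_def iv_sin_coeffs_def iv_widen.simps iv_horner.simps arctan_check_def arctan_ok_def iv_lower.simps iv_abs_upper.simps
  int_power_simps Num.inc.simps

lemma half_pi_check: "arctan_check (Iv 72057594037927936 0) (Iv 72057594037927936 0) 28296951008113761 512
  (iv_cos (Iv 28296951008113761 0)) (iv_sin (Iv 28296951008113761 0))"
  \<comment> \<open>With \<open>if_weak_cong\<close> only the condition is rewritten at first, and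
    the branch not taken is never evaluated.\<close>
  by (simp only: iv_eval cong: if_weak_cong)

lemma approximates_half_pi: "approximates prec (pi / 2) iv_half_pi"
proof -
  have one: "approximates prec 1 (Iv 72057594037927936 0)" by (simp add: approximates_Iv)
  have "approximates prec (real_of_int 2 * arctan (1 / 1)) (iv_scale 2 (Iv (2 * 28296951008113761) 512))"
    by (intro approximates_scale approximates_arctan[OF one one half_pi_check])
  thus ?thesis by (simp add: iv_half_pi_def arctan_one)
qed

lemma approximates_pi: "approximates prec pi iv_pi"
  unfolding iv_pi_def using approximates_scale[OF approximates_half_pi, of 2] by simp

lemma pair_ok_sound:
  assumes "approximates prec q Q" "approximates prec r R'" "approximates prec t T" "pair_ok Q R' T y h"
  shows "approximates prec (area q r t) (iv_area y)" "approximates prec (obtuse q r t) (iv_obtuse h)" "101 / 10000 \<le> q * r - t\<^sup>2"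
    "approximates prec (Phi q r t) (iv_Phi T (iv_obtuse h) y)"
proof -
  have X: "approximates prec (q * r - t * t) (iv_sub (iv_mul prec Q R') (iv_mul prec T T))"
    by (intro approximates_sub approximates_mul assms)
  obtain x1 x2 where x: "iv_sub (iv_mul prec Q R') (iv_mul prec T T) = Iv x1 x2" by (cases "iv_sub (iv_mul prec Q R') (iv_mul prec T T)")
  have ok: "727781699783073 \<le> iv_lower (Iv x1 x2)" "sqrt_ok prec (Iv x1 x2) (Iv y 128)"
    "arctan_check T (iv_area y) h 2048 (iv_cos (Iv h 0)) (iv_sin (Iv h 0))"
    using assms(4) unfolding pair_ok_def area_ok_def x iv_area_def by blast+
  show D: "approximates prec (area q r t) (iv_area y)"
    unfolding area_def iv_area_def power2_eq_square by (rule approximates_sqrt[OF X[unfolded x] ok(2)])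
  show O: "approximates prec (obtuse q r t) (iv_obtuse h)"
    unfolding obtuse_def iv_obtuse_def by (intro approximates_add approximates_half_pi approximates_arctan[OF assms(3) D ok(3)])
  have "real_of_int 727781699783073 \<le> real_of_int (iv_lower (Iv x1 x2))" using ok(1) by (simp only: of_int_le_iff)
  also have "\<dots> \<le> (q * r - t * t) * 2 ^ numeral prec" by (rule iv_bounds(1)[OF X[unfolded x]])
  finally show "101 / 10000 \<le> q * r - t\<^sup>2" by (simp add: power2_eq_square)
  show "approximates prec (Phi q r t) (iv_Phi T (iv_obtuse h) y)"
    unfolding Phi_eq iv_Phi_def by (intro approximates_add approximates_mul D O assms)
qed

lemma inverse_ok_sound: "approximates B x X \<Longrightarrow> inverse_ok B X (Iv y t) \<Longrightarrow> approximates B (inverse x) (Iv y t)"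
  using approximates_inverse(1) by (cases X) blast

lemma norm_ok_sound:
  assumes "approximates prec x X" "norm_ok X"
  shows "7 / 100 \<le> x \<and> x \<le> 11 / 10"
proof -
  obtain a r where X: "X = Iv a r" by (cases X)
  have "\<bar>x * 72057594037927936 - real_of_int a\<bar> \<le> real_of_int r" using assms(1) unfolding X approximates_Iv by simp
  moreover have "real_of_int 5044031582654956 \<le> real_of_int (a - r)" "real_of_int (a + r) \<le> real_of_int 79263353441720729"
    using assms(2) unfolding X norm_ok_def iv_lower.simps iv_upper.simps by (simp_all only: of_int_le_iff)
  ultimately show ?thesis by (auto simp: abs_le_iff)
qed

text \<open>The form in which \<open>certified_point\<close> states the gradient bound.\<close>

lemma small_ok_sound:
  assumes "approximates prec x X" "small_ok X"
  shows "\<bar>x\<bar> \<le> 1 / 2 ^ 41"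
proof -
  have "\<bar>x * 2 ^ numeral prec\<bar> \<le> real_of_int (iv_abs_upper X)" by (rule iv_bounds(2)[OF assms(1)])
  also have "\<dots> \<le> real_of_int 32768" using assms(2) unfolding small_ok_def by (simp only: of_int_le_iff)
  finally show ?thesis by (simp add: abs_mult)
qed

lemma chop_low: "approximates prec x X \<Longrightarrow> R x (iv_chop lowp X)"
  by (rule approximates_chop) simp_all

lemma R_int: "R (real_of_int n) (Iv (n * 268435456) 0)" by (simp add: approximates_Iv)

section \<open>Soundness of the certificates\<close>

context symmetric_perturbation
begin

text \<open>The expressions in the certificate mirror the formulas of gradient, Hessian data and
  loss term by term, so the approximation rules apply along their structure.\<close>

lemma cert2_sound:
  assumes mi: "mi = int m" and e: "e = 0 \<and> n = Suc m \<or> e = 1 \<and> n = Suc (Suc m)"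
    and ap: "approximates prec (a) A'"
      "approximates prec (b) B'"
      "approximates prec (c) C'"
      "approximates prec (d0) D0'"
      "approximates prec (g0) G0'"
      "approximates prec (d1) D1'"
      "approximates prec (g1) G1'"
      "approximates prec (a - b) AB'"
      "approximates prec (a - b + real m * b) U'"
      "approximates prec (p) P'"
      "approximates prec (p0) P0'"
      "approximates prec (p1) P1'"
      "approximates prec (s) S'"
      "approximates prec (s0) S0'"
      "approximates prec (s1) S1'"
      "approximates prec (s01) S01'"
    and ok: "cert2 mi e A' B' C' D0' G0' D1' G1' AB' U' P' P0' P1' S' S0' S1' S01' y y0 y1 y01 ya yb yc y00 y0m y10 y1m w w0 w1 w01 wa wb wc w00 w0m w10 w1m ip ip0 ip1 i i0 i1 i01 ia ib ic i00 i0m i10 i1m im im1 im2 ms ns"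
  shows "certified_point k n C"
proof -
  note ok = ok[unfolded cert2_def]
  have nok: "norm_ok P'" "norm_ok P0'" "norm_ok P1'" using ok by blast+
  have pok: "pair_ok P' P' S' y w"
    "pair_ok P0' P' S0' y0 w0"
    "pair_ok P1' P' S1' y1 w1"
    "pair_ok P1' P0' S01' y01 w01"
    "pair_ok P' (Iv 72057594037927936 0) A' ya wa"
    "pair_ok P' (Iv 72057594037927936 0) B' yb wb"
    "pair_ok P' (Iv 72057594037927936 0) C' yc wc"
    "pair_ok P0' (Iv 72057594037927936 0) D0' y00 w00"
    "pair_ok P0' (Iv 72057594037927936 0) G0' y0m w0m"
    "pair_ok P1' (Iv 72057594037927936 0) D1' y10 w10"
    "pair_ok P1' (Iv 72057594037927936 0) G1' y1m w1m"
    using ok by blast+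
  have iok: "inverse_ok prec P' (iv_inv ip)"
    "inverse_ok prec P0' (iv_inv ip0)"
    "inverse_ok prec P1' (iv_inv ip1)"
    "inverse_ok lowp (iv_chop lowp (iv_area y)) (iv_low_inv i)"
    "inverse_ok lowp (iv_chop lowp (iv_area y0)) (iv_low_inv i0)"
    "inverse_ok lowp (iv_chop lowp (iv_area y1)) (iv_low_inv i1)"
    "inverse_ok lowp (iv_chop lowp (iv_area y01)) (iv_low_inv i01)"
    "inverse_ok lowp (iv_chop lowp (iv_area ya)) (iv_low_inv ia)"
    "inverse_ok lowp (iv_chop lowp (iv_area yb)) (iv_low_inv ib)"
    "inverse_ok lowp (iv_chop lowp (iv_area yc)) (iv_low_inv ic)"
    "inverse_ok lowp (iv_chop lowp (iv_area y00)) (iv_low_inv i00)"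
    "inverse_ok lowp (iv_chop lowp (iv_area y0m)) (iv_low_inv i0m)"
    "inverse_ok lowp (iv_chop lowp (iv_area y10)) (iv_low_inv i10)"
    "inverse_ok lowp (iv_chop lowp (iv_area y1m)) (iv_low_inv i1m)"
    "inverse_ok lowp (Iv (mi * 268435456) 0) (Iv im 1)"
    "inverse_ok lowp (Iv ((mi - 1) * 268435456) 0) (Iv im1 1)"
    "inverse_ok lowp (Iv ((mi - 2) * 268435456) 0) (Iv im2 1)"
    using ok by blast+
  have gok: "grad_ok mi e A' B' C' D0' G0' D1' G1' AB' U' (iv_obtuse w) (iv_obtuse w0) (iv_obtuse w1) (iv_obtuse w01) (iv_obtuse wa) (iv_obtuse wb) (iv_obtuse wc) (iv_obtuse w00) (iv_obtuse w0m) (iv_obtuse w10) (iv_obtuse w1m)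
       (iv_add iv_pi (iv_mul prec (iv_inv ip) (iv_sub (iv_sub (iv_add (iv_add (iv_scale (mi - 1) (iv_sub (iv_area y) (iv_area yb))) (iv_area y0)) (iv_scale e (iv_area y1))) (iv_area ya)) (iv_area yc))))
       (iv_add iv_pi (iv_mul prec (iv_inv ip0) (iv_sub (iv_add (iv_scale mi (iv_sub (iv_area y0) (iv_area y00))) (iv_scale e (iv_area y01))) (iv_area y0m))))
       (iv_add iv_pi (iv_mul prec (iv_inv ip1) (iv_sub (iv_add (iv_scale mi (iv_sub (iv_area y1) (iv_area y10))) (iv_area y01)) (iv_area y1m))))"
    using ok by blast
  have lok: "loss_ok mi e P' P0' P1' (iv_Phi S' (iv_obtuse w) y) (iv_Phi S0' (iv_obtuse w0) y0) (iv_Phi S1' (iv_obtuse w1) y1) (iv_Phi S01' (iv_obtuse w01) y01) (iv_Phi A' (iv_obtuse wa) ya) (iv_Phi B' (iv_obtuse wb) yb) (iv_Phi C' (iv_obtuse wc) yc) (iv_Phi D0' (iv_obtuse w00) y00) (iv_Phi G0' (iv_obtuse w0m) y0m) (iv_Phi D1' (iv_obtuse w10) y10) (iv_Phi G1' (iv_obtuse w1m) y1m)"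
    using ok by blast
  have hok: "hess_ok (low_data mi e A' B' C' D0' G0' D1' G1' S' S0' S1' S01' y y0 y1 y01 ya yb yc y00 y0m y10 y1m w w0 w1 w01 ip ip0 ip1 i i0 i1 i01 ia ib ic i00 i0m i10 i1m im im1 im2) ms ns"
    using ok by blast
  have one: "approximates prec 1 (Iv 72057594037927936 0)" by (simp add: approximates_Iv)
  note q = pair_ok_sound[OF ap(10) ap(10) ap(13) pok(1)]
  note q0 = pair_ok_sound[OF ap(11) ap(10) ap(14) pok(2)]
  note q1 = pair_ok_sound[OF ap(12) ap(10) ap(15) pok(3)]
  note q01 = pair_ok_sound[OF ap(12) ap(11) ap(16) pok(4)]
  note qa = pair_ok_sound[OF ap(10) one ap(1) pok(5)]
  note qb = pair_ok_sound[OF ap(10) one ap(2) pok(6)]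
  note qc = pair_ok_sound[OF ap(10) one ap(3) pok(7)]
  note q00 = pair_ok_sound[OF ap(11) one ap(4) pok(8)]
  note q0m = pair_ok_sound[OF ap(11) one ap(5) pok(9)]
  note q10 = pair_ok_sound[OF ap(12) one ap(6) pok(10)]
  note q1m = pair_ok_sound[OF ap(12) one ap(7) pok(11)]
  note inv = inverse_ok_sound[OF ap(10) iok(1)[unfolded iv_inv_def], folded iv_inv_def] inverse_ok_sound[OF ap(11) iok(2)[unfolded iv_inv_def], folded iv_inv_def] inverse_ok_sound[OF ap(12) iok(3)[unfolded iv_inv_def], folded iv_inv_def]
  note low_inv = inverse_ok_sound[OF chop_low[OF q(1)] iok(4)[unfolded iv_low_inv_def], folded iv_low_inv_def]
    inverse_ok_sound[OF chop_low[OF q0(1)] iok(5)[unfolded iv_low_inv_def], folded iv_low_inv_def]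
    inverse_ok_sound[OF chop_low[OF q1(1)] iok(6)[unfolded iv_low_inv_def], folded iv_low_inv_def]
    inverse_ok_sound[OF chop_low[OF q01(1)] iok(7)[unfolded iv_low_inv_def], folded iv_low_inv_def]
    inverse_ok_sound[OF chop_low[OF qa(1)] iok(8)[unfolded iv_low_inv_def], folded iv_low_inv_def]
    inverse_ok_sound[OF chop_low[OF qb(1)] iok(9)[unfolded iv_low_inv_def], folded iv_low_inv_def]
    inverse_ok_sound[OF chop_low[OF qc(1)] iok(10)[unfolded iv_low_inv_def], folded iv_low_inv_def]
    inverse_ok_sound[OF chop_low[OF q00(1)] iok(11)[unfolded iv_low_inv_def], folded iv_low_inv_def]
    inverse_ok_sound[OF chop_low[OF q0m(1)] iok(12)[unfolded iv_low_inv_def], folded iv_low_inv_def]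
    inverse_ok_sound[OF chop_low[OF q10(1)] iok(13)[unfolded iv_low_inv_def], folded iv_low_inv_def]
    inverse_ok_sound[OF chop_low[OF q1m(1)] iok(14)[unfolded iv_low_inv_def], folded iv_low_inv_def]
  have rm: "real m = real_of_int mi" "real m - 1 = real_of_int (mi - 1)" "real m - 2 = real_of_int (mi - 2)" by (simp_all add: mi)
  have e': "real_of_int e = 0 \<and> n = Suc m \<or> real_of_int e = 1 \<and> n = Suc (Suc m)" using e by auto
  have "nondegenerate k n C"
  proof (rule nondegenerate_sym_point)
    show "n \<le> Suc (Suc m)" using e by auto
    show "\<And>q. q \<in> {p, p0, p1} \<Longrightarrow> 7 / 100 \<le> q \<and> q \<le> 11 / 10"
      using norm_ok_sound[OF ap(10) nok(1)] norm_ok_sound[OF ap(11) nok(2)] norm_ok_sound[OF ap(12) nok(3)] by blast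
    fix q r t assume "(q, r, t) \<in> {(p, p, s), (p0, p, s0), (p1, p, s1), (p1, p0, s01), (p, 1, a), (p, 1, b), (p, 1, c),
        (p0, 1, d0), (p0, 1, g0), (p1, 1, d1), (p1, 1, g1)}"
    thus "101 / 10000 \<le> q * r - t\<^sup>2"
      by (elim insertE emptyE; simp only: prod.inject; elim conjE; hypsubst)
        (rule q(3) q0(3) q1(3) q01(3) qa(3) qb(3) qc(3) q00(3) q0m(3) q10(3) q1m(3))+
  qed
  moreover have "\<exists>G. (\<forall>i<n. \<forall>j<k. \<bar>G i j\<bar> \<le> 1 / 2 ^ 41) \<and> (\<forall>d. grad_form k n C d = (\<Sum>i<n. \<Sum>j<k. G i j * d i j))"
  proof (intro exI conjI allI impI)
    let ?e = "real_of_int e"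
    let ?G = "sym_point m (G\<alpha> ?e + G\<beta> ?e) (G\<beta> ?e) (G\<gamma> ?e) (G\<delta>0 ?e) (G\<epsilon>0 ?e) G\<delta>1 G\<epsilon>1"
    \<comment> \<open>The locale fixes one direction, but the point is independent of it;
      interpreting the locale again at \<open>d'\<close> covers every direction.\<close>
    show "grad_form k n C d' = (\<Sum>i<n. \<Sum>j<k. ?G i j * d' i j)" for d'
    proof -
      interpret D: symmetric_perturbation m a b c d0 g0 d1 g1 d' by unfold_locales (rule m)
      show ?thesis by (rule D.grad_form_entries[OF e'])
    qed
    note rules = approximates_add approximates_sub approximates_mul approximates_scale approximates_pi ap(1-9) inv q(1) q0(1) q1(1) q01(1) qa(1) qb(1) qc(1) q00(1) q0m(1) q10(1) q1m(1) q(2) q0(2) q1(2) q01(2) qa(2) qb(2) qc(2) q00(2) q0m(2) q10(2) q1m(2)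
    have cW: "approximates prec (cW ?e) (iv_add iv_pi (iv_mul prec (iv_inv ip) (iv_sub (iv_sub (iv_add (iv_add (iv_scale (mi - 1) (iv_sub (iv_area y) (iv_area yb))) (iv_area y0)) (iv_scale e (iv_area y1))) (iv_area ya)) (iv_area yc))))"
      unfolding cW_def rm(2) by (intro rules)
    have c0: "approximates prec (c0 ?e) (iv_add iv_pi (iv_mul prec (iv_inv ip0) (iv_sub (iv_add (iv_scale mi (iv_sub (iv_area y0) (iv_area y00))) (iv_scale e (iv_area y01))) (iv_area y0m))))"
      unfolding c0_def rm(1) by (intro rules[unfolded rm(1)])
    have c1: "approximates prec c1 (iv_add iv_pi (iv_mul prec (iv_inv ip1) (iv_sub (iv_add (iv_scale mi (iv_sub (iv_area y1) (iv_area y10))) (iv_area y01)) (iv_area y1m))))"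
      unfolding c1_def rm(1) by (intro rules[unfolded rm(1)])
    note gok = gok[unfolded grad_ok_def small2_ok_def]
    note g = gok[THEN conjunct1, THEN conjunct1] gok[THEN conjunct1, THEN conjunct2] gok[THEN conjunct2, THEN conjunct1]
      gok[THEN conjunct2, THEN conjunct2, THEN conjunct1] gok[THEN conjunct2, THEN conjunct2, THEN conjunct2, THEN conjunct1]
      gok[THEN conjunct2, THEN conjunct2, THEN conjunct2, THEN conjunct2, THEN conjunct1]
      gok[THEN conjunct2, THEN conjunct2, THEN conjunct2, THEN conjunct2, THEN conjunct2]
    note rules' = rules[unfolded rm(1)] cW c0 c1
    have b: "\<bar>G\<alpha> ?e + G\<beta> ?e\<bar> \<le> 1 / 2 ^ 41" "\<bar>G\<beta> ?e\<bar> \<le> 1 / 2 ^ 41" "\<bar>G\<gamma> ?e\<bar> \<le> 1 / 2 ^ 41" "\<bar>G\<delta>0 ?e\<bar> \<le> 1 / 2 ^ 41"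
      "\<bar>G\<epsilon>0 ?e\<bar> \<le> 1 / 2 ^ 41" "\<bar>?e * G\<delta>1\<bar> \<le> 1 / 2 ^ 41" "\<bar>?e * G\<epsilon>1\<bar> \<le> 1 / 2 ^ 41"
      unfolding G\<alpha>_def G\<beta>_def G\<gamma>_def G\<delta>0_def G\<epsilon>0_def G\<delta>1_def G\<epsilon>1_def rm(2) unfolding rm(1)
      by ((rule small_ok_sound[OF _ g(1)], intro rules'), (rule small_ok_sound[OF _ g(2)], intro rules'), (rule small_ok_sound[OF _ g(3)], intro rules'), (rule small_ok_sound[OF _ g(4)], intro rules'), (rule small_ok_sound[OF _ g(5)], intro rules'), (rule small_ok_sound[OF _ g(6)], intro rules'), (rule small_ok_sound[OF _ g(7)], intro rules'))
    \<comment> \<open>For \<open>e = 0\<close> the two checks of the second extra row hold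
      trivially, but then no row index reaches \<open>m + 1\<close>.\<close>
    have "\<bar>G\<delta>1\<bar> \<le> 1 / 2 ^ 41 \<and> \<bar>G\<epsilon>1\<bar> \<le> 1 / 2 ^ 41 \<or> n = Suc m" using e b(6,7) by auto
    thus "\<bar>?G i j\<bar> \<le> 1 / 2 ^ 41" if "i < n" "j < k" for i j
      using b(1-5) that unfolding sym_point_def by auto
  qed
  moreover have "hess_form k n C d' \<ge> 1 / 128 * (\<Sum>i<n. dp k (d' i) (d' i))" for d'
  proof -
    interpret D: symmetric_perturbation m a b c d0 g0 d1 g1 d' by unfold_locales (rule m)
    have "data_rel (X (real_of_int e) (1 / 128)) (low_data mi e A' B' C' D0' G0' D1' G1' S' S0' S1' S01' y y0 y1 y01 ya yb yc y00 y0m y10 y1m w w0 w1 w01 ip ip0 ip1 i i0 i1 i01 ia ib ic i00 i0m i10 i1m im im1 im2)"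
      unfolding data_rel_def data_simps low_data_def
    proof (intro conjI)
      show "R (1 / 128) (Iv 2097152 0)" "R (1 / 2) (Iv 134217728 0)" by (simp_all add: approximates_Iv)
    qed ((unfold rm(2,3))?, (unfold rm(1))?, intro chop_low low_inv[unfolded rm(1)] inv[unfolded rm(1)] ap[unfolded rm(1)] R_int approximates_pi inverse_ok_sound[OF R_int iok(15)] inverse_ok_sound[OF R_int iok(16)] inverse_ok_sound[OF R_int iok(17)]
        q(1)[unfolded rm(1)] q0(1)[unfolded rm(1)] q1(1)[unfolded rm(1)] q01(1)[unfolded rm(1)] qa(1)[unfolded rm(1)] qb(1)[unfolded rm(1)] qc(1)[unfolded rm(1)] q00(1)[unfolded rm(1)] q0m(1)[unfolded rm(1)] q10(1)[unfolded rm(1)] q1m(1)[unfolded rm(1)]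
        q(2)[unfolded rm(1)] q0(2)[unfolded rm(1)] q1(2)[unfolded rm(1)] q01(2)[unfolded rm(1)])+
    from hess_ok_sound[OF this hok] show ?thesis by (intro D.hess_form_lower[OF e' refl]) blast+
  qed
  moreover have "scaled_loss k n C \<ge> 1 / 1000"
  proof -
    let ?e = "real_of_int e"
    \<comment> \<open>This is twice the loss, with arbitrary enclosures of the eleven values of
      \<open>Phi\<close>, which are filled in afterwards.\<close>
    have "approximates prec (real_of_int (mi * (mi - 1)) * Phi p p s + real_of_int (2 * mi) * Phi p0 p s0
         + ?e * (real_of_int (2 * mi) * Phi p1 p s1 + real_of_int 2 * Phi p1 p0 s01) + pi * (real_of_int mi * p + p0 + ?e * p1)
       - (real_of_int (2 * mi) * (Phi p 1 a + real_of_int (mi - 1) * Phi p 1 b + Phi p 1 c) + (real_of_int (2 * mi) * Phi p0 1 d0 + real_of_int 2 * Phi p0 1 g0)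
         + ?e * (real_of_int (2 * mi) * Phi p1 1 d1 + real_of_int 2 * Phi p1 1 g1))
       + real_of_int (mi + 1) * pi + real_of_int ((mi + 1) * mi) * 1)
      (iv_add (iv_add (iv_sub
     (iv_add (iv_add (iv_add (iv_scale (mi * (mi - 1)) F) (iv_scale (2 * mi) F0)) (iv_scale e (iv_add (iv_scale (2 * mi) F1) (iv_scale 2 F01))))
       (iv_mul prec iv_pi (iv_add (iv_add (iv_scale mi P') P0') (iv_scale e P1'))))
     (iv_add (iv_add (iv_scale (2 * mi) (iv_add (iv_add Fa (iv_scale (mi - 1) Fb)) Fc)) (iv_add (iv_scale (2 * mi) F00) (iv_scale 2 F0m)))
       (iv_scale e (iv_add (iv_scale (2 * mi) F10) (iv_scale 2 F1m)))))
     (iv_scale (mi + 1) iv_pi)) (iv_scale ((mi + 1) * mi) (Iv 72057594037927936 0)))"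
      if F: "approximates prec (Phi p p s) F" "approximates prec (Phi p0 p s0) F0" "approximates prec (Phi p1 p s1) F1" "approximates prec (Phi p1 p0 s01) F01" "approximates prec (Phi p 1 a) Fa" "approximates prec (Phi p 1 b) Fb" "approximates prec (Phi p 1 c) Fc" "approximates prec (Phi p0 1 d0) F00" "approximates prec (Phi p0 1 g0) F0m" "approximates prec (Phi p1 1 d1) F10" "approximates prec (Phi p1 1 g1) F1m"
      for F F0 F1 F01 Fa Fb Fc F00 F0m F10 F1m
      by (intro approximates_add approximates_sub approximates_mul approximates_scale approximates_pi ap(10-12) one F)
    from iv_bounds(1)[OF this[OF q(4) q0(4) q1(4) q01(4) qa(4) qb(4) qc(4) q00(4) q0m(4) q10(4) q1m(4)]] lok[unfolded loss_ok_def]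
    have "real_of_int 144115188075856 \<le> (real_of_int (mi * (mi - 1)) * Phi p p s + real_of_int (2 * mi) * Phi p0 p s0
         + ?e * (real_of_int (2 * mi) * Phi p1 p s1 + real_of_int 2 * Phi p1 p0 s01) + pi * (real_of_int mi * p + p0 + ?e * p1)
       - (real_of_int (2 * mi) * (Phi p 1 a + real_of_int (mi - 1) * Phi p 1 b + Phi p 1 c) + (real_of_int (2 * mi) * Phi p0 1 d0 + real_of_int 2 * Phi p0 1 g0)
         + ?e * (real_of_int (2 * mi) * Phi p1 1 d1 + real_of_int 2 * Phi p1 1 g1))
       + real_of_int (mi + 1) * pi + real_of_int ((mi + 1) * mi) * 1) * 2 ^ numeral prec"
      by (meson of_int_le_iff order_trans)
    also have "(real_of_int (mi * (mi - 1)) * Phi p p s + real_of_int (2 * mi) * Phi p0 p s0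
         + ?e * (real_of_int (2 * mi) * Phi p1 p s1 + real_of_int 2 * Phi p1 p0 s01) + pi * (real_of_int mi * p + p0 + ?e * p1)
       - (real_of_int (2 * mi) * (Phi p 1 a + real_of_int (mi - 1) * Phi p 1 b + Phi p 1 c) + (real_of_int (2 * mi) * Phi p0 1 d0 + real_of_int 2 * Phi p0 1 g0)
         + ?e * (real_of_int (2 * mi) * Phi p1 1 d1 + real_of_int 2 * Phi p1 1 g1))
       + real_of_int (mi + 1) * pi + real_of_int ((mi + 1) * mi) * 1) = 2 * scaled_loss k n C"
    proof -
      have *: "M * (M - 1) * f + 2 * M * f0 + E * (2 * M * f1 + 2 * f01) + w * (M * u + u0 + E * u1)
          - (2 * M * (fa + (M - 1) * fb + fc) + (2 * M * f00 + 2 * f0m) + E * (2 * M * f10 + 2 * f1m)) + (M + 1) * w + (M + 1) * M * 1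
        = 2 * (M * (M - 1) / 2 * f + M * f0 + E * (M * f1 + f01) + w / 2 * (M * u + u0 + E * u1)
          - (M * (fa + (M - 1) * fb + fc) + (M * f00 + f0m) + E * (M * f10 + f1m)) + ((M + 1) * w + (M + 1) * M) / 2)"
        for M f f0 f1 f01 E w u u0 u1 fa fb fc f00 f0m f10 f1m :: real by (simp add: field_simps)
      have "real k = real m + 1" "real k - 1 = real m" by simp_all
      thus ?thesis unfolding scaled_loss_sym_point[OF e'] mi
        by (simp only: of_int_mult of_int_add of_int_diff of_int_1 of_int_numeral of_int_of_nat_eq *)
    qed
    finally show ?thesis by simp
  qed
  ultimately show ?thesis unfolding certified_point_def by blast
qed
end

lemma cert_ok_sound:
  assumes m: "m > 2" and mi: "mi = int m" and e: "e = 0 \<and> n = Suc m \<or> e = 1 \<and> n = Suc (Suc m)"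
    and ok: "cert_ok mi e a b c d0 g0 d1 g1 y y0 y1 y01 ya yb yc y00 y0m y10 y1m w w0 w1 w01 wa wb wc w00 w0m w10 w1m ip ip0 ip1 i i0 i1 i01 ia ib ic i00 i0m i10 i1m im im1 im2 ms ns"
  shows "\<exists>C. certified_point (Suc m) n C"
proof -
  define q where "q = (\<lambda>x :: int. real_of_int x / 2 ^ numeral prec)"
  \<comment> \<open>Any direction serves here, as the point is given by the seven numbers
    alone.\<close>
  interpret symmetric_perturbation m "q a" "q b" "q c" "q d0" "q g0" "q d1" "q g1" "\<lambda>_ _. 0"
    by unfold_locales (rule m)
  have q: "approximates prec (q x) (Iv x 0)" for x unfolding q_def by (rule approximates_dyadic)
  have rm: "real m = real_of_int mi" by (simp add: mi)
  have "certified_point (Suc m) n C"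
    by (rule cert2_sound[OF mi e _ _ _ _ _ _ _ _ _ _ _ _ _ _ _ _ ok[unfolded cert_ok_def cert1_def]], unfold rm)
      (intro q approximates_add approximates_sub approximates_mul approximates_scale)+
  thus ?thesis by blast
qed

section \<open>Evaluation of the certificates by rewriting\<close>

lemma tri_zero_lists: "tri_zero 6 = [[0,0,0,0,0,0],[0,0,0,0,0],[0,0,0,0],[0,0,0],[0,0],[0]]"
  "tri_zero 7 = [[0,0,0,0,0,0,0],[0,0,0,0,0,0],[0,0,0,0,0],[0,0,0,0],[0,0,0],[0,0],[0]]"
  by (simp_all add: numeral_eq_Suc)

text \<open>Expanded once for a record with variables as entries, so that each certificate only
  substitutes numbers into the finished forms instead of unfolding selectors and lists
  again.\<close>

lemmas hess_ok_eval = hess_ok_def[where Y = "\<lparr>ha = a', hb = b', hc = c', hd0 = d0', hg0 = g0', hd1 = d1', hg1 = g1', hchi = chi', hpi = pi', hlam = lam', hm = m', hm1 = m1', hm2 = m2', him = im', him1 = im1', him2 = im2', hhalf = half', hip = ip', hip0 = ip0', hip1 = ip1', hs = s', hs0 = s0', hs1 = s1', hs01 = s01', hD = D', hD0 = D0', hD1 = D1', hD01 = D01', hDa = Da', hDb = Db', hDc = Dc', hD00 = D00', hD0m = D0m', hD10 = D10', hD1m = D1m', hI = I', hI0 = I0', hI1 = I1', hI01 = I01', hIa = Ia', hIb = Ib', hIc = Ic', hI00 = I00', hI0m = I0m', hI10 = I10', hI1m = I1m', hT = T', hT0 = T0', hT1 = T1', hT01 = T01'\<rparr>",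
    unfolded coefG_def coefK_def coefA_def formM_def formN_def lift_form_def list.map prod.case append.simps tri_sum.simps tri_zero_lists coef0_def coef1_def coefP_def
      coefP0_def coefP1_def vP_def vL_def vl0_def vl1_def vEa_def vEc_def nP0_def nP1_def nK0_def nK1_def nE0_def nE1_def nX_def nQ_def up.simps hess_data.simps]
  for a' b' c' d0' g0' d1' g1' chi' pi' lam' m' m1' m2' im' im1' im2' half' ip' ip0' ip1' s' s0' s1' s01' D' D0' D1' D01' Da' Db' Dc' D00' D0m' D10' D1m' I' I0' I1' I01' Ia' Ib' Ic' I00' I0m' I10' I1m' T' T0' T1' T01'

lemmas cert_eval = iv_eval plus_iv_def minus_iv_def times_iv_def uminus_iv_def zero_iv_def one_iv_def iv_low_mul.simps dbl_def
  tri_of.simps tri_row.simps row_add.simps tri_add.simps psd_ok.simps row_schur.simps tri_schur.simps sqrt_ok.simps inverse_ok.simps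
  iv_half_pi_def iv_pi_def iv_obtuse_def iv_area_def iv_inv_def iv_low_inv_def iv_upper.simps norm_ok_def area_ok_def pair_ok_def small_ok_def small2_ok_def
  iv_Phi_def grad_ok_def loss_ok_def low_data_def cert2_def cert1_def cert_ok_def hess_ok_eval

text \<open>In all cases n = k one has c = d0 = b and g0 = a, so the point is even invariant under
  all permutations of the targets. As b is near 2/k and a near 2/k - 1, it is close to the map that
  fixes the all-ones vector and negates its orthogonal complement. The dummy entries d1 and g1 are
  about 1 / (2 sqrt m) and 1/2, a row of squared norm about 1/2.\<close>

lemma certified_point_6_6: "\<exists>C. certified_point 6 6 C"
proof -
  have "\<exists>C. certified_point (Suc 5) 6 C"
  proof (rule cert_ok_sound)
    show "cert_ok 5 0 (- 47802818251997431) 23830151308797021 23830151308797021 23830151308797021 (- 47802818251997431) 16112567856389042 36028797018963968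
    71116522231197920 71116522231197920 45323023420823029 50544328246286575 53285838240575721 67502695341994606 67502695341994606 67502695341994606
    53285838240575721 48337703569167127 36028797018963967 (- 47754966585605) (- 47754966585605) 16627547278033926 1952278706942099
    (- 26344672301171662) 12226996027333731 12226996027333731 12226996027333731 (- 26344672301171662) 11592285415095746 28296951008113762
    73011054738894911 73011054738894911 144115188075855876 271987613 271987613 426776761 382690082 363001010 286548752 286548752 286548752 363001010
    400159951 536870912 53687091 67108864 89478485 [71982554,187464988,1165775533,87644536,34957845930,134217731]
    [111179277,70321264,363222941,1552317330,671088731,87995289,134217731]"
      by (simp only: cert_eval cong: if_weak_cong)
  qed simp_all
  thus ?thesis by simp
qed

lemma certified_point_7_7: "\<exists>C. certified_point 7 7 C"
proof -
  have "\<exists>C. certified_point (Suc 6) 7 C"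
  proof (rule cert_ok_sound)
    show "cert_ok 6 0 (- 51350272212119875) 20427975016768013 20427975016768013 20427975016768013 (- 51350272212119875) 14708694790461564 36028797018963968
    71340859289542255 71340859289542255 46332913286223952 50694193740762072 50038115269404268 68726714403405763 68726714403405763 68726714403405763
    50038115269404268 48783221775816147 36028797018963968 (- 80271813664508) (- 80271813664508) 15060953926519875 (- 466254550052572)
    (- 28763205558166333) 10409369342175085 10409369342175085 10409369342175085 (- 28763205558166333) 10550772781079646 28296951008113761
    72781348908887468 72781348908887468 144115188075855872 271132326 271132326 417474571 381558748 386561584 281445334 281445334 281445334 386561584
    396505446 536870912 44739243 53687091 67108864 [86818638,168157945,1374971558,87003430,1668583905,134217731]
    [115914234,72959652,444595252,1774764388,805306489,96194082,134217731]"
      by (simp only: cert_eval cong: if_weak_cong)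
  qed simp_all
  thus ?thesis by simp
qed

lemma certified_point_8_8: "\<exists>C. certified_point 8 8 C"
proof -
  have "\<exists>C. certified_point (Suc 7) 8 C"
  proof (rule cert_ok_sound)
    show "cert_ok 7 0 (- 53994551240290518) 17875320595021874 17875320595021874 17875320595021874 (- 53994551240290518) 13617605278429133 36028797018963968
    71499532915346441 71499532915346441 47063372048808851 50644102070134759 47293652899979001 69516718002860559 69516718002860559 69516718002860559
    47293652899979001 49098974080405314 36028797018963968 (- 92149417550003) (- 92149417550003) 13825851658066800 (- 2380079828816016)
    (- 30677030836929777) 9067889101324419 9067889101324419 9067889101324419 (- 30677030836929777) 9747582493883815 28296951008113761 72619773357978413
    72619773357978413 144115188075855873 270530622 270530622 410995054 381936145 408993849 278246926 278246926 278246926 408993849 393955545 536870912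
    38347922 44739243 53687091 [99151896,155771962,1565010880,86538500,985180780,134217731]
    [119087927,74848516,526677575,1951256020,939524275,104711333,134217731]"
      by (simp only: cert_eval cong: if_weak_cong)
  qed simp_all
  thus ?thesis by simp
qed

lemma certified_point_9_9: "\<exists>C. certified_point 9 9 C"
proof -
  have "\<exists>C. certified_point (Suc 8) 9 C"
  proof (rule cert_ok_sound)
    show "cert_ok 8 0 (- 56039729233346299) 15889882093703327 15889882093703327 15889882093703327 (- 56039729233346299) 12738103345051545 36028797018963968
    71614108933535560 71614108933535560 47611431068540525 50491551378097785 44943373522849272 70056189756575565 70056189756575565 70056189756575565
    44943373522849272 49334462117653623 36028797018963968 (- 94331122929917) (- 94331122929917) 12824372025639449 (- 3943143300510296)
    (- 32240094308624057) 8035952932067503 8035952932067503 8035952932067503 (- 32240094308624057) 9103765623213978 28296951008113761 72503577006625849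
    72503577006625849 144115188075855873 270097798 270097798 406264056 383090093 430381869 276104270 276104270 276104270 430381869 392075079 536870912
    33554432 38347922 44739243 [109554319,147142174,1740486155,86191621,746412819,134217731]
    [121350897,76252506,609262052,2102372874,1073742049,112854023,134217731]"
      by (simp only: cert_eval cong: if_weak_cong)
  qed simp_all
  thus ?thesis by simp
qed

lemma certified_point_10_10: "\<exists>C. certified_point 10 10 C"
proof -
  have "\<exists>C. certified_point (Suc 9) 10 C"
  proof (rule cert_ok_sound)
    show "cert_ok 9 0 (- 57667983222236556) 14301740683667336 14301740683667336 14301740683667336 (- 57667983222236556) 12009599006321323 36028797018963968
    71698723891923687 71698723891923687 48035237089563070 50286602636619283 42905222051002008 70440858751033696 70440858751033696 70440858751033696
    42905222051002008 49516845224375712 36028797018963969 (- 91959532710694) (- 91959532710694) 11993627021231500 (- 5251032137099964)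
    (- 33547983145213726) 7216897045181943 7216897045181943 7216897045181943 (- 33547983145213726) 8572732488971541 28296951008113761 72418024528014892
    72418024528014892 144115188075855868 269779043 269779043 402679664 384651420 450826547 274596498 274596498 274596498 450826547 390630967 536870912
    29826162 33554432 38347922 [118442099,140773748,1904716484,85928078,623093122,134217731]
    [123041018,77330739,692220113,2238971835,1207959827,120382054,134217731]"
      by (simp only: cert_eval cong: if_weak_cong)
  qed simp_all
  thus ?thesis by simp
qed

lemma certified_point_11_11: "\<exists>C. certified_point 11 11 C"
proof -
  have "\<exists>C. certified_point (Suc 10) 11 C"
  proof (rule cert_ok_sound)
    show "cert_ok 10 0 (- 58994756731647169) 13002581688866316 13002581688866316 13002581688866316 (- 58994756731647169) 11393305993581086 36028797018963968
    71762559284454007 71762559284454007 48371239712417754 50056265165431779 41117773599216388 70724716309130598 70724716309130598 70724716309130598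
    41117773599216388 49662269458856219 36028797018963969 (- 87539292471331) (- 87539292471331) 11291576185611948 (- 6366518772473943)
    (- 34663469780587705) 6550663689068016 6550663689068016 6550663689068016 (- 34663469780587705) 8124976726159001 28296951008113761 72353628188003095
    72353628188003095 144115188075855868 269539065 269539065 399882518 386421421 470424622 273494390 273494390 273494390 470424622 389487096 536870912
    26843546 29826162 33554432 [126123290,135870857,2060114939,85725007,546995489,134217731]
    [124349040,78181976,775467493,2366811778,1342177611,127243325,134217731]"
      by (simp only: cert_eval cong: if_weak_cong)
  qed simp_all
  thus ?thesis by simp
qed

lemma certified_point_12_12: "\<exists>C. certified_point 12 12 C"
proof -
  have "\<exists>C. certified_point (Suc 11) 12 C"
  proof (rule cert_ok_sound)
    show "cert_ok 11 0 (- 60096612921445811) 11920136007482514 11920136007482514 11920136007482514 (- 60096612921445811) 10863091032707148 36028797018963968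
    71811660011663443 71811660011663443 48643235645303118 49815615754135179 39534618586824546 70940110720232875 70940110720232875 70940110720232875
    39534618586824546 49780936938576512 36028797018963969 (- 82320574959913) (- 82320574959913) 10689088390325985 (- 7332708716655893)
    (- 35629659724769654) 5997923478923259 5997923478923259 5997923478923259 (- 35629659724769654) 7740781025443128 28296951008113761 72304181581978258
    72304181581978258 144115188075855869 269354769 269354769 397646515 388288147 489262672 272663983 272663983 272663983 489262672 388558639 536870912
    24403223 26843546 29826162 [132829413,131971686,2208461247,85566688,494948028,134217731]
    [125390116,78869780,858946369,2489066328,1476395449,133462477,134217731]"
      by (simp only: cert_eval cong: if_weak_cong)
  qed simp_all
  thus ?thesis by simp
qed

lemma certified_point_13_13: "\<exists>C. certified_point 13 13 C"
proof -
  have "\<exists>C. certified_point (Suc 12) 13 C"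
  proof (rule cert_ok_sound)
    show "cert_ok 12 0 (- 61026272927007913) 11004356127155744 11004356127155744 11004356127155744 (- 61026272927007913) 10400617828738617 36028797018963968
    71850087398653909 71850087398653909 48867321734778945 49573240380319587 38120207833631259 71107386246912710 71107386246912710 71107386246912710
    38120207833631259 49879610844992950 36028797018963969 (- 76932909168157) (- 76932909168157) 10165337114157271 (- 8180296815169524)
    (- 36477247823283286) 5531820422067197 5531820422067197 5531820422067197 (- 36477247823283286) 7406401294211310 28296951008113760 72265535216197597
    72265535216197597 144115188075855866 269210711 269210711 395823066 390186580 507416255 272022558 272022558 272022558 507416255 387789976 536870912
    22369621 24403223 26843546 [138737094,128790177,2351086951,85442032,456877391,134217731]
    [126237636,79436503,942615090,2607563186,1610613265,139092672,134217731]"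
      by (simp only: cert_eval cong: if_weak_cong)
  qed simp_all
  thus ?thesis by simp
qed

lemma certified_point_14_14: "\<exists>C. certified_point 14 14 C"
proof -
  have "\<exists>C. certified_point (Suc 13) 14 C"
  proof (rule cert_ok_sound)
    show "cert_ok 13 0 (- 61821200243976748) 10219493737349885 10219493737349885 10219493737349885 (- 61821200243976748) 9992590388089132 36028797018963968
    71880629579566518 71880629579566518 49054725812570206 49334054461637440 36846908679298129 71239858412118373 71239858412118373 71239858412118373
    36846908679298129 49962951940445659 36028797018963970 (- 71688972006613) (- 71688972006613) 9705026399609047 (- 8931807023408348)
    (- 37228758031522110) 5133378586921124 5133378586921124 5133378586921124 (- 37228758031522110) 7111924558276108 28296951008113760 72234851173268155
    72234851173268155 144115188075855865 269096323 269096323 394310901 392078318 524950771 271516726 271516726 271516726 524950771 387143120 536870912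
    20648881 22369621 24403223 [143983020,126139788,2489001158,85343052,427682345,134217731]
    [126940485,79911273,1026442197,2723403928,1744831076,144194727,134217731]"
      by (simp only: cert_eval cong: if_weak_cong)
  qed simp_all
  thus ?thesis by simp
qed

lemma certified_point_15_15: "\<exists>C. certified_point 15 15 C"
proof -
  have "\<exists>C. certified_point (Suc 14) 15 C"
  proof (rule cert_ok_sound)
    show "cert_ok 14 0 (- 62508735988183422) 9539337669831791 9539337669831791 9539337669831791 (- 62508735988183422) 9629101035898964 36028797018963968
    71905241077470638 71905241077470638 49213490734239126 49100834622720232 35692933257257038 71346538781978422 71346538781978422 71346538781978422
    35692933257257038 50034276676173339 36028797018963970 (- 66736077672092) (- 66736077672092) 9296657812922298 (- 9604189828890562)
    (- 37901140837004324) 4788802964995331 4788802964995331 4788802964995331 (- 37901140837004324) 6849996771077907 28296951008113760 72210145927124870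
    72210145927124870 144115188075855866 269004218 269004218 393038836 393940618 541922766 271110743 271110743 271110743 541922766 386591241 536870912
    19173961 20648881 22369621 [148674463,123893736,2622986599,85263921,404496227,134217731]
    [127532452,80314693,1110404422,2837289037,1879048893,148828091,134217731]"
      by (simp only: cert_eval cong: if_weak_cong)
  qed simp_all
  thus ?thesis by simp
qed

lemma certified_point_16_16: "\<exists>C. certified_point 16 16 C"
proof -
  have "\<exists>C. certified_point (Suc 15) 16 C"
  proof (rule cert_ok_sound)
    show "cert_ok 15 0 (- 63109295783025500) 8944234409132082 8944234409132082 8944234409132082 (- 63109295783025500) 9302595389222325 36028797018963968
    71925319097060672 71925319097060672 49349513042007167 48875083347084695 34640870911143889 71433702287830726 71433702287830726 71433702287830726
    34640870911143889 50096009305051768 36028797018963968 (- 62134257389419) (- 62134257389419) 8931411368866684 (- 10210478261708982)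
    (- 38507429269822744) 4487820513424611 4487820513424611 4487820513424611 (- 38507429269822744) 6615031618206931 28296951008113761 72190004888237593
    72190004888237593 144115188075855872 268929125 268929125 391955501 395760207 558381259 270779933 270779933 270779933 558381259 386114850 536870912
    17895697 19173961 20648881 [152896643,121962827,2753653721,85200303,385578583,134217731]
    [128037603,80661703,1194482620,2949667200,2013266716,153047205,134217731]"
      by (simp only: cert_eval cong: if_weak_cong)
  qed simp_all
  thus ?thesis by simp
qed

lemma certified_point_17_17: "\<exists>C. certified_point 17 17 C"
proof -
  have "\<exists>C. certified_point (Suc 16) 17 C"
  proof (rule cert_ok_sound)
    show "cert_ok 16 0 (- 63638429341480692) 8419159066122432 8419159066122432 8419159066122432 (- 63638429341480692) 9007199254740992 36028797018963968
    71941880586704997 71941880586704997 49467204533996479 48657532802985210 33676636264489728 71505826893762328 71505826893762328 71505826893762328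
    33676636264489728 50149963019456028 36028797018963968 (- 57897574676568) (- 57897574676568) 8602401257964380 (- 10760880212140778)
    (- 39057831220254540) 4222621309021367 4222621309021367 4222621309021367 (- 39057831220254540) 6402699165966658 28296951008113761 72173400416189691
    72173400416189691 144115188075855872 268867216 268867216 391022968 397529673 574368917 270506810 270506810 270506810 574368917 385699449 536870912
    16777216 17895697 19173961 [156718131,120282502,2881490375,85148940,369809821,134217731]
    [128473547,80963376,1278661519,3060849349,2147484545,156900535,134217731]"
      by (simp only: cert_eval cong: if_weak_cong)
  qed simp_all
  thus ?thesis by simp
qed

lemma certified_point_18_18: "\<exists>C. certified_point 18 18 C"
proof -
  have "\<exists>C. certified_point (Suc 17) 18 C"
  proof (rule cert_ok_sound)
    show "cert_ok 17 0 (- 64108187422730644) 7952429034345735 7952429034345735 7952429034345735 (- 64108187422730644) 8738266804301596 36028797018963968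
    71955678021779888 71955678021779888 49569925876134695 48448446155783381 32788704888836120 71566177314209260 71566177314209260 71566177314209260
    32788704888836120 50197521079474179 36028797018963967 (- 54016414326323) (- 54016414326323) 8304167684326518 (- 11263520354653224)
    (- 39560471362766985) 3987160628478836 3987160628478836 3987160628478836 (- 39560471362766985) 6209584419581410 28296951008113761 72159573305921180
    72159573305921180 144115188075855875 268815660 268815660 390212670 399245273 589923060 270278696 270278696 270278696 589923060 385334030 536870912
    15790321 16777216 17895697 [160194660,118804855,3006884897,85107346,356435214,134217731]
    [128853456,81228085,1362929230,3171051184,2281702380,160430514,134217731]"
      by (simp only: cert_eval cong: if_weak_cong)
  qed simp_all
  thus ?thesis by simp
qed

lemma certified_point_19_19: "\<exists>C. certified_point 19 19 C"
proof -
  have "\<exists>C. certified_point (Suc 18) 19 C"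
  proof (rule cert_ok_sound)
    show "cert_ok 18 0 (- 64528053039825192) 7534823826898646 7534823826898646 7534823826898646 (- 64528053039825192) 8492068896701030 36028797018963968
    71967276623668815 71967276623668815 49660278136415532 48247801589050612 31967550138276033 71617178950662987 71617178950662987 71617178950662987
    31967550138276033 50239757116462026 36028797018963968 (- 50469650542362) (- 50469650542362) 8032321718071340 (- 11724957090113281)
    (- 40021908098227042) 3776685963020214 3776685963020214 3776685963020214 (- 40021908098227042) 6032952857421585 28296951008113761 72147954011320089
    72147954011320089 144115188075855873 268772337 268772337 389502714 400905585 605076493 270086219 270086219 270086219 605076493 385010084 536870912
    14913081 15790321 16777216 [163372007,117493591,3130156299,85073606,344926791,134217731]
    [129187369,81462269,1447275129,3280430298,2415920221,163674071,134217731]"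
      by (simp only: cert_eval cong: if_weak_cong)
  qed simp_all
  thus ?thesis by simp
qed

lemma certified_point_20_20: "\<exists>C. certified_point 20 20 C"
proof -
  have "\<exists>C. certified_point (Suc 19) 20 C"
  proof (rule cert_ok_sound)
    show "cert_ok 19 0 (- 64905590577238989) 7158969025021853 7158969025021853 7158969025021853 (- 64905590577238989) 8265572908579127 36028797018963968
    71977106831523333 71977106831523333 49740303306149420 48055406548623576 31205222520008161 71660663988007931 71660663988007931 71660663988007931
    31205222520008161 50277517179753185 36028797018963969 (- 47231309848580) (- 47231309848580) 7783291866298311 (- 12150550879552923)
    (- 40447501887666684) 3587408602106902 3587408602106902 3587408602106902 (- 40447501887666684) 5870585458828262 28296951008113761 72138109261543323
    72138109261543323 144115188075855868 268735629 268735629 388876059 402510654 619858202 269922326 269922326 269922326 619858202 384720929 536870912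
    14128182 14913081 15790321 [166288130,116320710,3251567065,85046232,334903739,134217731]
    [129483082,81670955,1531690863,3389101293,2550138077,166663222,134217731]"
      by (simp only: cert_eval cong: if_weak_cong)
  qed simp_all
  thus ?thesis by simp
qed

text \<open>In all cases n = k + 1, a is near 1 and b near 0, so the symmetric rows nearly reproduce
  their own targets. The exceptional target has no such row: a positive c adds a little of it to
  every symmetric row, and both extra rows have a negative inner product with it.\<close>

lemma certified_point_8_9: "\<exists>C. certified_point 8 9 C"
proof -
  have "\<exists>C. certified_point (Suc 7) 9 C"
  proof (rule cert_ok_sound)
    show "cert_ok 7 1 70910978914355344 (- 2150690915764391) 16580272048683604 4949758685725434 (- 35036758759488205) 9103290887244186 (- 13618724180088425)
    73982772791467047 37680653467022374 27720368214551945 9235853268319539 17397075895082703 72982187613665462 71106397455384119 37075263055736499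
    13095830532211412 26128319466816525 24085043799928645 (- 47189459233408) (- 3883431784922844) 5410736815388423 31428562576482237 47925913181546034
    (- 1061414993082858) 8253558766238546 4781773553608647 (- 43706566529208863) 12078834782694203 (- 18541227089463578) 70182452061923832
    267422657485073484 488720565492159233 261450232 513335395 697783412 2094317932 1111842773 265034713 272026341 521717488 1477020726 740300697
    803104751 38347922 44739243 53687091 [88918926,154600116,1033071952,81264385,201342456,1316237807]
    [117873177,75136343,504605980,659087759,2812257953,111941187,1495787370]"
      by (simp only: cert_eval cong: if_weak_cong)
  qed simp_all
  thus ?thesis by simp
qed

lemma certified_point_10_11: "\<exists>C. certified_point 10 11 C"
proof -
  have "\<exists>C. certified_point (Suc 9) 11 C"
  proof (rule cert_ok_sound)
    show "cert_ok 9 1 71483229780914393 (- 1319367448035379) 13304593206002067 4132455964625345 (- 38245467276180128) 6963795650674481 (- 13712943248665208)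
    73563240958857647 40465531930489454 25025566004367187 8729079315845696 13818033292790963 72794570220097807 71580569874893351 39991665451315050
    12397367893876035 24000008571997120 20891386952023443 3887952062229 (- 3168054905401092) 4803337157411854 32221309944084028 49714224385672235
    (- 652933560506404) 6621072039317070 3709794529156266 (- 45300125445873869) 10174647698054831 (- 20927533373730376) 70582763356041180
    231466214584634342 599115288740257009 262941285 478007138 772922103 2215905299 1399823890 265717801 270224352 483671107 1560235469 805950259
    925875011 29826162 33554432 38347922 [107086334,136592736,1232215625,81756715,176866739,720457505]
    [122399896,77244843,666152919,816448796,3063973230,130090229,1694094845]"
      by (simp only: cert_eval cong: if_weak_cong)
  qed simp_all
  thus ?thesis by simp
qed

lemma certified_point_11_12: "\<exists>C. certified_point 11 12 C"
proof -
  have "\<exists>C. certified_point (Suc 10) 12 C"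
  proof (rule cert_ok_sound)
    show "cert_ok 10 1 71621308882417124 (- 1075719754335211) 12125431275911368 3825396549740996 (- 39607469808136776) 6247985441333324 (- 13675093261662926)
    73372586771697748 41653158494942133 24051947769901434 8564425473110469 12547535237474037 72704163247893773 71693977731322769 41236568643224900
    12096966050531148 23202242874153294 19757864782185643 14954862053994 (- 2914332858765452) 4573300176476521 32492584628602779 50345330518504142
    (- 533037712508498) 6036342162848967 3332748314643197 (- 45914136499515234) 9477161391075491 (- 21812819111890490) 70766162673194421
    218148785445998126 648002206940766979 263624522 464378064 804209842 2258506794 1541562765 266048219 269796902 469069415 1598980524 833661350
    978993091 26843546 29826162 33554432 [114546027,130620937,1327206945,81978247,170813209,640046671]
    [123882803,77993438,748110546,896465893,3199325289,137778465,1772166540]"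
      by (simp only: cert_eval cong: if_weak_cong)
  qed simp_all
  thus ?thesis by simp
qed

lemma certified_point_12_13: "\<exists>C. certified_point 12 13 C"
proof -
  have "\<exists>C. certified_point (Suc 11) 13 C"
  proof (rule cert_ok_sound)
    show "cert_ok 11 1 71713381662426900 (- 894465051976588) 11145580036188936 3563590991583225 (- 40840147222956875) 5672840226229052 (- 13609181630178882)
    73205786015202307 42732775368211465 23232478200316208 8431397306707970 11498896974717539 72623919429943104 71769142301918180 42366371484300178
    11819094225372105 22517126525523259 18814682526036609 21407708294038 (- 2703666253826952) 4377236730214211 32711051978565580 50865617515019588
    (- 443722545974675) 5550847442241662 3023397457901563 (- 46444486277322073) 8891853269832193 (- 22561636239660130) 70927398291668444
    206983091562094269 693885311160970141 264225195 452645843 832576402 2294140865 1682145092 266342181 269514341 456560532 1636573222 859026710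
    1028070130 24403223 26843546 29826162 [121181699,125859547,1420259831,82179834,166595282,592656402]
    [125052303,78612233,830616620,977163593,3339376514,144682650,1839455698]"
      by (simp only: cert_eval cong: if_weak_cong)
  qed simp_all
  thus ?thesis by simp
qed

lemma certified_point_13_14: "\<exists>C. certified_point 13 14 C"
proof -
  have "\<exists>C. certified_point (Suc 12) 14 C"
  proof (rule cert_ok_sound)
    show "cert_ok 12 1 71777039888739700 (- 755839196118245) 10317420236904962 3337039819287828 (- 41961719757502450) 5199758950754106 (- 13525506635591476)
    73062050386140150 43719605575372268 22527252988135421 8319490078796906 10617597757457732 72554155941879117 71820802536479676 43396775310128855
    11559845027773966 21916928488153875 18012493379634295 25035489574558 (- 2525143271795385) 4207711142371493 32890390602475619 51302723402319857
    (- 375319532833465) 5140549342298888 2765030217997230 (- 46908730396463678) 8392610643371380 (- 23205218982711774) 71066929788332064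
    197498559237858318 737391304604109599 264745008 442428811 858640560 2324999841 1821769251 266598279 269320481 445720056 1673276161 882551272
    1073855391 22369621 24403223 26843546 [127128903,121977454,1511853213,82362446,163526705,562168983]
    [125995109,79133177,913553920,1058427922,3482973970,150907302,1897928196]"
      by (simp only: cert_eval cong: if_weak_cong)
  qed simp_all
  thus ?thesis by simp
qed

lemma certified_point_14_15: "\<exists>C. certified_point 14 15 C"
proof -
  have "\<exists>C. certified_point (Suc 13) 15 C"
  proof (rule cert_ok_sound)
    show "cert_ok 13 1 71822458039814759 (- 647364268329247) 9607541608550886 3138655535480096 (- 42987080581175166) 4803174558002440 (- 13430432465068328)
    72938847123769254 44625866735043218 21909393395154437 8222139815006760 9865790475727228 72494001269732604 71857459214975485 44340760026608083
    11316583469192370 21382758152644026 17318092153881881 26900305142524 (- 2371385717555474) 4059287130520984 33040079028814236 51675636933657358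
    (- 321725045828838) 4788749612711360 2546047545108301 (- 47319550866314272) 7960948619204733 (- 23765727878900985) 71186968481573384
    189348734424667225 778992302592718224 265192197 433443976 882854800 2352527876 1960594355 266819499 269183093 436230978 1709244947 904598601
    1116913627 20648881 22369621 24403223 [132493363,118754014,1602317030,82527782,161218614,541430783]
    [126769354,79578334,996835889,1140169936,3629200479,156543787,1949154635]"
      by (simp only: cert_eval cong: if_weak_cong)
  qed simp_all
  thus ?thesis by simp
qed

lemma certified_point_15_16: "\<exists>C. certified_point 15 16 C"
proof -
  have "\<exists>C. certified_point (Suc 14) 16 C"
  proof (rule cert_ok_sound)
    show "cert_ok 14 1 71855776880052915 (- 560836736633291) 8991787356046981 2963231327192066 (- 43928543042870202) 4465477365611838 (- 13328075988437310)
    72833299907106007 45461580653990740 21360148006654591 8135117794383083 9216356755432897 72442248481353774 71884224020455241 45209141913435848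
    11087396384108144 20901290746981405 16708286370513374 27652010722979 (- 2237202713163760) 3927919405721041 33166849773006426 51997874541337549
    (- 278923828117358) 4483449783593879 2358132905231019 (- 47686408307134956) 7583400036327123 (- 24259356063913860) 71290128772003100
    182274094445877541 819047241978637181 265576503 425476036 905556137 2377693059 2098748304 267010115 269082867 427851808 1744576675 925436297
    1157677854 19173961 20648881 22369621 [137359204,116036546,1691887672,82677687,159435703,526785454]
    [127415284,79963479,1080398065,1222319942,3777385269,161669963,1994362846]"
      by (simp only: cert_eval cong: if_weak_cong)
  qed simp_all
  thus ?thesis by simp
qed

lemma certified_point_16_17: "\<exists>C. certified_point 16 17 C"
proof -
  have "\<exists>C. certified_point (Suc 15) 17 C"
  proof (rule cert_ok_sound)
    show "cert_ok 15 1 71880838793880134 (- 490677500234890) 8452239206325562 2806830609379867 (- 44796383374734179) 4174135312666822 (- 13221196168493285)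
    72742707497689492 46235094379815262 20866031530305623 8055628636688746 8649338086250393 72397688296193602 71904281426359431 46011000167706476
    10870808205753440 20462837209050743 16166356550774891 27698058523263 (- 2118820209410708) 3810544197946489 33275592491887746 52279342345620250
    (- 244182511819740) 4215784066028376 2195161247573642 (- 48016544208391254) 7249910482749723 (- 24698234684051478) 71378912096926456
    176077040529537022 857832087655101218 265907247 418357816 927000090 2401155017 2236334494 267174458 269007808 420395406 1779335331 945265454
    1196485618 17895697 19173961 20648881 [141794459,113716011,1780738895,82813921,158028061,516176019]
    [127961526,80300216,1164190346,1304821070,3927009147,166351232,2034473422]"
      by (simp only: cert_eval cong: if_weak_cong)
  qed simp_all
  thus ?thesis by simp
qed

lemma certified_point_17_18: "\<exists>C. certified_point 17 18 C"
proof -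
  have "\<exists>C. certified_point (Suc 16) 18 C"
  proof (rule cert_ok_sound)
    show "cert_ok 16 1 71900123724935702 (- 432981746348349) 7975311897629123 2666406635401316 (- 45599247945265057) 3919979714541474 (- 13111692721482709)
    72664707395521325 46953440438399396 20417085306387766 7981783149417853 8149705378388082 72359228963712145 71919676650768702 46754008152814471
    10665626541605264 20060162024740291 15679918858165896 27298957627849 (- 2013417618270591) 3704802026703505 33369929984462756 52527480310037549
    (- 215585841536547) 3979045917546514 2052518649173339 (- 48315619627014205) 6952813974769182 (- 25091647595249439) 71455532598604393
    170604833684043542 895561529127990088 266192679 411957312 947383665 2423369910 2373437102 267316462 268950224 413714543 1813565573 964240124
    1233604159 16777216 17895697 19173961 [145854922,111712483,1869002178,82938082,156896101,508355898]
    [128428952,80597292,1248173586,1387626600,4077703157,170642890,2070413240]"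
      by (simp only: cert_eval cong: if_weak_cong)
  qed simp_all
  thus ?thesis by simp
qed

lemma certified_point_18_19: "\<exists>C. certified_point 18 19 C"
proof -
  have "\<exists>C. certified_point (Suc 17) 19 C"
  proof (rule cert_ok_sound)
    show "cert_ok 17 1 71915276054684080 (- 384948232885939) 7550508271102882 2539555114389654 (- 46344465263864557) 3696141998330213 (- 13000900590739256)
    72597298161496164 47622598611728627 20005781831939621 7912279629466754 7705915742079273 72325928146850909 71931758579180097 47444693101103635
    10470853978706084 19687733920373155 15239583866397003 26623819389871 (- 1918837160370888) 3608847483819879 33452594903183228 52747993658494071
    (- 191758213691620) 3768059800578717 1926661905276514 (- 48588138886304948) 6686157916491294 (- 25446831773260654) 71521882664680780
    165737761745506918 932404550193718229 266439848 406168787 966861144 2444657421 2510125177 267439542 268905050 407691817 1847300435 982480421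
    1269248116 15790321 16777216 17895697 [149586863,109966046,1956779209,83051579,155971506,502531628]
    [128833093,80861435,1332318266,1470700700,4229210065,174591677,2102902612]"
      by (simp only: cert_eval cong: if_weak_cong)
  qed simp_all
  thus ?thesis by simp
qed

lemma certified_point_19_20: "\<exists>C. certified_point 19 20 C"
proof -
  have "\<exists>C. certified_point (Suc 18) 20 C"
  proof (rule cert_ok_sound)
    show "cert_ok 18 1 71927412351012917 (- 344523878597007) 7169582049980389 2424347450305513 (- 47038288563503947) 3497370462668078 (- 12889771674544640)
    72538809122730589 48247692900731946 19626313049924524 7846205533849509 7308950042318043 72296989574468610 71941437930182807 48088641283572512
    10285635132380069 19341236165905386 14838086222844787 25783654733270 (- 1833394836336456) 3521216624214804 33525681935109676 52945336398758750
    (- 171690232246691) 3578762327508594 1814824314481953 (- 48837740140942999) 6445245653247403 (- 25769520059825153) 71579552955662408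
    161380799368251208 968495665714598695 266654682 400906488 985555110 2465244255 2646455784 267546591 268868870 402232473 1880565747 1000081533
    1303592176 14913081 15790321 16777216 [153029095,108430902,2044149314,83155642,155205929,498169719]
    [129185722,81097911,1416599186,1554010126,4381263523,178236947,2132171784]"
      by (simp only: cert_eval cong: if_weak_cong)
  qed simp_all
  thus ?thesis by simp
qed

section \<open>The claimed pairs\<close>

lemma certified_point_pairs:
  assumes "(k, n) \<in> pairs_claimed"
  shows "(\<exists>C. certified_point k n C) \<and> n \<le> 20 \<and> k \<le> 20 \<and> k \<le> n"
proof -
  consider "n = k" "6 \<le> k" "k \<le> 20" | "n = k + 1" "k = 8 \<or> 10 \<le> k \<and> k \<le> 19"
    using assms by (auto simp: pairs_claimed_def)
  thus ?thesis
  proof cases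
    case 1
    hence "k = 6 \<or> k = 7 \<or> k = 8 \<or> k = 9 \<or> k = 10 \<or> k = 11 \<or> k = 12 \<or> k = 13 \<or> k = 14 \<or> k = 15 \<or> k = 16 \<or> k = 17 \<or> k = 18 \<or> k = 19 \<or> k = 20" by presburger
    thus ?thesis using certified_point_6_6 certified_point_7_7 certified_point_8_8 certified_point_9_9 certified_point_10_10 certified_point_11_11 certified_point_12_12 certified_point_13_13 certified_point_14_14 certified_point_15_15 certified_point_16_16 certified_point_17_17 certified_point_18_18 certified_point_19_19 certified_point_20_20 1
      by (elim disjE) simp_all
  next
    case 2
    hence "k = 8 \<or> k = 10 \<or> k = 11 \<or> k = 12 \<or> k = 13 \<or> k = 14 \<or> k = 15 \<or> k = 16 \<or> k = 17 \<or> k = 18 \<or> k = 19" by presburger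
    thus ?thesis using certified_point_8_9 certified_point_10_11 certified_point_11_12 certified_point_12_13 certified_point_13_14 certified_point_14_15 certified_point_15_16 certified_point_16_17 certified_point_17_18 certified_point_18_19 certified_point_19_20 2
      by (elim disjE) simp_all
  qed
qed

theorem theorem1:
  assumes "(k, n) \<in> pairs_claimed"
    and "orthonormal_rows k V"
  shows "\<exists>W. spurious_local_min n k (relu_loss k n V) W"
  using certified_point_pairs[OF assms(1)] certified_point_spurious assms(2) by blast

end
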